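(* Let $X$ be the Cayley graph of a classical $C'(1/6)$ small cancellation group. Then $\mathrm{asdim}_s(X)\le 2$ and $\mathrm{cdim}_{\partial_M}(X)\le1$.
   Context: A classical $C'(1/6)$ small cancellation group is a group given by a presentation $\langle S\mid R\rangle$ with $S$ finite and $R$ a symmetrised set of cyclically reduced words such that every piece (a common initial subword of two distinct elements of $R$) of a relator $r$ has length less than $|r|/6$; $X$ is the Cayley graph with respect to $S$. A Morse gauge is a function $N$ assigning to each $(K,C)$ a number $N(K,C)\ge0$; a geodesic is $N$-Morse if every $(K,C)$-quasi-geodesic with endpoints on it lies in its $N(K,C)$-neighbourhood. $X^{(N)}_e$ is the set of points joined to $e$ by an $N$-Morse geodesic (restricted metric); it is hyperbolic, and $\partial_s X^{(N)}_e$ denotes its sequential boundary with a visual metric. A stable subset is a quasi-convex subset whose points are pairwise joined by $N$-Morse geodesics for a fixed $N$. $\mathrm{asdim}_s(X)$ is the supremum of asymptotic dimensions of stable subsets of $X$; $\mathrm{cdim}_{\partial_M}(X)$ is the supremum of Buyalo capacity dimensions of the spaces $\partial_s X^{(N)}_e$ (the capacity dimension of a metric space $M$ being the minimal $m$ such that for some $\delta\in(0,1)$ and all small $r>0$ there is an open cover by sets of diameter $\le r$ with Lebesgue number $\ge\delta r$ and multiplicity $\le m+1$; the empty set has dimension $-1$). *)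

theory Defs
  imports "HOL-Analysis.Analysis" "HOL-Library.Extended_Real"
begin

text \<open>A letter is a pair (s, b): (s, True) is the generator s, (s, False) is its inverse.\<close>

type_synonym 'a letter = "'a \<times> bool"
type_synonym 'a word = "'a letter list"

definition letter_inv :: "'a letter \<Rightarrow> 'a letter" where
  "letter_inv x = (fst x, \<not> snd x)"

definition word_inv :: "'a word \<Rightarrow> 'a word" where
  "word_inv w = rev (map letter_inv w)"

definition freely_reduced :: "'a word \<Rightarrow> bool" where
  "freely_reduced w \<longleftrightarrow> (\<forall>i. Suc i < length w \<longrightarrow> w ! Suc i \<noteq> letter_inv (w ! i))"

definition cyclically_reduced :: "'a word \<Rightarrow> bool" where
  "cyclically_reduced w \<longleftrightarrow> (\<forall>k. freely_reduced (rotate k w))"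

definition symmetrised :: "'a set \<Rightarrow> 'a word set \<Rightarrow> bool" where
  "symmetrised S R \<longleftrightarrow>
     R \<subseteq> lists (S \<times> UNIV) \<and>
     (\<forall>r\<in>R. cyclically_reduced r) \<and>
     (\<forall>r\<in>R. word_inv r \<in> R \<and> (\<forall>k. rotate k r \<in> R))"

definition C'_sixth :: "'a set \<Rightarrow> 'a word set \<Rightarrow> bool" where
  "C'_sixth S R \<longleftrightarrow> finite S \<and> symmetrised S R \<and>
     (\<forall>r\<in>R. \<forall>r'\<in>R. r \<noteq> r' \<longrightarrow>
        (\<forall>p. (\<exists>q. r = p @ q) \<and> (\<exists>q'. r' = p @ q') \<longrightarrow> 6 * real (length p) < real (length r)))"

definition elem_step :: "'a set \<Rightarrow> 'a word set \<Rightarrow> 'a word \<Rightarrow> 'a word \<Rightarrow> bool" where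
  "elem_step S R u v \<longleftrightarrow> (\<exists>p q w. u = p @ q \<and> v = p @ w @ q \<and>
      (w \<in> R \<or> (\<exists>x \<in> S \<times> UNIV. w = [x, letter_inv x])))"

definition word_eq :: "'a set \<Rightarrow> 'a word set \<Rightarrow> 'a word \<Rightarrow> 'a word \<Rightarrow> bool" where
  "word_eq S R = equivclp (elem_step S R)"

definition grp_cls :: "'a set \<Rightarrow> 'a word set \<Rightarrow> 'a word \<Rightarrow> 'a word set" where
  "grp_cls S R u = {v \<in> lists (S \<times> UNIV). word_eq S R u v}"

definition grp_elems :: "'a set \<Rightarrow> 'a word set \<Rightarrow> 'a word set set" where
  "grp_elems S R = grp_cls S R ` lists (S \<times> UNIV)"

definition grp_one :: "'a set \<Rightarrow> 'a word set \<Rightarrow> 'a word set" where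
  "grp_one S R = grp_cls S R []"

definition gen_mult :: "'a set \<Rightarrow> 'a word set \<Rightarrow> 'a word set \<Rightarrow> 'a \<Rightarrow> 'a word set" where
  "gen_mult S R g s = {v \<in> lists (S \<times> UNIV). \<exists>u\<in>g. word_eq S R (u @ [(s, True)]) v}"

definition word_dist :: "'a set \<Rightarrow> 'a word set \<Rightarrow> 'a word set \<Rightarrow> 'a word set \<Rightarrow> nat" where
  "word_dist S R g h = (LEAST n. \<exists>u\<in>g. \<exists>v\<in>h. \<exists>w\<in>lists (S \<times> UNIV).
      length w = n \<and> word_eq S R (u @ w) v)"

text \<open>Points: (g, None, 0) is the vertex g; (g, Some s, t) with 0 < t < 1 is the point at
  distance t from g on the edge labelled s from g to g s.\<close>

type_synonym 'a cpoint = "'a word set \<times> 'a option \<times> real"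

definition cayley_points :: "'a set \<Rightarrow> 'a word set \<Rightarrow> 'a cpoint set" where
  "cayley_points S R =
     {(g, None, 0) | g. g \<in> grp_elems S R} \<union>
     {(g, Some s, t) | g s t. g \<in> grp_elems S R \<and> s \<in> S \<and> 0 < t \<and> t < 1}"

definition cayley_base :: "'a set \<Rightarrow> 'a word set \<Rightarrow> 'a cpoint" where
  "cayley_base S R = (grp_one S R, None, 0)"

definition cayley_ends :: "'a set \<Rightarrow> 'a word set \<Rightarrow> 'a cpoint \<Rightarrow> ('a word set \<times> real) set" where
  "cayley_ends S R p = (case p of
      (g, None, t) \<Rightarrow> {(g, 0)}
    | (g, Some s, t) \<Rightarrow> {(g, t), (gen_mult S R g s, 1 - t)})"

definition cayley_through :: "'a set \<Rightarrow> 'a word set \<Rightarrow> 'a cpoint \<Rightarrow> 'a cpoint \<Rightarrow> real" where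
  "cayley_through S R p q = Min {a + real (word_dist S R x y) + b | x a y b.
      (x, a) \<in> cayley_ends S R p \<and> (y, b) \<in> cayley_ends S R q}"

definition cayley_dist :: "'a set \<Rightarrow> 'a word set \<Rightarrow> 'a cpoint \<Rightarrow> 'a cpoint \<Rightarrow> real" where
  "cayley_dist S R p q =
     (if fst p = fst q \<and> fst (snd p) = fst (snd q) \<and> fst (snd p) \<noteq> None
      then min \<bar>snd (snd p) - snd (snd q)\<bar> (cayley_through S R p q)
      else cayley_through S R p q)"

definition geodesic_seg :: "'p set \<Rightarrow> ('p \<Rightarrow> 'p \<Rightarrow> real) \<Rightarrow> (real \<Rightarrow> 'p) \<Rightarrow> real \<Rightarrow> real \<Rightarrow> bool" where
  "geodesic_seg M d \<gamma> a b \<longleftrightarrow> a \<le> b \<and> \<gamma> ` {a..b} \<subseteq> M \<and>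
     (\<forall>s\<in>{a..b}. \<forall>t\<in>{a..b}. d (\<gamma> s) (\<gamma> t) = \<bar>s - t\<bar>)"

definition quasi_geodesic :: "'p set \<Rightarrow> ('p \<Rightarrow> 'p \<Rightarrow> real) \<Rightarrow> real \<Rightarrow> real \<Rightarrow> (real \<Rightarrow> 'p) \<Rightarrow> real \<Rightarrow> real \<Rightarrow> bool" where
  "quasi_geodesic M d K C \<phi> a b \<longleftrightarrow> a \<le> b \<and> \<phi> ` {a..b} \<subseteq> M \<and>
     (\<forall>s\<in>{a..b}. \<forall>t\<in>{a..b}.
        \<bar>s - t\<bar> / K - C \<le> d (\<phi> s) (\<phi> t) \<and> d (\<phi> s) (\<phi> t) \<le> K * \<bar>s - t\<bar> + C)"

definition morse_gauge :: "(real \<times> real \<Rightarrow> real) \<Rightarrow> bool" where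
  "morse_gauge N \<longleftrightarrow> (\<forall>K C. 1 \<le> K \<longrightarrow> 0 \<le> C \<longrightarrow> 0 \<le> N (K, C))"

definition morse_geodesic :: "'p set \<Rightarrow> ('p \<Rightarrow> 'p \<Rightarrow> real) \<Rightarrow> (real \<times> real \<Rightarrow> real) \<Rightarrow> (real \<Rightarrow> 'p) \<Rightarrow> real \<Rightarrow> real \<Rightarrow> bool" where
  "morse_geodesic M d N \<gamma> a b \<longleftrightarrow> geodesic_seg M d \<gamma> a b \<and>
     (\<forall>K C \<phi> a' b'. 1 \<le> K \<and> 0 \<le> C \<and> quasi_geodesic M d K C \<phi> a' b' \<and>
        \<phi> a' \<in> \<gamma> ` {a..b} \<and> \<phi> b' \<in> \<gamma> ` {a..b} \<longrightarrow>
        (\<forall>s\<in>{a'..b'}. \<exists>y\<in>\<gamma> ` {a..b}. d (\<phi> s) y \<le> N (K, C)))"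

definition morse_joined :: "'p set \<Rightarrow> ('p \<Rightarrow> 'p \<Rightarrow> real) \<Rightarrow> (real \<times> real \<Rightarrow> real) \<Rightarrow> 'p \<Rightarrow> 'p \<Rightarrow> bool" where
  "morse_joined M d N x y \<longleftrightarrow>
     (\<exists>\<gamma> a b. morse_geodesic M d N \<gamma> a b \<and> \<gamma> a = x \<and> \<gamma> b = y)"

definition morse_stratum :: "'p set \<Rightarrow> ('p \<Rightarrow> 'p \<Rightarrow> real) \<Rightarrow> (real \<times> real \<Rightarrow> real) \<Rightarrow> 'p \<Rightarrow> 'p set" where
  "morse_stratum M d N e = {y \<in> M. morse_joined M d N e y}"

definition quasi_convex :: "'p set \<Rightarrow> ('p \<Rightarrow> 'p \<Rightarrow> real) \<Rightarrow> 'p set \<Rightarrow> bool" where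
  "quasi_convex M d Y \<longleftrightarrow> Y \<subseteq> M \<and> (\<exists>k. \<forall>\<gamma> a b. geodesic_seg M d \<gamma> a b \<and> \<gamma> a \<in> Y \<and> \<gamma> b \<in> Y \<longrightarrow>
       (\<forall>t\<in>{a..b}. \<exists>z\<in>Y. d (\<gamma> t) z \<le> k))"

definition stable_subset :: "'p set \<Rightarrow> ('p \<Rightarrow> 'p \<Rightarrow> real) \<Rightarrow> 'p set \<Rightarrow> bool" where
  "stable_subset M d Y \<longleftrightarrow> quasi_convex M d Y \<and>
     (\<exists>N. morse_gauge N \<and> (\<forall>x\<in>Y. \<forall>y\<in>Y. morse_joined M d N x y))"

definition asdim_le :: "'p set \<Rightarrow> ('p \<Rightarrow> 'p \<Rightarrow> real) \<Rightarrow> nat \<Rightarrow> bool" where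
  "asdim_le Y d n \<longleftrightarrow> (\<forall>r>0. \<exists>\<U>. \<Union>\<U> = Y \<and>
      (\<exists>D. \<forall>U\<in>\<U>. \<forall>x\<in>U. \<forall>y\<in>U. d x y \<le> D) \<and>
      (\<forall>x\<in>Y. finite {U\<in>\<U>. \<exists>y\<in>U. d x y \<le> r} \<and> card {U\<in>\<U>. \<exists>y\<in>U. d x y \<le> r} \<le> n + 1))"

definition gromov_prod :: "('p \<Rightarrow> 'p \<Rightarrow> real) \<Rightarrow> 'p \<Rightarrow> 'p \<Rightarrow> 'p \<Rightarrow> real" where
  "gromov_prod d e x y = (d x e + d y e - d x y) / 2"

definition seq_to_infty :: "'p set \<Rightarrow> ('p \<Rightarrow> 'p \<Rightarrow> real) \<Rightarrow> 'p \<Rightarrow> (nat \<Rightarrow> 'p) \<Rightarrow> bool" where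
  "seq_to_infty Y d e x \<longleftrightarrow> range x \<subseteq> Y \<and>
     (\<forall>B. \<exists>n0. \<forall>i\<ge>n0. \<forall>j\<ge>n0. gromov_prod d e (x i) (x j) \<ge> B)"

definition seq_equiv :: "('p \<Rightarrow> 'p \<Rightarrow> real) \<Rightarrow> 'p \<Rightarrow> (nat \<Rightarrow> 'p) \<Rightarrow> (nat \<Rightarrow> 'p) \<Rightarrow> bool" where
  "seq_equiv d e x y \<longleftrightarrow> (\<forall>B. \<exists>n0. \<forall>i\<ge>n0. \<forall>j\<ge>n0. gromov_prod d e (x i) (y j) \<ge> B)"

definition seq_boundary :: "'p set \<Rightarrow> ('p \<Rightarrow> 'p \<Rightarrow> real) \<Rightarrow> 'p \<Rightarrow> (nat \<Rightarrow> 'p) set set" where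
  "seq_boundary Y d e =
     (\<lambda>x. {y. seq_to_infty Y d e y \<and> seq_equiv d e x y}) ` {x. seq_to_infty Y d e x}"

definition boundary_gromov_prod ::
  "('p \<Rightarrow> 'p \<Rightarrow> real) \<Rightarrow> 'p \<Rightarrow> (nat \<Rightarrow> 'p) set \<Rightarrow> (nat \<Rightarrow> 'p) set \<Rightarrow> ereal" where
  "boundary_gromov_prod d e \<xi> \<eta> = (SUP x\<in>\<xi>. SUP y\<in>\<eta>.
      Liminf (sequentially \<times>\<^sub>F sequentially) (\<lambda>(i, j). ereal (gromov_prod d e (x i) (y j))))"

definition metric_on :: "'b set \<Rightarrow> ('b \<Rightarrow> 'b \<Rightarrow> real) \<Rightarrow> bool" where
  "metric_on B \<rho> \<longleftrightarrow> (\<forall>x\<in>B. \<forall>y\<in>B. 0 \<le> \<rho> x y \<and> (\<rho> x y = 0 \<longleftrightarrow> x = y) \<and> \<rho> x y = \<rho> y x) \<and>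
     (\<forall>x\<in>B. \<forall>y\<in>B. \<forall>z\<in>B. \<rho> x z \<le> \<rho> x y + \<rho> y z)"

definition visual_metric ::
  "'p set \<Rightarrow> ('p \<Rightarrow> 'p \<Rightarrow> real) \<Rightarrow> 'p \<Rightarrow> ((nat \<Rightarrow> 'p) set \<Rightarrow> (nat \<Rightarrow> 'p) set \<Rightarrow> real) \<Rightarrow> bool" where
  "visual_metric Y d e \<rho> \<longleftrightarrow> metric_on (seq_boundary Y d e) \<rho> \<and>
     (\<exists>\<epsilon>>0. \<exists>k1>0. \<exists>k2>0. \<forall>\<xi>\<in>seq_boundary Y d e. \<forall>\<eta>\<in>seq_boundary Y d e. \<xi> \<noteq> \<eta> \<longrightarrow>
        \<bar>boundary_gromov_prod d e \<xi> \<eta>\<bar> \<noteq> \<infinity> \<and>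
        k1 * exp (- \<epsilon> * real_of_ereal (boundary_gromov_prod d e \<xi> \<eta>)) \<le> \<rho> \<xi> \<eta> \<and>
        \<rho> \<xi> \<eta> \<le> k2 * exp (- \<epsilon> * real_of_ereal (boundary_gromov_prod d e \<xi> \<eta>)))"

definition metric_open :: "'b set \<Rightarrow> ('b \<Rightarrow> 'b \<Rightarrow> real) \<Rightarrow> 'b set \<Rightarrow> bool" where
  "metric_open B \<rho> U \<longleftrightarrow> U \<subseteq> B \<and> (\<forall>x\<in>U. \<exists>\<epsilon>>0. \<forall>y\<in>B. \<rho> x y < \<epsilon> \<longrightarrow> y \<in> U)"

text \<open>Lebesgue number of a cover (Buyalo): inf over x of sup over U of dist(x, B - U).\<close>
definition lebesgue_number :: "'b set \<Rightarrow> ('b \<Rightarrow> 'b \<Rightarrow> real) \<Rightarrow> 'b set set \<Rightarrow> ereal" where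
  "lebesgue_number B \<rho> \<U> = (INF x\<in>B. SUP U\<in>\<U>. INF y\<in>B - U. ereal (\<rho> x y))"

definition cdim_le :: "'b set \<Rightarrow> ('b \<Rightarrow> 'b \<Rightarrow> real) \<Rightarrow> nat \<Rightarrow> bool" where
  "cdim_le B \<rho> m \<longleftrightarrow> (\<exists>\<delta>. 0 < \<delta> \<and> \<delta> < 1 \<and> (\<exists>r0>0. \<forall>r. 0 < r \<and> r < r0 \<longrightarrow>
     (\<exists>\<U>. \<Union>\<U> = B \<and> (\<forall>U\<in>\<U>. metric_open B \<rho> U) \<and>
        (\<forall>U\<in>\<U>. \<forall>x\<in>U. \<forall>y\<in>U. \<rho> x y \<le> r) \<and>
        lebesgue_number B \<rho> \<U> \<ge> ereal (\<delta> * r) \<and>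
        (\<forall>x\<in>B. finite {U\<in>\<U>. x \<in> U} \<and> card {U\<in>\<U>. x \<in> U} \<le> m + 1))))"

end

theory Submission
  imports Defs
begin

text \<open>
  Choosing for every vertex an edge towards a base vertex turns the geodesics from the base vertex into a
  tree. By Gauss--Bonnet for reduced van Kampen diagrams, the region between two adjacent branches is a
  ladder of relator faces, and near a Morse geodesic these faces have bounded length. Relators embed
  isometrically, so each face occupies about half of its length on either branch, and by \<open>C'(1/6)\<close> a face
  on one side of a branch overlaps a face on the other side in less than a sixth of it. Hence three
  consecutive branches cannot run disjointly for long: passing outwards lengthens every face. So sufficiently
  far below a ball centred on a Morse geodesic the tree has at most two branches.

  Grouping the points at infinity by their ancestor at level \<open>n\<close> thus gives covers of the boundary of
  multiplicity two at scale \<open>exp (- \<epsilon> n)\<close>. For a stable subset one cuts it into annuli around the base vertex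
  and groups each annulus by ancestors slightly below it; a ball meets two annuli and at most two groups in
  each, and joining groups that see two groups of the annulus below brings the count down to three.\<close>

section \<open>Words and the Cayley graph\<close>

text \<open>Group elements are sets of words; extensionality must not be tried on equations between them.\<close>
declare equalityI [rule del]

text \<open>\<open>R\<close> may be infinite, so the lengths of relators are unbounded and the
  Cayley graph need not be hyperbolic: every uniform constant has to come from the Morse gauge. The
  gauge enters through two kinds of quasi-geodesics built from the tree. The tree path to a vertex
  within \<open>L\<close> of \<open>anc k x\<close>, continued on the tree path of \<open>x\<close>,
  is a quasi-geodesic with constants \<open>(1, 2L+1)\<close> ending at \<open>x\<close>; hence all
  vertices of such a ball, even those that are not Morse, have fellow travelling ancestors. This is
  essential, since the balls must be full balls of the Cayley graph: connectedness of the ball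
  supplies the edges between strands over which the ladders are built. Corner paths with constants
  \<open>(3, 0)\<close> translate Gromov products into levels. The bound
  \<open>6 * \<delta> + 12\<close> on faces arises because two \<open>\<delta>\<close>-close
  branches would cut a longer face at one level by a path shorter than both arcs of the relator.
  Ladders, nontriviality of proper subwords of relators and their isometric embedding all rest on
  the same curvature formula, with different bounds on the arcs at the boundary.\<close>

lemma letter_inv_inv [simp]: "letter_inv (letter_inv x) = x"
  by (simp add: letter_inv_def)

lemma letter_inv_neq [simp]: "letter_inv x \<noteq> x" "x \<noteq> letter_inv x"
  by (auto simp: letter_inv_def prod_eq_iff)

lemma letter_inv_inj [simp]: "letter_inv x = letter_inv y \<longleftrightarrow> x = y"
  by (metis letter_inv_inv)

lemma letter_inv_mem [simp]: "letter_inv x \<in> S \<times> UNIV \<longleftrightarrow> x \<in> S \<times> UNIV"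
  by (auto simp: letter_inv_def mem_Times_iff)

lemma word_inv_simps [simp]:
  "word_inv [] = []" "word_inv (x # w) = word_inv w @ [letter_inv x]"
  "word_inv (u @ v) = word_inv v @ word_inv u" "length (word_inv w) = length w"
  by (simp_all add: word_inv_def)

lemma word_inv_inv [simp]: "word_inv (word_inv w) = w"
  by (simp add: word_inv_def rev_map o_def)

lemma word_inv_inj [simp]: "word_inv u = word_inv v \<longleftrightarrow> u = v"
  by (metis word_inv_inv)

lemma word_inv_eq_Nil [simp]: "word_inv w = [] \<longleftrightarrow> w = []"
  by (simp add: word_inv_def)

lemma word_inv_lists [simp]: "word_inv w \<in> lists (S \<times> UNIV) \<longleftrightarrow> w \<in> lists (S \<times> UNIV)"
  by (induction w) (auto simp: lists_eq_set letter_inv_def)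

lemma equivclp_map:
  assumes "equivclp r u v" and "\<And>u v. r u v \<Longrightarrow> r (f u) (f v)"
  shows "equivclp r (f u) (f v)"
  using assms(1)
proof (induction rule: equivclp_induct)
  case (step y z)
  then have "equivclp r (f y) (f z)"
    by (metis assms(2) r_into_equivclp equivclp_sym)
  with step show ?case by (meson equivclp_trans)
qed simp

locale presentation =
  fixes S :: "'a set" and R :: "'a word set"
  assumes finS: "finite S" and C6: "C'_sixth S R" and Nil_notin_R: "[] \<notin> R"
begin

definition Ltr :: "'a letter set" where "Ltr = S \<times> UNIV"
definition W :: "'a word set" where "W = lists Ltr"
abbreviation weq :: "'a word \<Rightarrow> 'a word \<Rightarrow> bool" (infix \<open>\<doteq>\<close> 50) where "u \<doteq> v \<equiv> word_eq S R u v"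
abbreviation G :: "'a word set set" where "G \<equiv> grp_elems S R"

lemma W_simps [simp]:
  "[] \<in> W" "x # w \<in> W \<longleftrightarrow> x \<in> Ltr \<and> w \<in> W" "u @ v \<in> W \<longleftrightarrow> u \<in> W \<and> v \<in> W"
  by (auto simp: W_def)

lemma W_iff: "w \<in> W \<longleftrightarrow> set w \<subseteq> Ltr" by (auto simp: W_def)

lemma W_inv [simp]: "word_inv w \<in> W \<longleftrightarrow> w \<in> W" by (simp only: W_def Ltr_def word_inv_lists)

lemma Ltr_inv [simp]: "letter_inv x \<in> Ltr \<longleftrightarrow> x \<in> Ltr" by (simp only: Ltr_def letter_inv_mem)

lemma W_take: "w \<in> W \<Longrightarrow> take k w \<in> W" by (auto simp: W_iff dest: in_set_takeD)
lemma W_drop: "w \<in> W \<Longrightarrow> drop k w \<in> W" by (auto simp: W_iff dest: in_set_dropD)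
lemma W_nth: "w \<in> W \<Longrightarrow> k < length w \<Longrightarrow> w ! k \<in> Ltr" by (auto simp: W_iff)

lemma sym: "symmetrised S R" using C6 by (simp add: C'_sixth_def)

lemma R_W: "r \<in> R \<Longrightarrow> r \<in> W" using sym by (auto simp only: symmetrised_def W_def Ltr_def)

lemma R_inv: "r \<in> R \<Longrightarrow> word_inv r \<in> R" using sym by (auto simp: symmetrised_def)

lemma R_rotate: "r \<in> R \<Longrightarrow> rotate k r \<in> R" using sym by (auto simp: symmetrised_def)

lemma R_swap: "u @ v \<in> R \<Longrightarrow> v @ u \<in> R"
  using R_rotate[of "u @ v" "length u"] by (simp add: rotate_append)

lemma R_reduced: "r \<in> R \<Longrightarrow> freely_reduced r"
  using sym unfolding symmetrised_def cyclically_reduced_def by (metis rotate0 id_apply)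

lemma R_nonempty: "r \<in> R \<Longrightarrow> r \<noteq> []" using Nil_notin_R by auto

lemma piece_length:
  assumes "p @ q \<in> R" "p @ q' \<in> R" "q \<noteq> q'"
  shows "6 * length p < length (p @ q)"
proof -
  have "6 * real (length p) < real (length (p @ q))"
    using C6 assms unfolding C'_sixth_def by blast
  then show ?thesis by linarith
qed

section \<open>Word equality as a congruence with cancellation\<close>

lemma weq_refl [simp]: "u \<doteq> u" by (simp add: word_eq_def)
lemma weq_sym: "u \<doteq> v \<Longrightarrow> v \<doteq> u" by (simp add: word_eq_def equivclp_sym)
lemma weq_trans: "u \<doteq> v \<Longrightarrow> v \<doteq> w \<Longrightarrow> u \<doteq> w" unfolding word_eq_def by (rule equivclp_trans)

lemma weq_append_left: "u \<doteq> v \<Longrightarrow> a @ u \<doteq> a @ v"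
  unfolding word_eq_def
  by (erule equivclp_map[where f = "\<lambda>u. a @ u"]) (metis (no_types, lifting) append.assoc elem_step_def)

lemma weq_append_right: "u \<doteq> v \<Longrightarrow> u @ a \<doteq> v @ a"
  unfolding word_eq_def
  by (erule equivclp_map[where f = "\<lambda>u. u @ a"]) (metis (no_types, lifting) append.assoc elem_step_def)

lemma weq_append: "u \<doteq> v \<Longrightarrow> u' \<doteq> v' \<Longrightarrow> u @ u' \<doteq> v @ v'"
  by (meson weq_append_left weq_append_right weq_trans)

lemma relator_weq: "r \<in> R \<Longrightarrow> r \<doteq> []"
proof -
  assume "r \<in> R"
  then have "elem_step S R [] r" unfolding elem_step_def Ltr_def by auto
  then show ?thesis unfolding word_eq_def by (simp add: equivclp_sym r_into_equivclp)
qed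

lemma cancel_weq: "x \<in> Ltr \<Longrightarrow> [x, letter_inv x] \<doteq> []"
proof -
  assume "x \<in> Ltr"
  then have "elem_step S R [] [x, letter_inv x]" unfolding elem_step_def Ltr_def
    by (intro exI[of _ "[]"] exI[of _ "[x, letter_inv x]"]) auto
  then show ?thesis unfolding word_eq_def by (simp add: equivclp_sym r_into_equivclp)
qed

lemma inv_right_weq: "w \<in> W \<Longrightarrow> w @ word_inv w \<doteq> []"
proof (induction w)
  case (Cons x w)
  then have x: "x \<in> Ltr" and IH: "w @ word_inv w \<doteq> []" by auto
  have "[x] @ (w @ word_inv w) @ [letter_inv x] \<doteq> [x] @ [] @ [letter_inv x]"
    by (intro weq_append IH weq_refl)
  then show ?case using cancel_weq[OF x] by (auto intro: weq_trans)
qed simp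

lemma inv_left_weq: "w \<in> W \<Longrightarrow> word_inv w @ w \<doteq> []"
  using inv_right_weq[of "word_inv w"] by simp

lemma weq_cancel_left:
  assumes "a \<in> W" shows "a @ u \<doteq> a @ v \<longleftrightarrow> u \<doteq> v"
proof
  assume "a @ u \<doteq> a @ v"
  then have "word_inv a @ a @ u \<doteq> word_inv a @ a @ v" by (rule weq_append_left)
  moreover have "word_inv a @ a @ z \<doteq> z" for z
    using weq_append_right[OF inv_left_weq[OF assms], of z] by simp
  ultimately show "u \<doteq> v" by (meson weq_sym weq_trans)
qed (rule weq_append_left)

lemma weq_cancel_right:
  assumes "a \<in> W" shows "u @ a \<doteq> v @ a \<longleftrightarrow> u \<doteq> v"
proof
  assume "u @ a \<doteq> v @ a"
  then have "(u @ a) @ word_inv a \<doteq> (v @ a) @ word_inv a" by (rule weq_append_right)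
  moreover have "(z @ a) @ word_inv a \<doteq> z" for z
    using weq_append_left[OF inv_right_weq[OF assms], of z] by simp
  ultimately show "u \<doteq> v" by (meson weq_sym weq_trans)
qed (rule weq_append_right)

lemma weq_iff_trivial: assumes "v \<in> W" shows "u \<doteq> v \<longleftrightarrow> u @ word_inv v \<doteq> []"
proof -
  have "u \<doteq> v \<longleftrightarrow> u @ word_inv v \<doteq> v @ word_inv v" using assms by (simp add: weq_cancel_right)
  then show ?thesis using inv_right_weq[OF assms] weq_sym weq_trans by blast
qed

lemma weq_conj: assumes "u \<in> W" "u @ v \<doteq> []" shows "v @ u \<doteq> []"
proof -
  have "u @ v @ u \<doteq> u @ []" using weq_append_right[OF assms(2), of u] by simp
  then show ?thesis using weq_cancel_left[OF assms(1)] by blast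
qed

text \<open>Right multiplication of a class by a word, that is, following a path in the Cayley
  graph; \<open>gen_mult_eq\<close> identifies \<open>gen_mult\<close> as the case of one positive
  letter.\<close>

definition mul :: "'a word set \<Rightarrow> 'a word \<Rightarrow> 'a word set" where
  "mul g w = {v \<in> W. \<exists>u\<in>g. u @ w \<doteq> v}"

lemma cls_def: "grp_cls S R u = {v \<in> W. u \<doteq> v}" by (simp add: grp_cls_def W_def Ltr_def)

lemma G_def: "G = grp_cls S R ` W" by (simp add: grp_elems_def W_def Ltr_def)

lemma cls_self: "u \<in> W \<Longrightarrow> u \<in> grp_cls S R u" by (simp add: cls_def)

lemma cls_eq_iff: assumes "v \<in> W" shows "grp_cls S R u = grp_cls S R v \<longleftrightarrow> u \<doteq> v"
proof
  assume "grp_cls S R u = grp_cls S R v"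
  then have "v \<in> grp_cls S R u" using cls_self[OF assms] by simp
  then show "u \<doteq> v" by (simp add: cls_def)
next
  assume uv: "u \<doteq> v"
  have "u \<doteq> z \<longleftrightarrow> v \<doteq> z" for z using uv weq_sym weq_trans by blast
  then show "grp_cls S R u = grp_cls S R v" by (simp add: cls_def)
qed

lemma mul_cls: assumes "u \<in> W" shows "mul (grp_cls S R u) w = grp_cls S R (u @ w)"
proof (intro set_eqI iffI)
  fix v assume "v \<in> mul (grp_cls S R u) w"
  then obtain u' where "v \<in> W" "u \<doteq> u'" "u' @ w \<doteq> v" by (auto simp: mul_def cls_def)
  then show "v \<in> grp_cls S R (u @ w)" using weq_append_right weq_trans by (fastforce simp: cls_def)
next
  fix v assume "v \<in> grp_cls S R (u @ w)"
  then show "v \<in> mul (grp_cls S R u) w" using cls_self[OF assms] by (auto simp: mul_def cls_def)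
qed

lemma G_cases: "g \<in> G \<Longrightarrow> \<exists>u\<in>W. g = grp_cls S R u" by (auto simp: G_def)

lemma mul_in_G [simp, intro]: "g \<in> G \<Longrightarrow> w \<in> W \<Longrightarrow> mul g w \<in> G"
  using G_cases[of g] by (auto simp: mul_cls G_def)

lemma mul_Nil [simp]: "g \<in> G \<Longrightarrow> mul g [] = g"
  using G_cases[of g] by (auto simp: mul_cls)

lemma mul_append: "g \<in> G \<Longrightarrow> u \<in> W \<Longrightarrow> mul g (u @ v) = mul (mul g u) v"
  using G_cases[of g] by (auto simp: mul_cls)

lemma mul_eq_iff: "g \<in> G \<Longrightarrow> u \<in> W \<Longrightarrow> v \<in> W \<Longrightarrow> mul g u = mul g v \<longleftrightarrow> u \<doteq> v"
  using G_cases[of g] by (auto simp: mul_cls cls_eq_iff weq_cancel_left)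

lemma mul_fix_iff: "g \<in> G \<Longrightarrow> u \<in> W \<Longrightarrow> mul g u = g \<longleftrightarrow> u \<doteq> []"
  using mul_eq_iff[of g u "[]"] by simp

lemma mul_inv: "g \<in> G \<Longrightarrow> w \<in> W \<Longrightarrow> mul (mul g w) (word_inv w) = g"
  by (metis inv_right_weq mul_append mul_fix_iff W_simps(3) W_inv)

lemma mul_inv_letter: "g \<in> G \<Longrightarrow> x \<in> Ltr \<Longrightarrow> mul (mul g [x]) [letter_inv x] = g"
  using mul_inv[of g "[x]"] by simp

lemma G_trans: assumes "g \<in> G" "h \<in> G" shows "\<exists>w\<in>W. mul g w = h"
proof -
  obtain u v where "u \<in> W" "g = grp_cls S R u" "v \<in> W" "h = grp_cls S R v" using assms G_cases by meson
  moreover from this have "u @ (word_inv u @ v) \<doteq> v"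
    using weq_append_right[OF inv_right_weq[of u], of v] by simp
  ultimately show ?thesis
    by (intro bexI[of _ "word_inv u @ v"]) (auto simp: mul_cls cls_eq_iff)
qed

lemma one_in_G [simp]: "grp_one S R \<in> G" by (auto simp: grp_one_def G_def)

lemma gen_mult_eq: "gen_mult S R g s = mul g [(s, True)]" by (simp add: gen_mult_def mul_def W_def Ltr_def)

abbreviation dst :: "'a word set \<Rightarrow> 'a word set \<Rightarrow> nat" where "dst \<equiv> word_dist S R"

text \<open>Representatives of a class differ by word equality only, so their choice in
  \<open>word_dist\<close> is immaterial, and a distance is the length of a shortest path read from
  the first vertex.\<close>

lemma dst_eq: assumes "g \<in> G" "h \<in> G"
  shows "dst g h = (LEAST n. \<exists>w\<in>W. length w = n \<and> mul g w = h)"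
proof -
  obtain u v where u: "u \<in> W" "g = grp_cls S R u" and v: "v \<in> W" "h = grp_cls S R v" using assms G_cases by meson
  have "(\<exists>u'\<in>g. \<exists>v'\<in>h. \<exists>w\<in>W. length w = n \<and> u' @ w \<doteq> v') \<longleftrightarrow> (\<exists>w\<in>W. length w = n \<and> mul g w = h)" for n
  proof
    assume "\<exists>u'\<in>g. \<exists>v'\<in>h. \<exists>w\<in>W. length w = n \<and> u' @ w \<doteq> v'"
    then obtain u' v' w where h: "u \<doteq> u'" "v \<doteq> v'" "w \<in> W" "length w = n" "u' @ w \<doteq> v'"
      using u v by (auto simp: cls_def)
    then have "u @ w \<doteq> v" using weq_trans[OF weq_append_right[OF h(1)] h(5)] weq_trans[OF _ weq_sym[OF h(2)]] by blast
    then show "\<exists>w\<in>W. length w = n \<and> mul g w = h" using h u v by (auto simp: mul_cls cls_eq_iff)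
  next
    assume "\<exists>w\<in>W. length w = n \<and> mul g w = h"
    then obtain w where "w \<in> W" "length w = n" "u @ w \<doteq> v" using u v by (auto simp: mul_cls cls_eq_iff)
    then show "\<exists>u'\<in>g. \<exists>v'\<in>h. \<exists>w\<in>W. length w = n \<and> u' @ w \<doteq> v'"
      using cls_self[OF u(1)] cls_self[OF v(1)] u(2) v(2) by blast
  qed
  then show ?thesis unfolding word_dist_def W_def[symmetric] Ltr_def[symmetric] by simp
qed

lemma dst_word: assumes "g \<in> G" "h \<in> G" shows "\<exists>w\<in>W. length w = dst g h \<and> mul g w = h"
proof -
  have "\<exists>n. \<exists>w\<in>W. length w = n \<and> mul g w = h" using G_trans[OF assms] by auto
  from LeastI_ex[OF this] show ?thesis by (simp add: dst_eq[OF assms])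
qed

lemma dst_le: "g \<in> G \<Longrightarrow> w \<in> W \<Longrightarrow> dst g (mul g w) \<le> length w"
  by (subst dst_eq) (auto intro!: Least_le)

lemma dst_leI: "g \<in> G \<Longrightarrow> w \<in> W \<Longrightarrow> mul g w = h \<Longrightarrow> dst g h \<le> length w"
  using dst_le by blast

lemma dst_self [simp]: "g \<in> G \<Longrightarrow> dst g g = 0"
  using dst_le[of g "[]"] by simp

lemma dst_zero: "g \<in> G \<Longrightarrow> h \<in> G \<Longrightarrow> dst g h = 0 \<longleftrightarrow> g = h"
  using dst_word[of g h] by auto

lemma dst_sym: assumes "g \<in> G" "h \<in> G" shows "dst g h = dst h g"
proof -
  have "dst h g \<le> dst g h" if "g \<in> G" "h \<in> G" for g h
    using dst_word[OF that] mul_inv[of g] that by (metis dst_leI W_inv word_inv_simps(4))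
  then show ?thesis using assms by (meson le_antisym)
qed

lemma dst_triangle: assumes "g \<in> G" "h \<in> G" "k \<in> G" shows "dst g k \<le> dst g h + dst h k"
proof -
  obtain u v where "u \<in> W" "length u = dst g h" "mul g u = h" "v \<in> W" "length v = dst h k" "mul h v = k"
    using dst_word assms by meson
  then show ?thesis using dst_leI[of g "u @ v" k] assms by (simp add: mul_append)
qed

lemma finLtr: "finite Ltr" using finS by (simp add: Ltr_def)

lemma finite_ball: "g \<in> G \<Longrightarrow> finite {h \<in> G. dst g h \<le> n}"
proof -
  assume g: "g \<in> G"
  have "{h \<in> G. dst g h \<le> n} \<subseteq> mul g ` {w. set w \<subseteq> Ltr \<and> length w \<le> n}"
    using dst_word[OF g] by (force simp: W_iff)
  then show ?thesis using finite_lists_length_le[of Ltr n] finLtr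
    by (meson finite_imageI finite_subset)
qed

text \<open>A ball is an image of the set of words of length at most \<open>n\<close>, which is
  finite and does not depend on the centre.\<close>

lemma card_ball: "\<exists>B. \<forall>g\<in>G. card {h \<in> G. dst g h \<le> n} \<le> B"
proof -
  let ?A = "{w. set w \<subseteq> Ltr \<and> length w \<le> n}"
  have fin: "finite ?A" using finite_lists_length_le[of Ltr n] finLtr by simp
  have "card {h \<in> G. dst g h \<le> n} \<le> card ?A" if g: "g \<in> G" for g
  proof -
    have "{h \<in> G. dst g h \<le> n} \<subseteq> mul g ` ?A" using dst_word[OF g] by (force simp: W_iff)
    then have "card {h \<in> G. dst g h \<le> n} \<le> card (mul g ` ?A)" by (intro card_mono finite_imageI fin)
    also have "\<dots> \<le> card ?A" by (rule card_image_le[OF fin])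
    finally show ?thesis .
  qed
  then show ?thesis by blast
qed

definition geo :: "'a word \<Rightarrow> bool" where
  "geo w \<longleftrightarrow> w \<in> W \<and> (\<forall>v\<in>W. v \<doteq> w \<longrightarrow> length w \<le> length v)"

lemma geo_W: "geo w \<Longrightarrow> w \<in> W" by (simp add: geo_def)

lemma geo_iff_dst: "g \<in> G \<Longrightarrow> w \<in> W \<Longrightarrow> geo w \<longleftrightarrow> dst g (mul g w) = length w"
  by (smt (verit, best) dst_le dst_word geo_def le_antisym mul_eq_iff mul_in_G)

lemma geo_sub: assumes "geo (u @ v @ w)" shows "geo v"
  unfolding geo_def
proof (intro conjI ballI impI)
  show "v \<in> W" using assms by (auto simp: geo_def)
  fix v' assume "v' \<in> W" "v' \<doteq> v"
  then have "u @ v' @ w \<doteq> u @ v @ w" by (intro weq_append weq_refl)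
  then show "length v \<le> length v'" using assms \<open>v' \<in> W\<close> unfolding geo_def
    by (metis W_simps(3) add_le_cancel_left add_le_cancel_right length_append)
qed

lemma geo_inv: "geo w \<Longrightarrow> geo (word_inv w)"
  unfolding geo_def
proof (intro conjI ballI impI)
  assume *: "w \<in> W \<and> (\<forall>v\<in>W. v \<doteq> w \<longrightarrow> length w \<le> length v)"
  then show "word_inv w \<in> W" by simp
  fix v assume v: "v \<in> W" "v \<doteq> word_inv w"
  then have "v @ w \<doteq> []" using weq_iff_trivial[of "word_inv w" v] * by simp
  then have "word_inv v @ v @ w \<doteq> word_inv v @ []" by (rule weq_append_left)
  moreover have "word_inv v @ v @ w \<doteq> w" using weq_append_right[OF inv_left_weq[OF v(1)], of w] by simp
  ultimately have "word_inv v \<doteq> w" using weq_sym weq_trans by (metis append_Nil2)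
  then show "length (word_inv w) \<le> length v" using * v by (metis W_inv word_inv_simps(4))
qed

end

section \<open>Van Kampen diagrams\<close>

text \<open>Consecutive pairs without and with wrap-around. Stating the axioms of diagrams with
  \<open>cyc\<close> makes them insensitive to rotating a face (\<open>cyc_swap\<close>).\<close>

definition lin :: "'b list \<Rightarrow> ('b \<times> 'b) set" where "lin xs = set (zip xs (tl xs))"
definition cyc :: "'b list \<Rightarrow> ('b \<times> 'b) set" where "cyc xs = set (zip xs (rotate1 xs))"

lemma lin_simps [simp]: "lin [] = {}" "lin [x] = {}"
  by (simp_all add: lin_def)

lemma lin_Cons: "xs \<noteq> [] \<Longrightarrow> lin (x # xs) = insert (x, hd xs) (lin xs)"
  by (cases xs) (simp_all add: lin_def)

lemma lin_append: "xs \<noteq> [] \<Longrightarrow> ys \<noteq> [] \<Longrightarrow> lin (xs @ ys) = lin xs \<union> {(last xs, hd ys)} \<union> lin ys"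
proof (induction xs)
  case (Cons x xs)
  show ?case
  proof (cases "xs = []")
    case True with Cons show ?thesis by (simp add: lin_Cons)
  next
    case False with Cons show ?thesis by (simp add: lin_Cons insert_commute)
  qed
qed simp

lemma cyc_Nil [simp]: "cyc [] = {}" by (simp add: cyc_def)

lemma cyc_ne: "xs \<noteq> [] \<Longrightarrow> cyc xs = insert (last xs, hd xs) (lin xs)"
proof -
  assume "xs \<noteq> []"
  then obtain y ys where xs: "xs = y # ys" by (cases xs) auto
  have "set (zip (y # ys) (ys @ [z])) = insert (last (y # ys), z) (lin (y # ys))" for z
    by (induction ys arbitrary: y) (auto simp: lin_def intro!: equalityI)
  then show ?thesis by (simp add: xs cyc_def)
qed

lemma cyc_append: "xs \<noteq> [] \<Longrightarrow> ys \<noteq> [] \<Longrightarrow>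
    cyc (xs @ ys) = lin xs \<union> lin ys \<union> {(last xs, hd ys), (last ys, hd xs)}"
  by (simp add: cyc_ne lin_append insert_commute Un_ac)

lemma cyc_Cons: "xs \<noteq> [] \<Longrightarrow> cyc (x # xs) = lin xs \<union> {(x, hd xs), (last xs, x)}"
  using cyc_append[of "[x]" xs] by simp

lemma cyc_swap: "cyc (xs @ ys) = cyc (ys @ xs)"
  by (cases "xs = []"; cases "ys = []"; simp add: cyc_append insert_commute Un_ac)

lemma cyc_in_set: "(a, b) \<in> cyc xs \<Longrightarrow> a \<in> set xs \<and> b \<in> set xs"
  by (auto simp: cyc_def dest: set_zip_leftD set_zip_rightD)

lemma lin_in_set: "(a, b) \<in> lin xs \<Longrightarrow> a \<in> set xs \<and> b \<in> set xs"
  unfolding lin_def by (metis list.set_sel(2) set_zip_leftD set_zip_rightD tl_Nil)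

lemma lin_sub_cyc: "lin xs \<subseteq> cyc xs" by (cases "xs = []") (auto simp: cyc_ne)

text \<open>The cyclic list from the successor of \<open>e\<close> round to its predecessor: the
  path that replaces an edge of the boundary when the face behind it is cut off.\<close>

definition aft :: "'b list \<Rightarrow> 'b \<Rightarrow> 'b list" where
  "aft f e = tl (dropWhile (\<lambda>x. x \<noteq> e) f) @ takeWhile (\<lambda>x. x \<noteq> e) f"

lemma aft_split: "e \<notin> set us \<Longrightarrow> aft (us @ e # vs) e = vs @ us"
proof -
  assume "e \<notin> set us"
  then have "\<And>x. x \<in> set us \<Longrightarrow> x \<noteq> e" by auto
  then show ?thesis by (simp add: aft_def takeWhile_tail dropWhile_append2)
qed

lemma aftE:
  assumes "e \<in> set f" obtains us vs where "f = us @ e # vs" "e \<notin> set us" "aft f e = vs @ us"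
  using assms split_list_first[of e f] aft_split by metis

lemma set_aft: "e \<in> set f \<Longrightarrow> insert e (set (aft f e)) = set f"
  by (erule aftE) (auto intro!: equalityI)

lemma distinct_aft: "e \<in> set f \<Longrightarrow> distinct f \<Longrightarrow> distinct (e # aft f e)"
  by (erule aftE) (auto intro!: equalityI)

lemma cyc_aft: "e \<in> set f \<Longrightarrow> cyc (e # aft f e) = cyc f"
  by (erule aftE) (metis append_Cons cyc_swap)

lemma length_aft: "e \<in> set f \<Longrightarrow> length f = Suc (length (aft f e))"
  by (erule aftE) simp

lemma map_aft_rotate: "e \<in> set f \<Longrightarrow> \<exists>k. map l (e # aft f e) = rotate k (map l f)"
  by (erule aftE) (metis append_Cons list.simps(9) map_append rotate_append length_map)

definition darts :: "nat list \<Rightarrow> nat list set \<Rightarrow> nat set" where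
  "darts os FS = set os \<union> (\<Union>f\<in>FS. set f)"

text \<open>A planar diagram over the presentation, as a combinatorial map: \<open>os\<close> is the outer face and
  \<open>FS\<close> are the inner faces, all cyclic lists of darts; \<open>al\<close> reverses darts; \<open>vt\<close> is a labelling of the
  initial vertices of darts (possibly coarser than the vertices of the map) and \<open>ps\<close> maps these to
  the Cayley graph. Planarity is the Euler inequality, which for a coarser labelling still holds after
  gluing; connectedness is never needed.\<close>
locale diagram = presentation S R for S :: "'a set" and R +
  fixes os :: "nat list" and FS :: "nat list set" and al :: "nat \<Rightarrow> nat"
    and lab :: "nat \<Rightarrow> 'a letter" and vt :: "nat \<Rightarrow> nat" and ps :: "nat \<Rightarrow> 'a word set"
  assumes finFS: "finite FS" and dist_os: "distinct os"
    and dist_f: "\<And>f. f \<in> FS \<Longrightarrow> distinct f"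
    and disj: "\<And>f g. f \<in> FS \<Longrightarrow> g \<in> FS \<Longrightarrow> f \<noteq> g \<Longrightarrow> set f \<inter> set g = {}"
    and disj_os: "\<And>f. f \<in> FS \<Longrightarrow> set f \<inter> set os = {}"
    and al_D: "\<And>d. d \<in> darts os FS \<Longrightarrow> al d \<in> darts os FS"
    and al_ne: "\<And>d. d \<in> darts os FS \<Longrightarrow> al d \<noteq> d"
    and al_al: "\<And>d. d \<in> darts os FS \<Longrightarrow> al (al d) = d"
    and lab_Ltr: "\<And>d. d \<in> darts os FS \<Longrightarrow> lab d \<in> Ltr"
    and lab_al: "\<And>d. d \<in> darts os FS \<Longrightarrow> lab (al d) = letter_inv (lab d)"
    and ps_G: "\<And>d. d \<in> darts os FS \<Longrightarrow> ps d \<in> G"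
    and ps_al: "\<And>d. d \<in> darts os FS \<Longrightarrow> ps (al d) = mul (ps d) [lab d]"
    and cyc_vt: "\<And>xs d d'. xs \<in> insert os FS \<Longrightarrow> (d, d') \<in> cyc xs \<Longrightarrow> vt d' = vt (al d)"
    and cyc_ps: "\<And>xs d d'. xs \<in> insert os FS \<Longrightarrow> (d, d') \<in> cyc xs \<Longrightarrow> ps d' = ps (al d)"
    and face_R: "\<And>f. f \<in> FS \<Longrightarrow> map lab f \<in> R"
    and euler: "card (darts os FS) + (if os = [] then 0 else 2) \<le> 2 * card (vt ` darts os FS) + 2 * card FS"
begin

abbreviation "D \<equiv> darts os FS"

lemma fin_D [simp]: "finite D" using finFS by (simp add: darts_def)

lemma face_ne: "f \<in> FS \<Longrightarrow> f \<noteq> []" using face_R R_nonempty by fastforce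

lemma in_D: "d \<in> set os \<Longrightarrow> d \<in> D" "f \<in> FS \<Longrightarrow> d \<in> set f \<Longrightarrow> d \<in> D"
  by (auto simp: darts_def)

lemma aft_R: "f \<in> FS \<Longrightarrow> e \<in> set f \<Longrightarrow> map lab (e # aft f e) \<in> R"
  using map_aft_rotate[of e f lab] face_R R_rotate by metis

end

text \<open>This is reducedness of a diagram: the faces on the two sides of an edge are not mirror
  images. An edge with the same face on both sides is covered as well.\<close>

definition nomirror :: "nat list set \<Rightarrow> (nat \<Rightarrow> nat) \<Rightarrow> (nat \<Rightarrow> 'a letter) \<Rightarrow> bool" where
  "nomirror FS al lab \<longleftrightarrow> (\<forall>f\<in>FS. \<forall>g\<in>FS. \<forall>e\<in>set f. al e \<in> set g \<longrightarrow>
     map lab (aft f e) \<noteq> word_inv (map lab (aft g (al e))))"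

text \<open>The number of faces is recorded because folding and the minimal counterexamples below
  argue by induction on it.\<close>

definition fills :: "'a set \<Rightarrow> 'a word set \<Rightarrow> nat \<Rightarrow> 'a word \<Rightarrow> bool" where
  "fills S R n w \<longleftrightarrow> (\<exists>os FS al lab vt ps. diagram S R os FS al lab vt ps \<and> nomirror FS al lab \<and>
     map lab os = w \<and> card FS = n)"

lemma fillsI: "diagram S R os FS al lab vt ps \<Longrightarrow> nomirror FS al lab \<Longrightarrow> map lab os = w \<Longrightarrow> card FS = n \<Longrightarrow> fills S R n w"
  unfolding fills_def by blast

section \<open>Surgery at the outer boundary of a diagram\<close>

context diagram
begin

lemma rotate_outer:
  assumes "os = us @ vs" shows "diagram S R (vs @ us) FS al lab vt ps"
proof -
  have D: "darts (vs @ us) FS = D" by (auto simp: darts_def assms intro!: equalityI)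
  have c: "cyc (vs @ us) = cyc os" by (simp add: assms cyc_swap)
  show ?thesis
  proof (unfold_locales, goal_cases)
    case (13 xs d d') then show ?case using cyc_vt c by (metis insert_iff)
  next
    case (14 xs d d') then show ?case using cyc_ps c by (metis insert_iff)
  next
    case 16 then show ?case using euler D by (auto simp: assms split: if_splits)
  qed (use finFS dist_os dist_f disj disj_os al_D al_ne al_al lab_Ltr lab_al ps_G ps_al face_R D
       in \<open>auto simp: assms Int_Un_distrib intro!: equalityI\<close>)
qed

text \<open>Two darts and one face disappear, so the Euler inequality survives as long as no vertex
  is lost. A vertex can get lost only if the boundary becomes empty, and there the inequality asks
  for two less.\<close>

lemma remove_face:
  assumes os: "os = d # vs" and f: "f \<in> FS" and e: "al d \<in> set f"
  shows "diagram S R (aft f (al d) @ vs) (FS - {f}) al lab vt ps"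
proof -
  let ?e = "al d" and ?us = "aft f (al d)" and ?FS = "FS - {f}"
  let ?D' = "darts (?us @ vs) ?FS"
  have sf: "set f = insert ?e (set ?us)" using set_aft[OF e] by simp
  have dst: "distinct (?e # ?us)" using distinct_aft[OF e dist_f[OF f]] .
  have dD: "d \<in> D" and eD: "?e \<in> D" using in_D f e os by auto
  have edis: "?e \<noteq> d" using al_ne dD by auto
  have oth: "g \<in> ?FS \<Longrightarrow> ?e \<notin> set g \<and> d \<notin> set g" for g
    using disj[of f g] disj_os[of g] f e os by auto
  have D': "?D' = D - {d, ?e}"
    using sf dst oth disj_os[OF f] dist_os os f unfolding darts_def by (auto intro!: equalityI)
  have aleq: "x \<in> ?D' \<Longrightarrow> al x \<in> ?D'" for x
    using al_D al_al dD eD unfolding D' by (metis Diff_iff empty_iff insert_iff)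
  have cf: "cyc (?e # ?us) = cyc f" by (rule cyc_aft[OF e])
  \<comment> \<open>Here \<open>h\<close> stands for \<open>vt\<close> or \<open>ps\<close>: both
    satisfy the same axiom on \<open>cyc\<close>, so one case analysis serves both.\<close>
  have L: "h y = h (al x)"
    if "(x, y) \<in> cyc (?us @ vs)" and C: "\<And>xs d d'. xs \<in> insert os FS \<Longrightarrow> (d, d') \<in> cyc xs \<Longrightarrow> h d' = h (al d)"
    for h :: "nat \<Rightarrow> 'b" and x y
  proof -
    have 1: "(x, y) \<in> cyc (?e # ?us) \<Longrightarrow> h y = h (al x)" for x y using C[of f] f cf by auto
    have 2: "(x, y) \<in> cyc (d # vs) \<Longrightarrow> h y = h (al x)" for x y using C[of os] os by auto
    have ald: "al ?e = d" using al_al dD by simp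
    show ?thesis
    proof (cases "?us = []")
      case True
      then have "h ?e = h d" using 1[of ?e ?e] ald by (simp add: cyc_ne)
      show ?thesis
      proof (cases "vs = []")
        case False
        then have "h (hd vs) = h ?e" "h d = h (al (last vs))"
          using 2[of d "hd vs"] 2[of "last vs" d] by (simp_all add: cyc_Cons)
        moreover have "(x, y) \<in> lin vs \<Longrightarrow> h y = h (al x)" using 2[of x y] False by (simp add: cyc_Cons)
        ultimately show ?thesis using that(1) True \<open>h ?e = h d\<close> False by (auto simp: cyc_ne)
      qed (use that True in simp)
    next
      case us: False
      then have a: "h (hd ?us) = h d" "h ?e = h (al (last ?us))"
        using 1[of ?e "hd ?us"] 1[of "last ?us" ?e] ald by (simp_all add: cyc_Cons)
      show ?thesis
      proof (cases "vs = []")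
        case True
        then have "h d = h ?e" using 2[of d d] by (simp add: cyc_ne)
        then show ?thesis using that(1) True us a 1[of x y] by (auto simp: cyc_ne lin_Cons)
      next
        case False
        then have "h (hd vs) = h ?e" "h d = h (al (last vs))"
          using 2[of d "hd vs"] 2[of "last vs" d] by (simp_all add: cyc_Cons)
        then show ?thesis using that(1) us False a 1[of x y] 2[of x y] by (auto simp: cyc_append cyc_Cons)
      qed
    qed
  qed
  have E: "card ?D' + (if ?us @ vs = [] then 0 else 2) \<le> 2 * card (vt ` ?D') + 2 * card ?FS"
  proof -
    have c1: "card ?D' + 2 = card D"
      using D' dD eD edis card_Diff_subset[of "{d, ?e}" D] card_mono[of D "{d, ?e}"] by auto
    have c2: "card ?FS + 1 = card FS" using f finFS by (metis Suc_eq_plus1 card.remove)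
    have Dv: "vt ` D = vt ` ?D' \<union> {vt d, vt ?e}" using dD eD by (auto simp: D' intro!: equalityI)
    show ?thesis
    proof (cases "?us @ vs = []")
      case True
      then have "vt d = vt ?e" using cyc_vt[of os d d] os by (simp add: cyc_ne)
      then have "vt ` D = insert (vt d) (vt ` ?D')" using Dv by simp
      then have "card (vt ` D) \<le> card (vt ` ?D') + 1" by (simp add: card_insert_if D')
      then show ?thesis using euler c1 c2 os True by simp
    next
      case False
      have mem: "vt d \<in> vt ` ?D' \<and> vt ?e \<in> vt ` ?D'"
      proof (cases "?us = []")
        case True
        then have "cyc f = {(?e, ?e)}" using cf by (simp add: cyc_ne)
        then have "vt ?e = vt d" using cyc_vt[of f ?e ?e] f al_al dD by simp
        moreover have "vt (hd vs) = vt ?e" using cyc_vt[of os d "hd vs"] os False True by (simp add: cyc_Cons)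
        moreover have "hd vs \<in> ?D'" using False True by (simp add: darts_def)
        ultimately show ?thesis by (metis imageI)
      next
        case us: False
        have mc: "(?e, hd ?us) \<in> cyc f" "(last ?us, ?e) \<in> cyc f" using us by (simp_all add: cf[symmetric] cyc_Cons)
        have "vt (hd ?us) = vt d" using cyc_vt[OF _ mc(1)] f al_al dD by simp
        moreover have "vt ?e = vt (al (last ?us))" using cyc_vt[OF _ mc(2)] f by simp
        moreover have "hd ?us \<in> ?D'" "al (last ?us) \<in> ?D'" using us aleq by (auto simp: darts_def)
        ultimately show ?thesis by (metis imageI)
      qed
      then have "vt ` D = vt ` ?D'" using Dv by auto
      then show ?thesis using euler c1 c2 os False by (auto split: if_splits)
    qed
  qed
  show ?thesis
  proof (unfold_locales, goal_cases)
    case (2) show ?case using dst dist_os os disj_os[OF f] sf by auto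
  next
    case (5 g)
    then have "set f \<inter> set g = {}" "set g \<inter> set os = {}" using disj[of f g] disj_os[of g] f by auto
    then show ?case using sf os by (auto simp: Int_Un_distrib Int_commute)
  next
    case (6 d) then show ?case by (rule aleq)
  next
    case (13 xs x y) then show ?case using L[of x y vt] cyc_vt by blast
  next
    case (14 xs x y) then show ?case using L[of x y ps] cyc_ps by blast
  next
    case 16 show ?case by (rule E)
  qed (use finFS dist_f disj al_ne al_al lab_Ltr lab_al ps_G ps_al face_R D' in auto)
qed

lemma nomirror_subset: "nomirror FS al lab \<Longrightarrow> F \<subseteq> FS \<Longrightarrow> nomirror F al lab"
  unfolding nomirror_def by (meson subsetD)

text \<open>The edge has the outer face on both sides. Its two darts take at most one vertex with
  them, or two if nothing of the boundary remains; the Euler inequality pays for both.\<close>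

lemma fold_spur:
  assumes os: "os = d1 # d2 # vs" and a: "al d1 = d2"
  shows "diagram S R vs FS al lab vt ps"
proof -
  let ?D' = "darts vs FS"
  have dD: "d1 \<in> D" "d2 \<in> D" using in_D os by auto
  have a2: "al d2 = d1" using al_al[OF dD(1)] a by simp
  have D': "?D' = D - {d1, d2}"
    using disj_os dist_os os unfolding darts_def by (auto intro!: equalityI)
  have aleq: "x \<in> ?D' \<Longrightarrow> al x \<in> ?D'" for x
    using al_D al_al dD a a2 unfolding D' by (metis Diff_iff empty_iff insert_iff)
  have L: "h y = h (al x)"
    if "(x, y) \<in> cyc vs" and C: "\<And>xs d d'. xs \<in> insert os FS \<Longrightarrow> (d, d') \<in> cyc xs \<Longrightarrow> h d' = h (al d)"
    for h :: "nat \<Rightarrow> 'b" and x y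
  proof -
    have vs: "vs \<noteq> []" using that(1) by auto
    have 2: "(x, y) \<in> cyc (d1 # d2 # vs) \<Longrightarrow> h y = h (al x)" for x y using C[of os] os by auto
    have "h d1 = h (al (last vs))" "h (hd vs) = h d1"
      using 2[of "last vs" d1] 2[of d2 "hd vs"] vs a2 by (simp_all add: cyc_Cons lin_Cons)
    then show ?thesis using that(1) vs 2[of x y] by (auto simp: cyc_ne lin_Cons)
  qed
  have E: "card ?D' + (if vs = [] then 0 else 2) \<le> 2 * card (vt ` ?D') + 2 * card FS"
  proof -
    have c1: "card ?D' + 2 = card D"
      using D' dD al_ne[OF dD(1)] a card_Diff_subset[of "{d1, d2}" D] card_mono[of D "{d1, d2}"] by auto
    have fin: "finite (vt ` ?D')" by (simp add: D')
    have Dv: "vt ` D = insert (vt d2) (insert (vt d1) (vt ` ?D'))" using dD by (auto simp: D' intro!: equalityI)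
    then have le: "card (vt ` D) \<le> Suc (card (insert (vt d1) (vt ` ?D')))" "card (vt ` D) \<le> Suc (Suc (card (vt ` ?D')))"
      using fin by (simp_all add: card_insert_if)
    show ?thesis
    proof (cases "vs = []")
      case True then show ?thesis using le euler c1 os by simp
    next
      case False
      then have "vt (hd vs) = vt d1" using cyc_vt[of os d2 "hd vs"] os a2 by (simp add: cyc_Cons lin_Cons)
      moreover have "hd vs \<in> ?D'" using False by (simp add: darts_def)
      ultimately have "insert (vt d1) (vt ` ?D') = vt ` ?D'" by (metis imageI insert_absorb)
      then show ?thesis using le(1) euler c1 os False by simp
    qed
  qed
  show ?thesis
  proof (unfold_locales, goal_cases)
    case (6 d) then show ?case by (rule aleq)
  next
    case (13 xs x y) then show ?case using L[of x y vt] cyc_vt by blast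
  next
    case (14 xs x y) then show ?case using L[of x y ps] cyc_ps by blast
  next
    case 16 show ?case by (rule E)
  next
    case (5 g) then show ?case using disj_os[of g] os by auto
  qed (use finFS dist_os os dist_f disj al_ne al_al lab_Ltr lab_al ps_G ps_al face_R D' in auto)
qed

text \<open>The reverses of \<open>d1\<close> and \<open>d2\<close> become the two sides of one
  edge, which identifies the start of \<open>d1\<close> with the end of \<open>d2\<close>.
  Relabelling merges at most two vertex labels while two darts vanish, so the Euler inequality
  persists whether or not these two vertices coincided before.\<close>

lemma fold_glue:
  assumes os: "os = d1 # d2 # vs" and a: "al d1 \<noteq> d2" and l: "lab d2 = letter_inv (lab d1)"
  shows "diagram S R vs FS (al (al d1 := al d2, al d2 := al d1)) lab
           (\<lambda>x. if vt x = vt (al d2) then vt d1 else vt x) ps"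
proof -
  let ?D' = "darts vs FS" and ?e1 = "al d1" and ?e2 = "al d2"
  let ?al = "al (?e1 := ?e2, ?e2 := ?e1)"
  let ?vt = "\<lambda>x. if vt x = vt ?e2 then vt d1 else vt x"
  have dD: "d1 \<in> D" "d2 \<in> D" using in_D os by auto
  have d12: "d1 \<noteq> d2" using dist_os os by auto
  have ee: "?e1 \<noteq> ?e2" "?e1 \<noteq> d1" "?e2 \<noteq> d2" "?e2 \<noteq> d1" "al ?e1 = d1" "al ?e2 = d2"
    using al_al dD d12 al_ne a by metis+
  have D': "?D' = D - {d1, d2}"
    using disj_os dist_os os unfolding darts_def by (auto intro!: equalityI)
  have eD: "?e1 \<in> ?D'" "?e2 \<in> ?D'" using al_D dD ee a D' by auto
  have aleq: "x \<in> ?D' \<Longrightarrow> ?al x \<in> ?D'" for x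
    proof -
    assume "x \<in> ?D'"
    moreover from this have "x \<noteq> ?e1 \<Longrightarrow> x \<noteq> ?e2 \<Longrightarrow> al x \<in> ?D'"
      using al_D[of x] al_al[of x] unfolding D' by auto
    ultimately show ?thesis using eD by auto
  qed
  have psd: "ps ?e2 = ps d1" "ps d2 = ps ?e1"
  proof -
    show "ps d2 = ps ?e1" using cyc_ps[of os d1 d2] os by (simp add: cyc_Cons)
    then show "ps ?e2 = ps d1"
      using ps_al[OF dD(2)] ps_al[OF dD(1)] l mul_inv_letter[OF ps_G[OF dD(1)] lab_Ltr[OF dD(1)]] by simp
  qed
  have vt2: "vt d2 = vt ?e1" using cyc_vt[of os d1 d2] os by (simp add: cyc_Cons)
  have L: "h' y = h' (?al x)"
    if xy: "(x, y) \<in> cyc xs" "xs \<in> insert vs FS"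
      and C: "\<And>xs d d'. xs \<in> insert os FS \<Longrightarrow> (d, d') \<in> cyc xs \<Longrightarrow> h d' = h (al d)"
      and h': "\<And>u v. h u = h v \<Longrightarrow> h' u = h' v" "h' ?e2 = h' d1"
    for h h' :: "nat \<Rightarrow> 'b" and x y xs
  proof -
    have C': "h' d' = h' (al d)" if "xs \<in> insert os FS" "(d, d') \<in> cyc xs" for xs d d' using C[OF that] h' by blast
    have 2: "(x, y) \<in> cyc (d1 # d2 # vs) \<Longrightarrow> h' y = h' (al x)" for x y using C'[of os] os by auto
    have hd2: "h' d2 = h' ?e1" using 2[of d1 d2] by (simp add: cyc_Cons)
    have conv: "h' (?al x) = h' (al x)" for x
      using ee h'(2) hd2 by auto
    show ?thesis
    proof (cases "xs \<in> FS")
      case True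
      then show ?thesis using C'[of xs x y] xy conv[of x] by simp
    next
      case False
      then have xs: "xs = vs" "vs \<noteq> []" using xy by auto
      have "h' d1 = h' (al (last vs))" "h' (hd vs) = h' ?e2"
        using 2[of "last vs" d1] 2[of d2 "hd vs"] xs by (simp_all add: cyc_Cons lin_Cons)
      then have "h' (hd vs) = h' (al (last vs))" using h'(2) by simp
      then have "h' y = h' (al x)" using xy xs 2[of x y] by (auto simp: cyc_ne lin_Cons)
      then show ?thesis using conv[of x] by simp
    qed
  qed
  have E: "card ?D' + (if vs = [] then 0 else 2) \<le> 2 * card (?vt ` ?D') + 2 * card FS"
  proof -
    have c1: "card ?D' + 2 = card D"
      using D' dD d12 card_Diff_subset[of "{d1, d2}" D] card_mono[of D "{d1, d2}"] by auto
    have fin: "finite (?vt ` ?D')" by (simp add: D')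
    have "vt ` D \<subseteq> insert (vt ?e2) (?vt ` ?D')"
    proof
      fix v assume "v \<in> vt ` D"
      then obtain x where x: "x \<in> D" "v = vt x" by auto
      then consider "x = d1" | "x = d2" | "x \<in> ?D'" using D' by auto
      then show "v \<in> insert (vt ?e2) (?vt ` ?D')"
      proof cases
        case 1 then have "v = ?vt ?e2" using x by simp
        then show ?thesis using eD by blast
      next
        case 2 then have "v = vt ?e1" using x vt2 by simp
        then have "v = vt ?e2 \<or> v = ?vt ?e1" by auto
        then show ?thesis using imageI[OF eD(1), of ?vt] by auto
      next
        case 3
        have "v = vt ?e2 \<or> v = ?vt x" using x by auto
        then show ?thesis using imageI[OF 3, of ?vt] by auto
      qed
    qed
    then have le: "card (vt ` D) \<le> Suc (card (?vt ` ?D'))"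
      using card_mono[of "insert (vt ?e2) (?vt ` ?D')" "vt ` D"] fin by (auto simp: card_insert_if split: if_splits)
    have "card D + 2 \<le> 2 * card (vt ` D) + 2 * card FS" using euler os by simp
    then have "card ?D' + 2 \<le> 2 * card (?vt ` ?D') + 2 * card FS" using le c1 by linarith
    moreover have "(if vs = [] then 0 else 2) \<le> (2 :: nat)" by simp
    ultimately show ?thesis by linarith
  qed
  show ?thesis
  proof (unfold_locales, goal_cases)
    case (6 d) then show ?case by (rule aleq)
  next
    case (7 d) then show ?case using al_ne[of d] ee D' by auto
  next
    case (8 d)
    then have "d \<in> D" "d \<noteq> d1" "d \<noteq> d2" using D' by auto
    then show ?case using al_al[of d] ee by (auto dest: arg_cong[of _ _ al])
  next
    case (10 d) then show ?case using lab_al[of d] lab_al[OF dD(1)] lab_al[OF dD(2)] l D' ee by auto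
  next
    case (12 d)
    then have "d \<in> D" using D' by simp
    have lab_e: "lab ?e1 = letter_inv (lab d1)" "lab ?e2 = lab d1" using lab_al dD l by simp_all
    have "ps ?e1 = mul (ps ?e2) [lab ?e2]" using psd ps_al[OF dD(1)] lab_e by simp
    moreover have "ps ?e2 = mul (ps ?e1) [lab ?e1]"
      using psd(1) ps_al[of ?e1] ee eD D' by simp
    ultimately show ?case using ps_al[OF \<open>d \<in> D\<close>] by auto
  next
    case (13 xs x y) show ?case by (rule L[OF 13(2) 13(1), of vt]) (use cyc_vt in auto)
  next
    case (14 xs x y) show ?case by (rule L[OF 14(2) 14(1), of ps]) (use cyc_ps psd in auto)
  next
    case 16 show ?case by (rule E)
  next
    case (5 g) then show ?case using disj_os[of g] os by auto
  qed (use finFS dist_os os dist_f disj lab_Ltr ps_G face_R D' in auto)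
qed

text \<open>All labels in use are below \<open>l\<close>, so \<open>Suc l\<close> is free for the
  tip of the spur, and \<open>l\<close> for its base in case the boundary is empty.\<close>

lemma insert_spur:
  assumes x: "x \<in> Ltr" and fr: "m \<notin> D" "Suc m \<notin> D" and L: "\<forall>d\<in>D. vt d < l"
  shows "\<exists>vt' ps'. diagram S R (m # Suc m # os) FS (al (m := Suc m, Suc m := m))
     (lab (m := x, Suc m := letter_inv x)) vt' ps'"
proof -
  define b where "b = (if os = [] then l else vt (hd os))"
  define g where "g = (if os = [] then grp_one S R else ps (hd os))"
  let ?D' = "darts (m # Suc m # os) FS"
  let ?vt = "vt (m := b, Suc m := Suc l)" and ?ps = "ps (m := g, Suc m := mul g [x])"
  let ?al = "al (m := Suc m, Suc m := m)" and ?lab = "lab (m := x, Suc m := letter_inv x)"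
  have D': "?D' = insert m (insert (Suc m) D)" by (auto simp: darts_def intro!: equalityI)
  have g: "g \<in> G" using ps_G in_D by (auto simp: g_def)
  have ne: "d \<in> D \<Longrightarrow> d \<noteq> m \<and> d \<noteq> Suc m \<and> al d \<noteq> m \<and> al d \<noteq> Suc m" for d using fr al_D[of d] by metis
  have "diagram S R (m # Suc m # os) FS ?al ?lab ?vt ?ps"
  proof (unfold_locales, goal_cases)
    case 2 show ?case using dist_os fr in_D by auto
  next
    case (5 f) then show ?case using disj_os[of f] fr in_D by auto
  next
    case (6 d) then show ?case using D' ne al_D by auto
  next
    case (7 d) then show ?case using D' ne al_ne by auto
  next
    case (8 d) then show ?case using D' ne al_al by auto
  next
    case (9 d) then show ?case using D' ne lab_Ltr x by auto
  next
    case (10 d) then show ?case using D' ne lab_al by auto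
  next
    case (11 d) then show ?case using D' ne ps_G x g by auto
  next
    case (12 d) then show ?case using D' ne ps_al mul_inv_letter[OF g x] by auto
  next
    case (13 xs d d')
    show ?case
    proof (cases "xs \<in> FS")
      case True then show ?thesis using 13 cyc_vt[of xs d d'] cyc_in_set[OF 13(2)] ne in_D(2) by auto
    next
      case False
      then have "xs = m # Suc m # os" using 13 by auto
      then have c: "(d, d') \<in> cyc (m # Suc m # os)" using 13 by simp
      show ?thesis
      proof (cases "os = []")
        case True then show ?thesis using c by (auto simp: cyc_Cons)
      next
        case False
        have "vt (hd os) = vt (al (last os))" using cyc_vt[of os] False by (simp add: cyc_ne)
        then have "b = vt (al (last os))" "b = vt (hd os)" using False by (simp_all add: b_def)
        moreover have "(d, d') \<in> lin os \<Longrightarrow> vt d' = vt (al d)" using cyc_vt[of os d d'] lin_sub_cyc by auto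
        moreover have "(d, d') \<in> lin os \<Longrightarrow> d \<in> D \<and> d' \<in> D" using lin_in_set[of d d' os] in_D by auto
        moreover have "hd os \<in> D" "last os \<in> D" using False in_D by auto
        ultimately show ?thesis using c False ne fr by (auto simp: cyc_Cons lin_Cons)
      qed
    qed
  next
    case (14 xs d d')
    show ?case
    proof (cases "xs \<in> FS")
      case True then show ?thesis using 14 cyc_ps[of xs d d'] cyc_in_set[OF 14(2)] ne in_D(2) by auto
    next
      case False
      then have "xs = m # Suc m # os" using 14 by auto
      then have c: "(d, d') \<in> cyc (m # Suc m # os)" using 14 by simp
      show ?thesis
      proof (cases "os = []")
        case True then show ?thesis using c by (auto simp: cyc_Cons)
      next
        case False
        have "ps (hd os) = ps (al (last os))" using cyc_ps[of os] False by (simp add: cyc_ne)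
        then have "g = ps (al (last os))" "g = ps (hd os)" using False by (simp_all add: g_def)
        moreover have "(d, d') \<in> lin os \<Longrightarrow> ps d' = ps (al d)" using cyc_ps[of os d d'] lin_sub_cyc by auto
        moreover have "(d, d') \<in> lin os \<Longrightarrow> d \<in> D \<and> d' \<in> D" using lin_in_set[of d d' os] in_D by auto
        moreover have "hd os \<in> D" "last os \<in> D" using False in_D by auto
        ultimately show ?thesis using c False ne fr by (auto simp: cyc_Cons lin_Cons)
      qed
    qed
  next
    case (15 f)
    then have "map ?lab f = map lab f" using ne in_D(2) by (intro map_cong) auto
    then show ?case using face_R[OF 15] by metis
  next
    case 16
    have im: "?vt ` ?D' = insert b (insert (Suc l) (vt ` D))"
      unfolding D' using fr by (auto intro!: equalityI)
    have "os \<noteq> [] \<Longrightarrow> vt (hd os) < l" using L in_D(1)[of "hd os"] by auto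
    then have nl: "Suc l \<notin> insert b (vt ` D)" using L by (auto simp: b_def split: if_splits)
    have fin: "finite (vt ` D)" by simp
    have "card (?vt ` ?D') = Suc (card (insert b (vt ` D)))"
      unfolding im insert_commute[of b] by (rule card_insert_disjoint[OF _ nl]) simp
    moreover have "card (insert b (vt ` D)) = card (vt ` D) + (if os = [] then 1 else 0)"
    proof (cases "os = []")
      case True then have "b \<notin> vt ` D" using L by (auto simp: b_def)
      then have "card (insert b (vt ` D)) = Suc (card (vt ` D))" by simp
      then show ?thesis using True by simp
    next
      case False then have "b \<in> vt ` D" using in_D(1)[of "hd os"] by (auto simp: b_def)
      then show ?thesis using False by (simp add: insert_absorb)
    qed
    moreover have "card ?D' = card D + 2" using D' fr by simp
    ultimately show ?case using euler by (auto split: if_splits)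
  qed (use finFS dist_f disj in auto)
  then show ?thesis by blast
qed

text \<open>A disc with a single face is hung on the base vertex. The outer darts from
  \<open>m\<close> to \<open>m + k - 1\<close> read \<open>r\<close>; their reverses, obtained by
  reflecting the numbers, form the face, which therefore reads \<open>word_inv r\<close>.\<close>

lemma insert_relator:
  assumes r: "r \<in> R" and k: "k = length r" and fr: "\<forall>d\<in>D. d < m" and L: "\<forall>d\<in>D. vt d < l"
  shows "\<exists>vt' ps'. diagram S R ([m..<m + k] @ os) (insert [m + k..<m + 2 * k] FS)
     (\<lambda>d. if d < m then al d else 2 * m + 2 * k - 1 - d)
     (\<lambda>d. if d < m then lab d else if d < m + k then r ! (d - m) else letter_inv (r ! (m + 2 * k - 1 - d))) vt' ps'"
proof -
  define b where "b = (if os = [] then l + m else vt (hd os))"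
  define g where "g = (if os = [] then grp_one S R else ps (hd os))"
  let ?ds = "[m..<m + k]" and ?es = "[m + k..<m + 2 * k]"
  let ?os = "?ds @ os" and ?FS = "insert ?es FS"
  let ?al = "\<lambda>d. if d < m then al d else 2 * m + 2 * k - 1 - d"
  let ?lab = "\<lambda>d. if d < m then lab d else if d < m + k then r ! (d - m) else letter_inv (r ! (m + 2 * k - 1 - d))"
  \<comment> \<open>\<open>c d\<close> numbers the initial vertex of \<open>d\<close> along the new
    loop; the positions \<open>m\<close> and \<open>m + k\<close> both are the base vertex, hence
    the clause for \<open>b\<close> in \<open>vl\<close>.\<close>
  define c where "c d = (if d < m + k then d else 2 * m + 2 * k - d)" for d
  define vl where "vl i = (if i = m \<or> i = m + k then b else l + i)" for i
  define pl where "pl i = mul g (take (i - m) r)" for i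
  let ?vt = "\<lambda>d. if d < m then vt d else vl (c d)"
  let ?ps = "\<lambda>d. if d < m then ps d else pl (c d)"
  let ?D' = "darts ?os ?FS"
  have k0: "k > 0" using r R_nonempty k by auto
  have D': "?D' = D \<union> {m..<m + 2 * k}" by (auto simp: darts_def intro!: equalityI)
  have g: "g \<in> G" using ps_G in_D by (auto simp: g_def)
  have rW: "r \<in> W" using r R_W by auto
  have al_lt: "d \<in> D \<Longrightarrow> al d < m" for d using fr al_D by auto
  have mulgr: "mul g r = g" using g rW relator_weq[OF r] mul_fix_iff by auto
  have vlm: "vl m = b" "vl (m + k) = b" by (simp_all add: vl_def)
  have plm: "pl m = g" "pl (m + k) = g" using g mulgr by (simp_all add: pl_def k)
  have esne: "?es \<noteq> []" "?ds \<noteq> []" using k0 by auto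
  have lin_upt: "lin [i..<j] = {(d, Suc d) | d. i \<le> d \<and> Suc d < j}" for i j
  proof (induction j)
    case (Suc j)
    show ?case
    proof (cases "i < j")
      case True
      then have "lin [i..<Suc j] = lin [i..<j] \<union> {(j - 1, j)}" by (simp add: lin_append)
      also have "\<dots> = {(d, Suc d) | d. i \<le> d \<and> Suc d < Suc j}"
        using True Suc by (auto intro!: equalityI)
      finally show ?thesis .
    next
      case False then have "lin [i..<Suc j] = {}" by (cases "i = j") auto
      then show ?thesis using False by auto
    qed
  qed simp
  have Lc: "h d' = h (?al d)"
    if cy: "(d, d') \<in> cyc xs" "xs \<in> insert ?os ?FS"
      and h: "\<And>d. d < m \<Longrightarrow> h d = hh d" "\<And>d. \<not> d < m \<Longrightarrow> h d = hl (c d)"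
      and hl: "hl m = hb" "hl (m + k) = hb" and hb: "os \<noteq> [] \<Longrightarrow> hb = hh (hd os)"
      and C: "\<And>xs d d'. xs \<in> insert os FS \<Longrightarrow> (d, d') \<in> cyc xs \<Longrightarrow> hh d' = hh (al d)"
    for h hh hl :: "nat \<Rightarrow> 'b" and hb d d' xs
  proof -
    have up: "h (Suc d) = h (?al d)" if "m \<le> d" "Suc d < m + k \<or> (m + k \<le> d \<and> Suc d < m + 2 * k)" for d
    proof -
      have "c (Suc d) = c (?al d)" using that by (auto simp: c_def)
      then show ?thesis using h(2)[of "Suc d"] h(2)[of "?al d"] that by auto
    qed
    have hm: "h m = hb" "h (m + k) = hb" using h(2)[of m] h(2)[of "m + k"] hl k0 by (simp_all add: c_def add.commute)
    have ha: "h (?al (m + k - 1)) = hb" "h (?al (m + 2 * k - 1)) = hb" using hm k0 by (auto simp: mult_2)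
    have old: "h d' = h (?al d)" if "(d, d') \<in> cyc xs" "xs \<in> insert os FS" for d d' xs
    proof -
      have "d \<in> D" "d' \<in> D" using cyc_in_set[OF that(1)] that(2) in_D by auto
      then show ?thesis using C[OF that(2,1)] fr al_lt h(1) by auto
    qed
    consider "xs = ?es" | "xs = ?os" | "xs \<in> FS" using cy(2) by auto
    then show ?thesis
    proof cases
      case 1
      then have "(d, d') \<in> insert (m + 2 * k - 1, m + k) (lin ?es)" using cy(1) esne by (simp add: cyc_ne hd_upt last_upt)
      then show ?thesis using ha hm up by (auto simp: lin_upt)
    next
      case 3 then show ?thesis using old cy(1) by blast
    next
      case 2
      show ?thesis
      proof (cases "os = []")
        case True
        then have "(d, d') \<in> insert (m + k - 1, m) (lin ?ds)" using cy(1) 2 esne by (simp add: cyc_ne)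
        then show ?thesis using ha hm up by (auto simp: lin_upt)
      next
        case False
        have mem: "hd os \<in> D" "last os \<in> D" using False in_D by auto
        have "h (hd os) = hb" using hb[OF False] h(1) fr mem by simp
        moreover have "h (hd os) = h (?al (last os))" using old[of "last os" "hd os" os] False by (simp add: cyc_ne)
        moreover have "(d, d') \<in> lin ?ds \<union> lin os \<union> {(m + k - 1, hd os), (last os, m)}"
          using cy(1) 2 False esne by (simp add: cyc_append)
        moreover have "(d, d') \<in> lin os \<Longrightarrow> h d' = h (?al d)" using old[of d d' os] subsetD[OF lin_sub_cyc] by blast
        ultimately show ?thesis using ha hm up by (auto simp: lin_upt)
      qed
    qed
  qed
  have "diagram S R ?os ?FS ?al ?lab ?vt ?ps"
  proof (unfold_locales, goal_cases)
    case 1 show ?case using finFS by simp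
  next
    case 2 show ?case using dist_os fr in_D by (fastforce intro!: equalityI)
  next
    case (3 f) then show ?case using dist_f by auto
  next
    case (4 f f')
    have "set ?es \<inter> set g = {}" if "g \<in> FS" for g using fr in_D(2)[OF that] by (fastforce intro!: equalityI)
    then show ?case using 4 disj by (metis Int_commute insertE)
  next
    case (5 f)
    have "set g \<inter> set ?ds = {}" if "g \<in> FS" for g using fr in_D(2)[OF that] by (fastforce intro!: equalityI)
    moreover have "set ?es \<inter> set os = {}" using fr in_D(1) by (fastforce intro!: equalityI)
    moreover have "set ?es \<inter> set ?ds = {}" by (auto intro!: equalityI)
    ultimately show ?case using 5 disj_os by (auto simp: Int_Un_distrib)
  next
    case (6 d) then show ?case using D' al_D fr by auto
  next
    case (7 d)
    show ?case
    proof (cases "d < m")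
      case True then show ?thesis using 7 D' al_ne by auto
    next
      case False
      then have "d < m + 2 * k" "m \<le> d" using 7 D' fr by auto
      then have "Suc d \<le> 2 * m + 2 * k" by linarith
      then have "2 * m + 2 * k - 1 - d = d \<Longrightarrow> 2 * m + 2 * k = d + Suc d"
        by (metis diff_diff_left le_add_diff_inverse2 plus_1_eq_Suc)
      then have "2 * m + 2 * k - 1 - d = d \<Longrightarrow> 2 * (m + k) = Suc (2 * d)" by simp
      then have "2 * m + 2 * k - 1 - d \<noteq> d" by (metis dvd_triv_left even_Suc)
      then show ?thesis using False by simp
    qed
  next
    case (8 d) then show ?case using D' al_al al_lt fr by auto
  next
    case (9 d)
    then show ?case using D' lab_Ltr W_nth[OF rW] k fr by auto
  next
    case (10 d)
    show ?case
    proof (cases "d < m")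
      case True
      then have "d \<in> D" using 10 D' by auto
      then show ?thesis using True lab_al al_lt by simp
    next
      case False
      then show ?thesis using 10 D' fr by auto
    qed
  next
    case (11 d) then show ?case using D' ps_G fr g rW W_take by (auto simp: pl_def)
  next
    case (12 d)
    show ?case
    proof (cases "d < m")
      case True then show ?thesis using 12 D' ps_al al_lt by auto
    next
      case False
      then have d: "m \<le> d" "d < m + 2 * k" using 12 D' fr by auto
      have step: "pl (Suc i) = mul (pl i) [r ! (i - m)]" if "m \<le> i" "i < m + k" for i
      proof -
        have "take (Suc i - m) r = take (i - m) r @ [r ! (i - m)]"
          using that k by (simp add: Suc_diff_le take_Suc_conv_app_nth)
        then show ?thesis using g rW W_take by (simp add: pl_def mul_append)
      qed
      have pG: "pl i \<in> G" for i using g rW W_take by (simp add: pl_def)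
      show ?thesis
      proof (cases "d < m + k")
        case True
        then have "c d = d" "c (2 * m + 2 * k - 1 - d) = Suc d" using d by (auto simp: c_def)
        then show ?thesis using step[of d] True d by auto
      next
        case False
        let ?i = "2 * m + 2 * k - 1 - d"
        have cc: "c d = Suc ?i" "c ?i = ?i" "m \<le> ?i" "?i < m + k" using d False by (auto simp: c_def)
        have ri: "m + 2 * k - 1 - d = ?i - m" using d False by simp
        have "mul (pl (Suc ?i)) [letter_inv (r ! (?i - m))] = pl ?i"
          using step[OF cc(3,4)] mul_inv_letter[OF pG, of "r ! (?i - m)" ?i] W_nth[OF rW, of "?i - m"] cc k by auto
        then show ?thesis using cc ri False d by auto
      qed
    qed
  next
    case (13 xs d d')
    show ?case by (rule Lc[of d d' xs ?vt vt vl b, OF 13(2,1)]) (use vlm cyc_vt in \<open>auto simp: b_def\<close>)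
  next
    case (14 xs d d')
    show ?case by (rule Lc[of d d' xs ?ps ps pl g, OF 14(2,1)]) (use plm cyc_ps in \<open>auto simp: g_def\<close>)
  next
    case (15 f)
    have "map ?lab ?es = word_inv r"
      unfolding word_inv_def by (rule nth_equalityI) (auto simp: k rev_nth intro!: arg_cong[of _ _ "\<lambda>i. letter_inv (r ! i)"])
    then have "f = ?es \<Longrightarrow> map ?lab f \<in> R" using R_inv[OF r] by simp
    moreover have "map ?lab f = map lab f" if "f \<in> FS" using fr in_D(2)[OF that] by (intro map_cong) auto
    ultimately show ?case using face_R[of f] 15 by (metis (no_types, lifting) insertE)
  next
    case 16
    let ?new = "(\<lambda>i. l + i) ` {m<..<m + k}"
    have "vl ` (c ` {m..<m + 2 * k}) = insert b ?new"
    proof -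
      have "c ` {m..<m + 2 * k} = {m..m + k}"
      proof (intro equalityI subsetI)
        fix i assume i: "i \<in> {m..m + k}"
        show "i \<in> c ` {m..<m + 2 * k}"
        proof (cases "i = m + k")
          case True then show ?thesis using k0 by (intro image_eqI[of _ _ "m + k"]) (auto simp: c_def)
        next
          case False then show ?thesis using i k0 by (intro image_eqI[of _ _ i]) (auto simp: c_def)
        qed
      qed (auto simp: c_def split: if_splits)
      then show ?thesis using k0 by (auto simp: vl_def image_iff intro!: equalityI)
    qed
    moreover have "?vt ` ?D' = vt ` D \<union> vl ` (c ` {m..<m + 2 * k})"
    proof -
      have "?vt ` D = vt ` D" using fr by (intro image_cong) auto
      moreover have "?vt ` {m..<m + 2 * k} = vl ` (c ` {m..<m + 2 * k})" by (auto simp: image_image intro!: image_cong)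
      ultimately show ?thesis unfolding D' image_Un by (simp only:)
    qed
    ultimately have im: "?vt ` ?D' = insert b (vt ` D) \<union> ?new" by (simp only: Un_insert_left Un_insert_right)
    have "b \<in> vt ` D \<or> b = l + m" using in_D(1)[of "hd os"] by (auto simp: b_def)
    then have dj: "insert b (vt ` D) \<inter> ?new = {}" using L by (fastforce intro!: equalityI)
    have cn: "card ?new = k - 1" by (subst card_image) (auto simp: inj_on_def)
    have "card (?vt ` ?D') = card (insert b (vt ` D)) + (k - 1)"
      unfolding im using dj cn by (subst card_Un_disjoint) auto
    moreover have "card (insert b (vt ` D)) = card (vt ` D) + (if os = [] then 1 else 0)"
    proof (cases "os = []")
      case True then have "b \<notin> vt ` D" using L by (auto simp: b_def)
      then have "card (insert b (vt ` D)) = Suc (card (vt ` D))" by simp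
      then show ?thesis using True by simp
    next
      case False then have "b \<in> vt ` D" using in_D(1)[of "hd os"] by (auto simp: b_def)
      then show ?thesis using False by (simp add: insert_absorb)
    qed
    moreover have "D \<inter> {m..<m + 2 * k} = {}" using fr by (auto intro!: equalityI)
    then have "card ?D' = card D + 2 * k" unfolding D' by (subst card_Un_disjoint) auto
    moreover have "?es \<notin> FS" using fr in_D(2)[of ?es "m + k"] k0 by fastforce
    then have "card ?FS = Suc (card FS)" using finFS by simp
    ultimately show ?case using euler k0 by (auto split: if_splits)
  qed
  then show ?thesis by blast
qed

lemma face_words_rotate:
  assumes "f \<in> FS" "e \<in> set f" "e' \<in> set f"
  shows "\<exists>k. map lab (e' # aft f e') = rotate k (map lab (e # aft f e))"
proof -
  obtain i j where i: "map lab (e # aft f e) = rotate i (map lab f)" and j: "map lab (e' # aft f e') = rotate j (map lab f)"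
    using map_aft_rotate assms by metis
  let ?L = "length f"
  have "rotate (i * (?L - 1)) (rotate i (map lab f)) = rotate (i * ?L) (map lab f)"
    using face_ne[OF assms(1)] by (cases ?L) (simp_all add: rotate_rotate algebra_simps)
  also have "\<dots> = map lab f" by (subst rotate_conv_mod) simp
  finally have "rotate (j + i * (?L - 1)) (rotate i (map lab f)) = rotate j (map lab f)"
    by (simp add: rotate_rotate[symmetric])
  then show ?thesis using i j by metis
qed

end

section \<open>Folding and van Kampen's lemma\<close>

context presentation
begin

text \<open>Such an equation would match the positions of the cyclic word by a reflection. According
  to parity, the reflection fixes a position, where a letter would be its own inverse, or exchanges
  two neighbours, which would then cancel.\<close>

lemma rotate_neq_inv: assumes "r \<in> R" shows "rotate k r \<noteq> word_inv r"
proof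
  assume eq: "rotate k r = word_inv r"
  let ?L = "length r"
  define j where "j = k mod ?L"
  have L: "?L > 0" using R_nonempty[OF assms] by simp
  have jL: "j < ?L" using L by (simp add: j_def)
  have E: "r ! ((j + i) mod ?L) = letter_inv (r ! (?L - 1 - i))" if "i < ?L" for i
  proof -
    have "rotate k r ! i = r ! ((k + i) mod ?L)" by (rule nth_rotate[OF that])
    moreover have "word_inv r ! i = letter_inv (r ! (?L - 1 - i))"
      using that by (simp add: word_inv_def rev_nth)
    ultimately show ?thesis using eq by (simp add: j_def mod_add_left_eq)
  qed
  show False
  proof (cases "even (?L - 1 - j)")
    case True
    then obtain i where i: "?L - 1 - j = 2 * i" by (elim evenE)
    then have "j + i = ?L - 1 - i" "i < ?L" "j + i < ?L" using jL by auto
    then show False using E[of i] by simp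
  next
    case False
    then obtain i where i: "?L - 1 - j = 2 * i + 1" by (elim oddE)
    then have "Suc (j + i) = ?L - 1 - i" "i < ?L" "Suc (j + i) < ?L" using jL by auto
    then have "r ! Suc (j + i) = letter_inv (r ! (j + i))" using E[of i] by (metis letter_inv_inv mod_less Suc_lessD)
    then show False using R_reduced[OF assms] \<open>Suc (j + i) < ?L\<close> unfolding freely_reduced_def by blast
  qed
qed

lemma fills_rotate: assumes "fills S R n (u @ v)" shows "fills S R n (v @ u)"
proof -
  obtain os FS al lab vt ps where d: "diagram S R os FS al lab vt ps" "nomirror FS al lab" "map lab os = u @ v" "card FS = n"
    using assms by (auto simp: fills_def)
  then obtain us vs where "os = us @ vs" "map lab us = u" "map lab vs = v" by (auto simp: map_eq_append_conv)
  then show ?thesis using diagram.rotate_outer[OF d(1)] d unfolding fills_def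
    by (intro exI[of _ "vs @ us"] exI[of _ FS] exI[of _ al] exI[of _ lab] exI[of _ vt] exI[of _ ps]) auto
qed

lemma fills_spur: assumes "fills S R n w" "x \<in> Ltr" shows "fills S R n (x # letter_inv x # w)"
proof -
  obtain os FS al lab vt ps where d: "diagram S R os FS al lab vt ps" "nomirror FS al lab" "map lab os = w" "card FS = n"
    using assms by (auto simp: fills_def)
  interpret diagram S R os FS al lab vt ps by (rule d)
  obtain m where m: "\<forall>d\<in>D. d < m" using finite_nat_set_iff_bounded[of D] by auto
  obtain l where l: "\<forall>d\<in>D. vt d < l" using finite_nat_set_iff_bounded[of "vt ` D"] by auto
  have "m \<notin> D" "Suc m \<notin> D" using m by auto
  from insert_spur[OF assms(2) this l] obtain vt' ps' where
    d': "diagram S R (m # Suc m # os) FS (al (m := Suc m, Suc m := m)) (lab (m := x, Suc m := letter_inv x)) vt' ps'" (is "diagram _ _ _ _ ?al ?lab _ _")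
    by blast
  have ne: "d \<in> D \<Longrightarrow> d \<noteq> m \<and> d \<noteq> Suc m" for d using m by auto
  have ml: "map ?lab xs = map lab xs" if "set xs \<subseteq> D" for xs using that ne by (intro map_cong) auto
  have "nomirror FS ?al ?lab" unfolding nomirror_def
  proof (intro ballI impI)
    fix f g e assume h: "f \<in> FS" "g \<in> FS" "e \<in> set f" "?al e \<in> set g"
    then have e: "?al e = al e" using ne in_D(2) by auto
    have "set (aft f e) \<subseteq> D" "set (aft g (al e)) \<subseteq> D"
      using set_aft[OF h(3)] set_aft[of "al e" g] h e in_D(2) by auto
    then show "map ?lab (aft f e) \<noteq> word_inv (map ?lab (aft g (?al e)))"
      using ml e d(2) h unfolding nomirror_def by (metis (no_types, lifting))
  qed
  moreover have "map ?lab (m # Suc m # os) = x # letter_inv x # w" using ml[of os] d(3) in_D(1) by auto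
  ultimately show ?thesis by (rule fillsI[OF d' _ _ d(4)])
qed

text \<open>No mirror pair arises because the new face meets nothing but the outer face across its
  edges.\<close>

lemma fills_relator: assumes "fills S R n w" "r \<in> R" shows "fills S R (Suc n) (r @ w)"
proof -
  obtain os FS al lab vt ps where d: "diagram S R os FS al lab vt ps" "nomirror FS al lab" "map lab os = w" "card FS = n"
    using assms by (auto simp: fills_def)
  interpret diagram S R os FS al lab vt ps by (rule d)
  obtain m where m: "\<forall>d\<in>D. d < m" using finite_nat_set_iff_bounded[of D] by auto
  obtain l where l: "\<forall>d\<in>D. vt d < l" using finite_nat_set_iff_bounded[of "vt ` D"] by auto
  let ?k = "length r"
  let ?es = "[m + ?k..<m + 2 * ?k]"
  from insert_relator[OF assms(2) refl m l] obtain vt' ps' where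
    d': "diagram S R ([m..<m + ?k] @ os) (insert ?es FS)
     (\<lambda>d. if d < m then al d else 2 * m + 2 * ?k - 1 - d)
     (\<lambda>d. if d < m then lab d else if d < m + ?k then r ! (d - m) else letter_inv (r ! (m + 2 * ?k - 1 - d))) vt' ps'"
    (is "diagram _ _ _ _ ?al ?lab _ _") by blast
  have k0: "?k > 0" using R_nonempty[OF assms(2)] by simp
  have ml: "map ?lab xs = map lab xs" if "set xs \<subseteq> D" for xs
  proof (rule map_cong[OF refl])
    fix y assume "y \<in> set xs"
    then have "y < m" using that m by auto
    then show "?lab y = lab y" by simp
  qed
  have al_lt: "d \<in> D \<Longrightarrow> al d < m" for d using m al_D by auto
  have "nomirror (insert ?es FS) ?al ?lab" unfolding nomirror_def
  proof (intro ballI impI)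
    fix f g e assume h: "f \<in> insert ?es FS" "g \<in> insert ?es FS" "e \<in> set f" "?al e \<in> set g"
    have "e < m"
    proof (rule ccontr)
      assume "\<not> e < m"
      then have "e \<in> set ?es" using h in_D(2) m by (metis insertE)
      then have "?al e \<in> {m..<m + ?k}" by auto
      then show False using h(2,4) in_D(2)[of g "?al e"] m by (metis atLeastLessThan_iff insertE leD set_upt)
    qed
    then have f: "f \<in> FS" "e \<in> D" using h in_D(2) by auto
    then have e: "?al e = al e" and g: "g \<in> FS" using h m al_lt[OF f(2)] by auto
    have "set (aft f e) \<subseteq> D" "set (aft g (al e)) \<subseteq> D"
      using set_aft[OF h(3)] set_aft[of "al e" g] h e f g in_D(2) by auto
    then have ml2: "map ?lab (aft f e) = map lab (aft f e)" "map ?lab (aft g (al e)) = map lab (aft g (al e))"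
      using ml by blast+
    have "al e \<in> set g" using h(4) e by simp
    then have "map lab (aft f e) \<noteq> word_inv (map lab (aft g (al e)))"
      using d(2) h(3) f g unfolding nomirror_def by blast
    then show "map ?lab (aft f e) \<noteq> word_inv (map ?lab (aft g (?al e)))" unfolding e ml2 .
  qed
  moreover have "map ?lab ([m..<m + ?k] @ os) = r @ w"
  proof -
    have "map ?lab [m..<m + ?k] = r" by (rule nth_equalityI) auto
    then show ?thesis using ml[of os] d(3) in_D(1) by auto
  qed
  moreover have "?es \<notin> FS" using m in_D(2)[of ?es "m + ?k"] k0 by fastforce
  then have "card (insert ?es FS) = Suc n" using finFS d(4) by simp
  ultimately show ?thesis by (rule fillsI[OF d'])
qed

text \<open>Gluing can violate reducedness only along the new edge. If the faces there are mirror
  images, both are deleted instead; this leaves \<open>w\<close> conjugated by their common word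
  \<open>q\<close>, and \<open>q\<close> is cancelled by the induction hypothesis since fewer faces
  remain.\<close>

lemma fills_fold: "fills S R n (x # letter_inv x # w) \<Longrightarrow> \<exists>n'\<le>n. fills S R n' w"
proof (induction n arbitrary: x w rule: less_induct)
  case (less n)
  obtain os FS al lab vt ps where d: "diagram S R os FS al lab vt ps" "nomirror FS al lab"
    "map lab os = x # letter_inv x # w" "card FS = n"
    using less.prems by (auto simp: fills_def)
  interpret diagram S R os FS al lab vt ps by (rule d)
  obtain d1 d2 vs where os: "os = d1 # d2 # vs" and l: "lab d1 = x" "lab d2 = letter_inv x" "map lab vs = w"
    using d(3) by (auto simp: map_eq_Cons_conv)
  have dD: "d1 \<in> D" "d2 \<in> D" using os in_D by auto
  show ?case
  proof (cases "al d1 = d2")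
    case True
    from fillsI[OF fold_spur[OF os True] d(2) l(3) d(4)] show ?thesis by auto
  next
    case ne: False
    let ?e1 = "al d1" and ?e2 = "al d2"
    let ?al = "al (?e1 := ?e2, ?e2 := ?e1)"
    show ?thesis
    proof (cases "nomirror FS ?al lab")
      case True
      from fills_def fillsI[OF fold_glue[OF os ne] True l(3) d(4)] show ?thesis using l by auto
    next
      case False
      then obtain f g e where h: "f \<in> FS" "g \<in> FS" "e \<in> set f" "?al e \<in> set g"
        "map lab (aft f e) = word_inv (map lab (aft g (?al e)))" unfolding nomirror_def by blast
      have "e = ?e1 \<or> e = ?e2" using h d(2) unfolding nomirror_def by (metis fun_upd_other)
      then obtain f g where h: "f \<in> FS" "g \<in> FS" "?e1 \<in> set f" "?e2 \<in> set g"
        "map lab (aft f ?e1) = word_inv (map lab (aft g ?e2))"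
        using h by (metis fun_upd_apply word_inv_inv)
      let ?q = "map lab (aft f ?e1)"
      \<comment> \<open>A face mirrored onto itself would carry a relator that is a rotation of its
        own inverse.\<close>
      have "f \<noteq> g"
      proof
        assume fg: "f = g"
        have r1: "map lab (?e1 # aft f ?e1) = letter_inv x # ?q" using lab_al dD l by simp
        have r2: "map lab (?e2 # aft f ?e2) = x # word_inv ?q" using lab_al dD l h(5) fg by simp
        obtain k where "x # word_inv ?q = rotate k (letter_inv x # ?q)"
          using face_words_rotate[of f ?e1 ?e2] h fg r1 r2 by metis
        then have "rotate 1 (rotate k (letter_inv x # ?q)) = word_inv (letter_inv x # ?q)" by (metis One_nat_def letter_inv_inv rotate1_rotate_swap rotate_Suc rotate0 id_apply rotate1.simps(2) word_inv_simps(2))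
        then show False using rotate_neq_inv[of "letter_inv x # ?q" "1 + k"] aft_R[OF h(1,3)] r1 by (simp add: rotate_rotate)
      qed
      have d1: "diagram S R (aft f ?e1 @ d2 # vs) (FS - {f}) al lab vt ps" by (rule remove_face[OF os h(1,3)])
      have d2: "diagram S R (d2 # vs @ aft f ?e1) (FS - {f}) al lab vt ps"
        using diagram.rotate_outer[OF d1, of "aft f ?e1" "d2 # vs"] by simp
      have d3: "diagram S R (aft g ?e2 @ vs @ aft f ?e1) (FS - {f} - {g}) al lab vt ps"
        using diagram.remove_face[OF d2, of d2 "vs @ aft f ?e1" g] h \<open>f \<noteq> g\<close> by simp
      have "card (FS - {f} - {g}) < n" using h \<open>f \<noteq> g\<close> finFS d(4)
        by (metis Diff_subset card_Diff1_less finite_Diff less_le_trans le_less psubsetI psubset_card_mono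
            Diff_iff singletonI subset_trans order_less_le_trans)
      moreover have "nomirror (FS - {f} - {g}) al lab" by (rule nomirror_subset[OF d(2)]) auto
      moreover have "map lab (aft g ?e2 @ vs @ aft f ?e1) = word_inv ?q @ w @ ?q" using l h(5) by simp
      ultimately obtain n' where n': "n' < n" "fills S R n' ((word_inv ?q @ w) @ ?q)"
        using d3 unfolding fills_def by (metis append_assoc)
      \<comment> \<open>Letters are cancelled from the end of \<open>q\<close>; the number of faces
        never grows, so it stays below \<open>n\<close> and the induction hypothesis keeps
        applying.\<close>
      have "fills S R m (q @ word_inv q @ w) \<Longrightarrow> m < n \<Longrightarrow> \<exists>n'\<le>m. fills S R n' w" for q m
      proof (induction q arbitrary: m w rule: rev_induct)
        case (snoc y q)
        have "fills S R m ((y # letter_inv y # word_inv q @ w) @ q)"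
          using fills_rotate[of m q "y # letter_inv y # word_inv q @ w"] snoc.prems by simp
        then obtain m' where m': "m' \<le> m" "fills S R m' ((word_inv q @ w) @ q)"
          using less.IH[OF snoc.prems(2), of y "word_inv q @ w @ q"] by auto
        then have "fills S R m' (q @ word_inv q @ w)" using fills_rotate by blast
        then show ?case using snoc.IH[of m' w] m' snoc.prems(2) by (metis le_trans le_less_trans)
      qed auto
      from this[of n' ?q] n' fills_rotate[OF n'(2)] show ?thesis by (metis le_trans less_imp_le)
    qed
  qed
qed

lemma fills_fold_at: assumes "fills S R n (u @ x # letter_inv x # v)" shows "\<exists>n'\<le>n. fills S R n' (u @ v)"
proof -
  have "fills S R n (x # letter_inv x # v @ u)" using fills_rotate[OF assms] by simp
  then show ?thesis using fills_fold[of n x "v @ u"] fills_rotate by blast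
qed

lemma fills_cancel: "fills S R n (u @ q @ word_inv q @ v) \<Longrightarrow> \<exists>n'\<le>n. fills S R n' (u @ v)"
proof (induction q arbitrary: n rule: rev_induct)
  case (snoc y q)
  then obtain m where m: "m \<le> n" "fills S R m (u @ q @ word_inv q @ v)"
    using fills_fold_at[of n "u @ q" y "word_inv q @ v"] by auto
  then show ?case using snoc.IH[of m] by (metis le_trans)
qed auto

lemma fills_Nil: "fills S R 0 []"
proof -
  have "diagram S R [] {} id (\<lambda>_. undefined) (\<lambda>_. 0) (\<lambda>_. {})"
    by unfold_locales (auto simp: darts_def)
  then show ?thesis unfolding fills_def nomirror_def by force
qed

text \<open>Having a reduced diagram is invariant under elementary steps in both directions. A
  relator is erased from the boundary word by attaching its inverse and cancelling the two.\<close>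

theorem van_kampen: assumes "w \<doteq> []" shows "\<exists>n. fills S R n w"
proof -
  have st: "(\<exists>n. fills S R n u) \<longleftrightarrow> (\<exists>n. fills S R n v)" if "elem_step S R u v" for u v
  proof -
    obtain p q z where z: "u = p @ q" "v = p @ z @ q" and c: "z \<in> R \<or> (\<exists>x\<in>Ltr. z = [x, letter_inv x])"
      using \<open>elem_step S R u v\<close> unfolding elem_step_def Ltr_def by blast
    from c show ?thesis
    proof
      assume zR: "z \<in> R"
      show ?thesis
      proof
        assume "\<exists>n. fills S R n u"
        then obtain n where "fills S R n (q @ p)" using fills_rotate z by blast
        then show "\<exists>n. fills S R n v" using fills_relator[OF _ zR] fills_rotate[of _ "z @ q" p] z by (metis append_assoc)
      next
        assume "\<exists>n. fills S R n v"
        then obtain n where "fills S R n (q @ p @ z)" using fills_rotate[of _ "p @ z" q] z by auto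
        then have "fills S R (Suc n) ((word_inv z @ q @ p) @ z)" using fills_relator[OF _ R_inv[OF zR]] by auto
        then have "fills S R (Suc n) ([] @ z @ word_inv z @ (q @ p))" using fills_rotate by fastforce
        then show "\<exists>n. fills S R n u" using fills_cancel fills_rotate z by (metis append_Nil)
      qed
    next
      assume "\<exists>x\<in>Ltr. z = [x, letter_inv x]"
      then obtain x where x: "x \<in> Ltr" "z = [x, letter_inv x]" by auto
      show ?thesis
      proof
        assume "\<exists>n. fills S R n u"
        then obtain n where "fills S R n (q @ p)" using fills_rotate z by blast
        then have "fills S R n ((x # letter_inv x # q) @ p)" using fills_spur x by auto
        then show "\<exists>n. fills S R n v" using fills_rotate z x by fastforce
      next
        assume "\<exists>n. fills S R n v"
        then show "\<exists>n. fills S R n u" using fills_fold_at[of _ p x q] z x by auto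
      qed
    qed
  qed
  have "equivclp (elem_step S R) [] w" using weq_sym[OF assms] by (simp add: word_eq_def)
  then show ?thesis
  proof (induction rule: equivclp_induct)
    case base then show ?case using fills_Nil by auto
  next
    case (step y z) then show ?case using st by blast
  qed
qed

end

section \<open>Combinatorial curvature\<close>

lemma cyc_nth: "cyc xs = {(xs ! i, xs ! (Suc i mod length xs)) | i. i < length xs}"
  unfolding cyc_def set_zip by (auto simp: nth_rotate1 intro!: equalityI)

section \<open>Face permutation, vertex permutation and arcs\<close>

context diagram
begin

text \<open>The face permutation of the combinatorial map; uniqueness comes from the boundary lists
  being distinct and pairwise disjoint.\<close>

definition nx :: "nat \<Rightarrow> nat" where
  "nx d = (THE d'. \<exists>xs\<in>insert os FS. (d, d') \<in> cyc xs)"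

lemma lists_distinct: "xs \<in> insert os FS \<Longrightarrow> distinct xs" using dist_os dist_f by auto

lemma lists_disjoint: "xs \<in> insert os FS \<Longrightarrow> ys \<in> insert os FS \<Longrightarrow> d \<in> set xs \<Longrightarrow> d \<in> set ys \<Longrightarrow> xs = ys"
  using disj disj_os by (metis Int_iff empty_iff insert_iff)

lemma D_cases: "d \<in> D \<Longrightarrow> \<exists>xs\<in>insert os FS. d \<in> set xs" by (auto simp: darts_def)

lemma lists_D: "xs \<in> insert os FS \<Longrightarrow> d \<in> set xs \<Longrightarrow> d \<in> D" using in_D by auto

lemma nx_nth:
  assumes "xs \<in> insert os FS" "i < length xs" shows "nx (xs ! i) = xs ! (Suc i mod length xs)"
  unfolding nx_def
proof (rule the_equality)
  show "\<exists>ys\<in>insert os FS. (xs ! i, xs ! (Suc i mod length xs)) \<in> cyc ys"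
    using assms by (auto simp: cyc_nth)
  fix d' assume "\<exists>ys\<in>insert os FS. (xs ! i, d') \<in> cyc ys"
  then obtain ys j where ys: "ys \<in> insert os FS" "j < length ys" "xs ! i = ys ! j" "d' = ys ! (Suc j mod length ys)"
    by (auto simp: cyc_nth)
  then have "xs = ys" using lists_disjoint[OF assms(1) ys(1), of "xs ! i"] assms(2) by (metis nth_mem)
  then have "i = j" using ys assms lists_distinct by (metis nth_eq_iff_index_eq)
  then show "d' = xs ! (Suc i mod length xs)" using ys \<open>xs = ys\<close> by simp
qed

lemma nx_pow_nth:
  assumes "xs \<in> insert os FS" "i < length xs" shows "(nx ^^ k) (xs ! i) = xs ! ((i + k) mod length xs)"
proof (induction k)
  case (Suc k)
  have "(i + k) mod length xs < length xs" using assms(2) by (simp add: mod_less_divisor[OF order.strict_trans1[OF zero_le]])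
  then have "nx (xs ! ((i + k) mod length xs)) = xs ! (Suc ((i + k) mod length xs) mod length xs)"
    by (rule nx_nth[OF assms(1)])
  then show ?case using Suc by (simp add: mod_Suc_eq)
qed (use assms in simp)

lemma nx_mem: "xs \<in> insert os FS \<Longrightarrow> d \<in> set xs \<Longrightarrow> (nx ^^ k) d \<in> set xs"
  by (metis in_set_conv_nth nx_pow_nth length_pos_if_in_set mod_less_divisor)

lemma nx_mem1: "xs \<in> insert os FS \<Longrightarrow> d \<in> set xs \<Longrightarrow> nx d \<in> set xs"
  using nx_mem[of xs d 1] by simp

lemma nx_D: "d \<in> D \<Longrightarrow> nx d \<in> D" using D_cases nx_mem1 lists_D by metis

lemma nx_cyc: assumes "d \<in> D" shows "\<exists>xs\<in>insert os FS. (d, nx d) \<in> cyc xs"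
proof -
  obtain xs i where "xs \<in> insert os FS" "i < length xs" "d = xs ! i" using D_cases[OF assms] by (metis in_set_conv_nth)
  then show ?thesis using nx_nth[of xs i] by (auto simp: cyc_nth)
qed

lemma vt_nx: "d \<in> D \<Longrightarrow> vt (nx d) = vt (al d)" using nx_cyc cyc_vt by metis
lemma ps_nx: "d \<in> D \<Longrightarrow> ps (nx d) = ps (al d)" using nx_cyc cyc_ps by metis

lemma nx_len: "xs \<in> insert os FS \<Longrightarrow> d \<in> set xs \<Longrightarrow> (nx ^^ length xs) d = d"
  by (metis in_set_conv_nth nx_pow_nth mod_add_self2 mod_less)

lemma nx_inj_list:
  assumes "xs \<in> insert os FS" "d \<in> set xs" "i < length xs" "j < length xs" "(nx ^^ i) d = (nx ^^ j) d"
  shows "i = j"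
proof -
  obtain m where m: "m < length xs" "d = xs ! m" using assms(2) by (metis in_set_conv_nth)
  let ?L = "length xs"
  have "(m + i) mod ?L < ?L" "(m + j) mod ?L < ?L" using m by (auto intro: mod_less_divisor)
  then have "(m + i) mod ?L = (m + j) mod ?L"
    using assms(5) nx_pow_nth[OF assms(1) m(1)] m lists_distinct[OF assms(1)] by (metis nth_eq_iff_index_eq)
  then have eq: "(m + i) mod ?L = (m + j) mod ?L" .
  have aux: "x = y" if "x \<le> y" "y < ?L" "(m + y) mod ?L = (m + x) mod ?L" for x y
  proof -
    have "?L dvd (m + y) - (m + x)" using mod_eq_dvd_iff_nat[of "m + x" "m + y" ?L] that by simp
    then have "?L dvd y - x" by simp
    then show ?thesis using that by (metis diff_is_0_eq dvd_imp_le le_antisym less_imp_diff_less linorder_not_less not_gr_zero)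
  qed
  show ?thesis using aux[of i j] aux[of j i] eq assms(3,4) by (cases "i \<le> j") simp_all
qed

lemma nx_inj: assumes "d \<in> D" "d' \<in> D" "nx d = nx d'" shows "d = d'"
proof -
  obtain xs where xs: "xs \<in> insert os FS" "d \<in> set xs" using D_cases[OF assms(1)] by auto
  obtain ys where ys: "ys \<in> insert os FS" "d' \<in> set ys" using D_cases[OF assms(2)] by auto
  have "xs = ys" using lists_disjoint[OF xs(1) ys(1)] nx_mem1 xs ys assms(3) by metis
  then obtain k where k: "length xs = Suc k" using xs by (cases "length xs") auto
  have "(nx ^^ k) (nx d) = d" "(nx ^^ k) (nx d') = d'"
    using nx_len[OF xs] nx_len[OF ys] \<open>xs = ys\<close> k by (simp_all add: funpow_swap1)
  then show ?thesis using assms(3) by metis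
qed

lemma nx_pow_inj: "d \<in> D \<Longrightarrow> d' \<in> D \<Longrightarrow> (nx ^^ k) d = (nx ^^ k) d' \<Longrightarrow> d = d'"
proof (induction k)
  case (Suc k)
  have "(nx ^^ k) e \<in> D" if "e \<in> D" for e using that nx_D by (induction k) auto
  then have "(nx ^^ k) d = (nx ^^ k) d'" using nx_inj[of "(nx ^^ k) d" "(nx ^^ k) d'"] Suc.prems by simp
  then show ?case using Suc by blast
qed simp

lemma nx_pow_D: "d \<in> D \<Longrightarrow> (nx ^^ k) d \<in> D" using nx_D by (induction k) auto

lemma nx_orbit:
  assumes "xs \<in> insert os FS" "d \<in> set xs" "e \<in> set xs" shows "\<exists>k<length xs. e = (nx ^^ k) d"
proof -
  obtain i j where ij: "i < length xs" "d = xs ! i" "j < length xs" "e = xs ! j" using assms by (metis in_set_conv_nth)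
  let ?L = "length xs"
  define k where "k = (j + ?L - i) mod ?L"
  have "k < ?L" unfolding k_def using ij by (intro mod_less_divisor) auto
  moreover have "(i + k) mod ?L = j"
  proof -
    have "(i + k) mod ?L = (i + (j + ?L - i)) mod ?L" unfolding k_def by (simp add: mod_add_right_eq)
    also have "i + (j + ?L - i) = j + ?L" using ij by simp
    finally show ?thesis using ij by simp
  qed
  ultimately show ?thesis using nx_pow_nth[OF assms(1) ij(1)] ij by auto
qed

lemma aft_nx:
  assumes "xs \<in> insert os FS" "d \<in> set xs" shows "d # aft xs d = map (\<lambda>k. (nx ^^ k) d) [0..<length xs]"
proof -
  obtain us vs where s: "xs = us @ d # vs" "d \<notin> set us" "aft xs d = vs @ us" using aftE[OF assms(2)] by blast
  let ?L = "length xs" and ?i = "length us"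
  have i: "?i < ?L" "xs ! ?i = d" using s by auto
  show ?thesis
  proof (rule nth_equalityI)
    fix k assume "k < length (d # aft xs d)"
    then have k: "k < ?L" using s by simp
    have "(nx ^^ k) d = xs ! ((?i + k) mod ?L)" using nx_pow_nth[OF assms(1) i(1)] i(2) by simp
    also have "\<dots> = rotate ?i xs ! k" using nth_rotate[OF k, of ?i] by simp
    also have "rotate ?i xs = d # aft xs d" using s rotate_append[of us "d # vs"] by simp
    finally show "(d # aft xs d) ! k = map (\<lambda>k. (nx ^^ k) d) [0..<?L] ! k" using k by simp
  qed (use s(1,3) in simp)
qed

text \<open>The vertex permutation: it turns to another dart leaving the same vertex. Where
  \<open>brk\<close> fails, the vertex has degree one or two; once degree one is excluded, breaks
  are exactly the ends of the arcs along which two faces meet.\<close>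

definition sg :: "nat \<Rightarrow> nat" where "sg d = nx (al d)"
definition brk :: "nat \<Rightarrow> bool" where "brk d \<longleftrightarrow> sg (sg d) \<noteq> d"

lemma sg_D: "d \<in> D \<Longrightarrow> sg d \<in> D" by (simp add: sg_def nx_D al_D)
lemma sg_vt: "d \<in> D \<Longrightarrow> vt (sg d) = vt d" using vt_nx[of "al d"] al_D al_al by (simp add: sg_def)
lemma sg_ps: "d \<in> D \<Longrightarrow> ps (sg d) = ps d" using ps_nx[of "al d"] al_D al_al by (simp add: sg_def)
lemma sg_inj: assumes "d \<in> D" "d' \<in> D" "sg d = sg d'" shows "d = d'"
proof -
  have "al d = al d'" using nx_inj[of "al d" "al d'"] assms al_D by (simp add: sg_def)
  then show ?thesis using al_al assms by metis
qed
lemma brk_sg: "d \<in> D \<Longrightarrow> brk (sg d) \<longleftrightarrow> brk d" unfolding brk_def using sg_inj sg_D by metis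

lemma not_brk_nx: assumes "d \<in> D" shows "\<not> brk (nx d) \<longleftrightarrow> nx (al (nx d)) = al d"
proof
  assume "\<not> brk (nx d)"
  then have "nx (al (nx (al (nx d)))) = nx d" by (simp add: brk_def sg_def)
  then have "al (nx (al (nx d))) = d" using nx_inj assms al_D nx_D by metis
  then show "nx (al (nx d)) = al d" using al_al assms al_D nx_D by metis
next
  assume "nx (al (nx d)) = al d"
  then show "\<not> brk (nx d)" using al_al[OF assms] by (simp add: brk_def sg_def)
qed

text \<open>A vertex of degree two is passed on both sides of an arc, in opposite directions, so
  going along the arc and back on the other side returns to \<open>al b\<close>.\<close>

lemma run_al:
  assumes "b \<in> D" "\<And>j. 0 < j \<Longrightarrow> j < k \<Longrightarrow> \<not> brk ((nx ^^ j) b)" "j < k"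
  shows "(nx ^^ j) (al ((nx ^^ j) b)) = al b"
  using assms(3)
proof (induction j)
  case (Suc j)
  let ?d = "(nx ^^ j) b"
  have "?d \<in> D" by (rule nx_pow_D[OF assms(1)])
  moreover have "\<not> brk (nx ?d)" using assms(2)[of "Suc j"] Suc.prems by simp
  ultimately have "nx (al (nx ?d)) = al ?d" using not_brk_nx by blast
  then show ?case using Suc by (simp add: funpow_swap1)
qed simp

lemma run_al_mem:
  assumes "b \<in> D" "\<And>j. 0 < j \<Longrightarrow> j < k \<Longrightarrow> \<not> brk ((nx ^^ j) b)" "j < k"
    "xs \<in> insert os FS" "al b \<in> set xs"
  shows "al ((nx ^^ j) b) \<in> set xs"
proof -
  obtain ys where ys: "ys \<in> insert os FS" "al ((nx ^^ j) b) \<in> set ys"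
    using D_cases[OF al_D[OF nx_pow_D[OF assms(1)]]] by blast
  have "al b \<in> set ys" using run_al[OF assms(1,2,3)] nx_mem[OF ys, of j] by simp
  then show ?thesis using lists_disjoint[OF ys(1) assms(4)] assms(5) ys(2) by metis
qed

text \<open>Read from \<open>b\<close>, the word of \<open>f\<close> and the inverted word of
  \<open>g\<close> agree along the whole run. Reducedness says that they are different relators, so
  the run is a piece.\<close>

lemma run_piece:
  assumes nm: "nomirror FS al lab" and f: "f \<in> FS" "b \<in> set f" and g: "g \<in> FS" "al b \<in> set g"
    and run: "\<And>j. 0 < j \<Longrightarrow> j < k \<Longrightarrow> \<not> brk ((nx ^^ j) b)" and k: "0 < k" "k \<le> length f"
  shows "6 * k < length f"
proof -
  have bD: "b \<in> D" using f in_D(2) by auto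
  let ?d = "\<lambda>j. (nx ^^ j) b"
  have mem: "al (?d j) \<in> set g" if "j < k" for j using run_al_mem[OF bD run that, where xs = g] g by blast
  have kg: "k \<le> length g"
  proof -
    have "inj_on (\<lambda>j. al (?d j)) {..<k}"
    proof (rule inj_onI)
      fix i j assume h: "i \<in> {..<k}" "j \<in> {..<k}" "al (?d i) = al (?d j)"
      then have "?d i = ?d j" using al_al[OF nx_pow_D[OF bD]] by metis
      then show "i = j" using nx_inj_list[of f b i j] f h k by auto
    qed
    moreover have "(\<lambda>j. al (?d j)) ` {..<k} \<subseteq> set g" using mem by auto
    ultimately have "k \<le> card (set g)" by (metis List.finite_set card_inj_on_le card_lessThan)
    then show ?thesis using dist_f[OF g(1)] by (simp add: distinct_card)
  qed
  let ?r = "map lab (b # aft f b)" and ?B = "map lab (aft g (al b))"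
  let ?r' = "lab b # word_inv ?B"
  have rR: "?r \<in> R" by (rule aft_R[OF f])
  have "lab (al b) # ?B \<in> R" using aft_R[OF g] by simp
  then have "word_inv ?B @ [lab b] \<in> R" using R_inv[of "lab (al b) # ?B"] lab_al[OF bD] by simp
  then have r'R: "?r' \<in> R" using R_swap[of "word_inv ?B" "[lab b]"] by simp
  have len: "length ?r = length f" "length ?r' = length g"
    using length_aft[OF f(2)] length_aft[OF g(2)] by simp_all
  have nth: "?r ! j = lab (?d j)" if "j < length f" for j
    using aft_nx[of f b] f that by (simp del: list.map upt_Suc)
  have nth': "?r' ! j = lab (?d j)" if "j < k" for j
  proof (cases j)
    case (Suc i)
    let ?G = "length g"
    have jG: "j < ?G" using that kg by simp
    have "?r' ! j = letter_inv (?B ! (?G - 1 - Suc i))"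
      using Suc jG length_aft[OF g(2)] by (simp add: word_inv_def rev_nth)
    also have "?B ! (?G - 1 - Suc i) = map lab (al b # aft g (al b)) ! (?G - j)"
      using Suc jG length_aft[OF g(2)] by (simp add: nth_Cons' del: map_map)
    also have "\<dots> = lab ((nx ^^ (?G - j)) (al b))"
      using aft_nx[of g "al b"] g Suc jG by (simp del: list.map upt_Suc)
    also have "(nx ^^ (?G - j)) (al b) = (nx ^^ (?G - j + j)) (al (?d j))"
      using run_al[OF bD run that] by (simp add: funpow_add)
    also have "\<dots> = al (?d j)" using nx_len[of g "al (?d j)"] g mem[OF that] jG by simp
    finally show ?thesis using lab_al[OF nx_pow_D[OF bD]] by simp
  qed simp
  have tk: "take k ?r = take k ?r'"
  proof (rule nth_equalityI)
    fix j assume "j < length (take k ?r)"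
    then have "j < k" "j < length f" using k len by auto
    then show "take k ?r ! j = take k ?r' ! j" using nth[of j] nth'[of j] by (simp del: list.map)
  qed (use k kg len in auto)
  have "map lab (aft f b) \<noteq> word_inv ?B" using nm f g unfolding nomirror_def by blast
  then have "drop k ?r \<noteq> drop k ?r'"
    using tk by (metis append_take_drop_id list.inject list.simps(9))
  then have "6 * length (take k ?r) < length (take k ?r @ drop k ?r)"
    using piece_length[of "take k ?r" "drop k ?r" "drop k ?r'"] rR r'R tk by (metis append_take_drop_id)
  then show ?thesis using k len by simp
qed

text \<open>An arc is represented by the break at which it starts. \<open>Eo\<close> collects the
  exterior arcs of a face, which it shares with the outer boundary, \<open>In\<close> the interior
  ones, and \<open>rl\<close> is the number of edges of an arc.\<close>

definition Bk :: "nat list \<Rightarrow> nat set" where "Bk f = {d \<in> set f. brk d}"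
definition Eo :: "nat list \<Rightarrow> nat set" where "Eo f = {d \<in> set f. brk d \<and> al d \<in> set os}"
definition In :: "nat list \<Rightarrow> nat set" where "In f = {d \<in> set f. brk d \<and> al d \<notin> set os}"
definition rl :: "nat \<Rightarrow> nat" where "rl b = (LEAST k. 0 < k \<and> brk ((nx ^^ k) b))"

lemma Bk_Un: "Bk f = Eo f \<union> In f" "Eo f \<inter> In f = {}" by (auto simp: Bk_def Eo_def In_def intro!: equalityI)
lemma fin_Bk [simp]: "finite (Bk f)" "finite (Eo f)" "finite (In f)" by (simp_all add: Bk_def Eo_def In_def)
lemma card_Bk: "card (Bk f) = card (Eo f) + card (In f)" using Bk_Un by (simp add: card_Un_disjoint)

lemma rl_ex: assumes "xs \<in> insert os FS" "b \<in> set xs" "brk b"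
  shows "0 < rl b" "rl b \<le> length xs" "brk ((nx ^^ rl b) b)" "\<And>j. 0 < j \<Longrightarrow> j < rl b \<Longrightarrow> \<not> brk ((nx ^^ j) b)"
proof -
  have P: "0 < length xs \<and> brk ((nx ^^ length xs) b)" using nx_len[OF assms(1,2)] assms by (cases xs) auto
  from LeastI[of "\<lambda>k. 0 < k \<and> brk ((nx ^^ k) b)", OF P] show "0 < rl b" "brk ((nx ^^ rl b) b)" by (auto simp: rl_def)
  show "rl b \<le> length xs" unfolding rl_def using P by (intro Least_le)
  show "\<And>j. 0 < j \<Longrightarrow> j < rl b \<Longrightarrow> \<not> brk ((nx ^^ j) b)" unfolding rl_def using not_less_Least by blast
qed

lemma break_before:
  assumes f: "f \<in> FS" and ne: "Bk f \<noteq> {}" and d: "d \<in> set f"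
  shows "\<exists>b\<in>Bk f. \<exists>i<rl b. d = (nx ^^ i) b"
proof -
  obtain b0 where b0: "b0 \<in> set f" "brk b0" using ne by (auto simp: Bk_def)
  define Q where "Q i = (\<exists>b\<in>set f. brk b \<and> d = (nx ^^ i) b)" for i
  have "\<exists>i. Q i" using nx_orbit[of f b0 d] b0 d f unfolding Q_def by blast
  then have Qi: "Q (LEAST i. Q i)" by (rule LeastI_ex)
  define i where "i = (LEAST i. Q i)"
  obtain b where b: "b \<in> set f" "brk b" "d = (nx ^^ i) b" using Qi by (auto simp: Q_def i_def)
  have "i < rl b"
  proof (rule ccontr)
    assume "\<not> i < rl b"
    then have i: "i = (i - rl b) + rl b" by simp
    have r: "0 < rl b" "brk ((nx ^^ rl b) b)" using rl_ex[of f b] f b by auto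
    have "d = (nx ^^ (i - rl b)) ((nx ^^ rl b) b)" using b(3) i by (metis comp_apply funpow_add)
    moreover have "(nx ^^ rl b) b \<in> set f" using nx_mem[of f b] f b by simp
    ultimately have "Q (i - rl b)" using r Q_def by blast
    then have "i \<le> i - rl b" unfolding i_def by (rule Least_le)
    then show False using r i by linarith
  qed
  then show ?thesis using b by (auto simp: Bk_def)
qed

lemma Bk_cover:
  assumes f: "f \<in> FS" and ne: "Bk f \<noteq> {}" shows "length f \<le> (\<Sum>b\<in>Bk f. rl b)"
proof -
  have "set f \<subseteq> (\<Union>b\<in>Bk f. (\<lambda>j. (nx ^^ j) b) ` {..<rl b})" using break_before[OF assms] by fastforce
  then have "card (set f) \<le> card (\<Union>b\<in>Bk f. (\<lambda>j. (nx ^^ j) b) ` {..<rl b})" by (intro card_mono) auto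
  also have "\<dots> \<le> (\<Sum>b\<in>Bk f. card ((\<lambda>j. (nx ^^ j) b) ` {..<rl b}))" by (rule card_UN_le) simp
  also have "\<dots> \<le> (\<Sum>b\<in>Bk f. rl b)" by (intro sum_mono) (metis card_image_le card_lessThan finite_lessThan)
  finally show ?thesis using dist_f[OF f] by (simp add: distinct_card)
qed

lemma In_rl:
  assumes "nomirror FS al lab" "f \<in> FS" "b \<in> In f" shows "6 * rl b < length f"
proof -
  have b: "b \<in> set f" "brk b" "al b \<notin> set os" "b \<in> D" using assms in_D(2) by (auto simp: In_def)
  then obtain g where "g \<in> FS" "al b \<in> set g" using al_D[OF b(4)] by (auto simp: darts_def)
  then show ?thesis using run_piece[OF assms(1,2) b(1), of g "rl b"] rl_ex[of f b] assms(2) b by auto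
qed

text \<open>The arcs cover the face, and each interior arc is a piece, so six times its length is at
  most \<open>length f - 1\<close>. The estimate is multiplied out to remain in the natural
  numbers.\<close>

lemma inner_bound:
  assumes "nomirror FS al lab" "f \<in> FS" "Bk f \<noteq> {}"
  shows "6 * length f + card (In f) \<le> 6 * (\<Sum>b\<in>Eo f. rl b) + card (In f) * length f"
proof -
  have "length f \<le> (\<Sum>b\<in>Eo f. rl b) + (\<Sum>b\<in>In f. rl b)"
    using Bk_cover[OF assms(2,3)] Bk_Un by (simp add: sum.union_disjoint)
  moreover have "(\<Sum>b\<in>In f. 6 * rl b + 1) \<le> (\<Sum>b\<in>In f. length f)"
    by (intro sum_mono) (use In_rl[OF assms(1,2)] in fastforce)
  then have "6 * (\<Sum>b\<in>In f. rl b) + card (In f) \<le> card (In f) * length f"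
    by (simp only: sum.distrib sum_distrib_left[symmetric] sum_constant) simp
  ultimately show ?thesis by linarith
qed

text \<open>Otherwise the entire boundary of the face would be one piece, shorter than a sixth of
  itself.\<close>

lemma no_break_face:
  assumes "nomirror FS al lab" "f \<in> FS" "Bk f = {}" "b \<in> set f" shows "al b \<in> set os"
proof (rule ccontr)
  assume "al b \<notin> set os"
  then obtain g where "g \<in> FS" "al b \<in> set g" using al_D[of b] in_D(2)[OF assms(2,4)] by (auto simp: darts_def)
  moreover have "\<not> brk ((nx ^^ j) b)" for j using assms nx_mem[of f b] by (auto simp: Bk_def)
  moreover have "0 < length f" using assms(4) by (cases f) auto
  ultimately have "6 * length f < length f" using run_piece[OF assms(1,2,4), of g "length f"] by auto
  then show False by simp
qed

text \<open>Combinatorial Gauss--Bonnet. A dart weighs 3, or 2 at a break. Every vertex then carries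
  at least 6, as \<open>3 + 3\<close> for degree two and as \<open>2 + 2 + 2\<close> or more
  otherwise, with a surplus at a break whose degree is not three. With Euler's inequality the number
  of breaks is at most \<open>6 * card FS - 6\<close>, less the surplus; distributing the breaks
  over the faces gives the sum.\<close>

lemma curvature:
  assumes ne: "os \<noteq> []" and sg_ne: "\<And>d. d \<in> D \<Longrightarrow> sg d \<noteq> d"
  shows "6 + (if \<exists>d\<in>D. brk d \<and> sg (sg (sg d)) \<noteq> d then 1 else 0)
     \<le> (\<Sum>f\<in>FS. 6 - 2 * int (card (Eo f)) - int (card (In f)))"
proof -
  define wt where "wt d = (3 :: int) - of_bool (brk d)" for d
  let ?x = "(if \<exists>d\<in>D. brk d \<and> sg (sg (sg d)) \<noteq> d then 1 else 0) :: int"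
  let ?F = "\<lambda>v. {d \<in> D. vt d = v}"
  have wt2: "wt d \<ge> 2" for d by (simp add: wt_def)
  have closed: "d \<in> ?F v \<Longrightarrow> sg d \<in> ?F v" for d v using sg_D sg_vt by auto
  have sub: "sum wt A \<le> sum wt (?F v)" if "A \<subseteq> ?F v" for A v
    using that by (intro sum_mono2) (auto intro: order_trans[OF _ wt2])
  have fib6: "6 \<le> sum wt (?F v)" if d: "d \<in> ?F v" for d v
  proof (cases "brk d")
    case True
    have "d \<noteq> sg d" "sg d \<noteq> sg (sg d)" "d \<noteq> sg (sg d)"
      using sg_ne[of d] sg_ne[of "sg d"] d sg_D[of d] True by (auto simp: brk_def)
    then have "sum wt {d, sg d, sg (sg d)} = wt d + wt (sg d) + wt (sg (sg d))" by simp
    then show ?thesis using sub[of "{d, sg d, sg (sg d)}" v] d closed wt2[of d] wt2[of "sg d"] wt2[of "sg (sg d)"] by fastforce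
  next
    case False
    have "d \<noteq> sg d" using sg_ne[of d] d by auto
    then have "sum wt {d, sg d} = wt d + wt (sg d)" by simp
    moreover have "wt d = 3" "wt (sg d) = 3" using False brk_sg d by (auto simp: wt_def)
    ultimately show ?thesis using sub[of "{d, sg d}" v] d closed by fastforce
  qed
  \<comment> \<open>Four different darts weigh at least 8; a surplus of one is enough to make the
    final inequality strict.\<close>
  have fib8: "7 \<le> sum wt (?F (vt d))" if d: "d \<in> D" "brk d" "sg (sg (sg d)) \<noteq> d" for d
  proof -
    let ?d1 = "sg d" and ?d2 = "sg (sg d)" and ?d3 = "sg (sg (sg d))"
    have m: "?d1 \<in> D" "?d2 \<in> D" "?d3 \<in> D" using d sg_D by auto
    have "d \<noteq> ?d1" "?d1 \<noteq> ?d2" "?d2 \<noteq> ?d3" using sg_ne d m by metis+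
    moreover have "d \<noteq> ?d2" "d \<noteq> ?d3" using d by (auto simp: brk_def)
    moreover have "?d1 \<noteq> ?d3" using sg_inj[OF d(1) m(2)] \<open>d \<noteq> ?d2\<close> by auto
    ultimately have "sum wt {d, ?d1, ?d2, ?d3} = wt d + wt ?d1 + wt ?d2 + wt ?d3" by simp
    moreover have "{d, ?d1, ?d2, ?d3} \<subseteq> ?F (vt d)" using d m sg_vt by auto
    ultimately show ?thesis using sub[of "{d, ?d1, ?d2, ?d3}" "vt d"] wt2[of d] wt2[of ?d1] wt2[of ?d2] wt2[of ?d3] by linarith
  qed
  have "sum wt D = (\<Sum>v\<in>vt ` D. sum wt (?F v))" by (rule sum.image_gen) simp
  moreover have "6 * int (card (vt ` D)) + ?x \<le> (\<Sum>v\<in>vt ` D. sum wt (?F v))"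
  proof (cases "\<exists>d\<in>D. brk d \<and> sg (sg (sg d)) \<noteq> d")
    case True
    then obtain d where d: "d \<in> D" "brk d" "sg (sg (sg d)) \<noteq> d" by blast
    have "(\<Sum>v\<in>vt ` D. sum wt (?F v)) = sum wt (?F (vt d)) + (\<Sum>v\<in>vt ` D - {vt d}. sum wt (?F v))"
      using d by (intro sum.remove) auto
    moreover have "(\<Sum>v\<in>vt ` D - {vt d}. 6) \<le> (\<Sum>v\<in>vt ` D - {vt d}. sum wt (?F v))"
      by (intro sum_mono) (use fib6 in auto)
    moreover have "card (vt ` D - {vt d}) + 1 = card (vt ` D)" using d
      by (metis Suc_eq_plus1 card.remove finite_imageI fin_D imageI)
    ultimately show ?thesis using fib8[OF d] True by simp
  next
    case False
    have "(\<Sum>v\<in>vt ` D. 6) \<le> (\<Sum>v\<in>vt ` D. sum wt (?F v))" by (intro sum_mono) (use fib6 in auto)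
    then show ?thesis using False by auto
  qed
  moreover have "sum wt D = 3 * int (card D) - int (card {d \<in> D. brk d})"
    by (simp add: wt_def sum_subtractf of_bool_def sum.If_cases Int_def)
  ultimately have 1: "6 * int (card (vt ` D)) + ?x + int (card {d \<in> D. brk d}) \<le> 3 * int (card D)" by linarith
  have "int (card D) + 2 \<le> 2 * int (card (vt ` D)) + 2 * int (card FS)" using euler ne by (simp split: if_splits)
  then have 2: "6 + ?x + int (card {d \<in> D. brk d}) \<le> 6 * int (card FS)" using 1 by linarith
  have dU: "{d \<in> D. brk d} = {d \<in> set os. brk d} \<union> (\<Union>f\<in>FS. Bk f)" by (auto simp: darts_def Bk_def intro!: equalityI)
  have "card {d \<in> D. brk d} = card {d \<in> set os. brk d} + card (\<Union>f\<in>FS. Bk f)"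
    unfolding dU using disj_os finFS by (intro card_Un_disjoint) (auto simp: Bk_def intro!: equalityI)
  also have "card (\<Union>f\<in>FS. Bk f) = (\<Sum>f\<in>FS. card (Bk f))"
    using finFS disj by (intro card_UN_disjoint) (auto simp: Bk_def intro!: equalityI)
  finally have 3: "card {d \<in> D. brk d} = card {d \<in> set os. brk d} + (\<Sum>f\<in>FS. card (Eo f) + card (In f))"
    by (simp add: card_Bk)
  \<comment> \<open>The break starting an exterior arc is turned by \<open>sg\<close> into a break
    on the outer boundary, injectively. This is why exterior arcs count twice in the
    formula.\<close>
  have 4: "(\<Sum>f\<in>FS. card (Eo f)) \<le> card {d \<in> set os. brk d}"
  proof -
    have "(\<Sum>f\<in>FS. card (Eo f)) = card (\<Union>f\<in>FS. Eo f)"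
      using finFS disj by (subst card_UN_disjoint) (auto simp: Eo_def intro!: equalityI)
    also have "\<dots> = card (sg ` (\<Union>f\<in>FS. Eo f))"
      by (rule card_image[symmetric]) (rule inj_onI, use sg_inj in_D(2) in \<open>auto simp: Eo_def\<close>)
    also have "\<dots> \<le> card {d \<in> set os. brk d}"
    proof (rule card_mono)
      show "sg ` (\<Union>f\<in>FS. Eo f) \<subseteq> {d \<in> set os. brk d}"
        using brk_sg in_D(2) nx_mem1[of os] by (auto simp: Eo_def sg_def[symmetric]) (auto simp: sg_def)
    qed simp
    finally show ?thesis .
  qed
  have "(\<Sum>f\<in>FS. 6 - 2 * int (card (Eo f)) - int (card (In f)))
      = 6 * int (card FS) - 2 * (\<Sum>f\<in>FS. int (card (Eo f))) - (\<Sum>f\<in>FS. int (card (In f)))"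
    by (simp add: sum_subtractf sum_distrib_left)
  moreover have "int (card {d \<in> D. brk d}) = int (card {d \<in> set os. brk d}) + (\<Sum>f\<in>FS. int (card (Eo f))) + (\<Sum>f\<in>FS. int (card (In f)))"
    using 3 by (simp add: sum.distrib)
  moreover have "(\<Sum>f\<in>FS. int (card (Eo f))) \<le> int (card {d \<in> set os. brk d})" using 4 by (metis of_nat_le_iff of_nat_sum)
  moreover have "(if \<exists>d\<in>D. brk d \<and> sg (sg (sg d)) \<noteq> d then 1 else 0 :: int) = ?x" by simp
  ultimately show ?thesis using 2 by linarith
qed

end

text \<open>Injectivity of \<open>ps\<close> on the outer darts expresses that the boundary is a
  simple closed path in the Cayley graph; as \<open>ps\<close> respects incidence, it is then simple
  in the diagram too.\<close>

locale simple_diagram = diagram +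
  assumes nm: "nomirror FS al lab" and len3: "3 \<le> length os" and inj_ps: "inj_on ps (set os)"
begin

lemma os_ne: "os \<noteq> []" using len3 by auto

text \<open>If both sides of an edge were outer, simplicity would make each dart the successor of
  the other, and the boundary would close up after two steps.\<close>

lemma al_outer: assumes "d \<in> set os" shows "al d \<notin> set os"
proof
  assume a: "al d \<in> set os"
  have d: "d \<in> D" "al d \<in> D" using assms a in_D by auto
  have n: "nx d \<in> set os" "nx (al d) \<in> set os" using nx_mem1[of os] assms a by auto
  have "ps (nx d) = ps (al d)" by (rule ps_nx[OF d(1)])
  then have e: "nx d = al d" using inj_ps n(1) a by (meson inj_onD)
  have "ps (nx (al d)) = ps d" using ps_nx[OF d(2)] al_al[OF d(1)] by simp
  then have "nx (al d) = d" using inj_ps n(2) assms by (meson inj_onD)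
  then have "(nx ^^ 2) d = (nx ^^ 0) d" using e by (simp add: numeral_2_eq_2)
  then have "2 = (0 :: nat)" using len3 assms by (intro nx_inj_list[of os d 2 0]) auto
  then show False by simp
qed

lemma al_outer_face: assumes "d \<in> set os" shows "\<exists>f\<in>FS. al d \<in> set f"
  using al_outer[OF assms] al_D[of d] in_D(1)[OF assms] by (auto simp: darts_def)

text \<open>At a vertex of degree one a face would read a letter followed by its inverse, but
  relators are reduced; the outer face is excluded by \<open>al_outer\<close>.\<close>

lemma sg_neq: assumes d: "d \<in> D" shows "sg d \<noteq> d"
proof
  assume e: "sg d = d"
  obtain xs where xs: "xs \<in> insert os FS" "al d \<in> set xs" using D_cases[OF al_D[OF d]] by auto
  then have d_xs: "d \<in> set xs" using nx_mem1[OF xs] e by (simp add: sg_def)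
  show False
  proof (cases "xs = os")
    case True then show False using al_outer[of d] d_xs xs by simp
  next
    case False
    then have f: "xs \<in> FS" using xs by simp
    let ?w = "map lab (al d # aft xs (al d))"
    have R: "?w \<in> R" by (rule aft_R[OF f xs(2)])
    have l2: "length xs \<ge> 2" using d_xs xs(2) al_ne[OF d] by (cases xs; cases "tl xs"; auto)
    have "0 < length xs" "1 < length xs" using l2 by auto
    then have "?w ! 0 = lab (al d)" "?w ! 1 = lab d"
      unfolding aft_nx[OF xs] using e by (simp_all del: upt_Suc add: sg_def)
    then have "?w ! Suc 0 = letter_inv (?w ! 0)" using lab_al[OF d] by (simp del: list.map)
    moreover have "Suc 0 < length ?w" using l2 length_aft[OF xs(2)] by (cases "aft xs (al d)") auto
    ultimately show False using R_reduced[OF R] unfolding freely_reduced_def by blast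
  qed
qed

text \<open>The boundary passes the common vertex of the two edges only once, so they are
  consecutive on the boundary as well, and the vertex has degree two.\<close>

lemma outer_adjacent:
  assumes "d \<in> D" "al d \<in> set os" "al (nx d) \<in> set os" shows "\<not> brk (nx d)" "nx (al (nx d)) = al d"
proof -
  have n: "nx d \<in> D" using nx_D assms(1) .
  have "ps (nx (al (nx d))) = ps (nx d)" using sg_ps[OF n] by (simp add: sg_def)
  also have "\<dots> = ps (al d)" by (rule ps_nx[OF assms(1)])
  finally show "nx (al (nx d)) = al d" using inj_ps assms(2) nx_mem1[of os, OF _ assms(3)] by (simp add: inj_on_eq_iff)
  then show "\<not> brk (nx d)" using not_brk_nx[OF assms(1)] by simp
qed

text \<open>Consecutive exterior edges never meet at a break, so interior arcs separate the exterior
  ones. Hence \<open>Eo_le_In\<close>, and a face with two exterior arcs contributes at most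
  \<open>6 - 4 - 2\<close>.\<close>

lemma next_break_In:
  assumes f: "f \<in> FS" and b: "b \<in> Eo f" shows "(nx ^^ rl b) b \<in> In f"
proof -
  have h: "b \<in> set f" "brk b" "al b \<in> set os" "b \<in> D" using b in_D(2)[OF f] by (auto simp: Eo_def)
  note r = rl_ex[of f b, OF _ h(1,2)]
  define d where "d = (nx ^^ (rl b - 1)) b"
  have nd: "(nx ^^ rl b) b = nx d" using r(1) f unfolding d_def by (metis Suc_diff_1 comp_apply funpow.simps(2) insertI2)
  have dD: "d \<in> D" unfolding d_def by (rule nx_pow_D[OF h(4)])
  have "al d \<in> set os" unfolding d_def
    using run_al_mem[OF h(4), of "rl b" "rl b - 1" os] r f h(3) by auto
  then have "al (nx d) \<notin> set os" using outer_adjacent(1)[OF dD] r(3) f nd by auto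
  then show ?thesis using nd r(3) f nx_mem[of f b "rl b"] h(1) by (simp add: In_def)
qed

lemma next_break_inj:
  assumes f: "f \<in> FS" shows "inj_on (\<lambda>b. (nx ^^ rl b) b) (Bk f)"
proof -
  have le: "b = b'" if h: "b \<in> Bk f" "b' \<in> Bk f" "(nx ^^ rl b) b = (nx ^^ rl b') b'" "rl b \<le> rl b'" for b b'
  proof -
    have m: "b \<in> set f" "brk b" "b' \<in> set f" "brk b'" "b \<in> D" "b' \<in> D" using h in_D(2)[OF f] by (auto simp: Bk_def)
    let ?k = "rl b' - rl b"
    have "(nx ^^ rl b) ((nx ^^ ?k) b') = (nx ^^ rl b') b'" using h(4) by (metis comp_apply funpow_add le_add_diff_inverse)
    then have e: "b = (nx ^^ ?k) b'" using nx_pow_inj[OF m(5) nx_pow_D[OF m(6)]] h(3) by metis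
    have "?k = 0"
    proof (rule ccontr)
      assume "?k \<noteq> 0"
      moreover have "0 < rl b" using rl_ex(1)[of f b] f m by auto
      ultimately have "\<not> brk ((nx ^^ ?k) b')" using rl_ex(4)[of f b' ?k] f m by auto
      then show False using e m by simp
    qed
    then show ?thesis using e by simp
  qed
  show ?thesis
  proof (rule inj_onI)
    fix b b' assume "b \<in> Bk f" "b' \<in> Bk f" "(nx ^^ rl b) b = (nx ^^ rl b') b'"
    then show "b = b'" using le[of b b'] le[of b' b] by (metis nat_le_linear)
  qed
qed

lemma Eo_le_In: assumes f: "f \<in> FS" shows "card (Eo f) \<le> card (In f)"
proof -
  have "inj_on (\<lambda>b. (nx ^^ rl b) b) (Eo f)" using next_break_inj[OF f] by (rule inj_on_subset) (auto simp: Bk_def Eo_def)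
  then show ?thesis using next_break_In[OF f] by (intro card_inj_on_le) auto
qed

definition trm :: "nat list \<Rightarrow> int" where "trm f = 6 - 2 * int (card (Eo f)) - int (card (In f))"

lemma curvature_simple:
  "6 + (if \<exists>d\<in>D. brk d \<and> sg (sg (sg d)) \<noteq> d then 1 else 0) \<le> (\<Sum>f\<in>FS. trm f)"
  using curvature[OF os_ne sg_neq] by (simp only: trm_def)

text \<open>Arcs shorter than a sixth cover the face only if there are at least seven of
  them.\<close>

lemma trm_Eo0: assumes "f \<in> FS" "Bk f \<noteq> {}" "Eo f = {}" shows "trm f < 0"
proof -
  have "6 * length f + card (In f) \<le> card (In f) * length f" using inner_bound[OF nm assms(1,2)] assms(3) by simp
  moreover have "0 < length f" using face_ne[OF assms(1)] by simp
  ultimately have "\<not> card (In f) \<le> 6" using mult_le_mono1[of "card (In f)" 6 "length f"]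
    using assms(2,3) Bk_Un(1)[of f] by (metis add_is_0 card_0_eq fin_Bk(3) le_add1 le_antisym nat_add_left_cancel_le le_trans mult_is_0 Un_empty_left add.right_neutral)
  then show ?thesis using assms(3) by (simp add: trm_def)
qed

lemma trm_Eo2: "f \<in> FS \<Longrightarrow> 2 \<le> card (Eo f) \<Longrightarrow> trm f \<le> 0"
  using Eo_le_In[of f] by (simp add: trm_def)

lemma trm_Eo1: assumes "f \<in> FS" "card (Eo f) = 1" shows "trm f \<le> 3"
  using Eo_le_In[of f] assms by (simp add: trm_def)

text \<open>If the only exterior arc takes at most the fraction \<open>p / q\<close> of the face,
  interior arcs of less than a sixth each have to cover the rest, and \<open>t\<close> of them do
  not suffice. Applied with the fraction one half and \<open>t = 3\<close>, and with five sixths and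
  \<open>t = 1\<close>.\<close>

lemma trm_short:
  assumes f: "f \<in> FS" and e: "Eo f = {b}" and s: "q * rl b \<le> p * length f" and pq: "6 * p + t * q \<le> 6 * q" "0 < q"
  shows "t < card (In f)"
proof (rule ccontr)
  assume "\<not> t < card (In f)"
  let ?L = "length f" and ?i = "card (In f)"
  have "Bk f \<noteq> {}" using e by (auto simp: Bk_def Eo_def)
  then have "6 * ?L + ?i \<le> 6 * rl b + ?i * ?L" using inner_bound[OF nm f] e by simp
  then have "q * (6 * ?L + ?i) \<le> q * (6 * rl b + ?i * ?L)" by (rule mult_le_mono2)
  also have "\<dots> = 6 * (q * rl b) + q * (?i * ?L)" by (simp add: algebra_simps)
  also have "\<dots> \<le> 6 * (p * ?L) + q * (t * ?L)"
    using s \<open>\<not> t < card (In f)\<close> by (intro add_mono mult_le_mono2 mult_le_mono1) auto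
  also have "\<dots> = (6 * p + t * q) * ?L" by (simp add: algebra_simps)
  also have "\<dots> \<le> 6 * q * ?L" using pq by (intro mult_le_mono1)
  finally have "q * ?i \<le> 0" by (simp add: algebra_simps)
  moreover have "1 \<le> ?i" using Eo_le_In[OF f] e by simp
  ultimately show False using pq by simp
qed

text \<open>The reverses of the darts of such a face are outer and closed under the boundary
  successor, and the boundary is a single orbit.\<close>

lemma no_break_outer:
  assumes "f \<in> FS" "Bk f = {}" shows "al ` set f = set os"
proof -
  have sub: "al ` set f \<subseteq> set os" using no_break_face[OF nm assms] by auto
  have cl: "nx (al d) \<in> al ` set f" if "d \<in> set f" for d
  proof -
    obtain k where k: "length f = Suc k" using face_ne[OF assms(1)] by (cases "length f") auto
    define p where "p = (nx ^^ k) d"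
    have p: "p \<in> set f" "nx p = d" using nx_mem[of f d k] nx_len[of f d] assms(1) that k by (auto simp: p_def)
    have "\<not> brk (nx p)" using p assms(2) that by (auto simp: Bk_def)
    then have "nx (al d) = al p" using not_brk_nx[of p] p in_D(2)[OF assms(1)] by simp
    then show ?thesis using p by auto
  qed
  obtain d where d: "d \<in> set f" using face_ne[OF assms(1)] by (cases f) auto
  have it: "(nx ^^ k) (al d) \<in> al ` set f" for k by (induction k) (use d cl in auto)
  have "set os \<subseteq> al ` set f"
  proof
    fix x assume "x \<in> set os"
    then obtain k where "x = (nx ^^ k) (al d)" using nx_orbit[of os "al d" x] d sub by auto
    then show "x \<in> al ` set f" using it by simp
  qed
  then show ?thesis using sub by (rule equalityI[rotated])
qed

end

section \<open>Geodesic triangles are ladders\<close>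

definition seg :: "nat \<Rightarrow> nat \<Rightarrow> 'b list \<Rightarrow> 'b list" where "seg i j w = drop i (take j w)"

lemma length_seg [simp]: "j \<le> length w \<Longrightarrow> length (seg i j w) = j - i" by (simp add: seg_def)

lemma nth_seg: "i + k < j \<Longrightarrow> j \<le> length w \<Longrightarrow> seg i j w ! k = w ! (i + k)" by (simp add: seg_def)

lemma seg_append_left: "j \<le> length u \<Longrightarrow> seg i j (u @ v) = seg i j u" by (simp add: seg_def)

lemma seg_word_inv: assumes "i \<le> j" "j \<le> length w"
  shows "seg (length w - j) (length w - i) (word_inv w) = word_inv (seg i j w)"
proof -
  have "word_inv w = word_inv (drop j w) @ word_inv (seg i j w) @ word_inv (take i w)"
    unfolding seg_def using assms
    by (metis append_take_drop_id drop_take le_add_diff_inverse take_add word_inv_simps(3) append.assoc)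
  then show ?thesis using assms by (simp add: seg_def min_def)
qed

lemma seg_append_right: "length u \<le> i \<Longrightarrow> seg i j (u @ v) = seg (i - length u) (j - length u) v"
  by (cases "length u \<le> j") (simp_all add: seg_def)

lemma seg_append: assumes "i \<le> j" "j \<le> k" "j \<le> length w" shows "seg i j w @ seg j k w = seg i k w"
proof -
  have "take k w = take j w @ drop j (take k w)" using assms(2) by (metis append_take_drop_id min.absorb1 take_take)
  then show ?thesis using assms unfolding seg_def by (metis drop_append append_take_drop_id length_take min.absorb2 diff_is_0_eq drop_0)
qed

context presentation
begin

text \<open>The rest of the relator, inverted, is a competing word with the same value.\<close>

lemma relator_geo: assumes "p @ q \<in> R" "geo p" shows "2 * length p \<le> length (p @ q)"
proof -
  have W: "p \<in> W" "q \<in> W" using R_W[OF assms(1)] by auto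
  have "p \<doteq> word_inv q" using relator_weq[OF assms(1)] weq_iff_trivial[of "word_inv q" p] W by simp
  then have "length p \<le> length (word_inv q)" using assms(2) W weq_sym unfolding geo_def by (metis W_inv)
  then show ?thesis by simp
qed

text \<open>One face of a ladder between the paths \<open>a\<close> and \<open>b\<close>, with lower rung \<open>\<rho>\<close> and upper rung \<open>\<rho>'\<close>, both
  leading from \<open>a\<close> to \<open>b\<close>; \<open>ladder_top\<close> is the last face, closed by the edge \<open>t\<close> from the end of \<open>a\<close> to
  that of \<open>b\<close>.\<close>
definition ladder_face where
  "ladder_face a b l c \<rho> l' c' \<rho>' \<longleftrightarrow> l < l' \<and> c < c' \<and> l' \<le> length a \<and> c' \<le> length b \<and>
     seg l l' a @ \<rho>' @ word_inv (seg c c' b) @ word_inv \<rho> \<in> R \<and>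
     6 * length \<rho> < (l' - l) + length \<rho>' + (c' - c) + length \<rho> \<and>
     6 * length \<rho>' < (l' - l) + length \<rho>' + (c' - c) + length \<rho>"

definition ladder_top where
  "ladder_top a b t l c \<rho> \<longleftrightarrow> l \<le> length a \<and> c \<le> length b \<and>
     seg l (length a) a @ t # word_inv (seg c (length b) b) @ word_inv \<rho> \<in> R \<and>
     6 * length \<rho> < (length a - l) + 1 + (length b - c) + length \<rho>"

definition ladder where
  "ladder a b t K lf cf rf \<longleftrightarrow>
     (\<forall>k<K. ladder_face a b (lf k) (cf k) (rf k) (lf (Suc k)) (cf (Suc k)) (rf (Suc k))) \<and>
     ladder_top a b t (lf K) (cf K) (rf K)"

lemma ladder_Cons:
  assumes "ladder_face a b l c \<rho> (lf 0) (cf 0) (rf 0)" "ladder a b t K lf cf rf"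
  shows "ladder a b t (Suc K) (case_nat l lf) (case_nat c cf) (case_nat \<rho> rf)"
  using assms unfolding ladder_def by (auto split: nat.split simp: less_Suc_eq_0_disj)

end

context diagram
begin

section \<open>Words along exterior arcs\<close>

definition runw :: "nat \<Rightarrow> nat \<Rightarrow> 'a word" where "runw d n = map (\<lambda>j. lab ((nx ^^ j) d)) [0..<n]"

lemma length_runw [simp]: "length (runw d n) = n" by (simp add: runw_def)

lemma runw_add: "runw d (m + n) = runw d m @ runw ((nx ^^ m) d) n"
proof (rule nth_equalityI)
  fix j assume "j < length (runw d (m + n))"
  then have j: "j < m + n" by simp
  show "runw d (m + n) ! j = (runw d m @ runw ((nx ^^ m) d) n) ! j"
  proof (cases "j < m")
    case False
    then have "(nx ^^ (j - m)) ((nx ^^ m) d) = (nx ^^ j) d" by (metis comp_apply funpow_add le_add_diff_inverse2 linorder_not_less)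
    then show ?thesis using False j by (simp add: runw_def nth_append)
  qed (use j in \<open>simp add: runw_def nth_append\<close>)
qed simp

lemma face_word: "f \<in> FS \<Longrightarrow> d \<in> set f \<Longrightarrow> runw d (length f) \<in> R"
  using aft_R[of f d] aft_nx[of f d] by (simp add: runw_def o_def del: list.map)

text \<open>No arc contains the start of another one, so the cover of \<open>Bk_cover\<close> is a
  partition.\<close>

lemma Bk_len:
  assumes f: "f \<in> FS" and ne: "Bk f \<noteq> {}" shows "length f = (\<Sum>b\<in>Bk f. rl b)"
proof (rule antisym[OF Bk_cover[OF assms]])
  let ?A = "\<lambda>b. (\<lambda>j. (nx ^^ j) b) ` {..<rl b}"
  have B: "b \<in> set f" "brk b" "b \<in> D" if "b \<in> Bk f" for b using that in_D(2)[OF f] by (auto simp: Bk_def)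
  have key: "b = b' \<and> i = j" if h: "b \<in> Bk f" "b' \<in> Bk f" "i \<le> j" "j < rl b'" "(nx ^^ i) b = (nx ^^ j) b'" for b b' i j
  proof -
    have "(nx ^^ i) ((nx ^^ (j - i)) b') = (nx ^^ j) b'" using h(3) by (metis comp_apply funpow_add le_add_diff_inverse)
    then have e: "b = (nx ^^ (j - i)) b'" using nx_pow_inj[OF B(3)[OF h(1)] nx_pow_D[OF B(3)[OF h(2)]]] h(5) by metis
    have "j - i = 0"
    proof (rule ccontr)
      assume "j - i \<noteq> 0"
      then have "\<not> brk ((nx ^^ (j - i)) b')" using rl_ex(4)[of f b' "j - i"] f B[OF h(2)] h(4) by auto
      then show False using e B[OF h(1)] by simp
    qed
    then show ?thesis using e h(3) by simp
  qed
  have inj: "inj_on (\<lambda>j. (nx ^^ j) b) {..<rl b}" if "b \<in> Bk f" for b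
    by (rule inj_onI) (metis key[OF that that] lessThan_iff nat_le_linear)
  have "(\<Sum>b\<in>Bk f. rl b) = (\<Sum>b\<in>Bk f. card (?A b))" using inj by (simp add: card_image)
  also have "\<dots> = card (\<Union>b\<in>Bk f. ?A b)"
  proof (rule card_UN_disjoint[symmetric])
    show "\<forall>b\<in>Bk f. \<forall>b'\<in>Bk f. b \<noteq> b' \<longrightarrow> ?A b \<inter> ?A b' = {}"
    proof (intro ballI impI)
      fix b b' assume h: "b \<in> Bk f" "b' \<in> Bk f" "b \<noteq> b'"
      show "?A b \<inter> ?A b' = {}"
      proof (rule ccontr)
        assume "?A b \<inter> ?A b' \<noteq> {}"
        then obtain x where "x \<in> ?A b" "x \<in> ?A b'" by (metis Int_iff ex_in_conv)
        then obtain i j where "i < rl b" "j < rl b'" "(nx ^^ i) b = (nx ^^ j) b'" by auto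
        then show False using key[OF h(1,2), of i j] key[OF h(2,1), of j i] h(3) by (metis nat_le_linear)
      qed
    qed
  qed auto
  also have "\<dots> \<le> card (set f)"
  proof (rule card_mono)
    show "(\<Union>b\<in>Bk f. ?A b) \<subseteq> set f"
    proof
      fix x assume "x \<in> (\<Union>b\<in>Bk f. ?A b)"
      then obtain b j where "b \<in> Bk f" "x = (nx ^^ j) b" by blast
      then show "x \<in> set f" using nx_mem[of f b j] f B(1) by simp
    qed
  qed simp
  also have "\<dots> \<le> length f" by (rule card_length)
  finally show "(\<Sum>b\<in>Bk f. rl b) \<le> length f" .
qed

abbreviation "N \<equiv> length os"
text \<open>The inner side of the \<open>i\<close>-th boundary edge. Inner faces traverse the
  boundary against its orientation, so along an exterior arc the index decreases.\<close>

abbreviation X :: "nat \<Rightarrow> nat" where "X i \<equiv> al (os ! i)"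

lemma nx_os: "i < N \<Longrightarrow> nx (os ! i) = os ! (Suc i mod N)" by (rule nx_nth) auto

lemma os_D: "i < N \<Longrightarrow> os ! i \<in> D" using in_D(1) nth_mem by blast

lemma X_D: "i < N \<Longrightarrow> X i \<in> D" using os_D al_D by blast

lemma al_X [simp]: "i < N \<Longrightarrow> al (X i) = os ! i" using os_D al_al by blast

lemma X_outer: "i < N \<Longrightarrow> al (X i) \<in> set os" by simp

lemma outer_X: assumes "d \<in> D" "al d \<in> set os" shows "\<exists>i<N. d = X i"
  using assms al_al by (metis in_set_conv_nth)

lemma X_inj: "i < N \<Longrightarrow> j < N \<Longrightarrow> X i = X j \<Longrightarrow> i = j"
  by (metis al_X dist_os nth_eq_iff_index_eq)

lemma nx_X: assumes "i < N" "\<not> brk (nx (X i))" shows "nx (X i) = X ((i + N - 1) mod N)"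
proof -
  let ?d = "nx (X i)"
  have e: "nx (al ?d) = os ! i" using not_brk_nx[OF X_D[OF assms(1)]] assms by simp
  let ?j = "(i + N - 1) mod N"
  have N0: "0 < N" using assms by auto
  have j: "?j < N" using N0 by simp
  have "Suc ?j mod N = (Suc (i + N - 1)) mod N" by (simp add: mod_Suc_eq)
  also have "Suc (i + N - 1) = i + N" using N0 by simp
  also have "(i + N) mod N = i" using assms(1) by simp
  finally have "nx (os ! ?j) = os ! i" using nx_os[OF j] by simp
  then have "al ?d = os ! ?j" using e nx_inj[OF al_D[OF nx_D[OF X_D[OF assms(1)]]] os_D[OF j]] by simp
  then show ?thesis using al_al[OF nx_D[OF X_D[OF assms(1)]]] by metis
qed

lemma nx_X_Suc: assumes "Suc i < N" "\<not> brk (nx (X (Suc i)))" shows "nx (X (Suc i)) = X i"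
  using nx_X[OF assms] assms by simp

text \<open>The second claim describes a run that passes the base point: after index 0 it continues
  with \<open>N - 1\<close>.\<close>

lemma run_X:
  assumes "i < N" "\<And>j. 0 < j \<Longrightarrow> j < m \<Longrightarrow> \<not> brk ((nx ^^ j) (X i))" "j < m"
  shows "j \<le> i \<Longrightarrow> (nx ^^ j) (X i) = X (i - j)"
    and "i < j \<Longrightarrow> j \<le> i + N \<Longrightarrow> (nx ^^ j) (X i) = X (N + i - j)"
proof -
  have "(j \<le> i \<longrightarrow> (nx ^^ j) (X i) = X (i - j)) \<and> (i < j \<and> j \<le> i + N \<longrightarrow> (nx ^^ j) (X i) = X (N + i - j))"
    using assms(3)
  proof (induction j)
    case (Suc j)
    have nb: "\<not> brk (nx ((nx ^^ j) (X i)))" using assms(2)[of "Suc j"] Suc.prems by simp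
    consider "Suc j \<le> i" | "j = i" | "i < j" "Suc j \<le> i + N" | "i + N < Suc j" by linarith
    then show ?case
    proof cases
      case 1
      then have e: "(nx ^^ j) (X i) = X (Suc (i - Suc j))" using Suc by (simp add: Suc_diff_Suc)
      have "nx (X (Suc (i - Suc j))) = X (i - Suc j)" using nx_X_Suc[of "i - Suc j"] nb e 1 assms(1) by simp
      then show ?thesis using e 1 by simp
    next
      case 2
      then have e: "(nx ^^ j) (X i) = X 0" using Suc by simp
      have "nx (X 0) = X ((0 + N - 1) mod N)" using nx_X[of 0] nb e assms(1) by (metis gr_zeroI not_less_zero)
      then show ?thesis using e 2 by simp
    next
      case 3
      then have e: "(nx ^^ j) (X i) = X (Suc (N + i - Suc j))" using Suc by (simp add: Suc_diff_Suc)
      have "nx (X (Suc (N + i - Suc j))) = X (N + i - Suc j)" using nx_X_Suc[of "N + i - Suc j"] nb e 3 assms(1) by simp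
      then show ?thesis using e 3 by simp
    qed auto
  qed simp
  then show "j \<le> i \<Longrightarrow> (nx ^^ j) (X i) = X (i - j)" "i < j \<Longrightarrow> j \<le> i + N \<Longrightarrow> (nx ^^ j) (X i) = X (N + i - j)" by auto
qed

lemma runw_X:
  assumes "i < N" "m \<le> Suc i" "\<And>j. j < m \<Longrightarrow> (nx ^^ j) d = X (i - j)"
  shows "runw d m = word_inv (seg (Suc i - m) (Suc i) (map lab os))"
proof (rule nth_equalityI)
  fix j assume "j < length (runw d m)"
  then have j: "j < m" by simp
  have "runw d m ! j = lab (X (i - j))" using assms(3)[OF j] j by (simp add: runw_def)
  also have "\<dots> = letter_inv (lab (os ! (i - j)))" using lab_al[OF os_D] assms by simp
  also have "\<dots> = word_inv (seg (Suc i - m) (Suc i) (map lab os)) ! j"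
    using j assms(1,2) by (simp add: word_inv_def rev_nth nth_seg)
  finally show "runw d m ! j = \<dots>" .
qed (use assms in simp)

lemma run_len: assumes "f \<in> FS" "b' \<in> Eo f" shows "rl b' \<le> N"
proof -
  have h: "b' \<in> set f" "brk b'" "al b' \<in> set os" "b' \<in> D" using assms in_D(2) by (auto simp: Eo_def)
  note r = rl_ex[of f b', OF _ h(1,2)]
  have "(\<lambda>j. al ((nx ^^ j) b')) ` {..<rl b'} \<subseteq> set os"
    using run_al_mem[OF h(4), of "rl b'" _ os] r(4) assms(1) h(3) by auto
  moreover have "inj_on (\<lambda>j. al ((nx ^^ j) b')) {..<rl b'}"
  proof (rule inj_onI)
    fix i j assume x: "i \<in> {..<rl b'}" "j \<in> {..<rl b'}" "al ((nx ^^ i) b') = al ((nx ^^ j) b')"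
    then have "(nx ^^ i) b' = (nx ^^ j) b'" using al_al[OF nx_pow_D[OF h(4)]] by metis
    then show "i = j" using nx_inj_list[of f b' i j] assms(1) h(1) x r(2) by auto
  qed
  ultimately have "rl b' \<le> card (set os)" by (metis List.finite_set card_inj_on_le card_lessThan)
  then show ?thesis using card_length[of os] by linarith
qed

lemma geodesic_run_word:
  assumes f: "f \<in> FS" "X i \<in> set f" "i < N" and m: "m \<le> length f" "m \<le> Suc i"
    and run: "\<And>j. j < m \<Longrightarrow> (nx ^^ j) (X i) = X (i - j)" and g: "geo (seg (Suc i - m) (Suc i) (map lab os))"
  shows "2 * m \<le> length f"
proof -
  have "geo (runw (X i) m)" using runw_X[OF f(3) m(2) run] geo_inv[OF g] by simp
  moreover have "runw (X i) m @ runw ((nx ^^ m) (X i)) (length f - m) \<in> R"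
    using face_word[OF f(1,2)] runw_add[of "X i" m "length f - m"] m by simp
  ultimately show ?thesis using relator_geo m by fastforce
qed

end

text \<open>The outer vertices are mapped to the prefixes of the boundary word, all translated by
  the image of the first vertex; distinct prefixes therefore give injectivity of
  \<open>ps\<close>.\<close>

lemma (in presentation) simple_diagramI:
  assumes "diagram S R os FS al lab vt ps" "nomirror FS al lab" "map lab os = w" "3 \<le> length w" "w \<in> W"
    and simple: "\<And>j k. j < k \<Longrightarrow> k < length w \<Longrightarrow> \<not> take j w \<doteq> take k w"
  shows "simple_diagram S R os FS al lab vt ps"
proof -
  interpret diagram S R os FS al lab vt ps by (rule assms)
  have len: "length os = length w" using assms(3) by auto
  have p: "ps (os ! k) = mul (ps (os ! 0)) (take k w)" if "k < length w" for k
    using that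
  proof (induction k)
    case 0 then show ?case using ps_G in_D(1) len by (metis mul_Nil nth_mem take_0)
  next
    case (Suc k)
    then have k: "k < length os" "0 < length os" using len by auto
    then have k: "k < length os" "os ! k \<in> D" "os ! 0 \<in> D" using in_D(1) nth_mem by auto
    have "nx (os ! k) = os ! Suc k" using nx_nth[of os k] k Suc.prems len by simp
    then have "ps (os ! Suc k) = mul (ps (os ! k)) [lab (os ! k)]" using ps_nx[OF k(2)] ps_al[OF k(2)] by simp
    also have "lab (os ! k) = w ! k" using assms(3) k by auto
    also have "mul (ps (os ! k)) [w ! k] = mul (ps (os ! 0)) (take k w @ [w ! k])"
      using Suc mul_append[OF ps_G[OF k(3)] W_take[OF assms(5)]] by simp
    finally show ?case using Suc.prems by (simp add: take_Suc_conv_app_nth)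
  qed
  have g0: "ps (os ! 0) \<in> G" using ps_G in_D(1) len assms(4) by (metis length_greater_0_conv list.size(3) not_numeral_le_zero nth_mem)
  have "inj_on ps (set os)"
  proof (rule inj_onI)
    fix x y assume h: "x \<in> set os" "y \<in> set os" "ps x = ps y"
    then obtain i j where ij: "i < length w" "x = os ! i" "j < length w" "y = os ! j" using len by (metis in_set_conv_nth)
    then have "take i w \<doteq> take j w" using h(3) p g0 mul_eq_iff W_take[OF assms(5)] by metis
    then have "i = j" using simple[of i j] simple[of j i] ij weq_sym by (metis linorder_neqE_nat)
    then show "x = y" using ij by simp
  qed
  then show ?thesis using assms(2,4) len by unfold_locales auto
qed

section \<open>Triangles with two geodesic sides and one edge\<close>

locale triangle_diagram = simple_diagram +
  fixes a b t assumes word: "map lab os = a @ t # word_inv b" and geo_a: "geo a" and geo_b: "geo b"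
begin

abbreviation "A \<equiv> length a"
abbreviation "B \<equiv> length b"

lemma N_eq: "N = A + 1 + B" using arg_cong[OF word, of length] by simp

lemma seg_a: "j \<le> A \<Longrightarrow> seg i j (map lab os) = seg i j a" unfolding word by (rule seg_append_left)

lemma seg_b: assumes "i \<le> j" "j \<le> B" shows "seg (N - j) (N - i) (map lab os) = word_inv (seg i j b)"
proof -
  have "seg (N - j) (N - i) ((a @ [t]) @ word_inv b) = seg (B - j) (B - i) (word_inv b)"
    using assms N_eq by (subst seg_append_right) auto
  then show ?thesis using seg_word_inv[OF assms] by (simp add: word)
qed

lemma seg_ab: assumes "i \<le> A" "j \<le> B"
  shows "seg i (N - j) (map lab os) = seg i A a @ t # word_inv (seg j B b)"
proof -
  have "seg i A (map lab os) @ seg A (Suc A) (map lab os) @ seg (Suc A) (N - j) (map lab os) = seg i (N - j) (map lab os)"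
    using assms N_eq by (subst seg_append; simp?)+
  moreover have "seg A (Suc A) (map lab os) = [t]" by (simp add: word seg_def)
  moreover have "seg (Suc A) (N - j) (map lab os) = word_inv (seg j B b)" using seg_b[of j B] assms N_eq by simp
  ultimately show ?thesis using seg_a[of A i] by simp
qed

lemma geodesic_run:
  assumes f: "f \<in> FS" "X i \<in> set f" "i < N" and m: "m \<le> length f" "m \<le> Suc i"
    and run: "\<And>j. j < m \<Longrightarrow> (nx ^^ j) (X i) = X (i - j)" and side: "i < A \<or> A < Suc i - m"
  shows "2 * m \<le> length f"
proof -
  have "geo (seg (Suc i - m) (Suc i) (map lab os))"
  proof (cases "i < A")
    case True
    have "a = take (Suc i - m) a @ seg (Suc i - m) (Suc i) a @ drop (Suc i) a"
      unfolding seg_def by (metis append.assoc append_take_drop_id diff_le_self min.absorb1 take_take)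
    then have "geo (seg (Suc i - m) (Suc i) a)" using geo_a geo_sub by metis
    then show ?thesis using seg_a[of "Suc i"] True by simp
  next
    case False
    then have s: "A < Suc i - m" using side by simp
    let ?x = "N - Suc i" and ?y = "N - (Suc i - m)"
    have xy: "?x \<le> ?y" "?y \<le> B" "N - ?x = Suc i" "N - ?y = Suc i - m" using s N_eq f(3) m by auto
    have "b = take ?x b @ seg ?x ?y b @ drop ?y b"
      unfolding seg_def by (metis append.assoc append_take_drop_id xy(1) min.absorb1 take_take)
    then have "geo (word_inv (seg ?x ?y b))" using geo_b geo_sub geo_inv by metis
    then show ?thesis using seg_b[OF xy(1,2)] xy(3,4) by simp
  qed
  from geodesic_run_word[OF f m run this] show ?thesis .
qed

definition fc :: "nat \<Rightarrow> nat list" where "fc d = (THE f. f \<in> FS \<and> d \<in> set f)"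

lemma fc: assumes "f \<in> FS" "d \<in> set f" shows "fc d = f"
  unfolding fc_def by (rule the_equality) (use assms lists_disjoint in auto)

lemma X_fc: "i < N \<Longrightarrow> fc (X i) \<in> FS \<and> X i \<in> set (fc (X i))"
  using al_outer_face[of "os ! i"] fc by fastforce

text \<open>\<open>T\<close> is the face at the closing edge \<open>t\<close>; \<open>O0\<close> is
  the face at the first edge of \<open>a\<close>, the one that may reach around the common starting
  point of \<open>a\<close> and \<open>b\<close>.\<close>

abbreviation "T \<equiv> fc (X A)"
abbreviation "O0 \<equiv> fc (X 0)"

lemma AN: "A < N" "0 < N" using N_eq by auto

text \<open>An exterior arc within one geodesic side is at most half of its face, which leaves at
  least four interior arcs and no positive curvature. So the arc of a positive face must contain
  \<open>t\<close> or go around the common start of \<open>a\<close> and \<open>b\<close>. In the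
  latter case, unless the face is \<open>T\<close>, the bound on \<open>m\<close> says that the arc
  stops on \<open>b\<close> before reaching \<open>t\<close>.\<close>

lemma trm_pos:
  assumes f: "f \<in> FS" "Bk f \<noteq> {}" "0 < trm f"
  shows "trm f \<le> 3 \<and> (f = T \<or> f = O0)"
    and "f \<noteq> T \<Longrightarrow> \<exists>i m. Eo f = {X i} \<and> i < A \<and> rl (X i) = m \<and> Suc i < m \<and> m \<le> i + N - A"
proof -
  have "card (Eo f) = 1"
    using trm_Eo0[OF f(1,2)] trm_Eo2[OF f(1)] f(3) by (cases "card (Eo f) \<le> 1") (auto simp: le_Suc_eq)
  then obtain b' where b': "Eo f = {b'}" by (auto simp: card_1_singleton_iff)
  then have h: "b' \<in> set f" "brk b'" "al b' \<in> set os" "b' \<in> D" using in_D(2)[OF f(1)] by (auto simp: Eo_def)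
  obtain i where i: "i < N" "b' = X i" using outer_X[OF h(4,3)] by blast
  define m where "m = rl b'"
  note r = rl_ex[of f b', OF _ h(1,2), folded m_def]
  have mN: "m \<le> N" using run_len[OF f(1)] b' m_def by auto
  have run1: "(nx ^^ j) (X i) = X (i - j)" if "j < m" "j \<le> i" for j
    using run_X(1)[OF i(1) _ that] r(4) f(1) i(2) by auto
  have run2: "(nx ^^ j) (X i) = X (N + i - j)" if "j < m" "i < j" for j
    using run_X(2)[OF i(1) _ that(1,2)] r(4) f(1) i(2) that mN by auto
  have mem: "(nx ^^ j) (X i) \<in> set f" for j using nx_mem[of f b' j] f(1) h(1) i by auto
  have "\<not> (i < A \<or> A < Suc i - m) \<or> Suc i < m"
  proof (rule ccontr)
    assume c: "\<not> ?thesis"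
    then have "2 * m \<le> length f" using geodesic_run[OF f(1), of i m] r(2) run1 h(1) i f(1) by auto
    then have "3 < card (In f)" using trm_short[OF f(1) b', of 2 1 3] m_def by simp
    then show False using f(3) b' by (simp add: trm_def)
  qed
  then consider (t) "A \<le> i" "Suc i - m \<le> A" "m \<le> Suc i" | (o) "Suc i < m" by linarith
  then have "f = T \<or> f = O0 \<and> i < A \<and> Suc i < m \<and> m \<le> i + N - A"
  proof cases
    case t
    then have "i - A < m" by linarith
    then have "X A \<in> set f" using run1[of "i - A"] mem[of "i - A"] t by simp
    then show ?thesis using fc[OF f(1)] by simp
  next
    case o
    have "X 0 \<in> set f" using run1[of i] mem[of i] o by simp
    then have fO: "f = O0" using fc[OF f(1)] by simp
    show ?thesis
    proof (cases "i < A \<and> m \<le> i + N - A")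
      case False
      show ?thesis
      proof (cases "A \<le> i")
        case True
        then have "X A \<in> set f" using run1[of "i - A"] mem[of "i - A"] o by simp
        then show ?thesis using fc[OF f(1)] by simp
      next
        case lt: False
        then have "N + i - A < m" using False by linarith
        then have "X A \<in> set f" using run2[of "N + i - A"] mem[of "N + i - A"] AN lt by simp
        then show ?thesis using fc[OF f(1)] by simp
      qed
    qed (use o fO in auto)
  qed
  then show "trm f \<le> 3 \<and> (f = T \<or> f = O0)" using trm_Eo1[OF f(1)] b' by auto
  show "f \<noteq> T \<Longrightarrow> \<exists>i m. Eo f = {X i} \<and> i < A \<and> rl (X i) = m \<and> Suc i < m \<and> m \<le> i + N - A"
    using \<open>f = T \<or> f = O0 \<and> i < A \<and> Suc i < m \<and> m \<le> i + N - A\<close> b' i m_def by auto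
qed

lemma nx_break_mem: "f \<in> FS \<Longrightarrow> d \<in> Bk f \<Longrightarrow> (nx ^^ rl d) d \<in> Bk f"
  using rl_ex(3)[of f d] nx_mem[of f d "rl d"] by (simp add: Bk_def)

lemma rl_eq:
  assumes "0 < m" "brk ((nx ^^ m) d)" "\<And>j. 0 < j \<Longrightarrow> j < m \<Longrightarrow> \<not> brk ((nx ^^ j) d)" shows "rl d = m"
  unfolding rl_def using assms by (intro Least_equality) (auto simp: not_less[symmetric])

text \<open>By \<open>no_break_outer\<close> the face is as long as the boundary and reads its
  inverse, so the triangle is a single relator.\<close>

lemma no_break_word:
  assumes f: "f \<in> FS" "Bk f = {}" shows "a @ t # word_inv b \<in> R"
proof -
  have eq: "al ` set f = set os" by (rule no_break_outer[OF f])
  have nb: "\<not> brk d" if "d \<in> set f" for d using that f(2) by (auto simp: Bk_def)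
  have "os ! (N - 1) \<in> al ` set f" using eq AN by simp
  then obtain d where d: "d \<in> set f" "al d = os ! (N - 1)" by auto
  then have dX: "d = X (N - 1)" using al_al in_D(2)[OF f(1)] by metis
  have "inj_on al (set f)" by (rule inj_onI) (metis al_al in_D(2)[OF f(1)])
  then have "card (set f) = card (set os)" using eq card_image by metis
  then have len: "length f = N" using dist_f[OF f(1)] dist_os by (simp add: distinct_card)
  have run: "(nx ^^ j) (X (N - 1)) = X (N - 1 - j)" if "j < N" for j
    using run_X(1)[of "N - 1" N j] AN that nb nx_mem[of f d] f(1) d dX by auto
  have "runw (X (N - 1)) N = word_inv (seg 0 N (map lab os))" using runw_X[of "N - 1" N "X (N - 1)"] AN run by simp
  then have "word_inv (map lab os) \<in> R" using face_word[OF f(1) d(1)] len dX by (simp add: seg_def)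
  then show ?thesis using R_inv word by (metis word_inv_inv)
qed

text \<open>Two faces contribute at most 3 each and all others at most 0, while the total is at
  least 6; so equality holds throughout. The surplus in \<open>curvature\<close> is then absent as
  well, that is, every break vertex has degree three.\<close>

lemma tight:
  assumes all: "\<And>f. f \<in> FS \<Longrightarrow> Bk f \<noteq> {}"
  shows "T \<noteq> O0" "trm T = 3" "trm O0 = 3" "\<And>f. f \<in> FS \<Longrightarrow> f \<noteq> T \<Longrightarrow> f \<noteq> O0 \<Longrightarrow> trm f = 0"
    "\<And>d. d \<in> D \<Longrightarrow> brk d \<Longrightarrow> sg (sg (sg d)) = d"
proof -
  have TO: "T \<in> FS" "O0 \<in> FS" using X_fc AN by auto
  have le3: "trm f \<le> 3" if "f \<in> FS" for f using trm_pos(1)[OF that all[OF that]] by (cases "0 < trm f") auto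
  have le0: "trm f \<le> 0" if "f \<in> FS" "f \<noteq> T" "f \<noteq> O0" for f using trm_pos(1)[OF that(1) all[OF that(1)]] that by force
  let ?r = "FS - {T, O0}"
  have rest: "(\<Sum>f\<in>?r. trm f) \<le> 0" by (rule sum_nonpos) (use le0 in auto)
  have split: "(\<Sum>f\<in>FS. trm f) = (\<Sum>f\<in>{T, O0}. trm f) + (\<Sum>f\<in>?r. trm f)"
    using TO finFS by (subst sum.subset_diff[of "{T, O0}" FS]) auto
  let ?x = "(if \<exists>d\<in>D. brk d \<and> sg (sg (sg d)) \<noteq> d then 1 else 0) :: int"
  have ge: "6 + ?x \<le> (\<Sum>f\<in>FS. trm f)" by (rule curvature_simple)
  show ne: "T \<noteq> O0"
  proof
    assume "T = O0"
    then have "(\<Sum>f\<in>FS. trm f) \<le> 3" using split rest le3[OF TO(1)] by simp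
    then show False using ge by (simp split: if_splits)
  qed
  then have s2: "(\<Sum>f\<in>FS. trm f) = trm T + trm O0 + (\<Sum>f\<in>?r. trm f)" using split by simp
  have x0: "0 \<le> ?x" by simp
  show "trm T = 3" "trm O0 = 3" using s2 rest ge x0 le3[OF TO(1)] le3[OF TO(2)] by linarith+
  then have rest0: "(\<Sum>f\<in>?r. trm f) = 0" "?x = 0" using s2 rest ge x0 by linarith+
  show "trm f = 0" if "f \<in> FS" "f \<noteq> T" "f \<noteq> O0" for f
  proof -
    have "\<forall>f\<in>?r. - trm f = 0"
      using rest0(1) le0 finFS by (subst sum_nonneg_eq_0_iff[symmetric]) (auto simp: sum_negf)
    then show ?thesis using that by simp
  qed
  show "sg (sg (sg d)) = d" if "d \<in> D" "brk d" for d using rest0(2) that by (metis zero_neq_one)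
qed

text \<open>A rung described from the face above it. Its exterior arc on \<open>a\<close> ends with
  \<open>X l\<close>, the rung starts at the next dart, reads \<open>\<rho>\<close> without breaks
  inside, and ends where the exterior arc on \<open>b\<close> begins. For \<open>l = A\<close> or
  \<open>c = B\<close> the edge \<open>t\<close> takes the place of the respective side.\<close>

definition rung_at :: "nat \<Rightarrow> nat \<Rightarrow> 'a word \<Rightarrow> bool" where
  "rung_at l c \<rho> \<longleftrightarrow> 0 < l \<and> l \<le> A \<and> 0 < c \<and> c \<le> B \<and> 0 < length \<rho> \<and> brk (nx (X l)) \<and> al (nx (X l)) \<notin> set os \<and>
     (\<forall>j. 1 < j \<and> j \<le> length \<rho> \<longrightarrow> \<not> brk ((nx ^^ j) (X l))) \<and>
     (nx ^^ Suc (length \<rho>)) (X l) = X (N - c - 1) \<and> brk (X (N - c - 1)) \<and> runw (nx (X l)) (length \<rho>) = \<rho>"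

text \<open>The hypotheses describe the rung from the face below, where it is the arc from
  \<open>b\<close> back to \<open>a\<close>. Degree three at its two ends determines the darts met
  on turning around them, which gives the description from above.\<close>

lemma rung_atI:
  assumes s3: "\<And>d. d \<in> D \<Longrightarrow> brk d \<Longrightarrow> sg (sg (sg d)) = d"
    and lc: "0 < l" "l \<le> A" "0 < c" "c \<le> B"
    and b1: "brk (X (l - 1))" and b2: "b2 = nx (X (N - c))" "brk b2" "al b2 \<notin> set os"
    and nxt: "(nx ^^ rl b2) b2 = X (l - 1)"
  shows "rung_at l c (word_inv (runw b2 (rl b2)))"
proof -
  let ?b1 = "X (l - 1)"
  define m where "m = rl b2"
  have idx: "l < N" "l - 1 < N" "N - c < N" "N - c - 1 < N" "Suc (l - 1) = l" "Suc (N - c - 1) = N - c"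
    using lc N_eq by auto
  obtain f where f: "f \<in> FS" "X (N - c) \<in> set f" using X_fc[OF idx(3)] by blast
  have b2f: "b2 \<in> set f" using nx_mem1[of f] f b2(1) by auto
  have D12: "?b1 \<in> D" "b2 \<in> D" using X_D idx b2f f in_D(2) by auto
  note r = rl_ex[of f b2, folded m_def, OF _ b2f b2(2)]
  have m0: "0 < m" using r(1) f by auto
  define dd where "dd j = (nx ^^ j) b2" for j
  have dD: "dd j \<in> D" for j unfolding dd_def by (rule nx_pow_D[OF D12(2)])
  have ddf: "dd j \<in> set f" for j unfolding dd_def using nx_mem[of f b2] f b2f by auto
  let ?z = "dd (m - 1)"
  have nz: "nx ?z = ?b1" using nxt m0 unfolding dd_def m_def[symmetric] by (metis Suc_diff_1 comp_apply funpow.simps(2))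
  have s1: "sg ?b1 = os ! l" using idx nx_os[OF idx(2)] by (simp add: sg_def)
  have s2: "sg (sg ?b1) = nx (X l)" using s1 sg_def[of "os ! l"] by metis
  have brk1: "brk (nx (X l))" using b1 brk_sg sg_D D12(1) s2 by metis
  have "nx (al (nx (X l))) = nx ?z" using s3[OF D12(1) b1] s2 nz by (simp add: sg_def)
  then have az: "al (nx (X l)) = ?z" using nx_inj[OF al_D[OF nx_D[OF X_D[OF idx(1)]]] dD] by simp
  then have nXl: "nx (X l) = al ?z" using al_al[OF nx_D[OF X_D[OF idx(1)]]] by simp
  have ra: "(nx ^^ j) (al (dd j)) = al b2" if "j < m" for j
    unfolding dd_def by (rule run_al[OF D12(2), of m]) (use r(4) f that in auto)
  have pos: "(nx ^^ i) (al ?z) = al (dd (m - 1 - i))" if "i < m" for i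
  proof -
    let ?k = "m - 1 - i"
    have "(nx ^^ ?k) ((nx ^^ i) (al ?z)) = (nx ^^ (m - 1)) (al ?z)"
      using that by (metis Suc_pred' comp_apply diff_add_inverse2 funpow_add le_add_diff_inverse2 less_Suc_eq_le m0)
    also have "\<dots> = (nx ^^ ?k) (al (dd ?k))" using ra[of "m - 1"] ra[of ?k] m0 by simp
    finally show ?thesis by (rule nx_pow_inj[OF nx_pow_D[OF al_D[OF dD]] al_D[OF dD]])
  qed
  have posX: "(nx ^^ Suc i) (X l) = al (dd (m - 1 - i))" if "i < m" for i
    using pos[OF that] nXl by (metis comp_apply funpow_Suc_right)
  have nbr: "\<not> brk ((nx ^^ j) (X l))" if j: "1 < j" "j \<le> m" for j
  proof -
    obtain i where i: "j = Suc (Suc i)" "Suc i < m" using j by (metis Suc_le_eq less_imp_Suc_add plus_1_eq_Suc add.commute add_Suc_right One_nat_def)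
    have "(nx ^^ j) (X l) = nx (al (dd (m - 1 - i)))" using posX[of i] i by simp
    then have "(nx ^^ j) (X l) = sg (dd (m - 1 - i))" by (simp add: sg_def)
    moreover have "\<not> brk (dd (m - 1 - i))" unfolding dd_def using r(4)[of "m - 1 - i"] f i by auto
    ultimately show ?thesis using brk_sg[OF dD] by simp
  qed
  let ?y = "sg b2"
  have yX: "(nx ^^ Suc m) (X l) = ?y"
  proof -
    have "(nx ^^ m) (X l) = al (dd 0)" using posX[of "m - 1"] m0 by simp
    then show ?thesis by (simp add: sg_def dd_def)
  qed
  have "nx (al (sg ?y)) = nx (X (N - c))" using s3[OF D12(2) b2(2)] b2(1) sg_def[of "sg ?y"] by simp
  then have "al (sg ?y) = X (N - c)" by (rule nx_inj[OF al_D[OF sg_D[OF sg_D[OF D12(2)]]] X_D[OF idx(3)]])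
  then have "sg ?y = os ! (N - c)" by (metis al_al[OF sg_D[OF sg_D[OF D12(2)]]] al_X[OF idx(3)])
  then have "nx (al ?y) = os ! (N - c)" by (metis sg_def)
  moreover have "nx (os ! (N - c - 1)) = os ! (N - c)" using nx_os[OF idx(4)] idx(3,6) by simp
  ultimately have "nx (al ?y) = nx (os ! (N - c - 1))" by metis
  then have "al ?y = os ! (N - c - 1)" by (rule nx_inj[OF al_D[OF sg_D[OF D12(2)]] os_D[OF idx(4)]])
  then have yeq: "?y = X (N - c - 1)" by (metis al_al[OF sg_D[OF D12(2)]])
  have "brk (X (N - c - 1))" using brk_sg[OF D12(2)] b2(2) yeq by simp
  moreover have "al (nx (X l)) \<notin> set os" using az ddf disj_os[OF f(1)] by auto
  moreover have "runw (nx (X l)) m = word_inv (runw b2 m)"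
  proof (rule nth_equalityI)
    fix i assume "i < length (runw (nx (X l)) m)"
    then have i: "i < m" by simp
    have "runw (nx (X l)) m ! i = lab (al (dd (m - 1 - i)))" using pos[OF i] nXl i by (simp add: runw_def)
    also have "\<dots> = letter_inv (lab (dd (m - 1 - i)))" by (rule lab_al[OF dD])
    finally show "runw (nx (X l)) m ! i = word_inv (runw b2 m) ! i"
      using i by (simp add: runw_def word_inv_def rev_nth dd_def)
  qed simp
  ultimately show ?thesis unfolding rung_at_def m_def[symmetric]
    using lc m0 brk1 nbr yX yeq by simp
qed

text \<open>Curvature 3 with one exterior arc leaves one interior arc. The exterior arc of
  \<open>O0\<close> descends \<open>l\<close> edges of \<open>a\<close> and then climbs
  \<open>c\<close> edges of \<open>b\<close>; the interior arc is the first rung.\<close>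

lemma first_rung:
  assumes all: "\<And>f. f \<in> FS \<Longrightarrow> Bk f \<noteq> {}"
  shows "\<exists>l c \<rho>. ladder_face a b 0 0 [] l c \<rho> \<and> rung_at l c \<rho>"
proof -
  note tg = tight[OF all]
  have s3: "\<And>d. d \<in> D \<Longrightarrow> brk d \<Longrightarrow> sg (sg (sg d)) = d" using tight(5) all by blast
  have OF: "O0 \<in> FS" using X_fc AN by auto
  obtain i m where im: "Eo O0 = {X i}" "i < A" "rl (X i) = m" "Suc i < m" "m \<le> i + N - A"
    using trm_pos(2)[OF OF all[OF OF]] tg(1,3) by auto
  define l c where "l = Suc i" and "c = m - l"
  have lc: "0 < l" "l \<le> A" "0 < c" "c \<le> B" "m = l + c" using im N_eq by (auto simp: l_def c_def)
  have iN: "i < N" using im AN by simp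
  have Xi: "X i \<in> set O0" "brk (X i)" using im(1) by (auto simp: Eo_def)
  note r = rl_ex[of O0 "X i", OF _ Xi, unfolded im(3)]
  define bn where "bn = (nx ^^ m) (X i)"
  have bnI: "bn \<in> In O0" using next_break_In[OF OF, of "X i"] im by (simp add: bn_def)
  have "card (In O0) = 1" using tg(3) im(1) by (simp add: trm_def)
  then have In1: "In O0 = {bn}" using bnI by (auto simp: card_1_singleton_iff)
  have Bk2: "Bk O0 = {X i, bn}" using Bk_Un(1)[of O0] im(1) In1 by (simp add: insert_commute)
  have ne: "X i \<noteq> bn" using bnI X_outer[OF iN] by (auto simp: In_def)
  have bnp: "bn \<in> set O0" "brk bn" "al bn \<notin> set os" using bnI by (auto simp: In_def)
  have nbn: "(nx ^^ rl bn) bn = X i"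
  proof -
    have "(nx ^^ rl bn) bn \<noteq> (nx ^^ rl (X i)) (X i)"
      using inj_onD[OF next_break_inj[OF OF], of bn "X i"] Bk2 ne by auto
    then show ?thesis using nx_break_mem[OF OF, of bn] Bk2 im(3) bn_def by auto
  qed
  have run1: "(nx ^^ j) (X i) = X (i - j)" if "j < m" "j \<le> i" for j
    using run_X(1)[OF iN _ that] r(4) OF by auto
  have run2: "(nx ^^ j) (X i) = X (N + i - j)" if "j < m" "i < j" for j
    using run_X(2)[OF iN _ that] r(4) OF that im by auto
  have len: "length O0 = m + rl bn" using Bk_len[OF OF all[OF OF]] Bk2 ne im by simp
  have R0: "runw (X i) m @ runw bn (rl bn) \<in> R"
    using face_word[OF OF Xi(1)] len runw_add[of "X i" m "rl bn"] by (simp add: bn_def)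
  have "runw (X i) m = runw (X i) l @ runw (X (N - 1)) c"
  proof -
    have "(nx ^^ l) (X i) = X (N - 1)" using run2[of l] im by (simp add: l_def)
    then show ?thesis using runw_add[of "X i" l c] lc by simp
  qed
  moreover have "runw (X i) l = word_inv (seg 0 l a)"
  proof -
    have "runw (X i) l = word_inv (seg (Suc i - l) (Suc i) (map lab os))" 
      by (rule runw_X[OF iN]) (use run1 im in \<open>auto simp: l_def\<close>)
    then show ?thesis using seg_a[of l 0] lc by (simp add: l_def)
  qed
  moreover have "runw (X (N - 1)) c = seg 0 c b"
  proof -
    have "(nx ^^ j) (X (N - 1)) = X (N - 1 - j)" if "j < c" for j
    proof -
      have "(nx ^^ l) (X i) = X (N - 1)" using run2[of l] im by (simp add: l_def)
      then have "(nx ^^ j) (X (N - 1)) = (nx ^^ (j + l)) (X i)" by (simp add: funpow_add)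
      also have "\<dots> = X (N + i - (j + l))" using run2[of "j + l"] that lc by (simp add: l_def)
      finally show ?thesis by (simp add: l_def)
    qed
    then have "runw (X (N - 1)) c = word_inv (seg (N - c) N (map lab os))"
      using runw_X[of "N - 1" c "X (N - 1)"] AN lc N_eq by simp
    then show ?thesis using seg_b[of 0 c] lc by simp
  qed
  ultimately have "word_inv (seg 0 l a) @ seg 0 c b @ runw bn (rl bn) \<in> R" using R0 by simp
  then have "word_inv (runw bn (rl bn)) @ word_inv (seg 0 c b) @ seg 0 l a \<in> R" using R_inv by fastforce
  then have "seg 0 l a @ word_inv (runw bn (rl bn)) @ word_inv (seg 0 c b) \<in> R"
    using R_swap[of "word_inv (runw bn (rl bn)) @ word_inv (seg 0 c b)" "seg 0 l a"] by simp
  moreover have "6 * rl bn < length O0" using In_rl[OF nm OF] In1 by simp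
  ultimately have "ladder_face a b 0 0 [] l c (word_inv (runw bn (rl bn)))"
    using lc len unfolding ladder_face_def by simp
  moreover have "bn = nx (X (N - c))"
  proof -
    have "(nx ^^ (m - 1)) (X i) = X (N + i - (m - 1))" using run2[of "m - 1"] im by simp
    moreover have "N + i - (m - 1) = N - c" using lc im by (simp add: l_def)
    moreover have "bn = nx ((nx ^^ (m - 1)) (X i))" using im(4) unfolding bn_def
      by (metis Suc_lessD Suc_pred' comp_apply funpow.simps(2) less_Suc_eq_0_disj less_imp_Suc_add zero_less_Suc)
    ultimately show ?thesis by simp
  qed
  then have "rung_at l c (word_inv (runw bn (rl bn)))"
    using rung_atI[OF s3 lc(1-4) _ _ bnp(2,3)] Xi nbn by (simp add: l_def)
  ultimately show ?thesis by blast
qed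

text \<open>Above a rung there is either the top face, with one exterior and one interior arc, or a
  face of curvature 0 with two exterior arcs. The latter has exactly two interior arcs, alternating
  with the exterior ones, and the second of them is the next rung.\<close>

lemma next_rung:
  assumes all: "\<And>f. f \<in> FS \<Longrightarrow> Bk f \<noteq> {}" and inv: "rung_at l c \<rho>"
  shows "ladder_top a b t l c \<rho> \<or> (\<exists>l' c' \<rho>'. ladder_face a b l c \<rho> l' c' \<rho>' \<and> rung_at l' c' \<rho>')"
proof -
  note tg = tight[OF all]
  have s3: "\<And>d. d \<in> D \<Longrightarrow> brk d \<Longrightarrow> sg (sg (sg d)) = d" using tight(5) all by blast
  define m where "m = length \<rho>"
  have lc: "0 < l" "l \<le> A" "0 < c" "c \<le> B" "0 < m" using inv by (auto simp: rung_at_def m_def)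
  have idx: "l < N" "N - c - 1 < N" "A \<le> N - c - 1" using lc N_eq by auto
  define g where "g = fc (X l)"
  have g: "g \<in> FS" "X l \<in> set g" using X_fc[OF idx(1)] by (auto simp: g_def)
  define br bo where "br = nx (X l)" and "bo = X (N - c - 1)"
  have mem: "(nx ^^ j) (X l) \<in> set g" for j using nx_mem[of g "X l" j] g by auto
  have brm: "(nx ^^ m) br = bo" "brk br" "al br \<notin> set os" "brk bo" "runw br m = \<rho>"
    using inv unfolding rung_at_def m_def br_def bo_def by (auto simp: funpow_swap1)
  have brI: "br \<in> In g" using brm mem[of 1] by (simp add: In_def br_def)
  have boE: "bo \<in> Eo g" using brm(4) mem[of "Suc m"] inv X_outer[OF idx(2)]
    unfolding Eo_def bo_def rung_at_def m_def by auto
  have rlbr: "rl br = m"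
  proof (rule rl_eq[OF lc(5)])
    fix j assume j: "0 < j" "j < m"
    have "(nx ^^ j) br = (nx ^^ Suc j) (X l)" by (simp add: br_def funpow_swap1)
    then show "\<not> brk ((nx ^^ j) br)" using inv j unfolding rung_at_def m_def by auto
  qed (use brm in simp)
  have XA: "X A \<in> set g \<Longrightarrow> g = T" using fc[OF g(1)] by simp
  obtain ba i where ba: "ba \<in> Bk g" "i < rl ba" "X l = (nx ^^ i) ba"
    using break_before[OF g(1) all[OF g(1)] g(2)] by blast
  have baf: "ba \<in> set g" "brk ba" "ba \<in> D" using ba(1) in_D(2)[OF g(1)] by (auto simp: Bk_def)
  define r where "r = rl ba"
  note rr = rl_ex[of g ba, folded r_def, OF _ baf(1,2)]
  have ir: "r = Suc i"
  proof (rule ccontr)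
    assume "r \<noteq> Suc i"
    then have "\<not> brk ((nx ^^ Suc i) ba)" using rr(4)[of "Suc i"] ba(2) g(1) by (simp add: r_def)
    then show False using brm(2) ba(3) by (simp add: br_def)
  qed
  have nba: "(nx ^^ r) ba = br" using ba(3) ir by (simp add: br_def)
  have "(nx ^^ i) (al ((nx ^^ i) ba)) = al ba" by (rule run_al[OF baf(3), of r]) (use rr(4) g ir in auto)
  then have alba: "al ba \<in> set os" using ba(3) nx_mem[of os "os ! l" i] idx by (metis al_X insertI1 nth_mem)
  then have baE: "ba \<in> Eo g" using baf by (simp add: Eo_def)
  obtain k where k: "k < N" "ba = X k" using outer_X[OF baf(3) alba] by blast
  have rN: "r \<le> N" using run_len[OF g(1) baE] by (simp add: r_def)
  have run1: "(nx ^^ j) (X k) = X (k - j)" if "j < r" "j \<le> k" for j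
    using run_X(1)[OF k(1) _ that] rr(4) g k by auto
  have run2: "(nx ^^ j) (X k) = X (N + k - j)" if "j < r" "k < j" for j
    using run_X(2)[OF k(1) _ that] rr(4) g k that rN by auto
  have memk: "(nx ^^ j) (X k) \<in> set g" for j using nx_mem[of g ba j] g baf k by auto
  show ?thesis
  \<comment> \<open>\<open>ba\<close> starts the exterior arc that ends at the rung,
    \<open>bo\<close> the one that begins after it. If they coincide, the arc runs from
    \<open>b\<close> over \<open>t\<close> to \<open>a\<close>.\<close>
  proof (cases "ba = bo")
    case True
    then have kk: "k = N - c - 1" using X_inj[OF k(1) idx(2)] k by (simp add: bo_def)
    have "i \<le> k"
    proof (rule ccontr)
      assume "\<not> i \<le> k"
      then have "X l = X (N + k - i)" using run2[of i] ba k ir by simp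
      then have "l = N + k - i" using X_inj[OF idx(1), of "N + k - i"] \<open>\<not> i \<le> k\<close> rN ir by simp
      then show False using rN ir kk idx lc by linarith
    qed
    then have "X l = X (k - i)" using run1[of i] ba k ir by simp
    then have lk: "l = k - i" using X_inj[OF idx(1), of "k - i"] k by simp
    then have rl': "r = N - c - l" "k = l + i" using kk ir lc idx \<open>i \<le> k\<close> by linarith+
    have "X A \<in> set g" using run1[of "k - A"] memk[of "k - A"] kk idx lc ir rl' by simp
    then have gT: "g = T" by (rule XA)
    have e1: "card (Eo g) = 1"
    proof -
      have "card (Eo g) \<noteq> 0" using boE by auto
      moreover have "card (Eo g) < 2" using tg(2) gT Eo_le_In[OF g(1)] by (simp add: trm_def)
      ultimately show ?thesis by linarith
    qed
    then have i1: "card (In g) = 1" using tg(2) gT by (simp add: trm_def)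
    have "Eo g = {bo}" "In g = {br}" using e1 i1 boE brI by (auto simp: card_1_singleton_iff)
    then have "Bk g = {bo, br}" using Bk_Un(1)[of g] by (simp add: insert_commute)
    moreover have "bo \<noteq> br" using boE brI by (auto simp: Eo_def In_def)
    ultimately have len: "length g = m + r" using Bk_len[OF g(1) all[OF g(1)]] rlbr True by (simp add: r_def)
    have "runw br (m + r) \<in> R" using face_word[OF g(1), of br] brI len by (simp add: In_def)
    then have "\<rho> @ runw bo r \<in> R" using runw_add[of br m r] brm by simp
    moreover have "runw bo r = word_inv (seg l (N - c) (map lab os))"
    proof -
      have "runw bo r = word_inv (seg (Suc k - r) (Suc k) (map lab os))"
        by (rule runw_X[OF k(1)]) (use run1 rl' ir True k in auto)
      moreover have "Suc k = N - c" "Suc k - r = l" using kk rl' lc N_eq ir by auto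
      ultimately show ?thesis by simp
    qed
    ultimately have "\<rho> @ word_inv (seg l A a @ t # word_inv (seg c B b)) \<in> R" using seg_ab[OF lc(2,4)] by simp
    then have "word_inv (\<rho> @ word_inv (seg l A a @ t # word_inv (seg c B b))) \<in> R" by (rule R_inv)
    then have "seg l A a @ t # word_inv (seg c B b) @ word_inv \<rho> \<in> R" by simp
    moreover have "6 * m < length g" using In_rl[OF nm g(1) brI] rlbr by simp
    ultimately have "ladder_top a b t l c \<rho>" unfolding ladder_top_def
      using lc len rl' N_eq by (simp add: m_def[symmetric])
    then show ?thesis ..
  next
    case False
    have "2 \<le> card (Eo g)" using card_mono[of "Eo g" "{ba, bo}"] baE boE False by simp
    then have "trm g \<le> 0" using trm_Eo2[OF g(1)] by simp
    then have gT: "g \<noteq> T" "g \<noteq> O0" using tg(2,3) by auto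
    then have "trm g = 0" using tight(4)[of g] all g(1) by blast
    then have c22: "card (Eo g) = 2" "card (In g) = 2"
      using \<open>2 \<le> card (Eo g)\<close> Eo_le_In[OF g(1)] by (simp_all add: trm_def)
    have XA': "X A \<notin> set g" using XA gT by auto
    have bof: "bo \<in> set g" "brk bo" using boE by (auto simp: Eo_def)
    define m2 where "m2 = rl bo"
    define bn where "bn = (nx ^^ m2) bo"
    note ro = rl_ex[of g bo, folded m2_def, OF _ bof]
    have bnI: "bn \<in> In g" using next_break_In[OF g(1) boE] by (simp add: bn_def m2_def)
    have BkE: "x \<in> Eo g \<Longrightarrow> x \<in> Bk g" "x \<in> In g \<Longrightarrow> x \<in> Bk g" for x by (auto simp: Bk_Un)
    have nin: "x \<in> Bk g \<Longrightarrow> y \<in> Bk g \<Longrightarrow> (nx ^^ rl x) x = (nx ^^ rl y) y \<Longrightarrow> x = y" for x y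
      using next_break_inj[OF g(1)] by (auto dest: inj_onD)
    have nbr: "(nx ^^ rl br) br = bo" "(nx ^^ rl ba) ba = br" "(nx ^^ rl bo) bo = bn"
      using brm rlbr nba by (simp_all add: r_def bn_def m2_def)
    have "bn \<noteq> br" using nin[of bo ba] nbr BkE baE boE False by metis
    have EI: "x \<in> Eo g \<Longrightarrow> y \<in> In g \<Longrightarrow> x \<noteq> y" for x y by (auto simp: Eo_def In_def)
    have Eo2: "Eo g = {ba, bo}" using card_subset_eq[of "Eo g" "{ba, bo}"] baE boE False c22 by simp
    have In2: "In g = {br, bn}" using card_subset_eq[of "In g" "{br, bn}"] brI bnI \<open>bn \<noteq> br\<close> c22 by simp
    define mn where "mn = rl bn"
    have nbn: "(nx ^^ rl bn) bn = ba"
    proof -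
      have "(nx ^^ rl bn) bn \<in> {ba, bo} \<union> {br, bn}" using nx_break_mem[OF g(1) BkE(2)[OF bnI]] Bk_Un(1)[of g] Eo2 In2 by simp
      moreover have "(nx ^^ rl bn) bn \<noteq> bo" using nin[of bn br] nbr BkE bnI brI \<open>bn \<noteq> br\<close> by metis
      moreover have "(nx ^^ rl bn) bn \<noteq> br" using nin[of bn ba] nbr BkE bnI baE EI[OF baE bnI] by metis
      moreover have "(nx ^^ rl bn) bn \<noteq> bn" using nin[of bn bo] nbr BkE bnI boE EI[OF boE bnI] by metis
      ultimately show ?thesis by auto
    qed
    \<comment> \<open>An arc that wrapped around the base point, or ran as far as \<open>t\<close>,
      would put \<open>X A\<close> on \<open>g\<close>, which is not the top face. So each exterior
      arc stays on its own side.\<close>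
    have nowrap: "i \<le> k"
    proof (rule ccontr)
      assume w: "\<not> i \<le> k"
      then have "X l = X (N + k - i)" using run2[of i] ba k ir by simp
      then have "l = N + k - i" using X_inj[OF idx(1), of "N + k - i"] w rN ir by simp
      then have "X A \<in> set g" using run2[of "N + k - A"] memk[of "N + k - A"] AN lc ir w by simp
      then show False using XA' by simp
    qed
    then have "X l = X (k - i)" using run1[of i] ba k ir by simp
    then have kl: "k = l + i" using X_inj[OF idx(1), of "k - i"] k nowrap by simp
    have rA: "l + r \<le> A"
    proof (rule ccontr)
      assume w: "\<not> l + r \<le> A"
      then have "A \<le> k" "k - A < r" using kl ir lc(2) by linarith+
      then have "X A \<in> set g" using run1[of "k - A"] memk[of "k - A"] by simp
      then show False using XA' by simp
    qed
    have runo: "(nx ^^ j) bo = X (N - c - 1 - j)" if "j < m2" "j \<le> N - c - 1" for j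
      unfolding bo_def by (rule run_X(1)[OF idx(2), of m2]) (use ro(4) g that in \<open>auto simp: bo_def\<close>)
    have m2B: "c + m2 \<le> B"
    proof (rule ccontr)
      assume w: "\<not> c + m2 \<le> B"
      then have "X A = (nx ^^ (B - c)) bo" using runo[of "B - c"] N_eq lc by simp
      then have "X A \<in> set g" using nx_mem[of g bo "B - c"] g bof by simp
      then show False using XA' by simp
    qed
    have m20: "0 < m2" using ro(1) g by simp
    have ne4: "bo \<noteq> br" "bo \<noteq> bn" "ba \<noteq> br" "ba \<noteq> bn" using EI baE boE brI bnI by blast+
    have "Bk g = {ba, bo, br, bn}" using Bk_Un(1)[of g] Eo2 In2 by (simp add: insert_commute)
    then have len: "length g = m + (m2 + (mn + r))"
      using Bk_len[OF g(1) all[OF g(1)]] rlbr ne4 False \<open>bn \<noteq> br\<close> by (auto simp: r_def m2_def mn_def)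
    have "runw br (m + (m2 + (mn + r))) \<in> R" using face_word[OF g(1), of br] brI len by (simp add: In_def)
    moreover have "(nx ^^ m2) bo = bn" "(nx ^^ mn) bn = ba" using nbn by (simp_all add: bn_def mn_def)
    ultimately have W4: "\<rho> @ runw bo m2 @ runw bn mn @ runw ba r \<in> R"
      using runw_add[of br m "m2 + (mn + r)"] runw_add[of bo m2 "mn + r"] runw_add[of bn mn r] brm by simp
    let ?l = "l + r" and ?c = "c + m2" and ?\<rho> = "word_inv (runw bn mn)"
    have wo: "runw bo m2 = seg c ?c b"
    proof -
      have "runw bo m2 = word_inv (seg (Suc (N - c - 1) - m2) (Suc (N - c - 1)) (map lab os))"
        by (rule runw_X[OF idx(2)]) (use runo m2B N_eq in auto)
      moreover have "Suc (N - c - 1) = N - c" "Suc (N - c - 1) - m2 = N - ?c" using N_eq m2B by auto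
      ultimately show ?thesis using seg_b[of c ?c] m2B by simp
    qed
    have wa: "runw ba r = word_inv (seg l ?l a)"
    proof -
      have "runw ba r = word_inv (seg (Suc k - r) (Suc k) (map lab os))"
        by (rule runw_X[OF k(1)]) (use run1 kl ir k in auto)
      then show ?thesis using seg_a[of ?l l] rA kl ir by simp
    qed
    have "word_inv (\<rho> @ seg c ?c b @ runw bn mn @ word_inv (seg l ?l a)) \<in> R" using R_inv W4 wo wa by metis
    then have "seg l ?l a @ ?\<rho> @ word_inv (seg c ?c b) @ word_inv \<rho> \<in> R" by simp
    moreover have "6 * m < length g" "6 * mn < length g"
      using In_rl[OF nm g(1) brI] In_rl[OF nm g(1) bnI] rlbr by (simp_all add: mn_def)
    ultimately have "ladder_face a b l c \<rho> ?l ?c ?\<rho>" unfolding ladder_face_def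
      using len m20 ir rA m2B by (simp add: m_def[symmetric])
    moreover have "rung_at ?l ?c ?\<rho>" unfolding mn_def
    proof (rule rung_atI[OF s3])
      have "(nx ^^ (m2 - 1)) bo = X (N - c - 1 - (m2 - 1))" using runo[of "m2 - 1"] m20 m2B N_eq by simp
      moreover have "N - c - 1 - (m2 - 1) = N - ?c" using m20 by simp
      moreover have "bn = nx ((nx ^^ (m2 - 1)) bo)" using m20 unfolding bn_def by (metis Suc_diff_1 comp_apply funpow.simps(2))
      ultimately show "bn = nx (X (N - ?c))" by simp
      show "brk (X (?l - 1))" "(nx ^^ rl bn) bn = X (?l - 1)" using baf nbn k kl ir by simp_all
      show "brk bn" "al bn \<notin> set os" using bnI by (simp_all add: In_def)
    qed (use lc rA m2B in auto)
    ultimately show ?thesis by blast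
  qed
qed

theorem ladder_exists: "\<exists>K lf cf rf. lf 0 = 0 \<and> cf 0 = 0 \<and> rf 0 = [] \<and> ladder a b t K lf cf rf"
proof (cases "\<exists>f\<in>FS. Bk f = {}")
  case True
  then have "ladder_top a b t 0 0 []" using no_break_word by (auto simp: ladder_top_def seg_def)
  then show ?thesis by (intro exI[of _ 0] exI[of _ "\<lambda>_. 0"] exI[of _ "\<lambda>_. []"]) (simp add: ladder_def)
next
  case False
  then have all: "\<And>f. f \<in> FS \<Longrightarrow> Bk f \<noteq> {}" by blast
  \<comment> \<open>Each face strictly raises the level on \<open>a\<close>, so the ladder ends
    after finitely many steps.\<close>
  have climb: "rung_at l c \<rho> \<Longrightarrow> \<exists>K lf cf rf. lf 0 = l \<and> cf 0 = c \<and> rf 0 = \<rho> \<and> ladder a b t K lf cf rf" for l c \<rho>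
  proof (induction "A - l" arbitrary: l c \<rho> rule: less_induct)
    case less
    from next_rung[OF all less.prems] show ?case
    proof
      assume "ladder_top a b t l c \<rho>"
      then show ?thesis by (intro exI[of _ 0] exI[of _ "\<lambda>_. l"] exI[of _ "\<lambda>_. c"] exI[of _ "\<lambda>_. \<rho>"]) (simp add: ladder_def)
    next
      assume "\<exists>l' c' \<rho>'. ladder_face a b l c \<rho> l' c' \<rho>' \<and> rung_at l' c' \<rho>'"
      then obtain l' c' \<rho>' where n: "ladder_face a b l c \<rho> l' c' \<rho>'" "rung_at l' c' \<rho>'" by blast
      then have "A - l' < A - l" by (auto simp: ladder_face_def)
      from less.hyps[OF this n(2)] obtain K lf cf rf where
        "lf 0 = l'" "cf 0 = c'" "rf 0 = \<rho>'" "ladder a b t K lf cf rf" by blast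
      then have "ladder a b t (Suc K) (case_nat l lf) (case_nat c cf) (case_nat \<rho> rf)" using ladder_Cons n(1) by simp
      then show ?thesis by (intro exI[of _ "Suc K"] exI[of _ "case_nat l lf"] exI[of _ "case_nat c cf"] exI[of _ "case_nat \<rho> rf"]) simp
    qed
  qed
  obtain l c \<rho> where n: "ladder_face a b 0 0 [] l c \<rho>" "rung_at l c \<rho>" using first_rung[OF all] by blast
  from climb[OF n(2)] obtain K lf cf rf where
    "lf 0 = l" "cf 0 = c" "rf 0 = \<rho>" "ladder a b t K lf cf rf" by blast
  then have "ladder a b t (Suc K) (case_nat 0 lf) (case_nat 0 cf) (case_nat [] rf)" using ladder_Cons n(1) by simp
  then show ?thesis by (intro exI[of _ "Suc K"] exI[of _ "case_nat 0 lf"] exI[of _ "case_nat 0 cf"] exI[of _ "case_nat [] rf"]) simp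
qed

end

theorem (in presentation) geodesic_triangle_ladder:
  assumes "geo a" "geo b" "t \<in> Ltr" "a @ [t] \<doteq> b" "a \<noteq> []" "b \<noteq> []"
    and simple: "\<And>j k. j < k \<Longrightarrow> k < length (a @ t # word_inv b) \<Longrightarrow>
      \<not> take j (a @ t # word_inv b) \<doteq> take k (a @ t # word_inv b)"
  shows "\<exists>K lf cf rf. lf 0 = 0 \<and> cf 0 = 0 \<and> rf 0 = [] \<and> ladder a b t K lf cf rf"
proof -
  let ?w = "a @ t # word_inv b"
  have W: "a \<in> W" "b \<in> W" using assms geo_W by auto
  have "?w \<doteq> []" using weq_iff_trivial[of b "a @ [t]"] W assms(4) by simp
  then obtain n where "fills S R n ?w" using van_kampen by blast
  then obtain os FS al lab vt ps where d: "diagram S R os FS al lab vt ps" "nomirror FS al lab" "map lab os = ?w"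
    by (auto simp: fills_def)
  have "3 \<le> length ?w" using assms(5,6) by (cases a; cases b) auto
  then interpret simple_diagram S R os FS al lab vt ps
    using simple_diagramI[OF d] W assms(3) simple by simp
  interpret triangle_diagram S R os FS al lab vt ps a b t
    by unfold_locales (use d assms in auto)
  show ?thesis by (rule ladder_exists)
qed

section \<open>Relators embed isometrically\<close>

context diagram
begin

text \<open>The condition on \<open>v\<close> says that \<open>f\<close> is the mirror image of the
  face with word \<open>p @ q\<close> attached along the same stretch of \<open>p\<close>. Cutting
  \<open>f\<close> off turns \<open>p\<close> into \<open>word_inv q\<close> up to cancellation, and
  cancelling does not create faces.\<close>

lemma mirror_remove:
  assumes nm: "nomirror FS al lab" and w: "map lab os = p @ s" and i: "i < length p" "i' \<le> i"
    and f: "f \<in> FS" "X i \<in> set f"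
    and v: "runw (X i) (length f) = word_inv (seg i' (Suc i) p) @ v" "word_inv v = drop (Suc i) p @ q @ take i' p"
  shows "\<exists>n'<card FS. fills S R n' (word_inv q @ s)"
proof -
  have len: "length p \<le> N" using arg_cong[OF w, of length] by simp
  define us vs where "us = take i os" and "vs = drop (Suc i) os"
  have os: "os = us @ os ! i # vs" using i len by (simp add: us_def vs_def id_take_nth_drop)
  have d1: "diagram S R (os ! i # vs @ us) FS al lab vt ps" using rotate_outer[of us "os ! i # vs"] os by simp
  have d2: "diagram S R (aft f (X i) @ vs @ us) (FS - {f}) al lab vt ps"
    by (rule diagram.remove_face[OF d1 refl f])
  have tl: "map lab (aft f (X i)) = tl (runw (X i) (length f))"
  proof -
    have "map lab (X i # aft f (X i)) = runw (X i) (length f)" using aft_nx[of f "X i"] f by (simp add: runw_def o_def del: list.map)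
    then show ?thesis by (metis list.sel(3) list.simps(9))
  qed
  have "seg i' (Suc i) p = seg i' i p @ [p ! i]"
    using i by (simp add: seg_def take_Suc_conv_app_nth)
  then have tlv: "map lab (aft f (X i)) = word_inv (seg i' i p) @ v" using tl v(1) by simp
  have lus: "map lab us = take i p" "map lab vs = drop (Suc i) p @ s"
    using w i by (simp_all add: us_def vs_def take_map[symmetric] drop_map[symmetric])
  have "card (FS - {f}) < card FS" by (rule card_Diff1_less[OF finFS f(1)])
  moreover have "fills S R (card (FS - {f})) ((word_inv (seg i' i p) @ v @ drop (Suc i) p @ s) @ take i p)"
    by (rule fillsI[OF d2 nomirror_subset[OF nm]]) (use tlv lus in auto)
  then have "fills S R (card (FS - {f})) (take i p @ word_inv (seg i' i p) @ v @ drop (Suc i) p @ s)"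
    using fills_rotate by blast
  moreover have "take i p = take i' p @ seg i' i p" using i unfolding seg_def by (metis append_take_drop_id min.absorb1 take_take)
  ultimately have lt: "card (FS - {f}) < card FS"
    "fills S R (card (FS - {f})) (take i' p @ seg i' i p @ word_inv (seg i' i p) @ (v @ drop (Suc i) p @ s))" by simp_all
  obtain n1 where n1: "n1 < card FS" "fills S R n1 (take i' p @ v @ drop (Suc i) p @ s)"
    using fills_cancel[OF lt(2)] le_less_trans[OF _ lt(1)] by blast
  have "v = word_inv (take i' p) @ word_inv q @ word_inv (drop (Suc i) p)" using arg_cong[OF v(2), of word_inv] by simp
  then have "fills S R n1 ([] @ take i' p @ word_inv (take i' p) @ (word_inv q @ word_inv (drop (Suc i) p) @ drop (Suc i) p @ s))"
    using n1(2) by simp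
  then obtain n2 where n2: "n2 \<le> n1" "fills S R n2 (word_inv q @ word_inv (drop (Suc i) p) @ drop (Suc i) p @ s)"
    using fills_cancel by fastforce
  then obtain n3 where "n3 \<le> n2" "fills S R n3 (word_inv q @ s)"
    using fills_cancel[of n2 "word_inv q" "word_inv (drop (Suc i) p)" s] by auto
  then show ?thesis using n1 n2 by (meson le_less_trans)
qed

text \<open>If cutting off a face along \<open>p\<close> cannot turn \<open>p\<close> into the opposite side of the relator \<open>p @ q\<close>,
  then the boundary runs along \<open>p\<close> are pieces.\<close>
lemma boundary_piece:
  assumes nm: "nomirror FS al lab" and w: "map lab os = p @ s" and pq: "p @ q \<in> R"
    and min: "\<And>n. n < card FS \<Longrightarrow> \<not> fills S R n (word_inv q @ s)"
    and f: "f \<in> FS" "X i \<in> set f" and k: "i < length p" "k \<le> Suc i" "k \<le> length f"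
    and run: "\<And>j. j < k \<Longrightarrow> (nx ^^ j) (X i) = X (i - j)"
  shows "6 * k < length f"
proof (cases "k = 0")
  case True
  then show ?thesis using face_ne[OF f(1)] by simp
next
  case False
  let ?i = "Suc i - k"
  have iN: "i < N" using k(1) arg_cong[OF w, of length] by simp
  define v where "v = runw ((nx ^^ k) (X i)) (length f - k)"
  have "runw (X i) (length f) = runw (X i) k @ v" using runw_add[of "X i" k "length f - k"] k by (simp add: v_def)
  moreover have "runw (X i) k = word_inv (seg ?i (Suc i) p)"
    using runw_X[OF iN k(2) run] seg_append_left[of "Suc i" p ?i s] k w by simp
  ultimately have u: "runw (X i) (length f) = word_inv (seg ?i (Suc i) p) @ v" by simp
  have "word_inv (word_inv (seg ?i (Suc i) p) @ v) \<in> R" using face_word[OF f] R_inv u by metis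
  then have r1: "seg ?i (Suc i) p @ word_inv v \<in> R" using R_swap[of "word_inv v" "seg ?i (Suc i) p"] by simp
  have "p = take ?i p @ seg ?i (Suc i) p @ drop (Suc i) p"
    unfolding seg_def by (metis append.assoc append_take_drop_id diff_le_self min.absorb1 take_take)
  then have "take ?i p @ seg ?i (Suc i) p @ drop (Suc i) p @ q \<in> R" using pq by (metis append.assoc)
  then have r2: "seg ?i (Suc i) p @ (drop (Suc i) p @ q @ take ?i p) \<in> R"
    using R_swap[of "take ?i p" "seg ?i (Suc i) p @ drop (Suc i) p @ q"] by simp
  have "word_inv v \<noteq> drop (Suc i) p @ q @ take ?i p"
  proof
    assume e: "word_inv v = drop (Suc i) p @ q @ take ?i p"
    have "?i \<le> i" using False by linarith
    from mirror_remove[OF nm w k(1) this f u e] min show False by blast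
  qed
  then have "6 * length (seg ?i (Suc i) p) < length (seg ?i (Suc i) p @ word_inv v)" by (rule piece_length[OF r1 r2])
  then show ?thesis using k by (simp add: v_def)
qed

end

section \<open>Subwords of relators via minimal counterexamples\<close>

context presentation
begin

text \<open>Take a counterexample with the fewest faces and then the shortest \<open>p\<close>. The
  opposite side \<open>word_inv q\<close> would be a counterexample too, so minimality and
  \<open>boundary_piece\<close> make boundary runs within \<open>p\<close> pieces. An exterior arc
  consists of at most two of them and stays below a third of its face; then no face has positive
  curvature.\<close>

lemma closed_subword_trivial:
  assumes "p @ q \<in> R" "p \<doteq> []" shows "p = [] \<or> q = []"
proof (rule ccontr)
  assume c: "\<not> (p = [] \<or> q = [])"
  define C where "C n p q \<longleftrightarrow> p @ q \<in> R \<and> p \<doteq> [] \<and> p \<noteq> [] \<and> q \<noteq> [] \<and> fills S R n p" for n p q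
  have "\<exists>n p q. C n p q" using van_kampen assms c unfolding C_def by blast
  then obtain n where n: "\<exists>p q. C n p q" "\<And>n'. n' < n \<Longrightarrow> \<not> (\<exists>p q. C n' p q)"
    using exists_least_iff[of "\<lambda>n. \<exists>p q. C n p q"] by blast
  then obtain l where l: "\<exists>p q. C n p q \<and> length p = l" "\<And>l'. l' < l \<Longrightarrow> \<not> (\<exists>p q. C n p q \<and> length p = l')"
    using exists_least_iff[of "\<lambda>l. \<exists>p q. C n p q \<and> length p = l"] by blast
  then obtain p q where pq: "C n p q" "length p = l" by blast
  then have C: "p @ q \<in> R" "p \<doteq> []" "p \<noteq> []" "q \<noteq> []" "fills S R n p" by (auto simp: C_def)
  have W: "p \<in> W" "q \<in> W" using R_W[OF C(1)] by auto
  obtain os FS al lab vt ps where d: "diagram S R os FS al lab vt ps" "nomirror FS al lab" "map lab os = p" "card FS = n"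
    using C(5) by (auto simp: fills_def)
  interpret diagram S R os FS al lab vt ps by (rule d)
  have N: "N = length p" using d(3) by auto
  have red: "freely_reduced p" unfolding freely_reduced_def
  proof (intro allI impI)
    fix i assume i: "Suc i < length p"
    have "(p @ q) ! Suc i \<noteq> letter_inv ((p @ q) ! i)"
      using R_reduced[OF C(1), unfolded freely_reduced_def, rule_format, of i] i by (metis length_append trans_less_add1)
    moreover have "(p @ q) ! Suc i = p ! Suc i" "(p @ q) ! i = p ! i" using i by (simp_all add: nth_append)
    ultimately show "p ! Suc i \<noteq> letter_inv (p ! i)" by metis
  qed
  have "\<not> fills S R n' (word_inv q @ [])" if "n' < card FS" for n'
  proof
    assume "fills S R n' (word_inv q @ [])"
    moreover have "word_inv q @ word_inv p \<in> R" using R_inv[OF C(1)] by simp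
    moreover have "word_inv q \<doteq> []"
    proof -
      have "p @ q \<doteq> p @ []" using weq_trans[OF relator_weq[OF C(1)] weq_sym[OF C(2)]] by simp
      then have "q \<doteq> []" using weq_cancel_left[OF W(1)] by blast
      from weq_append_right[OF weq_sym[OF this], of "word_inv q"] have "[] @ word_inv q \<doteq> q @ word_inv q" .
      from weq_trans[OF this inv_right_weq[OF W(2)]] show ?thesis by simp
    qed
    ultimately have "C n' (word_inv q) (word_inv p)" using C by (simp add: C_def)
    then show False using n(2)[of n'] that d(4) by blast
  qed
  moreover have "map lab os = p @ []" using d(3) by simp
  ultimately have bp: "6 * k < length f" if "f \<in> FS" "X i \<in> set f" "i < length p" "k \<le> Suc i" "k \<le> length f"
    "\<And>j. j < k \<Longrightarrow> (nx ^^ j) (X i) = X (i - j)" for f i k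
    using boundary_piece[OF d(2) _ C(1), of "[]"] that by blast
  \<comment> \<open>Free reduction excludes vertices of degree one, except at the base point. There
    \<open>p\<close> would be a conjugate \<open>x p'' x^-1\<close>, and \<open>p''\<close> a
    shorter counterexample with no more faces.\<close>
  have sgn: "sg d \<noteq> d" if dD: "d \<in> D" for d
  proof
    assume e: "sg d = d"
    obtain xs where xs: "xs \<in> insert os FS" "al d \<in> set xs" using D_cases[OF al_D[OF dD]] by auto
    then have d_xs: "d \<in> set xs" using nx_mem1[OF xs] e by (simp add: sg_def)
    have l2: "length xs \<ge> 2" using d_xs xs(2) al_ne[OF dD] by (cases xs; cases "tl xs"; auto)
    have nxd: "nx (al d) = d" using e by (simp add: sg_def)
    show False
    proof (cases "xs = os")
      case True
      obtain i where i: "i < N" "al d = os ! i" using xs True by (metis in_set_conv_nth)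
      have "d = os ! (Suc i mod N)" using nx_os[OF i(1)] nxd i by simp
      then have lb: "p ! (Suc i mod N) = letter_inv (p ! i)"
        using lab_al[OF al_D[OF dD]] al_al[OF dD] i d(3) by (metis N length_map mod_less_divisor nth_map length_greater_0_conv C(3))
      show False
      proof (cases "Suc i < N")
        case True then show False using lb red N unfolding freely_reduced_def by simp
      next
        case False
        then have iN: "i = N - 1" "Suc i = N" using i by auto
        obtain x p' where p': "p = x # p'" using C(3) by (cases p) auto
        have "p' \<noteq> []" using l2 True p' N by auto
        then obtain p'' y where p'': "p' = p'' @ [y]" by (metis rev_exhaust)
        have "y = letter_inv x" using lb p' p'' iN N by (simp add: nth_append)
        then have pe: "p = x # p'' @ [letter_inv x]" using p' p'' by simp
        have xL: "x \<in> Ltr" using W pe by simp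
        have "p'' \<noteq> []" using red pe unfolding freely_reduced_def by (auto dest!: spec[of _ 0])
        moreover have "p'' @ ([letter_inv x] @ q @ [x]) \<in> R" using R_swap[of "[x]" "p'' @ [letter_inv x] @ q"] C(1) pe by simp
        moreover have "p'' \<doteq> []"
        proof -
          have "([letter_inv x] @ [x]) @ p'' \<doteq> []"
            using weq_conj[of "[x] @ p''" "[letter_inv x]"] C(2) pe W by simp
          moreover have "([letter_inv x] @ [x]) @ p'' \<doteq> [] @ p''"
            using cancel_weq[of "letter_inv x"] xL by (intro weq_append_right) simp
          ultimately show ?thesis using weq_trans[OF weq_sym] by (metis append_Nil)
        qed
        moreover have "\<exists>n'\<le>n. fills S R n' p''"
          using fills_rotate[of n "x # p''" "[letter_inv x]"] fills_fold[of n "letter_inv x" p''] C(5) pe by simp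
        ultimately obtain n' where "n' \<le> n" "C n' p'' ([letter_inv x] @ q @ [x])" unfolding C_def by auto
        moreover from this have "n' = n" using n(2)[of n'] by (metis le_neq_implies_less)
        ultimately show False using l(2)[of "length p''"] pq(2) pe by auto
      qed
    next
      case False
      then have f: "xs \<in> FS" using xs by simp
      let ?w = "map lab (al d # aft xs (al d))"
      have R: "?w \<in> R" by (rule aft_R[OF f xs(2)])
      have "0 < length xs" "1 < length xs" using l2 by auto
      then have "?w ! 0 = lab (al d)" "?w ! 1 = lab d"
        unfolding aft_nx[OF xs] using nxd by (simp_all del: upt_Suc)
      then have "?w ! Suc 0 = letter_inv (?w ! 0)" using lab_al[OF dD] by (simp del: list.map)
      moreover have "Suc 0 < length ?w" using l2 length_aft[OF xs(2)] by (cases "aft xs (al d)") auto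
      ultimately show False using R_reduced[OF R] unfolding freely_reduced_def by blast
    qed
  qed
  \<comment> \<open>A run through the base point is split there into two pieces.\<close>
  have short: "3 * m < length f" if f: "f \<in> FS" "b \<in> set f" "al b \<in> set os" and m: "m \<le> N" "m \<le> length f"
    and run: "\<And>j. 0 < j \<Longrightarrow> j < m \<Longrightarrow> \<not> brk ((nx ^^ j) b)" for f b m
  proof -
    obtain i where i: "i < N" "b = X i" using outer_X[OF in_D(2)[OF f(1,2)] f(3)] by blast
    let ?u = "min m (Suc i)"
    have u: "6 * ?u < length f"
      
    proof (rule bp[OF f(1), of i])
      fix j assume "j < ?u"
      then have j: "j < m" "j \<le> i" by simp_all
      show "(nx ^^ j) (X i) = X (i - j)" by (rule run_X(1)[OF i(1), of m]) (use run i j in auto)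
    qed (use i f N m in auto)
    show ?thesis
    proof (cases "m \<le> Suc i")
      case True then show ?thesis using u by simp
    next
      case False
      let ?m = "m - Suc i"
      have X0: "(nx ^^ Suc i) (X i) = X (N - 1)" using run_X(2)[OF i(1), of m "Suc i"] run i False by auto
      have mem: "X (N - 1) \<in> set f" using nx_mem[of f b "Suc i"] f i X0 by auto
      have "(nx ^^ j) (X (N - 1)) = X (N - 1 - j)" if "j < ?m" for j
      proof -
        have "(nx ^^ j) (X (N - 1)) = (nx ^^ (j + Suc i)) (X i)" using X0 by (metis comp_apply funpow_add)
        also have "\<dots> = X (N + i - (j + Suc i))" using run_X(2)[OF i(1), of m "j + Suc i"] run i that m by auto
        finally show ?thesis by simp
      qed
      then have "6 * ?m < length f" using bp[OF f(1) mem, of ?m] N m i by simp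
      moreover have "6 * Suc i < length f" using u False by simp
      moreover obtain k where "m = Suc i + k" using False by (metis le_add_diff_inverse nat_le_linear)
      ultimately show ?thesis by simp
    qed
  qed
  have "6 - 2 * int (card (Eo f)) - int (card (In f)) \<le> 0" if f: "f \<in> FS" for f
  proof -
    have ne: "Bk f \<noteq> {}"
    proof
      assume Bk: "Bk f = {}"
      obtain b where b: "b \<in> set f" using face_ne[OF f] by (cases f) auto
      have nb: "\<not> brk ((nx ^^ j) b)" for j using Bk nx_mem[of f b j] f b by (auto simp: Bk_def)
      have "al b \<in> set os" by (rule no_break_face[OF d(2) f Bk b])
      moreover have "length f \<le> N"
      proof -
        have "al ` set f \<subseteq> set os" using no_break_face[OF d(2) f Bk] by auto
        moreover have "inj_on al (set f)" by (rule inj_onI) (metis al_al in_D(2)[OF f])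
        ultimately have "card (set f) \<le> card (set os)" by (meson List.finite_set card_inj_on_le)
        then show ?thesis using dist_f[OF f] dist_os by (simp add: distinct_card)
      qed
      ultimately have "3 * length f < length f" using short[OF f b, of "length f"] nb by auto
      then show False by simp
    qed
    have "3 * rl b < length f" if "b \<in> Eo f" for b
    proof -
      have h: "b \<in> set f" "brk b" "al b \<in> set os" using that by (auto simp: Eo_def)
      show ?thesis using short[OF f h(1,3), of "rl b"] run_len[OF f that] rl_ex[of f b] f h by auto
    qed
    then have "(\<Sum>b\<in>Eo f. 3 * rl b) \<le> (\<Sum>b\<in>Eo f. length f)" by (intro sum_mono) (simp add: less_imp_le)
    then have "6 * (\<Sum>b\<in>Eo f. rl b) \<le> 2 * card (Eo f) * length f" by (simp add: sum_distrib_left[symmetric] mult.commute)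
    then have "6 * length f \<le> (2 * card (Eo f) + card (In f)) * length f"
      using inner_bound[OF d(2) f ne] by (simp add: algebra_simps)
    then have "6 \<le> 2 * card (Eo f) + card (In f)" using face_ne[OF f] by simp
    then show ?thesis by linarith
  qed
  then have "(\<Sum>f\<in>FS. 6 - 2 * int (card (Eo f)) - int (card (In f))) \<le> 0" by (intro sum_nonpos) auto
  moreover have "os \<noteq> []" using C(3) d(3) by auto
  ultimately show False using curvature[OF _ sgn] by (simp split: if_splits)
qed

text \<open>Take a counterexample with the shortest geodesic \<open>\<sigma>\<close> and then the
  fewest faces. Exterior runs on \<open>p\<close> are pieces, those on \<open>\<sigma>\<close> at
  most half a face, so only the faces at the two corners can be positive. Their exterior arcs are at
  most five sixths, which leaves two interior arcs and curvature at most 2: a total of 4 instead of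
  6.\<close>

theorem relator_isometric:
  assumes "p @ q \<in> R" "v \<in> W" "v \<doteq> p" shows "min (length p) (length q) \<le> length v"
proof (rule ccontr)
  assume c: "\<not> ?thesis"
  define C where "C z n p q \<sigma> \<longleftrightarrow> p @ q \<in> R \<and> geo \<sigma> \<and> \<sigma> \<doteq> p \<and> length \<sigma> < min (length p) (length q) \<and>
    fills S R n (p @ word_inv \<sigma>) \<and> length \<sigma> = z" for z n p q \<sigma>
  have mk: "\<exists>z'\<le>length v. \<exists>n p q \<sigma>. C z' n p q \<sigma>"
    if h: "p @ q \<in> R" "v \<in> W" "v \<doteq> p" "length v < min (length p) (length q)" for p q v
  proof -
    obtain \<sigma> where \<sigma>: "\<sigma> \<in> W \<and> \<sigma> \<doteq> p" "\<And>u. u \<in> W \<and> u \<doteq> p \<Longrightarrow> length \<sigma> \<le> length u"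
      using ex_has_least_nat[of "\<lambda>u. u \<in> W \<and> u \<doteq> p" v length] h(2,3) by blast
    have "geo \<sigma>" unfolding geo_def using \<sigma> weq_trans by blast
    moreover have "p @ word_inv \<sigma> \<doteq> []" using weq_iff_trivial[of \<sigma> p] \<sigma>(1) weq_sym by blast
    then obtain n where "fills S R n (p @ word_inv \<sigma>)" using van_kampen by blast
    moreover have "length \<sigma> \<le> length v" using \<sigma>(2) h by blast
    ultimately have "C (length \<sigma>) n p q \<sigma>" "length \<sigma> \<le> length v" using \<sigma>(1) h unfolding C_def by auto
    then show ?thesis by blast
  qed
  have "\<exists>z n p q \<sigma>. C z n p q \<sigma>" using mk[of p q v] assms c by fastforce
  then obtain z where z: "\<exists>n p q \<sigma>. C z n p q \<sigma>" "\<And>z'. z' < z \<Longrightarrow> \<not> (\<exists>n p q \<sigma>. C z' n p q \<sigma>)"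
    using exists_least_iff[of "\<lambda>z. \<exists>n p q \<sigma>. C z n p q \<sigma>"] by blast
  then obtain n where n: "\<exists>p q \<sigma>. C z n p q \<sigma>" "\<And>n'. n' < n \<Longrightarrow> \<not> (\<exists>p q \<sigma>. C z n' p q \<sigma>)"
    using exists_least_iff[of "\<lambda>n. \<exists>p q \<sigma>. C z n p q \<sigma>"] by blast
  then obtain p q \<sigma> where "C z n p q \<sigma>" by blast
  then have C: "p @ q \<in> R" "geo \<sigma>" "\<sigma> \<doteq> p" "length \<sigma> < length p" "length \<sigma> < length q" "fills S R n (p @ word_inv \<sigma>)" "length \<sigma> = z"
    by (auto simp: C_def)
  have small: "min (length p') (length q') \<le> length v'" if "p' @ q' \<in> R" "v' \<in> W" "v' \<doteq> p'" "length v' < z" for p' q' v'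
    using mk[OF that(1-3)] z(2) that(4) by (meson le_less_trans linorder_not_less)
  let ?P = "length p" and ?Q = "length \<sigma>" and ?w = "p @ word_inv \<sigma>"
  have W: "p \<in> W" "q \<in> W" "\<sigma> \<in> W" using R_W[OF C(1)] geo_W[OF C(2)] by auto
  have Q0: "0 < ?Q"
  proof (rule ccontr)
    assume "\<not> 0 < ?Q"
    then have "p \<doteq> []" using C(3) weq_sym by simp
    then show False using closed_subword_trivial[OF C(1)] C(4,5) by auto
  qed
  have psimple: "\<not> take j p \<doteq> take k p" if jk: "j < k" "k \<le> ?P" for j k
  proof
    assume e: "take j p \<doteq> take k p"
    have s: "take k p = take j p @ seg j k p" using jk unfolding seg_def by (metis append_take_drop_id less_imp_le_nat min.absorb1 take_take)
    then have "take j p @ [] \<doteq> take j p @ seg j k p" using e by simp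
    then have "[] \<doteq> seg j k p" using weq_cancel_left[OF W_take[OF W(1)]] by blast
    then have t: "seg j k p \<doteq> []" by (rule weq_sym)
    have "p = take j p @ seg j k p @ drop k p" using s by (metis append.assoc append_take_drop_id)
    then have "take j p @ seg j k p @ drop k p @ q \<in> R" using C(1) by (metis append.assoc)
    then have "seg j k p @ (drop k p @ q @ take j p) \<in> R" using R_swap[of "take j p" "seg j k p @ drop k p @ q"] by simp
    moreover have "length (seg j k p) = k - j" using jk by simp
    ultimately show False using closed_subword_trivial[OF _ t] jk C(5) Q0 by fastforce
  qed
  have gsimple: "\<not> take j \<sigma> \<doteq> take k \<sigma>" if jk: "j < k" "k \<le> ?Q" for j k
  proof
    assume e: "take j \<sigma> \<doteq> take k \<sigma>"
    have "take j \<sigma> @ drop k \<sigma> \<doteq> take k \<sigma> @ drop k \<sigma>" by (rule weq_append_right[OF e])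
    then have "take j \<sigma> @ drop k \<sigma> \<doteq> \<sigma>" by simp
    moreover have "take j \<sigma> @ drop k \<sigma> \<in> W" using W(3) W_take W_drop by simp
    ultimately have "?Q \<le> length (take j \<sigma> @ drop k \<sigma>)" using C(2) unfolding geo_def by blast
    then show False using jk by simp
  qed
  \<comment> \<open>A common vertex inside \<open>\<sigma>\<close> would split the configuration
    into two with shorter geodesics, for which the claim holds. The two estimates together
    contradict that \<open>\<sigma>\<close> is shorter than \<open>p\<close> and
    \<open>q\<close>.\<close>
  have cross: "\<not> take j p \<doteq> take k \<sigma>" if jk: "j \<le> ?P" "0 < k" "k < ?Q" for j k
  proof
    assume e: "take j p \<doteq> take k \<sigma>"
    have rj: "take j p @ drop j p @ q \<in> R" using C(1) by (metis append.assoc append_take_drop_id)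
    have "min j (length (drop j p @ q)) \<le> k"
      using small[OF rj W_take[OF W(3)] weq_sym[OF e]] C(7) jk by simp
    moreover have "min (length (drop j p)) (length (q @ take j p)) \<le> length (drop k \<sigma>)"
    proof (rule small)
      show "drop j p @ q @ take j p \<in> R" using R_swap[OF rj] by simp
      show "drop k \<sigma> \<in> W" using W_drop W(3) by blast
      have "take k \<sigma> @ drop k \<sigma> \<doteq> take j p @ drop j p" using C(3) by simp
      then have "take k \<sigma> @ drop k \<sigma> \<doteq> take k \<sigma> @ drop j p" using weq_trans[OF _ weq_append_right[OF e, of "drop j p"]] by blast
      then show "drop k \<sigma> \<doteq> drop j p" using weq_cancel_left[OF W_take[OF W(3)]] by blast
    qed (use jk C in auto)
    ultimately show False using C(4,5) jk by (auto simp: min_def split: if_splits)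
  qed
  have pre: "take k ?w \<doteq> take (?Q - (k - ?P)) \<sigma>" if k: "?P \<le> k" "k \<le> ?P + ?Q" for k
  proof -
    let ?m = "?Q - (k - ?P)"
    have "word_inv \<sigma> = word_inv (drop ?m \<sigma>) @ word_inv (take ?m \<sigma>)" by (metis append_take_drop_id word_inv_simps(3))
    then have "take (k - ?P) (word_inv \<sigma>) = word_inv (drop ?m \<sigma>)" using k by (metis add_diff_cancel_left' append_eq_conv_conj diff_diff_cancel diff_le_mono length_drop word_inv_simps(4))
    then have "take k ?w = p @ word_inv (drop ?m \<sigma>)" using k by simp
    moreover have "p @ word_inv (drop ?m \<sigma>) \<doteq> \<sigma> @ word_inv (drop ?m \<sigma>)" by (rule weq_append_right[OF weq_sym[OF C(3)]])
    moreover have "\<sigma> @ word_inv (drop ?m \<sigma>) = take ?m \<sigma> @ (drop ?m \<sigma> @ word_inv (drop ?m \<sigma>))" by (metis append.assoc append_take_drop_id)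
    moreover have "take ?m \<sigma> @ (drop ?m \<sigma> @ word_inv (drop ?m \<sigma>)) \<doteq> take ?m \<sigma> @ []"
      by (rule weq_append_left[OF inv_right_weq[OF W_drop[OF W(3)]]])
    ultimately show ?thesis by (metis append_Nil2 weq_trans)
  qed
  have simple: "\<not> take j ?w \<doteq> take k ?w" if jk: "j < k" "k < length ?w" for j k
  proof
    assume e: "take j ?w \<doteq> take k ?w"
    consider "k \<le> ?P" | "j \<le> ?P" "?P < k" | "?P < j" by linarith
    then show False
    proof cases
      case 1 then show False using psimple[of j k] e jk by simp
    next
      case 2
      then have "0 < ?Q - (k - ?P)" "?Q - (k - ?P) < ?Q" "take j p \<doteq> take (?Q - (k - ?P)) \<sigma>"
        using weq_trans[OF e pre[of k]] jk Q0 by auto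
      then show False using cross[OF 2(1)] by blast
    next
      case 3
      have "take (?Q - (j - ?P)) \<sigma> \<doteq> take (?Q - (k - ?P)) \<sigma>"
        using weq_trans[OF weq_sym[OF pre[of j]] weq_trans[OF e pre[of k]]] 3 jk by simp
      moreover have "?Q - (k - ?P) < ?Q - (j - ?P)" "?Q - (j - ?P) \<le> ?Q" using 3 jk by auto
      ultimately show False using gsimple weq_sym by blast
    qed
  qed
  obtain os FS al lab vt ps where d: "diagram S R os FS al lab vt ps" "nomirror FS al lab" "map lab os = ?w" "card FS = n"
    using C(6) by (auto simp: fills_def)
  have "3 \<le> length ?w" using Q0 C(4) unfolding length_append word_inv_simps(4) by linarith
  then interpret simple_diagram S R os FS al lab vt ps
    using simple_diagramI[OF d(1-3)] W simple by simp
  have N: "N = ?P + ?Q" using arg_cong[OF d(3), of length] by simp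
  \<comment> \<open>\<open>word_inv q\<close> with the same \<open>\<sigma>\<close> is again a
    counterexample, so it has no diagram with fewer faces.\<close>
  have nof: "\<not> fills S R n' (word_inv q @ word_inv \<sigma>)" if "n' < card FS" for n'
  proof
    assume "fills S R n' (word_inv q @ word_inv \<sigma>)"
    moreover have "\<sigma> \<doteq> word_inv q" using weq_trans[OF C(3)] weq_iff_trivial[of "word_inv q" p] relator_weq[OF C(1)] W by simp
    ultimately have "C z n' (word_inv q) (word_inv p) \<sigma>" using C R_inv[OF C(1)] by (simp add: C_def)
    then show False using n(2)[of n'] that d(4) by blast
  qed
  have bp: "6 * k < length f" if "f \<in> FS" "X i \<in> set f" "i < ?P" "k \<le> Suc i" "k \<le> length f"
    "\<And>j. j < k \<Longrightarrow> (nx ^^ j) (X i) = X (i - j)" for f i k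
    using boundary_piece[OF d(2,3) C(1) nof that] .
  have gr: "2 * k \<le> length f" if h: "f \<in> FS" "X i \<in> set f" "i < N" "?P \<le> Suc i - k" "k \<le> Suc i" "k \<le> length f"
    "\<And>j. j < k \<Longrightarrow> (nx ^^ j) (X i) = X (i - j)" for f i k
  proof (rule geodesic_run_word[OF h(1-3) h(6,5) h(7)])
    have "seg (Suc i - k) (Suc i) (map lab os) = seg (Suc i - k - ?P) (Suc i - ?P) (word_inv \<sigma>)"
      using h by (simp add: d(3) seg_append_right)
    moreover have "word_inv \<sigma> = take (Suc i - k - ?P) (word_inv \<sigma>) @ seg (Suc i - k - ?P) (Suc i - ?P) (word_inv \<sigma>) @ drop (Suc i - ?P) (word_inv \<sigma>)"
      unfolding seg_def by (metis append.assoc append_take_drop_id diff_le_mono diff_le_self min.absorb1 take_take)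
    ultimately show "geo (seg (Suc i - k) (Suc i) (map lab os))" using geo_inv[OF C(2)] geo_sub by metis
  qed
  have PN: "?P < N" "0 < N" using N Q0 by auto
  obtain F0 where F0: "F0 \<in> FS" "X 0 \<in> set F0" using al_outer_face[of "os ! 0"] PN by auto
  obtain FP where FP: "FP \<in> FS" "X ?P \<in> set FP" using al_outer_face[of "os ! ?P"] PN by auto
  have uniq: "f = g" if "f \<in> FS" "g \<in> FS" "x \<in> set f" "x \<in> set g" for f g x using lists_disjoint[of f g x] that by auto
  \<comment> \<open>The extreme case is an arc over a part of \<open>p\<close>, all of
    \<open>\<sigma>\<close> and again a part of \<open>p\<close>, which takes up at most
    \<open>1/6 + 1/2 + 1/6\<close> of the face.\<close>
  have runb: "6 * m \<le> 5 * length f" "f \<noteq> F0 \<Longrightarrow> f \<noteq> FP \<Longrightarrow> 2 * m \<le> length f"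
    if f: "f \<in> FS" and i: "i < N" "X i \<in> set f" and m: "m \<le> N" "m \<le> length f"
      and nb: "\<And>j. 0 < j \<Longrightarrow> j < m \<Longrightarrow> \<not> brk ((nx ^^ j) (X i))" for f i m
  proof -
    let ?L = "length f"
    have r1: "(nx ^^ j) (X i) = X (i - j)" if "j < m" "j \<le> i" for j using run_X(1)[OF i(1) nb that] .
    have r2: "(nx ^^ j) (X i) = X (N + i - j)" if "j < m" "i < j" for j using run_X(2)[OF i(1) nb that] that m by simp
    have mem: "(nx ^^ j) (X i) \<in> set f" for j using nx_mem[of f "X i" j] f i by auto
    have it: "(nx ^^ j) ((nx ^^ k) (X i)) = (nx ^^ (j + k)) (X i)" for j k by (simp add: funpow_add)
    have "6 * m \<le> 5 * ?L \<and> (f \<noteq> F0 \<longrightarrow> f \<noteq> FP \<longrightarrow> 2 * m \<le> ?L)"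
    proof (cases "i < ?P")
      case iP: True
      show ?thesis
      proof (cases "m \<le> Suc i")
        case True
        have "6 * m < ?L" by (rule bp[OF f i(2) iP True m(2)]) (use r1 True in auto)
        then show ?thesis by linarith
      next
        case False
        have u1: "6 * Suc i < ?L" by (rule bp[OF f i(2) iP]) (use r1 False m in auto)
        have "X 0 \<in> set f" using r1[of i] mem[of i] False by simp
        then have fF: "f = F0" using uniq[OF f F0(1) _ F0(2)] by simp
        have s0: "(nx ^^ Suc i) (X i) = X (N - 1)" using r2[of "Suc i"] False by simp
        have sm: "X (N - 1) \<in> set f" using mem[of "Suc i"] s0 by simp
        let ?s = "min (m - Suc i) ?Q"
        have s: "2 * ?s \<le> ?L"
        proof (rule gr[OF f sm])
          fix j assume j: "j < ?s"
          have "(nx ^^ j) (X (N - 1)) = (nx ^^ (j + Suc i)) (X i)" using it[of j "Suc i"] s0 by simp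
          moreover have "j + Suc i < m" using j less_diff_conv[of j m "Suc i"] by simp
          ultimately show "(nx ^^ j) (X (N - 1)) = X (N - 1 - j)" using r2[of "j + Suc i"] by simp
        qed (use PN N m in auto)
        show ?thesis
        proof (cases "m - Suc i \<le> ?Q")
          case True
          obtain k where k: "m = Suc i + k" using False by (metis le_add_diff_inverse nat_le_linear)
          have "2 * k \<le> ?L" using s k True by (simp add: min_absorb1)
          then have "6 * m \<le> 5 * ?L" using u1 k by simp
          then show ?thesis using fF by blast
        next
          case big: False
          let ?u = "m - Suc i - ?Q"
          have t0: "(nx ^^ (Suc i + ?Q)) (X i) = X (?P - 1)" using r2[of "Suc i + ?Q"] big N by simp
          have tm: "X (?P - 1) \<in> set f" using mem[of "Suc i + ?Q"] t0 by simp
          have "6 * ?u < ?L"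
          proof (rule bp[OF f tm])
            fix j assume j: "j < ?u"
            have "(nx ^^ j) (X (?P - 1)) = (nx ^^ (j + (Suc i + ?Q))) (X i)" using it[of j "Suc i + ?Q"] t0 by simp
            moreover have "j + (Suc i + ?Q) < m" using j by simp
            ultimately show "(nx ^^ j) (X (?P - 1)) = X (?P - 1 - j)" using r2[of "j + (Suc i + ?Q)"] N by simp
          qed (use iP N m in auto)
          moreover have "2 * ?Q \<le> ?L" using s big by (simp add: min_absorb2)
          moreover obtain k where k: "m = Suc i + ?Q + k" using big by (metis False diff_diff_left le_add_diff_inverse nat_le_linear diff_is_0_eq)
          ultimately have "6 * m \<le> 5 * ?L" using u1 by simp
          then show ?thesis using fF by blast
        qed
      qed
    next
      case iP: False
      show ?thesis
      proof (cases "m \<le> Suc i - ?P")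
        case True
        have "2 * m \<le> ?L" by (rule gr[OF f i(2,1)]) (use r1 True iP m in auto)
        then show ?thesis by linarith
      next
        case False
        let ?s = "Suc i - ?P"
        have s: "2 * ?s \<le> ?L" by (rule gr[OF f i(2,1)]) (use r1 False iP m in auto)
        have "X ?P \<in> set f" using r1[of "i - ?P"] mem[of "i - ?P"] False iP by simp
        then have fF: "f = FP" using uniq[OF f FP(1) _ FP(2)] by simp
        let ?u = "min (m - ?s) ?P"
        have P0: "0 < ?P" using C(4) by linarith
        have t0: "?s \<le> i \<Longrightarrow> (nx ^^ ?s) (X i) = X (?P - 1)" using r1[of ?s] False iP by simp
        have si: "?s \<le> i" using P0 iP by linarith
        have tm: "X (?P - 1) \<in> set f" using mem[of ?s] t0[OF si] by simp
        have u: "6 * ?u < ?L"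
        proof (rule bp[OF f tm])
          fix j assume j: "j < ?u"
          have "(nx ^^ j) (X (?P - 1)) = (nx ^^ (j + ?s)) (X i)" using it[of j ?s] t0[OF si] by simp
          moreover have "j + ?s \<le> i" "i - (j + ?s) = ?P - 1 - j" "j + ?s < m" using j iP by auto
          ultimately show "(nx ^^ j) (X (?P - 1)) = X (?P - 1 - j)" using r1[of "j + ?s"] j by simp
        qed (use P0 m in auto)
        show ?thesis
        proof (cases "m - ?s \<le> ?P")
          case True
          obtain k where k: "m = ?s + k" using False by (metis le_add_diff_inverse nat_le_linear)
          have "6 * k < ?L" using u True unfolding k by (simp add: min_absorb1)
          moreover have "6 * (x + k) \<le> 5 * y" if "6 * k < y" "2 * x \<le> y" for x y :: nat using that by simp
          ultimately have "6 * (?s + k) \<le> 5 * ?L" using s by blast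
          then have "6 * m \<le> 5 * ?L" using k by simp
          then show ?thesis using fF by blast
        next
          case big: False
          then have "6 * ?P < ?L" using u by simp
          moreover have "m < 2 * ?P" using m(1) N C(4) by linarith
          ultimately have "6 * m \<le> 5 * ?L" by linarith
          then show ?thesis using fF by blast
        qed
      qed
    qed
    then show "6 * m \<le> 5 * ?L" "f \<noteq> F0 \<Longrightarrow> f \<noteq> FP \<Longrightarrow> 2 * m \<le> ?L" by auto
  qed
  have ne: "Bk f \<noteq> {}" if f: "f \<in> FS" for f
  proof
    assume Bk: "Bk f = {}"
    have eq: "al ` set f = set os" by (rule no_break_outer[OF f Bk])
    have "inj_on al (set f)" by (rule inj_onI) (metis al_al in_D(2)[OF f])
    then have "card (set f) = card (set os)" using eq card_image by metis
    then have len: "length f = N" using dist_f[OF f] dist_os by (simp add: distinct_card)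
    have "os ! (?P - 1) \<in> al ` set f" using eq PN by simp
    then obtain d' where d': "d' \<in> set f" "al d' = os ! (?P - 1)" by auto
    then have mem: "X (?P - 1) \<in> set f" using al_al in_D(2)[OF f] by metis
    have nb: "\<not> brk ((nx ^^ j) (X (?P - 1)))" for j using nx_mem[of f "X (?P - 1)" j] mem f Bk by (auto simp: Bk_def)
    have "6 * ?P < length f"
      by (rule bp[OF f mem]) (use C(4) N len run_X(1)[of "?P - 1" ?P] nb PN in auto)
    then show False using len N C(4) by simp
  qed
  have le: "trm f \<le> 2" "f \<noteq> F0 \<Longrightarrow> f \<noteq> FP \<Longrightarrow> trm f \<le> 0" if f: "f \<in> FS" for f
  proof -
    consider "Eo f = {}" | "card (Eo f) = 1" | "2 \<le> card (Eo f)" by (cases "card (Eo f) \<le> 1") (auto simp: le_Suc_eq)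
    then have "trm f \<le> 2 \<and> (f \<noteq> F0 \<longrightarrow> f \<noteq> FP \<longrightarrow> trm f \<le> 0)"
    proof cases
      case 1 then show ?thesis using trm_Eo0[OF f ne[OF f]] by linarith
    next
      case 3 then show ?thesis using trm_Eo2[OF f] by linarith
    next
      case 2
      then obtain b where b: "Eo f = {b}" by (auto simp: card_1_singleton_iff)
      then have h: "b \<in> set f" "brk b" "al b \<in> set os" "b \<in> D" using in_D(2)[OF f] by (auto simp: Eo_def)
      obtain i where i: "i < N" "b = X i" using outer_X[OF h(4,3)] by blast
      have bE: "b \<in> Eo f" using b by simp
      have rb: "6 * rl b \<le> 5 * length f" "f \<noteq> F0 \<Longrightarrow> f \<noteq> FP \<Longrightarrow> 2 * rl b \<le> length f"
        using runb[OF f i(1), of "rl b"] run_len[OF f bE] rl_ex[of f b] h f i by auto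
      have "1 < card (In f)" using trm_short[OF f b, of 6 5 1] rb(1) by simp
      moreover have "f \<noteq> F0 \<Longrightarrow> f \<noteq> FP \<Longrightarrow> 3 < card (In f)" using trm_short[OF f b, of 2 1 3] rb(2) by simp
      ultimately show ?thesis using 2 by (auto simp: trm_def)
    qed
    then show "trm f \<le> 2" "f \<noteq> F0 \<Longrightarrow> f \<noteq> FP \<Longrightarrow> trm f \<le> 0" by auto
  qed
  have "(\<Sum>f\<in>FS. trm f) = (\<Sum>f\<in>{F0, FP}. trm f) + (\<Sum>f\<in>FS - {F0, FP}. trm f)"
    using F0 FP finFS by (subst sum.subset_diff[of "{F0, FP}" FS]) auto
  moreover have "(\<Sum>f\<in>FS - {F0, FP}. trm f) \<le> 0" by (rule sum_nonpos) (use le(2) in auto)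
  moreover have "(\<Sum>f\<in>{F0, FP}. trm f) \<le> 4" using le(1)[OF F0(1)] le(1)[OF FP(1)] by (cases "F0 = FP") auto
  ultimately show False using curvature_simple by (simp split: if_splits)
qed

end

section \<open>The geodesic tree\<close>

lemma seg_drop: "seg i j (drop s w) = seg (s + i) (s + j) w"
  by (simp add: seg_def take_drop add.commute)

context presentation
begin

definition adj :: "'a word set \<Rightarrow> 'a word set \<Rightarrow> bool" where
  "adj x y \<longleftrightarrow> x \<in> G \<and> (\<exists>t\<in>Ltr. y = mul x [t])"

lemma adj_G: "adj x y \<Longrightarrow> x \<in> G \<and> y \<in> G" by (auto simp: adj_def)

lemma adj_sym: "adj x y \<Longrightarrow> adj y x"
  unfolding adj_def using mul_inv_letter by (metis Ltr_inv W_simps(1,2) mul_in_G)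

end

locale rooted = presentation S R for S :: "'a set" and R + fixes rt assumes rt: "rt \<in> grp_elems S R"
begin

definition lev :: "'a word set \<Rightarrow> nat" where "lev x = dst rt x"

lemma lev_rt [simp]: "lev rt = 0" using rt by (simp add: lev_def)

lemma lev_0: "x \<in> G \<Longrightarrow> lev x = 0 \<Longrightarrow> x = rt" using rt dst_zero by (simp add: lev_def)

lemma lev_lip: "x \<in> G \<Longrightarrow> y \<in> G \<Longrightarrow> lev y \<le> lev x + dst x y" using rt dst_triangle by (simp add: lev_def)

lemma parent_ex: assumes "x \<in> G" "x \<noteq> rt"
  shows "\<exists>p. fst p \<in> G \<and> snd p \<in> Ltr \<and> mul (fst p) [snd p] = x \<and> lev x = Suc (lev (fst p))"
proof -
  obtain w where w: "w \<in> W" "length w = lev x" "mul rt w = x" using dst_word[OF rt assms(1)] by (auto simp: lev_def)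
  have "w \<noteq> []" using w assms rt by auto
  then obtain u t where u: "w = u @ [t]" by (metis rev_exhaust)
  let ?y = "mul rt u"
  have uW: "u \<in> W" "t \<in> Ltr" using w u by auto
  then have y: "?y \<in> G" "mul ?y [t] = x" using rt w u by (auto simp: mul_append)
  have "lev ?y \<le> length u" using dst_le[OF rt uW(1)] by (simp add: lev_def)
  moreover have "lev x \<le> lev ?y + 1" using lev_lip[OF y(1) assms(1)] dst_leI[OF y(1) _ y(2)] uW by fastforce
  ultimately have "lev x = Suc (lev ?y)" using w u by simp
  then show ?thesis using y uW by (intro exI[of _ "(?y, t)"]) simp
qed

text \<open>Following these chosen edges, the geodesics to the root form a tree.\<close>
definition pe :: "'a word set \<Rightarrow> 'a word set \<times> 'a letter" where
  "pe x = (SOME p. fst p \<in> G \<and> snd p \<in> Ltr \<and> mul (fst p) [snd p] = x \<and> lev x = Suc (lev (fst p)))"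

lemma pe: assumes "x \<in> G" "x \<noteq> rt"
  shows "fst (pe x) \<in> G" "snd (pe x) \<in> Ltr" "mul (fst (pe x)) [snd (pe x)] = x" "lev x = Suc (lev (fst (pe x)))"
  using someI_ex[OF parent_ex[OF assms]] unfolding pe_def by auto

definition par :: "'a word set \<Rightarrow> 'a word set" where "par x = (if x = rt then rt else fst (pe x))"

lemma par_G: "x \<in> G \<Longrightarrow> par x \<in> G" using pe rt by (simp add: par_def)

lemma lev_par: "x \<in> G \<Longrightarrow> lev (par x) = lev x - 1" using pe(4)[of x] by (auto simp: par_def)

text \<open>By truncated subtraction this is \<open>x\<close> itself when \<open>n\<close> exceeds
  the level of \<open>x\<close>.\<close>

definition anc :: "nat \<Rightarrow> 'a word set \<Rightarrow> 'a word set" where "anc n x = (par ^^ (lev x - n)) x"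

lemma par_pow: "x \<in> G \<Longrightarrow> (par ^^ k) x \<in> G \<and> lev ((par ^^ k) x) = lev x - k"
  by (induction k) (auto simp: par_G lev_par)

lemma anc_G [simp]: "x \<in> G \<Longrightarrow> anc n x \<in> G" using par_pow by (simp add: anc_def)
lemma lev_anc: "x \<in> G \<Longrightarrow> lev (anc n x) = min n (lev x)" using par_pow by (auto simp: anc_def)
lemma anc_ge: "lev x \<le> n \<Longrightarrow> anc n x = x" by (simp add: anc_def)
lemma anc_lev [simp]: "anc (lev x) x = x" by (simp add: anc_ge)

lemma anc_anc: assumes "x \<in> G" "m \<le> n" shows "anc m (anc n x) = anc m x"
proof (cases "n \<le> lev x")
  case True
  have "anc m (anc n x) = (par ^^ (n - m)) ((par ^^ (lev x - n)) x)"
    using lev_anc[OF assms(1), of n] True by (simp add: anc_def min_def)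
  also have "\<dots> = (par ^^ (n - m + (lev x - n))) x" by (simp add: funpow_add)
  also have "n - m + (lev x - n) = lev x - m" using True assms(2) by simp
  finally show ?thesis by (simp add: anc_def)
next
  case False then show ?thesis using anc_ge by simp
qed

lemma anc_0 [simp]: "x \<in> G \<Longrightarrow> anc 0 x = rt" using lev_0[OF anc_G] lev_anc by simp

lemma anc_Suc: assumes "x \<in> G" "n < lev x"
  shows "snd (pe (anc (Suc n) x)) \<in> Ltr" "mul (anc n x) [snd (pe (anc (Suc n) x))] = anc (Suc n) x"
proof -
  let ?y = "anc (Suc n) x"
  have y: "?y \<in> G" "lev ?y = Suc n" using assms lev_anc by auto
  then have ne: "?y \<noteq> rt" by auto
  have "anc n x = anc n ?y" using anc_anc[OF assms(1), of n "Suc n"] by simp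
  also have "\<dots> = par ?y" using y by (simp add: anc_def)
  finally show "snd (pe ?y) \<in> Ltr" "mul (anc n x) [snd (pe ?y)] = ?y" using pe[OF y(1) ne] ne by (simp_all add: par_def)
qed

definition tw :: "'a word set \<Rightarrow> 'a word" where "tw x = map (\<lambda>k. snd (pe (anc (Suc k) x))) [0..<lev x]"

lemma length_tw [simp]: "length (tw x) = lev x" by (simp add: tw_def)

lemma tw_W: "x \<in> G \<Longrightarrow> tw x \<in> W" using anc_Suc(1) by (auto simp: tw_def W_iff)

lemma tw_take_anc: "x \<in> G \<Longrightarrow> n \<le> lev x \<Longrightarrow> take n (tw x) = tw (anc n x)"
  by (rule nth_equalityI) (auto simp: lev_anc tw_def anc_anc)

lemma mul_seg: assumes x: "x \<in> G" and ij: "i \<le> j" "j \<le> lev x"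
  shows "mul (anc i x) (seg i j (tw x)) = anc j x" "seg i j (tw x) \<in> W"
proof -
  show W: "seg i j (tw x) \<in> W" for j unfolding seg_def using tw_W[OF x] W_take W_drop by blast
  show "mul (anc i x) (seg i j (tw x)) = anc j x" using ij
  proof (induction rule: dec_induct)
    case base show ?case using x by (simp add: seg_def)
  next
    case (step k)
    have "seg i (Suc k) (tw x) = seg i k (tw x) @ [tw x ! k]"
      using step by (simp add: seg_def take_Suc_conv_app_nth)
    then have "mul (anc i x) (seg i (Suc k) (tw x)) = mul (anc k x) [tw x ! k]"
      using step mul_append[OF anc_G[OF x] W[of k]] by simp
    also have "\<dots> = anc (Suc k) x" using anc_Suc(2)[OF x, of k] step by (simp add: tw_def)
    finally show ?case .
  qed
qed

lemma dst_anc: assumes "x \<in> G" "i \<le> j" "j \<le> lev x" shows "dst (anc i x) (anc j x) = j - i"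
proof -
  have "dst (anc i x) (anc j x) \<le> j - i"
    using dst_leI[OF anc_G[OF assms(1)] mul_seg(2)[OF assms] mul_seg(1)[OF assms]] assms by simp
  moreover have "j \<le> i + dst (anc i x) (anc j x)" using lev_lip[OF anc_G[OF assms(1), of i] anc_G[OF assms(1), of j]] lev_anc assms by simp
  ultimately show ?thesis by simp
qed

lemma geo_seg: assumes "x \<in> G" "i \<le> j" "j \<le> lev x" shows "geo (seg i j (tw x))"
  using geo_iff_dst[OF anc_G[OF assms(1), of i] mul_seg(2)[OF assms]] mul_seg(1)[OF assms] dst_anc[OF assms] assms by simp

lemma anc_eq_below: "x \<in> G \<Longrightarrow> y \<in> G \<Longrightarrow> anc n x = anc n y \<Longrightarrow> m \<le> n \<Longrightarrow> anc m x = anc m y"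
  using anc_anc by metis

lemma seg_tw_eq: assumes "x \<in> G" "y \<in> G" "anc n x = anc n y" "j \<le> n" "n \<le> lev x" "n \<le> lev y"
  shows "seg i j (tw x) = seg i j (tw y)"
proof -
  have "take n (tw x) = take n (tw y)" using tw_take_anc assms by metis
  then have "take j (tw x) = take j (tw y)" using assms(4) by (metis min.absorb1 take_take)
  then show ?thesis by (simp add: seg_def)
qed

text \<open>A face lying between the tree geodesics to \<open>x\<close> (between levels \<open>c\<close>, \<open>c'\<close>) and to \<open>x'\<close> (between
  levels \<open>l\<close>, \<open>l'\<close>), read upwards along \<open>x\<close>.\<close>
definition sface where
  "sface x x' c c' l l' \<tau> \<beta> \<longleftrightarrow> x \<in> G \<and> x' \<in> G \<and> c < c' \<and> c' \<le> lev x \<and> l < l' \<and> l' \<le> lev x' \<and> \<tau> \<in> W \<and> \<beta> \<in> W \<and>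
     seg c c' (tw x) @ \<tau> @ word_inv (seg l l' (tw x')) @ \<beta> \<in> R \<and>
     mul (anc c' x) \<tau> = anc l' x' \<and> mul (anc l x') \<beta> = anc c x \<and>
     6 * length \<tau> < (c' - c) + length \<tau> + (l' - l) + length \<beta> \<and>
     6 * length \<beta> < (c' - c) + length \<tau> + (l' - l) + length \<beta>"

text \<open>Each geodesic side is at most half of the face and each rung less than a sixth, so more
  than a sixth remains for the side on \<open>x\<close>. The last four claims hold because levels
  change along a rung by no more than its length.\<close>

lemma sface_arc:
  assumes "sface x x' c c' l l' \<tau> \<beta>" and F: "F = (c' - c) + length \<tau> + (l' - l) + length \<beta>"
  shows "2 * (c' - c) \<le> F" "2 * (l' - l) \<le> F" "F < 6 * (c' - c)"
    "c \<le> l + length \<beta>" "l \<le> c + length \<beta>" "c' \<le> l' + length \<tau>" "l' \<le> c' + length \<tau>"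
proof -
  note s = assms(1)[unfolded sface_def]
  have "geo (seg c c' (tw x))" using geo_seg s by simp
  then show 1: "2 * (c' - c) \<le> F" using relator_geo[of "seg c c' (tw x)" "\<tau> @ word_inv (seg l l' (tw x')) @ \<beta>"] s F by simp
  have "geo (word_inv (seg l l' (tw x')))" using geo_inv geo_seg s by simp
  moreover have "word_inv (seg l l' (tw x')) @ \<beta> @ seg c c' (tw x) @ \<tau> \<in> R"
    using R_swap[of "seg c c' (tw x) @ \<tau>" "word_inv (seg l l' (tw x')) @ \<beta>"] s by simp
  ultimately show 2: "2 * (l' - l) \<le> F" using relator_geo[of "word_inv (seg l l' (tw x'))" "\<beta> @ seg c c' (tw x) @ \<tau>"] s F by simp
  show "F < 6 * (c' - c)" using 2 s F by linarith
  have G: "anc l x' \<in> G" "anc c' x \<in> G" "anc c x \<in> G" "anc l' x' \<in> G" using s by auto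
  have "dst (anc l x') (anc c x) \<le> length \<beta>" using dst_leI[OF G(1)] s by blast
  then show "c \<le> l + length \<beta>" "l \<le> c + length \<beta>"
    using lev_lip[OF G(1) G(3)] lev_lip[OF G(3) G(1)] dst_sym[OF G(1) G(3)] lev_anc s by auto
  have "dst (anc c' x) (anc l' x') \<le> length \<tau>" using dst_leI[OF G(2)] s by blast
  then show "c' \<le> l' + length \<tau>" "l' \<le> c' + length \<tau>"
    using lev_lip[OF G(2) G(4)] lev_lip[OF G(4) G(2)] dst_sym[OF G(2) G(4)] lev_anc s by auto
qed

text \<open>The relator read from the vertex of \<open>x\<close> at level \<open>h\<close>: up along
  \<open>x\<close>, over the upper rung, down along \<open>x'\<close>, over the lower rung and up to
  \<open>h\<close>. With it, two faces sharing an arc of \<open>x\<close> become two relators read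
  from the same vertex.\<close>

lemma sface_cycle:
  assumes sf: "sface x x' c c' l l' \<tau> \<beta>" and h: "c \<le> h" "h \<le> c'"
  defines "w \<equiv> seg h c' (tw x) @ \<tau> @ word_inv (seg l l' (tw x')) @ \<beta> @ seg c h (tw x)"
  shows "w \<in> R" "length w = (c' - c) + length \<tau> + (l' - l) + length \<beta>"
    "k \<le> l' - l \<Longrightarrow> mul (anc h x) (take ((c' - h) + length \<tau> + k) w) = anc (l' - k) x'"
    "mul (anc h x) (take (c' - h) w) = anc c' x"
    "mul (anc h x) (take (length w - (h - c)) w) = anc c x"
proof -
  note s = sf[unfolded sface_def]
  have seg: "seg c c' (tw x) = seg c h (tw x) @ seg h c' (tw x)" using seg_append[of c h c' "tw x"] h s by simp
  show wR: "w \<in> R"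
    using R_swap[of "seg c h (tw x)" "seg h c' (tw x) @ \<tau> @ word_inv (seg l l' (tw x')) @ \<beta>"] s seg by (simp add: w_def)
  show len: "length w = (c' - c) + length \<tau> + (l' - l) + length \<beta>" using s h by (simp add: w_def)
  have x: "x \<in> G" "x' \<in> G" using s by auto
  have W: "seg h c' (tw x) \<in> W" "seg l l' (tw x') \<in> W" "seg c h (tw x) \<in> W" "\<tau> \<in> W" "\<beta> \<in> W"
    using mul_seg(2) x s h by auto
  have up: "mul (anc h x) (seg h c' (tw x)) = anc c' x" using mul_seg(1)[OF x(1) h(2)] s by simp
  show "mul (anc h x) (take (c' - h) w) = anc c' x" using up s h by (simp add: w_def)
  have wW: "w \<in> W" using wR R_W by blast
  have tot: "mul (anc h x) w = anc h x" using mul_fix_iff[OF anc_G[OF x(1)] wW] relator_weq[OF wR] by simp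
  define k0 where "k0 = length w - (h - c)"
  define fr where "fr = seg h c' (tw x) @ \<tau> @ word_inv (seg l l' (tw x')) @ \<beta>"
  have "w = fr @ seg c h (tw x)" by (simp add: w_def fr_def)
  moreover have "length (seg c h (tw x)) = h - c" using s h by simp
  ultimately have "drop k0 w = seg c h (tw x)" by (simp add: k0_def)
  then have "mul (mul (anc h x) (take k0 w)) (seg c h (tw x)) = anc h x"
    using tot mul_append[OF anc_G[OF x(1), of h] W_take[OF wW, of k0], of "drop k0 w"] by (metis append_take_drop_id)
  also have "\<dots> = mul (anc c x) (seg c h (tw x))" using mul_seg(1)[OF x(1) h(1)] h s by simp
  finally have e: "mul (mul (anc h x) (take k0 w)) (seg c h (tw x)) = mul (anc c x) (seg c h (tw x))" .
  have "mul (anc h x) (take k0 w) = anc c x"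
    using mul_inv[OF mul_in_G[OF anc_G[OF x(1), of h] W_take[OF wW, of k0]] W(3)] mul_inv[OF anc_G[OF x(1), of c] W(3)]
    unfolding e by (rule trans[OF HOL.sym])
  then show "mul (anc h x) (take (length w - (h - c)) w) = anc c x" by (simp add: k0_def)
  assume k: "k \<le> l' - l"
  have sl: "seg l l' (tw x') = seg l (l' - k) (tw x') @ seg (l' - k) l' (tw x')"
  proof -
    have "l \<le> l' - k" "l' - k \<le> lev x'" using k s by linarith+
    then show ?thesis using seg_append[of l "l' - k" l' "tw x'"] by simp
  qed
  have "take ((c' - h) + length \<tau> + k) w = seg h c' (tw x) @ \<tau> @ word_inv (seg (l' - k) l' (tw x'))"
    using k s h unfolding w_def sl by simp
  then have "mul (anc h x) (take ((c' - h) + length \<tau> + k) w) = mul (anc l' x') (word_inv (seg (l' - k) l' (tw x')))"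
    using mul_append[OF anc_G[OF x(1)] W(1)] mul_append[OF anc_G[OF x(1)] W(4)] up s by simp
  also have "anc l' x' = mul (anc (l' - k) x') (seg (l' - k) l' (tw x'))" using mul_seg(1)[OF x(2), of "l' - k" l'] s by simp
  also have "mul \<dots> (word_inv (seg (l' - k) l' (tw x'))) = anc (l' - k) x'"
    by (rule mul_inv[OF anc_G[OF x(2)] mul_seg(2)[OF x(2)]]) (use s in auto)
  finally show "mul (anc h x) (take ((c' - h) + length \<tau> + k) w) = anc (l' - k) x'" .
qed

lemma sface_fellow_bound:
  assumes "x \<in> G" "x' \<in> G" "c \<le> c'" "c' \<le> lev x" "l \<le> l'" "l' \<le> lev x'" "\<tau> \<in> W" "\<beta> \<in> W"
    and R: "seg c c' (tw x) @ \<tau> @ word_inv (seg l l' (tw x')) @ \<beta> \<in> R"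
    and F: "F = (c' - c) + length \<tau> + (l' - l) + length \<beta>"
    and top: "mul (anc c' x) \<tau> = anc l' x'" and bot: "mul (anc l x') \<beta> = anc c x"
    and short: "6 * length \<beta> < F" "6 * length \<tau> < F \<or> length \<tau> \<le> 1"
    and fellow: "\<And>n. n \<le> lev x \<Longrightarrow> n \<le> lev x' \<Longrightarrow> dst (anc n x) (anc n x') \<le> \<delta>"
  shows "F \<le> 6 * \<delta> + 12"
proof -
  have G: "anc l x' \<in> G" "anc c' x \<in> G" "anc c x \<in> G" "anc l' x' \<in> G" using assms by auto
  have "dst (anc l x') (anc c x) \<le> length \<beta>" using dst_leI[OF G(1)] assms by blast
  then have b: "c \<le> l + length \<beta>" "l \<le> c + length \<beta>"
    using lev_lip[OF G(1) G(3)] lev_lip[OF G(3) G(1)] dst_sym[OF G(1) G(3)] lev_anc assms by auto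
  have "dst (anc c' x) (anc l' x') \<le> length \<tau>" using dst_leI[OF G(2)] assms by blast
  then have t: "c' \<le> l' + length \<tau>" "l' \<le> c' + length \<tau>"
    using lev_lip[OF G(2) G(4)] lev_lip[OF G(4) G(2)] dst_sym[OF G(2) G(4)] lev_anc assms by auto
  show ?thesis
  proof (rule ccontr)
    assume big: "\<not> ?thesis"
    define lo hi where "lo = max c l" and "hi = min c' l'"
    have gap: "2 * lo + F \<le> 2 * hi + 2 * length \<beta> + 2 * length \<tau>"
      using b t assms(3,5) F unfolding lo_def hi_def max_def min_def by (auto split: if_splits)
    have gap2: "lo + \<delta> + 2 \<le> hi" using gap short big by linarith
    then have le: "lo \<le> hi" by linarith
    define n where "n = (lo + hi) div 2"
    have n: "c \<le> n" "n \<le> c'" "l \<le> n" "n \<le> l'" "lo + hi \<le> 2 * n + 1" "2 * n \<le> lo + hi"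
      using le unfolding n_def lo_def hi_def by auto
    let ?u = "seg n c' (tw x) @ \<tau> @ word_inv (seg n l' (tw x'))"
    let ?v = "word_inv (seg l n (tw x')) @ \<beta> @ seg c n (tw x)"
    have "seg c c' (tw x) = seg c n (tw x) @ seg n c' (tw x)" "seg l l' (tw x') = seg l n (tw x') @ seg n l' (tw x')"
      using seg_append[of c n c' "tw x"] seg_append[of l n l' "tw x'"] n assms by auto
    then have "seg c n (tw x) @ (seg n c' (tw x) @ \<tau> @ word_inv (seg n l' (tw x')) @ word_inv (seg l n (tw x')) @ \<beta>) \<in> R"
      using R by simp
    from R_swap[OF this] have uv: "?u @ ?v \<in> R" by simp
    obtain v where v: "v \<in> W" "length v = dst (anc n x) (anc n x')" "mul (anc n x) v = anc n x'"
      using dst_word anc_G assms(1,2) by meson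
    have uW: "?u \<in> W" using R_W[OF uv] by simp
    have "mul (anc n x) ?u = anc n x'"
    proof -
      have "mul (anc n x) ?u = mul (mul (mul (anc n x) (seg n c' (tw x))) \<tau>) (word_inv (seg n l' (tw x')))"
        using uW anc_G[OF assms(1)] by (simp add: mul_append)
      also have "mul (mul (anc n x) (seg n c' (tw x))) \<tau> = mul (anc n x') (seg n l' (tw x'))"
        using mul_seg(1)[OF assms(1) n(2)] mul_seg(1)[OF assms(2) n(4)] top assms by simp
      also have "mul \<dots> (word_inv (seg n l' (tw x'))) = anc n x'"
        by (rule mul_inv) (use assms uW in auto)
      finally show ?thesis .
    qed
    then have "v \<doteq> ?u" using v mul_eq_iff[OF anc_G[OF assms(1)], of v ?u] uW by metis
    moreover have "length v \<le> \<delta>" using v(2) fellow[of n] n(2,4) assms(4,6) by simp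
    ultimately have "min (length ?u) (length ?v) \<le> \<delta>" using relator_isometric[OF uv v(1)] order_trans by blast
    moreover have "length ?u = (c' - n) + length \<tau> + (l' - n)" "length ?v = (n - l) + length \<beta> + (n - c)"
      using n assms by simp_all
    moreover have "2 * hi \<le> 2 * n + ((c' - n) + (l' - n))" "2 * n \<le> 2 * lo + ((n - l) + (n - c))"
      using n unfolding hi_def lo_def by auto
    ultimately have "2 * hi \<le> 2 * n + \<delta> \<or> 2 * n \<le> 2 * lo + \<delta>" by linarith
    then show False using n gap2 by linarith
  qed
qed

text \<open>The face sees its first branch only up to level \<open>d'\<close>, so it also is a face
  along any other vertex with the same ancestor at a higher level.\<close>

lemma sface_center:
  assumes "sface z z2 d d' e e' \<tau> \<beta>" "x \<in> G" "anc N x = anc N z" "d' \<le> N" "N \<le> lev x" "N \<le> lev z"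
  shows "sface x z2 d d' e e' \<tau> \<beta>"
proof -
  note s = assms(1)[unfolded sface_def]
  have "seg d d' (tw x) = seg d d' (tw z)" using seg_tw_eq[OF assms(2) _ assms(3,4)] s assms by blast
  moreover have "anc d x = anc d z" "anc d' x = anc d' z" using anc_eq_below[OF assms(2) _ assms(3)] s assms(4) by auto
  ultimately show ?thesis using s assms unfolding sface_def by auto
qed

text \<open>Two faces on either side of \<open>x\<close> share the arc between levels
  \<open>h\<close> and \<open>h'\<close>. If their words read from there were equal, they would
  trace the same cycle, and \<open>x1\<close> and \<open>x2\<close> would meet at a level where they
  are disjoint. So the words differ and the arc is a piece of both.\<close>

lemma sface_overlap:
  assumes s1: "sface x x1 c c' l l' \<tau> \<beta>" and s2: "sface x x2 d d' e e' \<tau>2 \<beta>2"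
    and h: "c \<le> h" "d \<le> h" "h < h'" "h' \<le> c'" "h' \<le> d'" and n: "n \<le> l" "n \<le> e"
    and dj: "\<And>m. n \<le> m \<Longrightarrow> m \<le> lev x1 \<Longrightarrow> m \<le> lev x2 \<Longrightarrow> anc m x1 \<noteq> anc m x2"
  shows "6 * (h' - h) < (c' - c) + length \<tau> + (l' - l) + length \<beta>"
    and "6 * (h' - h) < (d' - d) + length \<tau>2 + (e' - e) + length \<beta>2"
proof -
  note S1 = s1[unfolded sface_def] and S2 = s2[unfolded sface_def]
  have hc: "h \<le> c'" "h \<le> d'" using h by auto
  define w1 where "w1 = seg h c' (tw x) @ \<tau> @ word_inv (seg l l' (tw x1)) @ \<beta> @ seg c h (tw x)"
  define w2 where "w2 = seg h d' (tw x) @ \<tau>2 @ word_inv (seg e e' (tw x2)) @ \<beta>2 @ seg d h (tw x)"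
  note C1 = sface_cycle[OF s1 h(1) hc(1), folded w1_def] and C2 = sface_cycle[OF s2 h(2) hc(2), folded w2_def]
  let ?p = "seg h h' (tw x)"
  have lp: "length ?p = h' - h" using h S1 by simp
  have "seg h c' (tw x) = ?p @ seg h' c' (tw x)" "seg h d' (tw x) = ?p @ seg h' d' (tw x)"
    using seg_append[of h h' c' "tw x"] seg_append[of h h' d' "tw x"] h S1 by auto
  then obtain q1 q2 where q: "w1 = ?p @ q1" "w2 = ?p @ q2" by (simp add: w1_def w2_def)
  have "w1 \<noteq> w2"
  proof
    assume eq: "w1 = w2"
    define F where "F = length w1"
    have xG: "anc h x \<in> G" using S1 by simp
    have W: "w1 \<in> W" using C1(1) R_W by blast
    \<comment> \<open>The way round the other side of the cycle joins the same two vertices of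
      \<open>x\<close>, and \<open>x\<close> is geodesic. This is applied to stretches with one end
      from each face.\<close>
    have aux: "2 * ((b - h) + (h - a)) \<le> F"
      if ab: "a \<le> h" "h \<le> b" "b \<le> lev x" "2 * (b - h) \<le> F" "2 * (h - a) \<le> F"
        "mul (anc h x) (take (b - h) w1) = anc b x" "mul (anc h x) (take (F - (h - a)) w1) = anc a x" for a b
    proof -
      let ?i = "b - h" and ?j = "F - (h - a)"
      have ij: "?i \<le> ?j" using ab by linarith
      define u where "u = drop ?i (take ?j w1)"
      have "take ?j w1 = take ?i w1 @ u" unfolding u_def using ij by (metis append_take_drop_id min.absorb1 take_take)
      then have "mul (anc b x) u = anc a x" using ab(6,7) mul_append[OF xG W_take[OF W]] by metis
      moreover have "u \<in> W" unfolding u_def using W W_take W_drop by blast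
      moreover have "anc b x \<in> G" using S1 by simp
      ultimately have "dst (anc b x) (anc a x) \<le> length u" using dst_leI by blast
      also have "length u = ?j - ?i" using F_def by (simp add: u_def)
      finally have "b - a \<le> ?j - ?i" using dst_anc[of x a b] dst_sym S1 ab by simp
      moreover have "b - a = (b - h) + (h - a)" using ab by simp
      moreover have ar: "2 * (p + q) \<le> F" if "r \<le> F - q - p" "r = p + q" "p \<le> F - q" for p q r using that by simp
      ultimately show ?thesis by (intro ar[of "b - a"] ij)
    qed
    have F1: "F = (c' - c) + length \<tau> + (l' - l) + length \<beta>" using C1(2) by (simp add: F_def)
    have F2: "F = (d' - d) + length \<tau>2 + (e' - e) + length \<beta>2" using C2(2) eq by (simp add: F_def)
    note A1 = sface_arc[OF s1 F1] and A2 = sface_arc[OF s2 F2]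
    have sm: "2 * (c' - h) \<le> F" "2 * (h - d) \<le> F" "2 * (d' - h) \<le> F" "2 * (h - c) \<le> F"
      using A1(1) A2(1) h hc by linarith+
    have m1: "2 * ((c' - h) + (h - d)) \<le> F"
      by (rule aux[OF h(2) hc(1) _ sm(1,2) C1(4)]) (use S1 C2(5) eq F_def in simp_all)
    have m2: "2 * ((d' - h) + (h - c)) \<le> F"
      by (rule aux[OF h(1) hc(2) _ sm(3,4)]) (use S2 C1(5) C2(4) eq F_def in simp_all)
    let ?A1 = "(c' - h) + length \<tau>" and ?A2 = "(d' - h) + length \<tau>2"
    have "6 * length \<tau> < F" "6 * length \<beta> < F" "6 * length \<tau>2 < F" "6 * length \<beta>2 < F" using S1 S2 F1 F2 by auto
    moreover have "c' - c = (c' - h) + (h - c)" "d' - d = (d' - h) + (h - d)" using h hc by auto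
    moreover have ar: "P1 + t \<le> P2 + t2 + s2" if "F = (P2 + Q2) + t2 + s2 + b2" "6 * t < F" "6 * b2 < F" "2 * (P1 + Q2) \<le> F"
      for P1 P2 Q2 t t2 s2 b2 using that by simp
    \<comment> \<open>In the common word the stretches along \<open>x1\<close> and \<open>x2\<close>
      overlap. At position \<open>j\<close>, where the later one begins, both branches are at the
      same vertex.\<close>
    ultimately have le: "?A1 \<le> ?A2 + (e' - e)" "?A2 \<le> ?A1 + (l' - l)"
      using ar[of "d' - h" "h - d" "length \<tau>2" "e' - e" "length \<beta>2" "length \<tau>" "c' - h"]
        ar[of "c' - h" "h - c" "length \<tau>" "l' - l" "length \<beta>" "length \<tau>2" "d' - h"] F1 F2 m1 m2 by auto
    define j where "j = max ?A1 ?A2"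
    define k1 k2 where "k1 = j - ?A1" and "k2 = j - ?A2"
    have jj: "?A1 \<le> j" "?A2 \<le> j" "j \<le> (l' - l) + ?A1" "j \<le> (e' - e) + ?A2"
      using le unfolding j_def by (simp_all only: max.bounded_iff max.cobounded1 max.cobounded2 add.commute le_add1 le_add2 simp_thms)
    have k: "k1 \<le> l' - l" "k2 \<le> e' - e" "?A1 + k1 = j" "?A2 + k2 = j"
      using jj unfolding k1_def k2_def le_diff_conv by (simp_all only: le_add_diff_inverse)
    have "anc (l' - k1) x1 = anc (e' - k2) x2" using C1(3)[OF k(1)] C2(3)[OF k(2)] eq k(3,4) by simp
    moreover from this have "l' - k1 = e' - k2"
      using lev_anc[of x1 "l' - k1"] lev_anc[of x2 "e' - k2"] S1 S2 by (simp add: min_def split: if_splits)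
    moreover have "n \<le> l' - k1" "l' - k1 \<le> lev x1" "e' - k2 \<le> lev x2" using k(1) n(1) S1 S2 by linarith+
    ultimately show False using dj[of "l' - k1"] by simp
  qed
  then have "q1 \<noteq> q2" using q by auto
  have r: "?p @ q1 \<in> R" "?p @ q2 \<in> R" using C1(1) C2(1) q by auto
  have "6 * length ?p < length w1" using piece_length[OF r \<open>q1 \<noteq> q2\<close>] q(1) by simp
  then show "6 * (h' - h) < (c' - c) + length \<tau> + (l' - l) + length \<beta>" unfolding lp C1(2) .
  have "6 * length ?p < length w2" using piece_length[OF r(2,1)] \<open>q1 \<noteq> q2\<close> q(2) by simp
  then show "6 * (h' - h) < (d' - d) + length \<tau>2 + (e' - e) + length \<beta>2" unfolding lp C2(2) .
qed

text \<open>\<open>x\<close> and \<open>z\<close> represent the middle branch, \<open>x1\<close> and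
  \<open>x2\<close> its neighbours. Within the window every left face advances further along
  \<open>x1\<close> than along the middle, so the level difference \<open>l - c\<close> grows with
  each face, although it is bounded by \<open>\<Lambda>\<close> in absolute value.\<close>

lemma three_geodesics:
  assumes left: "\<And>k. k < K \<Longrightarrow> sface x x1 (c k) (c (Suc k)) (l k) (l (Suc k)) (\<tau> k) (\<beta> k)"
      "\<And>k. k < K \<Longrightarrow> (c (Suc k) - c k) + length (\<tau> k) + (l (Suc k) - l k) + length (\<beta> k) \<le> \<Lambda>"
      "c 0 < n" "lev x \<le> c K + \<Lambda>"
    and right: "\<And>k. k < M \<Longrightarrow> sface z x2 (d k) (d (Suc k)) (e k) (e (Suc k)) (\<tau>2 k) (\<beta>2 k)"
      "\<And>k. k < M \<Longrightarrow> (d (Suc k) - d k) + length (\<tau>2 k) + (e (Suc k) - e k) + length (\<beta>2 k) \<le> \<Lambda>"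
      "d 0 < n" "lev z \<le> d M + \<Lambda>"
    and G: "x \<in> G" "z \<in> G"
    and win: "N = n + 2 * \<Lambda> * \<Lambda> + 20 * \<Lambda> + 20" "N + \<Lambda> \<le> lev x" "N + \<Lambda> \<le> lev z" "anc N x = anc N z"
    and dj: "\<And>m. n \<le> m \<Longrightarrow> m \<le> lev x1 \<Longrightarrow> m \<le> lev x2 \<Longrightarrow> anc m x1 \<noteq> anc m x2"
  shows False
proof -
  have mono_c: "c k < c (Suc k)" "c (Suc k) \<le> c k + \<Lambda>" "l k < l (Suc k)" "c k \<le> l k + \<Lambda>" "l k \<le> c k + \<Lambda>"
    "c (Suc k) \<le> l (Suc k) + \<Lambda>" "l (Suc k) \<le> c (Suc k) + \<Lambda>" if "k < K" for k
  proof -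
    note s = left(1)[OF that, unfolded sface_def] and b = left(2)[OF that] and a = sface_arc(4-7)[OF left(1)[OF that] refl]
    show "c k < c (Suc k)" "l k < l (Suc k)" using s by blast+
    show "c (Suc k) \<le> c k + \<Lambda>" "c k \<le> l k + \<Lambda>" "l k \<le> c k + \<Lambda>" "c (Suc k) \<le> l (Suc k) + \<Lambda>" "l (Suc k) \<le> c (Suc k) + \<Lambda>"
      using b a by linarith+
  qed
  have mono_d: "d k < d (Suc k)" "d (Suc k) \<le> d k + \<Lambda>" "d k \<le> e k + \<Lambda>" if "k < M" for k
  proof -
    note s = right(1)[OF that, unfolded sface_def] and b = right(2)[OF that] and a = sface_arc(4-7)[OF right(1)[OF that] refl]
    show "d k < d (Suc k)" using s by blast
    show "d (Suc k) \<le> d k + \<Lambda>" "d k \<le> e k + \<Lambda>" using b a by linarith+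
  qed
  \<comment> \<open>A side on the middle branch exceeds a sixth of its face and every overlap stays
    below it, so neither of two opposite sides contains the other. Hence the left side is covered by
    two consecutive right ones and is shorter than a third of its face. The rungs take less than
    another third, which leaves more than a third for \<open>x1\<close>.\<close>
  have grow: "c (Suc k) + l k < l (Suc k) + c k" if k: "k < K" "n + 4 * \<Lambda> \<le> c k" "c (Suc k) + 4 * \<Lambda> \<le> N" for k
  proof -
    let ?F = "(c (Suc k) - c k) + length (\<tau> k) + (l (Suc k) - l k) + length (\<beta> k)"
    define Q where "Q i \<longleftrightarrow> c k < d i" for i
    have "Q M" using right(4) win(3) mono_c(1)[OF k(1)] k unfolding Q_def by linarith
    define i where "i = (LEAST i. Q i)"
    have Qi: "Q i" "i \<le> M" using LeastI[of Q M] Least_le[of Q M] \<open>Q M\<close> by (auto simp: i_def)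
    have "i \<noteq> 0" using Qi(1) right(3) k(2) unfolding Q_def by (metis le_add1 le_trans linorder_not_less less_imp_le)
    then obtain u where u: "i = Suc u" by (cases i) auto
    have nQ: "d u \<le> c k" using not_less_Least[of u Q] u unfolding i_def Q_def by auto
    have uM: "u < M" using Qi u by simp
    have du: "c k < d (Suc u)" using Qi u by (simp add: Q_def)
    have ru: "sface x x2 (d v) (d (Suc v)) (e v) (e (Suc v)) (\<tau>2 v) (\<beta>2 v)" if "v < M" "d (Suc v) \<le> N" for v
      by (rule sface_center[OF right(1)[OF that(1)] G(1) win(4) that(2)]) (use win in auto)
    have nl: "n \<le> l k" using mono_c(4)[OF k(1)] k by linarith
    have dN: "d (Suc u) \<le> N" using mono_d(2)[OF uM] nQ k mono_c(1)[OF k(1)] by linarith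
    have ne: "n \<le> e u" using mono_d(2,3)[OF uM] du k by linarith
    have lt: "d (Suc u) < c (Suc k)"
    proof (rule ccontr)
      assume "\<not> ?thesis"
      then have "6 * (c (Suc k) - c k) < ?F"
        using sface_overlap(1)[OF left(1)[OF k(1)] ru[OF uM dN], of "c k" "c (Suc k)" n] nQ nl ne dj mono_c(1)[OF k(1)] by auto
      then show False using sface_arc(3)[OF left(1)[OF k(1)] refl] by linarith
    qed
    have u1M: "Suc u < M"
    proof (rule ccontr)
      assume "\<not> ?thesis"
      then have "Suc u = M" using uM by simp
      then have "d (Suc u) = d M" by simp
      then show False using lt right(4) win(3) k by linarith
    qed
    have dN2: "d (Suc (Suc u)) \<le> N" using mono_d(2)[OF u1M] lt k by linarith
    have ne2: "n \<le> e (Suc u)" using mono_d(3)[OF u1M] du k by linarith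
    have ge: "c (Suc k) \<le> d (Suc (Suc u))"
    proof (rule ccontr)
      assume "\<not> ?thesis"
      then have "6 * (d (Suc (Suc u)) - d (Suc u)) < (d (Suc (Suc u)) - d (Suc u)) + length (\<tau>2 (Suc u)) + (e (Suc (Suc u)) - e (Suc u)) + length (\<beta>2 (Suc u))"
        using sface_overlap(2)[OF left(1)[OF k(1)] ru[OF u1M dN2], of "d (Suc u)" "d (Suc (Suc u))" n] du nl ne2 dj mono_d(1)[OF u1M] by auto
      then show False using sface_arc(3)[OF ru[OF u1M dN2] refl] by linarith
    qed
    have o1: "6 * (d (Suc u) - c k) < ?F"
      using sface_overlap(1)[OF left(1)[OF k(1)] ru[OF uM dN], of "c k" "d (Suc u)" n] nQ nl ne dj du lt by auto
    have o2: "6 * (c (Suc k) - d (Suc u)) < ?F"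
      using sface_overlap(1)[OF left(1)[OF k(1)] ru[OF u1M dN2], of "d (Suc u)" "c (Suc k)" n] du nl ne2 dj lt ge by auto
    have "6 * length (\<tau> k) < ?F" "6 * length (\<beta> k) < ?F" using left(1)[OF k(1)] by (auto simp: sface_def)
    then show ?thesis using o1 o2 du lt mono_c(1,3)[OF k(1)] by linarith
  qed
  define Q where "Q k \<longleftrightarrow> n + 4 * \<Lambda> \<le> c k" for k
  have "Q K" using left(4) win unfolding Q_def by linarith
  define k1 where "k1 = (LEAST k. Q k)"
  have Qk: "Q k1" "k1 \<le> K" using LeastI[of Q K] Least_le[of Q K] \<open>Q K\<close> by (auto simp: k1_def)
  have ck1: "c k1 \<le> n + 5 * \<Lambda>"
  proof (cases k1)
    case 0 then show ?thesis using left(3) by simp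
  next
    case (Suc k)
    then have "\<not> Q k" using not_less_Least[of k Q] unfolding k1_def by auto
    then show ?thesis using mono_c(2)[of k] Suc Qk unfolding Q_def by simp
  qed
  \<comment> \<open>A drift of \<open>2 * \<Lambda> + 1\<close> exceeds the range from
    \<open>-\<Lambda>\<close> to \<open>\<Lambda>\<close>. Each face uses up at most
    \<open>\<Lambda>\<close> levels, whence the quadratic term in the length of the window.\<close>
  have main: "i \<le> 2 * \<Lambda> + 1 \<Longrightarrow> k1 + i \<le> K \<and> c (k1 + i) \<le> n + 5 * \<Lambda> + i * \<Lambda> \<and> n + 4 * \<Lambda> \<le> c (k1 + i) \<and> c (k1 + i) + l k1 + i \<le> l (k1 + i) + c k1" for i
  proof (induction i)
    case 0 then show ?case using Qk ck1 unfolding Q_def by simp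
  next
    case (Suc i)
    let ?k = "k1 + i"
    have IH: "?k \<le> K" "c ?k \<le> n + 5 * \<Lambda> + i * \<Lambda>" "n + 4 * \<Lambda> \<le> c ?k" "c ?k + l k1 + i \<le> l ?k + c k1" using Suc by auto
    have "i * \<Lambda> \<le> 2 * \<Lambda> * \<Lambda>" using mult_le_mono1[of i "2 * \<Lambda>" \<Lambda>] Suc.prems by simp
    then have small: "c ?k + 5 * \<Lambda> + 1 \<le> N" using IH(2) win(1) by linarith
    have "?k \<noteq> K"
    proof
      assume "?k = K" then show False using left(4) win(2) small by simp
    qed
    then have kK: "?k < K" using IH(1) by simp
    have "c (Suc ?k) + l ?k < l (Suc ?k) + c ?k" using grow[OF kK IH(3)] mono_c(2)[OF kK] small by linarith
    then show ?case using kK IH mono_c(1,2)[OF kK] by auto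
  qed
  from main[of "2 * \<Lambda> + 1"] have fin: "k1 + (2 * \<Lambda> + 1) \<le> K" "c (k1 + (2 * \<Lambda> + 1)) + l k1 + (2 * \<Lambda> + 1) \<le> l (k1 + (2 * \<Lambda> + 1)) + c k1" by auto
  have "c k1 \<le> l k1 + \<Lambda>" using mono_c(4)[of k1] fin(1) by simp
  moreover have "l (k1 + (2 * \<Lambda> + 1)) \<le> c (k1 + (2 * \<Lambda> + 1)) + \<Lambda>"
    using mono_c(7)[of "k1 + 2 * \<Lambda>"] fin(1) by simp
  ultimately show False using fin(2) by linarith
qed

end

section \<open>From ladders to ancestor counts\<close>

context rooted
begin

lemma mul_seg_inv: assumes "x \<in> G" "i \<le> j" "j \<le> lev x"
  shows "mul (anc j x) (word_inv (seg i j (tw x))) = anc i x"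
  using mul_inv[OF anc_G[OF assms(1)] mul_seg(2)[OF assms], of i] mul_seg(1)[OF assms] by simp

text \<open>Both tree paths are cut at their last common level \<open>s\<close>, which is below
  \<open>n\<close>. Points at different levels differ, and so do points of the two branches at the
  same level above \<open>s\<close>; so the loop closed by the edge is simple and carries a
  ladder.\<close>

lemma ladder_sfaces:
  assumes adj: "adj x y" and n: "n \<le> lev x" "n \<le> lev y" "anc n x \<noteq> anc n y"
    and fellow: "\<And>n. n \<le> lev y \<Longrightarrow> n \<le> lev x \<Longrightarrow> dst (anc n y) (anc n x) \<le> \<delta>"
  shows "\<exists>K c l \<tau> \<beta>. c 0 < n \<and> lev y \<le> c K + (6 * \<delta> + 12) \<and>
     (\<forall>k<K. sface y x (c k) (c (Suc k)) (l k) (l (Suc k)) (\<tau> k) (\<beta> k) \<and>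
        (c (Suc k) - c k) + length (\<tau> k) + (l (Suc k) - l k) + length (\<beta> k) \<le> 6 * \<delta> + 12)"
proof -
  obtain t where t: "t \<in> Ltr" "y = mul x [t]" and x: "x \<in> G" using adj by (auto simp: adj_def)
  have y: "y \<in> G" using adj_G[OF adj] by simp
  define m where "m = (LEAST m. anc m x \<noteq> anc m y)"
  have m: "anc m x \<noteq> anc m y" "m \<le> n" using LeastI[of "\<lambda>m. anc m x \<noteq> anc m y" n] Least_le[of "\<lambda>m. anc m x \<noteq> anc m y" n] n by (auto simp: m_def)
  have m0: "0 < m" using m x y by (cases m) auto
  define s where "s = m - 1"
  have s: "Suc s = m" "anc s x = anc s y" "s < n"
    using m0 m not_less_Least[of s "\<lambda>m. anc m x \<noteq> anc m y"] by (auto simp: s_def m_def[symmetric])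
  have above: "anc k x \<noteq> anc k y" if "s < k" for k using anc_eq_below[OF x y, of k m] m(1) s that by auto
  have sl: "s < lev x" "s < lev y" using s n by auto
  define a b where "a = drop s (tw x)" and "b = drop s (tw y)"
  have asg: "a = seg s (lev x) (tw x)" "b = seg s (lev y) (tw y)" by (simp_all add: a_def b_def seg_def)
  have ga: "geo a" "geo b" unfolding asg using geo_seg x y sl by auto
  have la: "length a = lev x - s" "length b = lev y - s" by (simp_all add: a_def b_def)
  have W: "a \<in> W" "b \<in> W" using ga geo_W by auto
  let ?g = "anc s x" and ?w = "a @ t # word_inv b"
  have gG: "?g \<in> G" using x by simp
  have ma: "mul ?g a = x" unfolding asg using mul_seg(1)[OF x, of s "lev x"] sl by simp
  have mb: "mul ?g b = y" unfolding asg s(2) using mul_seg(1)[OF y, of s "lev y"] sl by simp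
  note ma = ma mb
  have mat: "mul ?g (a @ [t]) = y" using mul_append[OF gG W(1)] ma t by simp
  have eq: "a @ [t] \<doteq> b" using mat ma mul_eq_iff[OF gG, of "a @ [t]" b] W t by simp
  have pos1: "mul ?g (take j ?w) = anc (s + j) x" if "j \<le> length a" for j
  proof -
    have "take j ?w = seg s (s + j) (tw x)" using that by (simp add: a_def seg_def take_drop add.commute)
    then show ?thesis using mul_seg(1)[OF x, of s "s + j"] that la sl by simp
  qed
  have pos2: "mul ?g (take (length a + 1 + i) ?w) = anc (lev y - i) y" if "i \<le> length b" for i
  proof -
    have le: "s \<le> lev y - i" "lev y - i \<le> lev y" using that la sl by auto
    have bs: "b = seg s (lev y - i) (tw y) @ seg (lev y - i) (lev y) (tw y)"
      unfolding asg using seg_append[of s "lev y - i" "lev y" "tw y"] le by simp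
    have "length (seg (lev y - i) (lev y) (tw y)) = i" using that la by simp
    then have "take i (word_inv b) = word_inv (seg (lev y - i) (lev y) (tw y))" by (subst bs) simp
    then have "take (length a + 1 + i) ?w = (a @ [t]) @ word_inv (seg (lev y - i) (lev y) (tw y))" by simp
    then have "mul ?g (take (length a + 1 + i) ?w) = mul y (word_inv (seg (lev y - i) (lev y) (tw y)))"
      using mul_append[OF gG, of "a @ [t]"] W t mat by simp
    then show ?thesis using mul_seg_inv[OF y le(2)] by simp
  qed
  have simple: "\<not> take j ?w \<doteq> take k ?w" if jk: "j < k" "k < length ?w" for j k
  proof
    assume e: "take j ?w \<doteq> take k ?w"
    have wW: "?w \<in> W" using W t by simp
    have e: "mul ?g (take j ?w) = mul ?g (take k ?w)" using e mul_eq_iff[OF gG W_take[OF wW] W_take[OF wW]] by blast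
    consider "k \<le> length a" | "j \<le> length a" "length a < k" | "length a < j" by linarith
    then show False
    proof cases
      case 1
      then have "anc (s + j) x = anc (s + k) x" using e pos1[of j] pos1[of k] jk by simp
      from arg_cong[OF this, of lev] show False using lev_anc[OF x] 1 la jk by simp
    next
      case 2
      define i where "i = k - length a - 1"
      have i: "k = length a + 1 + i" "i < length b" using 2 jk by (auto simp: i_def)
      have e2: "anc (s + j) x = anc (lev y - i) y" using e pos1[OF 2(1)] pos2[of i] i by simp
      from arg_cong[OF this, of lev] have "s + j = lev y - i" using lev_anc[OF x] lev_anc[OF y] 2 la sl by (simp add: min_absorb1)
      moreover have "s < lev y - i" using i la by simp
      ultimately show False using above[of "s + j"] e2 by simp
    next
      case 3
      define i i' where "i = k - length a - 1" and "i' = j - length a - 1"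
      have i: "k = length a + 1 + i" "i < length b" "j = length a + 1 + i'" "i' < i" using 3 jk by (auto simp: i_def i'_def)
      have "anc (lev y - i') y = anc (lev y - i) y" using e pos2[of i] pos2[of i'] i by simp
      from arg_cong[OF this, of lev] show False using lev_anc[OF y] i la by simp
    qed
  qed
  have "a \<noteq> []" "b \<noteq> []" using la sl by auto
  then obtain K lf cf rf where L: "lf 0 = 0" "cf 0 = 0" "rf 0 = []" "ladder a b t K lf cf rf"
    using geodesic_triangle_ladder[OF ga t(1) eq] simple by blast
  define c l where "c k = s + cf k" and "l k = s + lf k" for k
  have LF: "l k < l (Suc k)" "c k < c (Suc k)" "l (Suc k) \<le> lev x" "c (Suc k) \<le> lev y"
    "seg (l k) (l (Suc k)) (tw x) @ rf (Suc k) @ word_inv (seg (c k) (c (Suc k)) (tw y)) @ word_inv (rf k) \<in> R"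
    "6 * length (rf k) < (l (Suc k) - l k) + length (rf (Suc k)) + (c (Suc k) - c k) + length (rf k)"
    "6 * length (rf (Suc k)) < (l (Suc k) - l k) + length (rf (Suc k)) + (c (Suc k) - c k) + length (rf k)" if "k < K" for k
  proof -
    have "ladder_face a b (lf k) (cf k) (rf k) (lf (Suc k)) (cf (Suc k)) (rf (Suc k))" using L(4) that by (simp add: ladder_def)
    note h = this[unfolded ladder_face_def la a_def b_def seg_drop]
    show "l k < l (Suc k)" "c k < c (Suc k)" "l (Suc k) \<le> lev x" "c (Suc k) \<le> lev y"
      using h sl by (auto simp: c_def l_def)
    show "seg (l k) (l (Suc k)) (tw x) @ rf (Suc k) @ word_inv (seg (c k) (c (Suc k)) (tw y)) @ word_inv (rf k) \<in> R"
      using h by (simp add: c_def l_def)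
    show "6 * length (rf k) < (l (Suc k) - l k) + length (rf (Suc k)) + (c (Suc k) - c k) + length (rf k)"
      "6 * length (rf (Suc k)) < (l (Suc k) - l k) + length (rf (Suc k)) + (c (Suc k) - c k) + length (rf k)"
      using h unfolding c_def l_def by linarith+
  qed
  have LT: "l K \<le> lev x" "c K \<le> lev y"
    "seg (l K) (lev x) (tw x) @ t # word_inv (seg (c K) (lev y) (tw y)) @ word_inv (rf K) \<in> R"
    "6 * length (rf K) < (lev x - l K) + 1 + (lev y - c K) + length (rf K)"
  proof -
    have h: "ladder_top a b t (lf K) (cf K) (rf K)" using L(4) by (simp add: ladder_def)
    note h = this[unfolded ladder_top_def]
    have sx: "seg (lf K) (length a) a = seg (l K) (lev x) (tw x)" "seg (cf K) (length b) b = seg (c K) (lev y) (tw y)"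
      using sl unfolding la unfolding a_def b_def seg_drop by (simp_all add: c_def l_def)
    show "l K \<le> lev x" "c K \<le> lev y" using h sl la by (auto simp: c_def l_def)
    show "seg (l K) (lev x) (tw x) @ t # word_inv (seg (c K) (lev y) (tw y)) @ word_inv (rf K) \<in> R"
      using h unfolding sx by simp
    show "6 * length (rf K) < (lev x - l K) + 1 + (lev y - c K) + length (rf K)" using h la by (simp add: c_def l_def)
  qed
  have rung: "k \<le> K \<Longrightarrow> rf k \<in> W \<and> mul (anc (l k) x) (rf k) = anc (c k) y" for k
  proof (induction k)
    case 0 then show ?case using L(1-3) s(2) y x by (simp add: c_def l_def)
  next
    case (Suc k)
    then have k: "k < K" and IH: "rf k \<in> W" "mul (anc (l k) x) (rf k) = anc (c k) y" by auto
    let ?u = "seg (l k) (l (Suc k)) (tw x)" and ?v = "seg (c k) (c (Suc k)) (tw y)"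
    have RW: "rf (Suc k) \<in> W" using R_W[OF LF(5)[OF k]] by simp
    have uW: "?u \<in> W" "?v \<in> W" using mul_seg(2)[OF x] mul_seg(2)[OF y] LF[OF k] by auto
    have "(?u @ rf (Suc k)) @ word_inv (rf k @ ?v) \<doteq> []" using relator_weq[OF LF(5)[OF k]] by simp
    then have "?u @ rf (Suc k) \<doteq> rf k @ ?v" using weq_iff_trivial[of "rf k @ ?v"] IH uW by simp
    then have "mul (anc (l k) x) (?u @ rf (Suc k)) = mul (anc (l k) x) (rf k @ ?v)"
      using mul_eq_iff[OF anc_G[OF x]] IH uW RW by simp
    moreover have "mul (anc (l k) x) ?u = anc (l (Suc k)) x" "mul (anc (c k) y) ?v = anc (c (Suc k)) y"
      using mul_seg(1)[OF x] mul_seg(1)[OF y] LF[OF k] by auto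
    ultimately show ?case using mul_append[OF anc_G[OF x]] IH uW RW by simp
  qed
  have sf: "sface y x (c k) (c (Suc k)) (l k) (l (Suc k)) (word_inv (rf (Suc k))) (rf k)" if k: "k < K" for k
  proof -
    have r: "rf k \<in> W" "mul (anc (l k) x) (rf k) = anc (c k) y" "rf (Suc k) \<in> W" "mul (anc (l (Suc k)) x) (rf (Suc k)) = anc (c (Suc k)) y"
      using rung[of k] rung[of "Suc k"] k by auto
    have "mul (anc (c (Suc k)) y) (word_inv (rf (Suc k))) = anc (l (Suc k)) x" using mul_inv[OF anc_G[OF x] r(3)] r(4) by metis
    moreover have "rf k @ (seg (c k) (c (Suc k)) (tw y) @ word_inv (rf (Suc k)) @ word_inv (seg (l k) (l (Suc k)) (tw x))) \<in> R"
      using R_inv[OF LF(5)[OF k]] by simp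
    from R_swap[OF this] have "seg (c k) (c (Suc k)) (tw y) @ word_inv (rf (Suc k)) @ word_inv (seg (l k) (l (Suc k)) (tw x)) @ rf k \<in> R" by simp
    ultimately show ?thesis using r LF[OF k] x y unfolding sface_def by (simp add: add.commute add.left_commute)
  qed
  have bound: "(c (Suc k) - c k) + length (word_inv (rf (Suc k))) + (l (Suc k) - l k) + length (rf k) \<le> 6 * \<delta> + 12" if k: "k < K" for k
    using sf[OF k] unfolding sface_def
    by (intro sface_fellow_bound[OF y x, of "c k" "c (Suc k)" "l k" "l (Suc k)" "word_inv (rf (Suc k))" "rf k"] fellow) (auto simp: less_imp_le)
  have top: "(lev y - c K) + length [letter_inv t] + (lev x - l K) + length (rf K) \<le> 6 * \<delta> + 12"
  proof (rule sface_fellow_bound[OF y x LT(2) order_refl LT(1) order_refl _ _ _ refl _ _ _ _ fellow])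
    show "[letter_inv t] \<in> W" "rf K \<in> W" using t rung[of K] by auto
    have "rf K @ (seg (c K) (lev y) (tw y) @ [letter_inv t] @ word_inv (seg (l K) (lev x) (tw x))) \<in> R"
      using R_inv[OF LT(3)] by simp
    from R_swap[OF this] show "seg (c K) (lev y) (tw y) @ [letter_inv t] @ word_inv (seg (l K) (lev x) (tw x)) @ rf K \<in> R" by simp
    show "mul (anc (lev y) y) [letter_inv t] = anc (lev x) x" using mul_inv_letter[OF x t(1)] t(2) by simp
    show "mul (anc (l K) x) (rf K) = anc (c K) y" using rung[of K] by simp
    show "6 * length (rf K) < lev y - c K + length [letter_inv t] + (lev x - l K) + length (rf K)" using LT(4) by simp
  qed auto
  have "lev y \<le> c K + (6 * \<delta> + 12)" using top LT(2) by simp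
  moreover have "c 0 < n" using L s by (simp add: c_def)
  ultimately show ?thesis using sf bound
    by (intro exI[of _ K] exI[of _ c] exI[of _ l] exI[of _ "\<lambda>k. word_inv (rf (Suc k))"] exI[of _ rf]) auto
qed

text \<open>Room for \<open>2 * \<Lambda> + 1\<close> faces of at most \<open>\<Lambda>\<close>
  levels each, plus margins at both ends; compare \<open>three_geodesics\<close>.\<close>

definition win :: "nat \<Rightarrow> nat" where "win \<Lambda> = 2 * \<Lambda> * \<Lambda> + 20 * \<Lambda> + 20"

text \<open>The edges to the two neighbouring strands may leave the middle strand from different
  vertices \<open>x\<close> and \<open>z\<close>; these only have to share their ancestor at the top
  of the window.\<close>

lemma no_triple:
  assumes fellow: "\<And>y y' n. y \<in> B \<Longrightarrow> y' \<in> B \<Longrightarrow> n \<le> lev y \<Longrightarrow> n \<le> lev y' \<Longrightarrow> dst (anc n y) (anc n y') \<le> \<delta>"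
    and L: "\<Lambda> = 6 * \<delta> + 12" and lev: "\<And>y. y \<in> B \<Longrightarrow> n + win \<Lambda> + \<Lambda> \<le> lev y" and BG: "B \<subseteq> G"
    and B: "x1 \<in> B" "x \<in> B" "z \<in> B" "x2 \<in> B" and adj: "adj x1 x" "adj x2 z"
    and N: "anc (n + win \<Lambda>) x = anc (n + win \<Lambda>) z"
    and ne: "anc n x1 \<noteq> anc n x" "anc n x2 \<noteq> anc n z" "anc n x1 \<noteq> anc n x2"
  shows False
proof -
  have G: "x1 \<in> G" "x \<in> G" "z \<in> G" "x2 \<in> G" using BG B by auto
  have lv: "n \<le> lev y" if "y \<in> B" for y using lev[OF that] by simp
  obtain K c l \<tau> \<beta> where left: "c 0 < n" "lev x \<le> c K + \<Lambda>"
     "\<forall>k<K. sface x x1 (c k) (c (Suc k)) (l k) (l (Suc k)) (\<tau> k) (\<beta> k) \<and>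
        (c (Suc k) - c k) + length (\<tau> k) + (l (Suc k) - l k) + length (\<beta> k) \<le> \<Lambda>"
    using ladder_sfaces[OF adj(1) lv[OF B(1)] lv[OF B(2)] ne(1) fellow[OF B(2,1)]] unfolding L by blast
  obtain M d e \<tau>2 \<beta>2 where right: "d 0 < n" "lev z \<le> d M + \<Lambda>"
     "\<forall>k<M. sface z x2 (d k) (d (Suc k)) (e k) (e (Suc k)) (\<tau>2 k) (\<beta>2 k) \<and>
        (d (Suc k) - d k) + length (\<tau>2 k) + (e (Suc k) - e k) + length (\<beta>2 k) \<le> \<Lambda>"
    using ladder_sfaces[OF adj(2) lv[OF B(4)] lv[OF B(3)] ne(2) fellow[OF B(3,4)]] unfolding L by blast
  have dj: "anc m x1 \<noteq> anc m x2" if "n \<le> m" for m using anc_eq_below[OF G(1,4) _ that] ne(3) by auto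
  show False
    using three_geodesics[of K x x1 c l \<tau> \<beta> \<Lambda> n M z x2 d e \<tau>2 \<beta>2 "n + win \<Lambda>"] left right G lev[OF B(2)] lev[OF B(3)] N dj
    by (simp add: win_def)
qed

text \<open>Going down, the number of ancestors can only drop, so it is constant over one of \<open>V + 1\<close> consecutive
  windows; were it at least three there, three neighbouring strands would stay disjoint over that window.\<close>
lemma few_ancestors:
  assumes fellow: "\<And>y y' n. y \<in> B \<Longrightarrow> y' \<in> B \<Longrightarrow> n \<le> lev y \<Longrightarrow> n \<le> lev y' \<Longrightarrow> dst (anc n y) (anc n y') \<le> \<delta>"
    and L: "\<Lambda> = 6 * \<delta> + 12" and lev: "\<And>y. y \<in> B \<Longrightarrow> n + (V + 1) * win \<Lambda> + \<Lambda> \<le> lev y" and BG: "B \<subseteq> G"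
    and fin: "finite B" "card B \<le> V"
    and conn: "\<And>U. U \<subseteq> B \<Longrightarrow> U \<noteq> {} \<Longrightarrow> U \<noteq> B \<Longrightarrow> \<exists>y\<in>U. \<exists>y'\<in>B - U. adj y y'"
  shows "card (anc n ` B) \<le> 2"
proof -
  define T where "T i = anc (n + i * win \<Lambda>) ` B" for i
  have down: "anc (n + i * win \<Lambda>) ` T j = T i" if "i \<le> j" for i j
  proof -
    have "anc (n + i * win \<Lambda>) (anc (n + j * win \<Lambda>) y) = anc (n + i * win \<Lambda>) y" if "y \<in> B" for y
      using anc_anc[of y] BG that \<open>i \<le> j\<close> by auto
    then show ?thesis unfolding T_def image_image by (intro image_cong) auto
  qed
  have finT: "finite (T i)" for i using fin by (simp add: T_def)
  have mono: "card (T i) \<le> card (T j)" if "i \<le> j" for i j using down[OF that] card_image_le[OF finT] by metis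
  have "\<exists>i\<le>V. card (T i) = card (T (Suc i))"
  proof (rule ccontr)
    assume "\<not> ?thesis"
    then have lt: "card (T i) < card (T (Suc i))" if "i \<le> V" for i using mono[of i "Suc i"] that by force
    have "i \<le> Suc V \<Longrightarrow> i \<le> card (T i)" for i by (induction i) (use lt in fastforce)+
    then have "Suc V \<le> card (T (Suc V))" by blast
    moreover have "card (T (Suc V)) \<le> card B" unfolding T_def by (rule card_image_le[OF fin(1)])
    ultimately show False using fin(2) by simp
  qed
  then obtain i where i: "i \<le> V" "card (T i) = card (T (Suc i))" by blast
  define n' where "n' = n + i * win \<Lambda>"
  have n'S: "n + Suc i * win \<Lambda> = n' + win \<Lambda>" by (simp add: n'_def)
  \<comment> \<open>Equal cardinalities make the passage down injective, so vertices with the same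
    ancestor at the bottom of the window already have the same one at its top.\<close>
  have inj: "inj_on (anc n') (T (Suc i))"
    using eq_card_imp_inj_on[OF finT, of "anc n'" "Suc i"] down[of i "Suc i"] i(2) by (simp add: n'_def)
  have lev': "n' + win \<Lambda> + \<Lambda> \<le> lev y" if "y \<in> B" for y
  proof -
    have "Suc i * win \<Lambda> \<le> (V + 1) * win \<Lambda>" using i(1) by (intro mult_le_mono1) simp
    then have "i * win \<Lambda> + win \<Lambda> \<le> (V + 1) * win \<Lambda>" by simp
    moreover define q where "q = (V + 1) * win \<Lambda>"
    ultimately show ?thesis using lev[OF that] unfolding n'_def q_def[symmetric] by linarith
  qed
  have up: "anc (n' + win \<Lambda>) y = anc (n' + win \<Lambda>) z" if "y \<in> B" "z \<in> B" "anc n' y = anc n' z" for y z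
  proof (rule inj_onD[OF inj])
    show "anc (n' + win \<Lambda>) y \<in> T (Suc i)" "anc (n' + win \<Lambda>) z \<in> T (Suc i)" using that unfolding T_def n'S by auto
    show "anc n' (anc (n' + win \<Lambda>) y) = anc n' (anc (n' + win \<Lambda>) z)"
      using that BG anc_anc[of y n' "n' + win \<Lambda>"] anc_anc[of z n' "n' + win \<Lambda>"] by (simp add: subset_iff)
  qed
  have "card (T i) \<le> 2"
  proof (rule ccontr)
    assume big: "\<not> card (T i) \<le> 2"
    have Ti: "T i = anc n' ` B" by (simp add: T_def n'_def)
    then obtain y0 where y0: "y0 \<in> B" using big by (metis card.empty ex_in_conv image_empty zero_le)
    \<comment> \<open>One edge leaves the class of \<open>y0\<close> for a second class, another
      leaves the union of these two for a third. The class containing \<open>z\<close> is the middle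
      strand.\<close>
    let ?U = "{y \<in> B. anc n' y = anc n' y0}"
    have "?U \<noteq> B"
    proof
      assume "?U = B"
      then have "anc n' ` B \<subseteq> {anc n' y0}" by blast
      then show False using big Ti card_mono[of "{anc n' y0}" "anc n' ` B"] by simp
    qed
    moreover have "?U \<noteq> {}" using y0 by blast
    ultimately obtain y y' where yy: "y \<in> ?U" "y' \<in> B - ?U" "adj y y'" using conn[of ?U] by blast
    let ?U2 = "{z \<in> B. anc n' z = anc n' y \<or> anc n' z = anc n' y'}"
    have "?U2 \<noteq> B"
    proof
      assume "?U2 = B"
      then have "anc n' ` B \<subseteq> {anc n' y, anc n' y'}" by blast
      then have "card (anc n' ` B) \<le> card {anc n' y, anc n' y'}" by (intro card_mono) auto
      also have "\<dots> \<le> 2" by (simp add: card_insert_if)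
      finally show False using big Ti by simp
    qed
    moreover have "?U2 \<noteq> {}" using yy by blast
    ultimately obtain z z' where zz: "z \<in> ?U2" "z' \<in> B - ?U2" "adj z z'" using conn[of ?U2] by blast
    have ne: "anc n' y \<noteq> anc n' y'" using yy by auto
    from zz(1) consider "anc n' z = anc n' y" | "anc n' z = anc n' y'" by blast
    then show False
    proof cases
      case 1
      show False
        by (rule no_triple[OF fellow L lev' BG, of y' y z z']) (use yy zz 1 ne up[of y z] adj_sym in auto)
    next
      case 2
      show False
        by (rule no_triple[OF fellow L lev' BG, of y y' z z']) (use yy zz 2 ne up[of y' z] adj_sym in auto)
    qed
  qed
  then show ?thesis using mono[of 0 i] by (simp add: T_def)
qed

text \<open>Geodesics from the centre stay in the ball, so a subset closed under adjacency in the
  ball and containing the centre is the whole ball. This applies to \<open>U\<close> or to its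
  complement.\<close>

lemma ball_connected:
  assumes z: "z \<in> G" and U: "U \<subseteq> {y \<in> G. dst z y \<le> L}" "U \<noteq> {}" "U \<noteq> {y \<in> G. dst z y \<le> L}"
  shows "\<exists>y\<in>U. \<exists>y'\<in>{y \<in> G. dst z y \<le> L} - U. adj y y'"
proof (rule ccontr)
  assume no: "\<not> ?thesis"
  let ?B = "{y \<in> G. dst z y \<le> L}"
  have reach: "z \<in> V \<Longrightarrow> y \<in> V" if V: "V \<subseteq> ?B" "\<And>u v. u \<in> V \<Longrightarrow> v \<in> ?B \<Longrightarrow> adj u v \<Longrightarrow> v \<in> V" and y: "y \<in> ?B" for V y
  proof -
    assume zV: "z \<in> V"
    obtain w where w: "w \<in> W" "length w = dst z y" "mul z w = y" using dst_word[OF z, of y] y by blast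
    have "k \<le> length w \<Longrightarrow> mul z (take k w) \<in> V" for k
    proof (induction k)
      case (Suc k)
      let ?u = "mul z (take k w)"
      have u: "?u \<in> V" "?u \<in> G" using Suc V(1) by auto
      have e: "mul z (take (Suc k) w) = mul ?u [w ! k]"
        using Suc.prems mul_append[OF z W_take[OF w(1)]] by (simp add: take_Suc_conv_app_nth)
      have "adj ?u (mul ?u [w ! k])" unfolding adj_def using u W_nth[OF w(1)] Suc.prems by auto
      moreover have "dst z (mul z (take (Suc k) w)) \<le> L"
        using dst_le[OF z W_take[OF w(1), of "Suc k"]] Suc.prems w y by simp
      moreover have "mul z (take (Suc k) w) \<in> G" using z W_take[OF w(1)] by blast
      ultimately show ?case using V(2)[OF u(1)] e by auto
    qed (use zV z in simp)
    from this[of "length w"] show "y \<in> V" using w by simp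
  qed
  have cl: "v \<in> U" if "u \<in> U" "v \<in> ?B" "adj u v" for u v using no that by blast
  have cl2: "v \<in> ?B - U" if "u \<in> ?B - U" "v \<in> ?B" "adj u v" for u v using cl[of v u] that adj_sym by blast
  have zB: "z \<in> ?B" using z by simp
  show False
  proof (cases "z \<in> U")
    case True
    have "y \<in> U" if "y \<in> ?B" for y using reach[of U y] U(1) cl that True by blast
    then have "?B \<subseteq> U" by blast
    then show False using U(1,3) by (metis subset_antisym)
  next
    case False
    have "y \<in> ?B - U" if "y \<in> ?B" for y using reach[of "?B - U" y] cl2 that False zB by blast
    then have "u \<notin> U" for u using U(1) by blast
    then show False using U(2) by (metis ex_in_conv)
  qed
qed

end

section \<open>Morse geodesics\<close>

context presentation
begin

abbreviation "P \<equiv> cayley_points S R"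
abbreviation "D \<equiv> cayley_dist S R"

lemma fst_point [simp]: "p \<in> P \<Longrightarrow> fst p \<in> G" by (auto simp: cayley_points_def)

lemma vertex_point: "g \<in> G \<Longrightarrow> (g, None, 0) \<in> P" by (auto simp: cayley_points_def)

lemma ends_near: assumes "p \<in> P" "(x, a) \<in> cayley_ends S R p"
  shows "x \<in> G" "dst (fst p) x \<le> 1" "0 \<le> a" "a \<le> 1"
proof -
  have *: "dst g (mul g [(s, True)]) \<le> 1" "mul g [(s, True)] \<in> G" if "g \<in> G" "s \<in> S" for g s
    using dst_le[of g "[(s, True)]"] that by (auto simp: Ltr_def)
  show "x \<in> G" "dst (fst p) x \<le> 1" "0 \<le> a" "a \<le> 1"
    using assms * by (auto simp: cayley_points_def cayley_ends_def gen_mult_eq)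
qed

lemma through_dst: assumes p: "p \<in> P" and q: "q \<in> P"
  shows "\<bar>cayley_through S R p q - real (dst (fst p) (fst q))\<bar> \<le> 2"
proof -
  let ?A = "{a + real (dst x y) + b | x a y b. (x, a) \<in> cayley_ends S R p \<and> (y, b) \<in> cayley_ends S R q}"
  have fe: "finite (cayley_ends S R p)" "finite (cayley_ends S R q)" by (auto simp: cayley_ends_def split: prod.split option.split)
  have "?A = (\<lambda>((x, a), (y, b)). a + real (dst x y) + b) ` (cayley_ends S R p \<times> cayley_ends S R q)"
    by (intro equalityI subsetI) (force simp: image_iff)+
  then have fin: "finite ?A" using fe by simp
  have "\<exists>t. (fst p, t) \<in> cayley_ends S R p" "\<exists>t. (fst q, t) \<in> cayley_ends S R q"
    using p q by (auto simp: cayley_points_def cayley_ends_def)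
  then obtain t t' where t: "(fst p, t) \<in> cayley_ends S R p" "(fst q, t') \<in> cayley_ends S R q" by blast
  have m: "t + real (dst (fst p) (fst q)) + t' \<in> ?A" using t by blast
  then have "Min ?A \<le> t + real (dst (fst p) (fst q)) + t'" using fin by simp
  then have up: "Min ?A \<le> real (dst (fst p) (fst q)) + 2" using ends_near[OF p t(1)] ends_near[OF q t(2)] by linarith
  have "Min ?A \<in> ?A" using fin m by (intro Min_in) blast+
  then obtain x a y b where *: "Min ?A = a + real (dst x y) + b" "(x, a) \<in> cayley_ends S R p" "(y, b) \<in> cayley_ends S R q" by blast
  note x = ends_near[OF p *(2)] and y = ends_near[OF q *(3)]
  have "dst (fst p) (fst q) \<le> dst (fst p) x + dst x (fst q)" using dst_triangle x(1) p q by simp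
  also have "dst x (fst q) \<le> dst x y + dst y (fst q)" using dst_triangle x(1) y(1) q by simp
  finally have "dst (fst p) (fst q) \<le> dst x y + 2" using x(2) y(2) dst_sym[OF y(1) fst_point[OF q]] by simp
  then have "real (dst (fst p) (fst q)) \<le> real (dst x y) + 2" by linarith
  then have "real (dst (fst p) (fst q)) - 2 \<le> Min ?A" using *(1) x(3) y(3) by linarith
  then show ?thesis using up by (simp add: cayley_through_def)
qed

text \<open>A point lies within 1 of the initial vertex of its edge. With an additive error 2, the
  vertex metric thereby replaces the metric graph.\<close>

lemma D_dst: assumes p: "p \<in> P" and q: "q \<in> P" shows "\<bar>D p q - real (dst (fst p) (fst q))\<bar> \<le> 2"
proof (cases "fst p = fst q \<and> fst (snd p) = fst (snd q) \<and> fst (snd p) \<noteq> None")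
  case True
  have "\<bar>snd (snd p) - snd (snd q)\<bar> \<le> 1" using p q by (auto simp: cayley_points_def)
  moreover have "dst (fst p) (fst q) = 0" using True q by simp
  moreover have "D p q = min \<bar>snd (snd p) - snd (snd q)\<bar> (cayley_through S R p q)" unfolding cayley_dist_def by (rule if_P[OF True])
  ultimately show ?thesis using through_dst[OF assms] by linarith
next
  case False then show ?thesis using through_dst[OF assms] by (auto simp: cayley_dist_def)
qed

end

context rooted
begin

text \<open>Only the first components of the ends are prescribed, because points of a stable subset
  or stratum may lie inside edges.\<close>

definition morse_vertex :: "(real \<times> real \<Rightarrow> real) \<Rightarrow> 'a word set \<Rightarrow> bool" where
  "morse_vertex N x \<longleftrightarrow> (\<exists>\<gamma> a b. morse_geodesic P D N \<gamma> a b \<and> fst (\<gamma> a) = rt \<and> fst (\<gamma> b) = x)"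

definition qpath :: "real \<Rightarrow> real \<Rightarrow> nat \<Rightarrow> (nat \<Rightarrow> 'a word set) \<Rightarrow> 'a word set \<Rightarrow> bool" where
  "qpath K C m \<phi> x \<longleftrightarrow> \<phi> 0 = rt \<and> \<phi> m = x \<and> (\<forall>i\<le>m. \<phi> i \<in> G) \<and>
     (\<forall>i j. i \<le> j \<longrightarrow> j \<le> m \<longrightarrow> (real j - real i) / K - C \<le> real (dst (\<phi> i) (\<phi> j)) \<and>
        real (dst (\<phi> i) (\<phi> j)) \<le> K * (real j - real i) + C)"

lemma morse_vertex_G: "morse_vertex N x \<Longrightarrow> x \<in> G"
  unfolding morse_vertex_def morse_geodesic_def geodesic_seg_def by force

text \<open>Rounding the parameter shifts differences by at most 1, costing at most
  \<open>K\<close>, and \<open>D_dst\<close> costs 2; hence the additive constant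
  \<open>C + K + 3\<close>. The step path is given the exact ends of \<open>\<gamma>\<close>, as the
  Morse property demands ends on the geodesic.\<close>

lemma qpath_near:
  assumes mg: "morse_geodesic P D N \<gamma> a b" "fst (\<gamma> a) = rt" "fst (\<gamma> b) = x"
    and q: "qpath K C m \<phi> x" and K: "1 \<le> K" "0 \<le> C" and i: "i \<le> m"
  shows "\<exists>t\<in>{a..b}. real (dst (\<phi> i) (fst (\<gamma> t))) \<le> N (K, C + K + 3) + 2"
proof -
  have geod: "a \<le> b" "\<And>t. t \<in> {a..b} \<Longrightarrow> \<gamma> t \<in> P"
    using mg(1) by (auto simp: morse_geodesic_def geodesic_seg_def)
  define \<psi> where "\<psi> s = (if s \<le> 0 then \<gamma> a else if real m \<le> s then \<gamma> b else (\<phi> (nat \<lfloor>s\<rfloor>), None, 0))" for s :: real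
  note q' = q[unfolded qpath_def]
  have fl: "nat \<lfloor>s\<rfloor> \<le> m" "real (nat \<lfloor>s\<rfloor>) \<le> s" "s < real (nat \<lfloor>s\<rfloor>) + 1" if "s \<in> {0..real m}" for s
    using that by (auto simp: nat_le_iff floor_le_iff of_nat_nat)
  have f\<psi>: "fst (\<psi> s) = \<phi> (nat \<lfloor>s\<rfloor>)" if "s \<in> {0..real m}" for s
    using that q' mg(2,3) by (auto simp: \<psi>_def)
  have P\<psi>: "\<psi> s \<in> P" if "s \<in> {0..real m}" for s
    using that geod vertex_point[of "\<phi> (nat \<lfloor>s\<rfloor>)"] q' fl(1)[OF that] by (auto simp: \<psi>_def)
  have *: "\<bar>s - t\<bar> / K - (C + K + 3) \<le> D (\<psi> s) (\<psi> t) \<and> D (\<psi> s) (\<psi> t) \<le> K * \<bar>s - t\<bar> + (C + K + 3)"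
    if st: "s \<in> {0..real m}" "t \<in> {0..real m}" for s t
  proof -
    define k l where "k = nat \<lfloor>s\<rfloor>" and "l = nat \<lfloor>t\<rfloor>"
    have kl: "k \<le> m" "l \<le> m" "real k \<le> s" "s < real k + 1" "real l \<le> t" "t < real l + 1"
      using fl[OF st(1)] fl[OF st(2)] unfolding k_def l_def by auto
    define e where "e = \<bar>real k - real l\<bar>"
    have e: "\<bar>e - \<bar>s - t\<bar>\<bar> \<le> 1" using kl by (auto simp: e_def)
    have qb: "(real j - real i) / K - C \<le> real (dst (\<phi> i) (\<phi> j)) \<and> real (dst (\<phi> i) (\<phi> j)) \<le> K * (real j - real i) + C"
      if "i \<le> j" "j \<le> m" for i j using q' that by blast
    have b: "e / K - C \<le> real (dst (\<phi> k) (\<phi> l)) \<and> real (dst (\<phi> k) (\<phi> l)) \<le> K * e + C"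
    proof (cases "k \<le> l")
      case True
      then have "e = real l - real k" by (simp add: e_def)
      then show ?thesis using qb[OF True kl(2)] by simp
    next
      case False
      then have "e = real k - real l" by (simp add: e_def)
      moreover have "dst (\<phi> k) (\<phi> l) = dst (\<phi> l) (\<phi> k)" using dst_sym q' kl by blast
      ultimately show ?thesis using qb[of l k] False kl(1) by simp
    qed
    have "\<bar>s - t\<bar> \<le> e + 1" "e \<le> \<bar>s - t\<bar> + 1" using e by (auto simp: abs_le_iff)
    then have "\<bar>s - t\<bar> / K \<le> (e + 1) / K" "K * e \<le> K * (\<bar>s - t\<bar> + 1)" using K by (auto simp: divide_right_mono mult_left_mono)
    moreover have "(e + 1) / K = e / K + 1 / K" "1 / K \<le> 1" "K * (\<bar>s - t\<bar> + 1) = K * \<bar>s - t\<bar> + K"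
      using K by (auto simp: add_divide_distrib algebra_simps)
    moreover have "\<bar>D (\<psi> s) (\<psi> t) - real (dst (\<phi> k) (\<phi> l))\<bar> \<le> 2"
      using D_dst[OF P\<psi>[OF st(1)] P\<psi>[OF st(2)]] f\<psi> st unfolding k_def l_def by simp
    ultimately show ?thesis using b K by (intro conjI) linarith+
  qed
  have "quasi_geodesic P D K (C + K + 3) \<psi> 0 (real m)" unfolding quasi_geodesic_def using P\<psi> * by auto
  moreover have "\<psi> 0 \<in> \<gamma> ` {a..b}" "\<psi> (real m) \<in> \<gamma> ` {a..b}" using geod(1) by (auto simp: \<psi>_def)
  moreover have "real i \<in> {0..real m}" using i by simp
  moreover have "0 \<le> C + K + 3" using K by simp
  ultimately have "\<exists>y\<in>\<gamma> ` {a..b}. D (\<psi> (real i)) y \<le> N (K, C + K + 3)"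
    using mg(1) K(1) unfolding morse_geodesic_def by blast
  then obtain t where t: "t \<in> {a..b}" "D (\<psi> (real i)) (\<gamma> t) \<le> N (K, C + K + 3)" by blast
  have "\<bar>D (\<psi> (real i)) (\<gamma> t) - real (dst (\<phi> i) (fst (\<gamma> t)))\<bar> \<le> 2"
    using D_dst[OF P\<psi>[of "real i"] geod(2)[OF t(1)]] f\<psi>[of "real i"] i by simp
  then show ?thesis using t by (intro bexI[of _ t]) auto
qed

lemma lev_diff: assumes "x \<in> G" "y \<in> G" shows "real (lev y) - real (lev x) \<le> real (dst x y)"
  using lev_lip[OF assms] by linarith

text \<open>Levels are distances from the root, so a point of level \<open>i\<close> near
  \<open>\<gamma>\<close> must be near the parameter \<open>a + i\<close>. With
  \<open>M = N (K, C + K + 3) + 2\<close> the error is at most \<open>M + (M + 4)\<close>.\<close>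

lemma qpath_level:
  assumes mg: "morse_geodesic P D N \<gamma> a b" "fst (\<gamma> a) = rt" "fst (\<gamma> b) = x"
    and q: "qpath K C m \<phi> x" and K: "1 \<le> K" "0 \<le> C" and i: "i \<le> m" "lev (\<phi> i) = i"
  shows "real (dst (\<phi> i) (fst (\<gamma> (min (a + real i) b)))) \<le> 2 * N (K, C + K + 3) + 8"
proof -
  have geod: "a \<le> b" "\<And>t. t \<in> {a..b} \<Longrightarrow> \<gamma> t \<in> P" "\<And>s t. s \<in> {a..b} \<Longrightarrow> t \<in> {a..b} \<Longrightarrow> D (\<gamma> s) (\<gamma> t) = \<bar>s - t\<bar>"
    using mg(1) by (auto simp: morse_geodesic_def geodesic_seg_def)
  obtain t where t: "t \<in> {a..b}" "real (dst (\<phi> i) (fst (\<gamma> t))) \<le> N (K, C + K + 3) + 2"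
    using qpath_near[OF mg q K i(1)] by blast
  define M s where "M = N (K, C + K + 3) + 2" and "s = min (a + real i) b"
  have s: "s \<in> {a..b}" using geod(1) by (auto simp: s_def)
  have aab: "a \<in> {a..b}" using geod by simp
  have G: "\<phi> i \<in> G" "fst (\<gamma> t) \<in> G" "fst (\<gamma> s) \<in> G" using q i geod(2) t(1) s by (auto simp: qpath_def)
  have "\<bar>\<bar>a - t\<bar> - real (lev (fst (\<gamma> t)))\<bar> \<le> 2"
    using D_dst[OF geod(2)[OF aab] geod(2)[OF t(1)]] geod(3)[OF aab t(1)] mg(2) by (simp add: lev_def)
  moreover have "real (lev (fst (\<gamma> t))) \<le> real i + real (dst (\<phi> i) (fst (\<gamma> t)))" "real i \<le> real (lev (fst (\<gamma> t))) + real (dst (\<phi> i) (fst (\<gamma> t)))"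
    using lev_diff[OF G(1,2)] lev_diff[OF G(2,1)] i(2) dst_sym[OF G(1,2)] by simp_all
  ultimately have "\<bar>t - (a + real i)\<bar> \<le> M + 2" using t by (auto simp: M_def abs_le_iff)
  then have "\<bar>t - s\<bar> \<le> M + 2" using t(1) by (auto simp: s_def min_def abs_le_iff)
  then have "real (dst (fst (\<gamma> t)) (fst (\<gamma> s))) \<le> M + 4"
    using D_dst[OF geod(2)[OF t(1)] geod(2)[OF s]] geod(3)[OF t(1) s] by (auto simp: abs_le_iff)
  moreover have "real (dst (\<phi> i) (fst (\<gamma> s))) \<le> real (dst (\<phi> i) (fst (\<gamma> t))) + real (dst (fst (\<gamma> t)) (fst (\<gamma> s)))"
    using dst_triangle[OF G] by linarith
  ultimately show ?thesis using t(2) unfolding s_def M_def by linarith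
qed

lemma qpaths_fellow:
  assumes "morse_vertex N x" "qpath K C m \<phi> x" "qpath K C m' \<phi>' x" "1 \<le> K" "0 \<le> C" "i \<le> m" "i \<le> m'" "lev (\<phi> i) = i" "lev (\<phi>' i) = i"
  shows "real (dst (\<phi> i) (\<phi>' i)) \<le> 4 * N (K, C + K + 3) + 16"
proof -
  obtain \<gamma> a b where mg: "morse_geodesic P D N \<gamma> a b" "fst (\<gamma> a) = rt" "fst (\<gamma> b) = x" using assms(1) by (auto simp: morse_vertex_def)
  let ?g = "fst (\<gamma> (min (a + real i) b))"
  have "\<gamma> (min (a + real i) b) \<in> P" using mg(1) by (auto simp: morse_geodesic_def geodesic_seg_def min_def)
  then have G: "\<phi> i \<in> G" "\<phi>' i \<in> G" "?g \<in> G" using assms by (auto simp: qpath_def)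
  have "dst (\<phi> i) (\<phi>' i) \<le> dst (\<phi> i) ?g + dst (\<phi>' i) ?g" using dst_triangle[OF G(1,3,2)] dst_sym[OF G(2,3)] by simp
  then have "real (dst (\<phi> i) (\<phi>' i)) \<le> real (dst (\<phi> i) ?g) + real (dst (\<phi>' i) ?g)" by linarith
  moreover have "real (dst (\<phi> i) ?g) \<le> 2 * N (K, C + K + 3) + 8" by (rule qpath_level[OF mg assms(2) assms(4-6,8)])
  moreover have "real (dst (\<phi>' i) ?g) \<le> 2 * N (K, C + K + 3) + 8" by (rule qpath_level[OF mg assms(3) assms(4,5,7,9)])
  ultimately show ?thesis by linarith
qed

lemma dst_anc_abs: assumes "x \<in> G" shows "real (dst (anc i x) (anc j x)) = \<bar>real (min j (lev x)) - real (min i (lev x))\<bar>"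
proof -
  define i' j' where "i' = min i (lev x)" and "j' = min j (lev x)"
  have e: "anc i x = anc i' x" "anc j x = anc j' x" by (auto simp: i'_def j'_def min_def anc_ge)
  have le: "i' \<le> lev x" "j' \<le> lev x" by (auto simp: i'_def j'_def)
  have "real (dst (anc i' x) (anc j' x)) = \<bar>real j' - real i'\<bar>"
  proof (cases "i' \<le> j'")
    case True then show ?thesis using dst_anc[OF assms True le(2)] by (simp only: of_nat_diff)
  next
    case False
    then have "dst (anc i' x) (anc j' x) = i' - j'"
      using dst_anc[OF assms _ le(1), of j'] dst_sym[OF anc_G[OF assms, of i'] anc_G[OF assms, of j']] by linarith
    then show ?thesis using False by (simp add: of_nat_diff)
  qed
  then show ?thesis unfolding e i'_def j'_def .
qed

text \<open>A path to \<open>x\<close> that runs through all ancestors of \<open>y\<close>, leaving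
  the tree path of \<open>y\<close> one level above its end.\<close>

definition switch :: "'a word set \<Rightarrow> 'a word set \<Rightarrow> nat \<Rightarrow> 'a word set" where
  "switch y x i = (if i \<le> lev y then anc i y else anc i x)"

text \<open>The levels of \<open>y\<close> and \<open>anc k x\<close> differ by at most
  \<open>L\<close>, and so does the jump between them, whence \<open>2 * L\<close>. The final index
  \<open>Suc (max ...)\<close> makes sure that the path has left the branch of \<open>y\<close> and
  ends at \<open>x\<close>, even if \<open>y\<close> is the higher vertex.\<close>

lemma switch_qpath:
  assumes x: "x \<in> G" and y: "y \<in> G" and k: "k \<le> lev x" and L: "dst (anc k x) y \<le> L"
  shows "qpath 1 (2 * real L + 1) (Suc (max (lev x) (lev y))) (switch y x) x"
proof -
  have z: "anc k x \<in> G" "lev (anc k x) = k" using x k lev_anc by auto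
  have ky: "lev y \<le> k + L" "k \<le> lev y + L"
    using lev_lip[OF z(1) y] lev_lip[OF y z(1)] z(2) L dst_sym[OF z(1) y] by auto
  have GG: "switch y x i \<in> G" for i using x y by (simp add: switch_def)
  have lv: "lev (switch y x i) = (if i \<le> lev y then i else min i (lev x))" for i using x y by (simp add: switch_def lev_anc)
  have "real j - real i - (2 * real L + 1) \<le> real (dst (switch y x i) (switch y x j)) \<and>
      real (dst (switch y x i) (switch y x j)) \<le> real j - real i + (2 * real L + 1)"
    if ij: "i \<le> j" "j \<le> Suc (max (lev x) (lev y))" for i j
  proof
    have "real j - real L - 1 \<le> real (lev (switch y x j))" using lv[of j] ij ky k by (auto simp: min_def max_def split: if_splits)
    moreover have "real (lev (switch y x i)) \<le> real i" using lv[of i] by auto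
    ultimately show "real j - real i - (2 * real L + 1) \<le> real (dst (switch y x i) (switch y x j))"
      using lev_diff[OF GG[of i] GG[of j]] by linarith
    show "real (dst (switch y x i) (switch y x j)) \<le> real j - real i + (2 * real L + 1)"
    proof (cases "j \<le> lev y")
      case True then show ?thesis using ij dst_anc_abs[OF y, of i j] by (simp add: switch_def)
    next
      case j: False
      show ?thesis
      proof (cases "i \<le> lev y")
        case False
        then show ?thesis using j ij dst_anc_abs[OF x, of i j] by (auto simp: switch_def min_def abs_if)
      next
        case True
        have 1: "real (dst (anc i y) y) = real (lev y) - real i" using dst_anc_abs[OF y, of i "lev y"] True by simp
        have 2: "real (dst (anc k x) (anc j x)) = \<bar>real (min j (lev x)) - real k\<bar>" using dst_anc_abs[OF x, of k j] k by simp
        have "dst (anc i y) (anc j x) \<le> dst (anc i y) y + dst y (anc j x)" using dst_triangle x y by simp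
        also have "dst y (anc j x) \<le> dst (anc k x) y + dst (anc k x) (anc j x)"
          using dst_triangle[OF y z(1) anc_G[OF x, of j]] dst_sym[OF y z(1)] by simp
        finally have "real (dst (anc i y) (anc j x)) \<le> real (lev y) - real i + real L + \<bar>real (min j (lev x)) - real k\<bar>"
          using 1 2 L by linarith
        moreover have "\<bar>real (min j (lev x)) - real k\<bar> \<le> real j - real (lev y) + real L"
          using ky k j by (auto simp: min_def abs_if)
        ultimately show ?thesis using True j by (simp add: switch_def)
      qed
    qed
  qed
  then show ?thesis using x y GG unfolding qpath_def by (auto simp: switch_def anc_ge)
qed

text \<open>Vertices of the ball may fail to be Morse, but their tree paths are initial parts of
  quasi-geodesics to the Morse vertex \<open>x\<close>. The number \<open>2 * L + 5\<close> is
  \<open>C + K + 3\<close> for \<open>K = 1\<close>, rearranged from \<open>C + K + 3\<close> with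
  \<open>C = 2 * L + 1\<close>.\<close>

lemma ball_fellow:
  assumes "morse_vertex N x" "k \<le> lev x" "y \<in> G" "y' \<in> G" "dst (anc k x) y \<le> L" "dst (anc k x) y' \<le> L" "n \<le> lev y" "n \<le> lev y'"
  shows "dst (anc n y) (anc n y') \<le> nat \<lceil>4 * N (1, 2 * real L + 5) + 16\<rceil>"
proof -
  have x: "x \<in> G" using morse_vertex_G assms(1) by simp
  have s: "switch y x n = anc n y" "switch y' x n = anc n y'" using assms by (auto simp: switch_def)
  have "real (dst (switch y x n) (switch y' x n)) \<le> 4 * N (1, (2 * real L + 1) + 1 + 3) + 16"
    by (rule qpaths_fellow[OF assms(1) switch_qpath[OF x assms(3,2,5)] switch_qpath[OF x assms(4,2,6)]])
      (simp_all add: s lev_anc assms(3,4,7,8) le_SucI le_max_iff_disj)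
  then show ?thesis unfolding s by (simp add: add.assoc) linarith
qed

text \<open>\<open>\<kappa>\<close> consists of \<open>V + 1\<close> windows, the margin
  \<open>\<Lambda>\<close> above them, and \<open>L\<close> because the ball reaches
  \<open>L\<close> levels below \<open>anc k x\<close>. At level 0 the root is the only
  ancestor.\<close>

lemma two_ancestors:
  "\<exists>\<kappa>. \<forall>x k n. morse_vertex N x \<and> k \<le> lev x \<and> (n = 0 \<or> n + \<kappa> \<le> k) \<longrightarrow> card (anc n ` {y \<in> G. dst (anc k x) y \<le> L}) \<le> 2"
proof -
  obtain V where V: "\<forall>g\<in>G. card {h \<in> G. dst g h \<le> L} \<le> V" using card_ball by blast
  define \<delta> where "\<delta> = nat \<lceil>4 * N (1, 2 * real L + 5) + 16\<rceil>"
  define \<Lambda> where "\<Lambda> = 6 * \<delta> + 12"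
  define \<kappa> where "\<kappa> = (V + 1) * win \<Lambda> + \<Lambda> + L"
  have "card (anc n ` {y \<in> G. dst (anc k x) y \<le> L}) \<le> 2" if *: "morse_vertex N x" "k \<le> lev x" "n = 0 \<or> n + \<kappa> \<le> k" for x k n
  proof (cases "n = 0")
    case True
    then have "anc n ` {y \<in> G. dst (anc k x) y \<le> L} \<subseteq> {rt}" by auto
    from card_mono[OF _ this] show ?thesis by simp
  next
    case False
    have x: "x \<in> G" using morse_vertex_G *(1) by simp
    define B where "B = {y \<in> G. dst (anc k x) y \<le> L}"
    have z: "anc k x \<in> G" "lev (anc k x) = k" using x *(2) lev_anc by auto
    have lv: "n + (V + 1) * win \<Lambda> + \<Lambda> \<le> lev y" if "y \<in> B" for y
    proof -
      have "y \<in> G" "dst (anc k x) y \<le> L" using that by (auto simp: B_def)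
      then have "k \<le> lev y + L" using lev_lip[OF _ z(1), of y] z(2) dst_sym[OF z(1), of y] by simp
      moreover have "n + \<kappa> \<le> k" using * False by simp
      moreover define q where "q = (V + 1) * win \<Lambda>"
      ultimately show ?thesis unfolding \<kappa>_def q_def[symmetric] by linarith
    qed
    have fel: "dst (anc m y) (anc m y') \<le> \<delta>" if "y \<in> B" "y' \<in> B" "m \<le> lev y" "m \<le> lev y'" for y y' m
      using ball_fellow[OF *(1,2), of y y' L m] that by (simp add: B_def \<delta>_def)
    have conn: "\<exists>y\<in>U. \<exists>y'\<in>B - U. adj y y'" if "U \<subseteq> B" "U \<noteq> {}" "U \<noteq> B" for U
      using ball_connected[OF z(1), of U L] that unfolding B_def by blast
    have fin: "finite B" "card B \<le> V" unfolding B_def using finite_ball[OF z(1)] V z(1) by auto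
    have "card (anc n ` B) \<le> 2"
      by (rule few_ancestors[where B = B and \<Lambda> = \<Lambda> and \<delta> = \<delta> and V = V]) (use fel lv conn fin in \<open>auto simp: \<Lambda>_def B_def\<close>)
    then show ?thesis by (simp add: B_def)
  qed
  then show ?thesis by blast
qed

end

section \<open>Asymptotic dimension\<close>

context rooted
begin

text \<open>The tree vertex \<open>\<kappa>\<close> levels below the annulus of \<open>y\<close> labels the piece of that annulus containing \<open>y\<close>; a
  piece that is close to two different pieces of the annulus below is absorbed into one piece indexed by
  that pair. Truncated subtraction is harmless: the tree vertex is then the root.\<close>
definition foot :: "nat \<Rightarrow> nat \<Rightarrow> 'a word set \<Rightarrow> 'a word set" where
  "foot K \<kappa> y = anc (lev y div K * K - \<kappa>) y"

definition straddles :: "'a word set set \<Rightarrow> nat \<Rightarrow> nat \<Rightarrow> nat \<Rightarrow> nat \<Rightarrow> 'a word set \<Rightarrow> 'a word set set \<Rightarrow> bool" where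
  "straddles X r K \<kappa> k v Q \<longleftrightarrow> (\<exists>x\<in>X. \<exists>y\<in>X. \<exists>z\<in>X. \<exists>z'\<in>X. dst x y \<le> r \<and> dst x z \<le> r \<and> dst x z' \<le> r \<and>
     lev y div K = k \<and> foot K \<kappa> y = v \<and> Suc (lev z div K) = k \<and> Suc (lev z' div K) = k \<and>
     foot K \<kappa> z \<noteq> foot K \<kappa> z' \<and> Q = {foot K \<kappa> z, foot K \<kappa> z'})"

definition pieces :: "'a word set set \<Rightarrow> nat \<Rightarrow> nat \<Rightarrow> nat \<Rightarrow> nat \<Rightarrow> 'a word set \<Rightarrow> 'a word set set" where
  "pieces X r K \<kappa> k v = (if \<exists>Q. straddles X r K \<kappa> k v Q then SOME Q. straddles X r K \<kappa> k v Q else {v})"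

definition label :: "'a word set set \<Rightarrow> nat \<Rightarrow> nat \<Rightarrow> nat \<Rightarrow> 'a word set \<Rightarrow> nat \<times> 'a word set set" where
  "label X r K \<kappa> y = (lev y div K, pieces X r K \<kappa> (lev y div K) (foot K \<kappa> y))"

lemma dst_foot: assumes "y \<in> G" "0 < K" shows "dst y (foot K \<kappa> y) \<le> K + \<kappa>" "dst y (foot K \<kappa> y) \<le> lev y - lev y div K * K + \<kappa>"
proof -
  have *: "lev y div K * K - \<kappa> \<le> lev y" using div_times_less_eq_dividend[of "lev y" K] by linarith
  have "dst (foot K \<kappa> y) y = lev y - (lev y div K * K - \<kappa>)" unfolding foot_def using dst_anc[OF assms(1) * order_refl] by simp
  then show 1: "dst y (foot K \<kappa> y) \<le> lev y - lev y div K * K + \<kappa>" using dst_sym[OF assms(1), of "foot K \<kappa> y"] assms(1) by (simp add: foot_def)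
  have "lev y - lev y div K * K \<le> K" using assms(2) by (metis less_imp_le mod_less_divisor minus_div_mult_eq_mod)
  then show "dst y (foot K \<kappa> y) \<le> K + \<kappa>" using 1 by linarith
qed

text \<open>A ball of radius \<open>r\<close> meets two consecutive annuli with at most two feet
  each. If it sees two feet in the lower annulus, every piece of the upper one straddles this pair
  and receives the same label; so at most \<open>2 + 1\<close> labels occur in either case.\<close>

lemma asdim_labels:
  assumes X: "\<And>x. x \<in> X \<Longrightarrow> morse_vertex N x"
  shows "\<exists>(lb :: 'a word set \<Rightarrow> nat \<times> 'a word set set) E. (\<forall>y\<in>X. \<forall>y'\<in>X. lb y = lb y' \<longrightarrow> dst y y' \<le> E) \<and>
     (\<forall>x\<in>X. finite (lb ` {y \<in> X. dst x y \<le> r}) \<and> card (lb ` {y \<in> X. dst x y \<le> r}) \<le> 3)"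
proof -
  obtain \<kappa>1 where \<kappa>1: "\<And>x k n. morse_vertex N x \<Longrightarrow> k \<le> lev x \<Longrightarrow> n = 0 \<or> n + \<kappa>1 \<le> k \<Longrightarrow> card (anc n ` {y \<in> G. dst (anc k x) y \<le> r}) \<le> 2"
    using two_ancestors[of N r] by blast
  define \<kappa> where "\<kappa> = \<kappa>1 + r"
  \<comment> \<open>Two points witnessing that the same piece straddles are at most
    \<open>6 * r + 2 * \<kappa>\<close> apart, and the vertices in the annulus below are another
    \<open>r\<close> away.\<close>
  define L where "L = 7 * r + 2 * \<kappa>"
  obtain \<kappa>2 where \<kappa>2: "\<And>x k n. morse_vertex N x \<Longrightarrow> k \<le> lev x \<Longrightarrow> n = 0 \<or> n + \<kappa>2 \<le> k \<Longrightarrow> card (anc n ` {y \<in> G. dst (anc k x) y \<le> L}) \<le> 2"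
    using two_ancestors[of N L] by blast
  \<comment> \<open>Annuli thicker than \<open>2 * r\<close> let a ball of radius \<open>r\<close>
    meet only two of them; the rest puts the feet of the lower annulus at least
    \<open>\<kappa>2\<close> levels below a straddling point.\<close>
  define K where "K = \<kappa>2 + \<kappa> + 2 * r + 1"
  have K: "0 < K" "2 * r < K" by (simp_all add: K_def)
  have XG: "x \<in> G" if "x \<in> X" for x using X morse_vertex_G that by blast
  note two1 = \<kappa>1[OF X order_refl, simplified] and two2 = \<kappa>2[OF X order_refl, simplified]
  have div1: "lev y div K = k \<longleftrightarrow> k * K \<le> lev y \<and> lev y < Suc k * K" for y k
    using K(1) by (metis div_nat_eqI dividend_less_times_div div_times_less_eq_dividend mult.commute mult_Suc_right times_div_less_eq_dividend)
  have near: "lev y \<le> lev x + dst x y" "lev x \<le> lev y + dst x y" if "x \<in> X" "y \<in> X" for x y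
    using lev_lip[OF XG[OF that(1)] XG[OF that(2)]] lev_lip[OF XG[OF that(2)] XG[OF that(1)]] dst_sym[OF XG[OF that(1)] XG[OF that(2)]] by auto
  \<comment> \<open>A straddling piece is near the bottom of its annulus, so its witnesses are close
    to \<open>v\<close> and to each other. All four feet below are then ancestors of one ball of
    radius \<open>L\<close>, of which there are at most two, and both pairs consist of these
    two.\<close>
  have uniq: "Q = Q'" if s: "straddles X r K \<kappa> k v Q" and s': "straddles X r K \<kappa> k v Q'" for k v Q Q'
  proof -
    obtain x y z1 z2 where x: "x \<in> X" "y \<in> X" "z1 \<in> X" "z2 \<in> X" "dst x y \<le> r" "dst x z1 \<le> r" "dst x z2 \<le> r"
      "lev y div K = k" "foot K \<kappa> y = v" "Suc (lev z1 div K) = k" "Suc (lev z2 div K) = k" "foot K \<kappa> z1 \<noteq> foot K \<kappa> z2" "Q = {foot K \<kappa> z1, foot K \<kappa> z2}"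
      using s unfolding straddles_def by blast
    obtain x' y' z1' z2' where x': "x' \<in> X" "y' \<in> X" "z1' \<in> X" "z2' \<in> X" "dst x' y' \<le> r" "dst x' z1' \<le> r" "dst x' z2' \<le> r"
      "lev y' div K = k" "foot K \<kappa> y' = v" "Suc (lev z1' div K) = k" "Suc (lev z2' div K) = k" "foot K \<kappa> z1' \<noteq> foot K \<kappa> z2'" "Q' = {foot K \<kappa> z1', foot K \<kappa> z2'}"
      using s' unfolding straddles_def by blast
    obtain j where j: "k = Suc j" using x(10) by blast
    have zj: "lev z1 div K = j" "lev z2 div K = j" "lev z1' div K = j" "lev z2' div K = j" using x x' j by auto
    have up: "dst y v \<le> \<kappa> + 2 * r" if "x \<in> X" "y \<in> X" "z \<in> X" "dst x y \<le> r" "dst x z \<le> r" "lev y div K = k" "foot K \<kappa> y = v" "lev z div K = j" for x y z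
    proof -
      have "lev z < k * K" using div1[of z j] that(8) j by simp
      then have "lev y \<le> k * K + 2 * r" using near[OF that(1,2)] near[OF that(1,3)] that(4,5) by linarith
      then show ?thesis using dst_foot(2)[OF XG[OF that(2)] K(1), of \<kappa>] unfolding that(6,7) by linarith
    qed
    have dy: "dst y v \<le> \<kappa> + 2 * r" by (rule up[OF x(1-3,5,6,8,9) zj(1)])
    have dy': "dst y' v \<le> \<kappa> + 2 * r" by (rule up[OF x'(1-3,5,6,8,9) zj(3)])
    have G: "x \<in> G" "y \<in> G" "z1 \<in> G" "z2 \<in> G" "x' \<in> G" "y' \<in> G" "z1' \<in> G" "z2' \<in> G"
      using x(1-4) x'(1-4) XG by simp_all
    have "v \<in> G" unfolding x(9)[symmetric] foot_def using G(2) by simp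
    note G = G this
    have "dst x x' \<le> dst x y + dst y x'" by (rule dst_triangle[OF G(1,2,5)])
    moreover have "dst y x' \<le> dst y v + dst v x'" by (rule dst_triangle[OF G(2,9,5)])
    moreover have "dst v x' \<le> dst v y' + dst y' x'" by (rule dst_triangle[OF G(9,6,5)])
    ultimately have xx': "dst x x' \<le> 6 * r + 2 * \<kappa>" using dy dy' x(5) x'(5) dst_sym[OF G(9,6)] dst_sym[OF G(6,5)] by linarith
    have inL: "dst x z1 \<le> L" "dst x z2 \<le> L" "dst x z1' \<le> L" "dst x z2' \<le> L"
      using x(6,7) xx' x'(6,7) dst_triangle[OF G(1,5,7)] dst_triangle[OF G(1,5,8)] unfolding L_def by linarith+
    let ?n = "j * K - \<kappa>" let ?A = "anc ?n ` {y \<in> G. dst x y \<le> L}"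
    have lx: "Suc j * K \<le> lev x + r" using div1[of y k] x(8) j near(1)[OF x(1,2)] x(5) by simp
    have "?n = 0 \<or> ?n + \<kappa>2 \<le> lev x" using lx by (auto simp: K_def)
    then have c2: "card ?A \<le> 2" using two2[OF x(1)] by blast
    have fin: "finite ?A" using finite_ball[OF G(1)] by simp
    have ft: "foot K \<kappa> z = anc ?n z" if "lev z div K = j" for z using that by (simp add: foot_def)
    have sub: "Q \<subseteq> ?A" "Q' \<subseteq> ?A" using x(13) x'(13) ft zj inL G by auto
    have "card Q = 2" "card Q' = 2" using x(12,13) x'(12,13) by auto
    then have "Q = ?A" "Q' = ?A" using card_seteq[OF fin sub(1)] card_seteq[OF fin sub(2)] c2 by auto
    then show ?thesis by simp
  qed
  have pieces: "pieces X r K \<kappa> k v = Q" if "straddles X r K \<kappa> k v Q" for k v Q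
    unfolding pieces_def using that uniq by (metis (mono_tags, lifting) someI_ex)
  let ?lb = "label X r K \<kappa>"
  have diam: "dst y y' \<le> 6 * (K + \<kappa>) + 4 * r" if y: "y \<in> X" "y' \<in> X" and e: "?lb y = ?lb y'" for y y'
  proof (cases "\<exists>Q. straddles X r K \<kappa> (lev y div K) (foot K \<kappa> y) Q")
    case False
    have le: "lev y div K = lev y' div K" using e by (simp add: label_def)
    \<comment> \<open>Labels of absorbed pieces have two elements and the others only one, so the
      two kinds never coincide.\<close>
    have "\<not> (\<exists>Q. straddles X r K \<kappa> (lev y' div K) (foot K \<kappa> y') Q)"
    proof
      assume "\<exists>Q. straddles X r K \<kappa> (lev y' div K) (foot K \<kappa> y') Q"
      then obtain Q where Q: "straddles X r K \<kappa> (lev y' div K) (foot K \<kappa> y') Q" by blast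
      then have "{foot K \<kappa> y} = Q" using pieces[OF Q] e False by (simp add: label_def pieces_def)
      then show False using Q unfolding straddles_def by (metis insertI1 insertI2 singletonD)
    qed
    then have f: "foot K \<kappa> y = foot K \<kappa> y'" using False e by (simp add: label_def pieces_def)
    have G: "y \<in> G" "foot K \<kappa> y \<in> G" "y' \<in> G" using y XG by (auto simp: foot_def)
    show ?thesis using dst_triangle[OF G] dst_foot(1)[OF G(1) K(1), of \<kappa>] dst_foot(1)[OF G(3) K(1), of \<kappa>] f dst_sym[OF G(3,2)] by simp
  next
    case True
    then obtain Q where Q: "straddles X r K \<kappa> (lev y div K) (foot K \<kappa> y) Q" by blast
    have pQ: "pieces X r K \<kappa> (lev y' div K) (foot K \<kappa> y') = Q" using pieces[OF Q] e by (simp add: label_def)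
    have "card Q = 2" using Q unfolding straddles_def by auto
    then have "\<exists>Q. straddles X r K \<kappa> (lev y' div K) (foot K \<kappa> y') Q" using pQ by (auto simp: pieces_def split: if_splits)
    then have Q': "straddles X r K \<kappa> (lev y' div K) (foot K \<kappa> y') Q" using pieces pQ by blast
    have reach: "dst u q \<le> 3 * (K + \<kappa>) + 2 * r" if u: "u \<in> X" and s: "straddles X r K \<kappa> (lev u div K) (foot K \<kappa> u) Q" and q: "q \<in> Q" for u q
    proof -
      obtain x w z where w: "x \<in> X" "w \<in> X" "z \<in> X" "dst x w \<le> r" "dst x z \<le> r" "foot K \<kappa> w = foot K \<kappa> u" "q = foot K \<kappa> z"
        using s q unfolding straddles_def by blast
      have G: "u \<in> G" "w \<in> G" "x \<in> G" "z \<in> G" "foot K \<kappa> u \<in> G" "q \<in> G" using u w XG by (auto simp: foot_def)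
      have "dst u q \<le> dst u (foot K \<kappa> u) + dst (foot K \<kappa> u) q" by (rule dst_triangle[OF G(1,5,6)])
      moreover have "dst (foot K \<kappa> u) q \<le> dst (foot K \<kappa> u) w + dst w q" by (rule dst_triangle[OF G(5,2,6)])
      moreover have "dst w q \<le> dst w x + dst x q" by (rule dst_triangle[OF G(2,3,6)])
      moreover have "dst x q \<le> dst x z + dst z q" by (rule dst_triangle[OF G(3,4,6)])
      moreover have "dst (foot K \<kappa> u) w = dst w (foot K \<kappa> w)" using dst_sym[OF G(5,2)] w(6) by simp
      moreover have "dst w x = dst x w" by (rule dst_sym[OF G(2,3)])
      ultimately have "dst u q \<le> dst u (foot K \<kappa> u) + dst w (foot K \<kappa> w) + dst x w + dst x z + dst z q" by simp
      then have "dst u q \<le> (K + \<kappa>) + (K + \<kappa>) + r + r + (K + \<kappa>)"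
        using dst_foot(1)[OF G(1) K(1), of \<kappa>] dst_foot(1)[OF G(2) K(1), of \<kappa>] dst_foot(1)[OF G(4) K(1), of \<kappa>, folded w(7)] w(4,5)
        by simp
      then show ?thesis by simp
    qed
    obtain z where z: "z \<in> X" "foot K \<kappa> z \<in> Q" using Q unfolding straddles_def by blast
    define q where "q = foot K \<kappa> z"
    have q: "q \<in> Q" "q \<in> G" using z XG by (simp_all add: q_def foot_def)
    have "dst y y' \<le> dst y q + dst y' q" using dst_triangle[OF XG[OF y(1)] q(2) XG[OF y(2)]] dst_sym[OF XG[OF y(2)] q(2)] by simp
    then show ?thesis using reach[OF y(1) Q q(1)] reach[OF y(2) Q' q(1)] by simp
  qed
  have mult: "finite (?lb ` {y \<in> X. dst x y \<le> r}) \<and> card (?lb ` {y \<in> X. dst x y \<le> r}) \<le> 3" if x: "x \<in> X" for x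
  proof
    let ?B = "{y \<in> X. dst x y \<le> r}"
    have "?B \<subseteq> {y \<in> G. dst x y \<le> r}" using XG by blast
    then have finB: "finite ?B" by (rule finite_subset) (rule finite_ball[OF XG[OF x]])
    then show "finite (?lb ` ?B)" by simp
    define A where "A k = {y \<in> ?B. lev y div K = k}" for k
    have feet: "card (foot K \<kappa> ` A k) \<le> 2" for k
    proof (cases "A k = {}")
      case False
      then obtain y where y: "y \<in> X" "dst x y \<le> r" "lev y div K = k" by (auto simp: A_def)
      have "k * K \<le> lev x + r" using div1[of y k] y(3) near[OF x y(1)] y(2) by linarith
      then have "k * K - \<kappa> = 0 \<or> k * K - \<kappa> + \<kappa>1 \<le> lev x" by (auto simp: \<kappa>_def)
      then have "card (anc (k * K - \<kappa>) ` {y \<in> G. dst x y \<le> r}) \<le> 2" using two1[OF x] by blast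
      moreover have "foot K \<kappa> ` A k \<subseteq> anc (k * K - \<kappa>) ` {y \<in> G. dst x y \<le> r}" using XG by (auto simp: A_def foot_def)
      moreover have "finite (anc (k * K - \<kappa>) ` {y \<in> G. dst x y \<le> r})" using finite_ball[OF XG[OF x]] by simp
      ultimately show ?thesis using card_mono order_trans by blast
    qed simp
    have finA: "finite (A k)" for k unfolding A_def by (rule finite_subset[OF _ finB]) blast
    have lbA: "?lb ` A k = (\<lambda>v. (k, pieces X r K \<kappa> k v)) ` foot K \<kappa> ` A k" for k
      unfolding image_image by (rule image_cong) (auto simp: A_def label_def)
    have lbc: "card (?lb ` A k) \<le> card (foot K \<kappa> ` A k)" for k unfolding lbA using card_image_le[of "foot K \<kappa> ` A k"] finA by blast
    define k where "k = (lev x - r) div K"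
    have cover: "?B = A k \<union> A (Suc k)"
    proof -
      have "lev y div K = k \<or> lev y div K = Suc k" if y: "y \<in> X" "dst x y \<le> r" for y
      proof -
        have b: "lev x - r \<le> lev y" "lev y \<le> lev x - r + 2 * r" using near[OF x y(1)] y(2) by auto
        have "lev x - r < Suc k * K" "k * K \<le> lev x - r" unfolding k_def
          using K(1) by (simp_all add: dividend_less_div_times add.commute)
        then have "k * K \<le> lev y" "lev y < Suc (Suc k) * K" using b K(2) by auto
        then show ?thesis using div1[of y k] div1[of y "Suc k"] by (meson not_less)
      qed
      then show ?thesis unfolding A_def by (intro equalityI subsetI) auto
    qed
    have "card (?lb ` ?B) \<le> card (?lb ` A k) + card (?lb ` A (Suc k))"
      unfolding cover image_Un by (rule card_Un_le)
    moreover have "card (?lb ` A k) + card (?lb ` A (Suc k)) \<le> 3"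
    proof (cases "card (foot K \<kappa> ` A k) \<le> 1")
      case True then show ?thesis using lbc[of k] lbc[of "Suc k"] feet[of "Suc k"] by linarith
    next
      case False
      then obtain z z' where z: "z \<in> A k" "z' \<in> A k" "foot K \<kappa> z \<noteq> foot K \<kappa> z'"
        using finA card_le_Suc0_iff_eq[of "foot K \<kappa> ` A k"] by auto
      have "straddles X r K \<kappa> (Suc k) (foot K \<kappa> y) {foot K \<kappa> z, foot K \<kappa> z'}" if "y \<in> A (Suc k)" for y
        unfolding straddles_def using x that z by (intro bexI[of _ x] bexI[of _ y] bexI[of _ z] bexI[of _ z']) (auto simp: A_def)
      then have "?lb ` A (Suc k) \<subseteq> {(Suc k, {foot K \<kappa> z, foot K \<kappa> z'})}" using pieces by (auto simp: label_def A_def)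
      from card_mono[OF _ this] have "card (?lb ` A (Suc k)) \<le> 1" by simp
      then show ?thesis using lbc[of k] feet[of k] by linarith
    qed
    ultimately show "card (?lb ` ?B) \<le> 3" by linarith
  qed
  show ?thesis using diam mult by blast
qed

end

context presentation
begin

text \<open>The tree is rooted at an arbitrary point of \<open>Y\<close>: one gauge serves all pairs
  of points, so all of \<open>Y\<close> consists of Morse vertices for this root.\<close>

lemma stable_asdim: assumes st: "stable_subset P D Y" shows "asdim_le Y D 2"
proof (cases "Y = {}")
  case True then show ?thesis unfolding asdim_le_def by (intro allI impI exI[of _ "{}"]) auto
next
  case False
  then obtain y0 where y0: "y0 \<in> Y" by (metis ex_in_conv)
  have YP: "Y \<subseteq> P" using st by (auto simp: stable_subset_def quasi_convex_def)
  obtain N where N: "\<And>x y. x \<in> Y \<Longrightarrow> y \<in> Y \<Longrightarrow> morse_joined P D N x y" using st by (auto simp: stable_subset_def)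
  interpret rooted S R "fst y0" by unfold_locales (use y0 YP in auto)
  have m: "morse_vertex N x" if "x \<in> fst ` Y" for x using N[OF y0] that unfolding morse_vertex_def morse_joined_def by blast
  show ?thesis unfolding asdim_le_def
  proof (intro allI impI)
    fix r :: real assume "0 < r"
    define r' where "r' = nat \<lceil>r\<rceil> + 2"
    have "\<exists>(lb :: 'a word set \<Rightarrow> nat \<times> 'a word set set) E. (\<forall>y\<in>fst ` Y. \<forall>y'\<in>fst ` Y. lb y = lb y' \<longrightarrow> dst y y' \<le> E) \<and>
       (\<forall>x\<in>fst ` Y. finite (lb ` {y \<in> fst ` Y. dst x y \<le> r'}) \<and> card (lb ` {y \<in> fst ` Y. dst x y \<le> r'}) \<le> 3)"
      by (rule asdim_labels[of "fst ` Y" N r', OF m])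
    then obtain lb :: "'a word set \<Rightarrow> nat \<times> 'a word set set" and E where
      lb0: "(\<forall>y\<in>fst ` Y. \<forall>y'\<in>fst ` Y. lb y = lb y' \<longrightarrow> dst y y' \<le> E) \<and>
       (\<forall>x\<in>fst ` Y. finite (lb ` {y \<in> fst ` Y. dst x y \<le> r'}) \<and> card (lb ` {y \<in> fst ` Y. dst x y \<le> r'}) \<le> 3)"
      by (elim exE)
    note lb = lb0[THEN conjunct1, rule_format] lb0[THEN conjunct2, rule_format]
    define F where "F c = {y \<in> Y. lb (fst y) = c}" for c
    let ?U = "F ` (\<lambda>y. lb (fst y)) ` Y"
    have 1: "\<Union>?U = Y" by (intro equalityI subsetI) (auto simp: F_def)
    have 2: "\<forall>U\<in>?U. \<forall>x\<in>U. \<forall>y\<in>U. D x y \<le> real E + 2"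
    proof (intro ballI)
      fix U x y assume "U \<in> ?U" "x \<in> U" "y \<in> U"
      then have xy: "x \<in> Y" "y \<in> Y" "lb (fst x) = lb (fst y)" by (auto simp: F_def)
      then have "dst (fst x) (fst y) \<le> E" using lb(1) by blast
      then have "real (dst (fst x) (fst y)) \<le> real E" by simp
      moreover have "\<bar>D x y - real (dst (fst x) (fst y))\<bar> \<le> 2" using D_dst xy YP by blast
      ultimately show "D x y \<le> real E + 2" by linarith
    qed
    have 3: "finite {U \<in> ?U. \<exists>y\<in>U. D x y \<le> r} \<and> card {U \<in> ?U. \<exists>y\<in>U. D x y \<le> r} \<le> 2 + 1" if x: "x \<in> Y" for x
    proof -
      let ?A = "lb ` {y \<in> fst ` Y. dst (fst x) y \<le> r'}"
      have sub: "{U \<in> ?U. \<exists>y\<in>U. D x y \<le> r} \<subseteq> F ` ?A"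
      proof
        fix U assume "U \<in> {U \<in> ?U. \<exists>y\<in>U. D x y \<le> r}"
        then obtain c y where y: "U = F c" "y \<in> F c" "D x y \<le> r" by blast
        then have yY: "y \<in> Y" "lb (fst y) = c" by (auto simp: F_def)
        have "\<bar>D x y - real (dst (fst x) (fst y))\<bar> \<le> 2" using D_dst x yY YP by blast
        then have "real (dst (fst x) (fst y)) \<le> real r'" using y(3) real_nat_ceiling_ge[of r] by (simp add: r'_def)
        then show "U \<in> F ` ?A" using y(1) yY by auto
      qed
      have A: "finite ?A" "card ?A \<le> 3" using lb(2)[of "fst x"] x by auto
      have fin: "finite (F ` ?A)" using A(1) by simp
      have "card {U \<in> ?U. \<exists>y\<in>U. D x y \<le> r} \<le> 3"
        using card_mono[OF fin sub] card_image_le[OF A(1), of F] A(2) by linarith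
      then show ?thesis using finite_subset[OF sub fin] by simp
    qed
    show "\<exists>\<U>. \<Union>\<U> = Y \<and> (\<exists>D'. \<forall>U\<in>\<U>. \<forall>x\<in>U. \<forall>y\<in>U. D x y \<le> D') \<and>
        (\<forall>x\<in>Y. finite {U\<in>\<U>. \<exists>y\<in>U. D x y \<le> r} \<and> card {U\<in>\<U>. \<exists>y\<in>U. D x y \<le> r} \<le> 2 + 1)"
      by (rule exI[of _ ?U]) (intro conjI ballI exI[of _ "real E + 2"]; use 1 2 3 in blast)
  qed
qed

end

section \<open>Capacity dimension of the boundary\<close>

context rooted
begin

lemma tree_qpath: assumes x: "x \<in> G" and K: "1 \<le> K" "0 \<le> C" shows "qpath K C (lev x) (\<lambda>i. anc i x) x"
proof -
  have "(real j - real i) / K - C \<le> real (dst (anc i x) (anc j x)) \<and> real (dst (anc i x) (anc j x)) \<le> K * (real j - real i) + C"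
    if "i \<le> j" "j \<le> lev x" for i j
  proof -
    have d: "real (dst (anc i x) (anc j x)) = real j - real i" using dst_anc_abs[OF x, of i j] that by simp
    have "(real j - real i) / K \<le> real j - real i" "real j - real i \<le> K * (real j - real i)"
      using K that mult_right_mono[of 1 K "real j - real i"] by (auto simp: divide_le_eq mult.commute)
    then show ?thesis using d K by linarith
  qed
  then show ?thesis using x by (simp add: qpath_def)
qed

text \<open>If \<open>q n\<close> is nearest to the root on the geodesic \<open>q\<close>, then going to \<open>q n\<close> along the tree and then to
  \<open>q 0\<close> along \<open>q\<close> is a \<open>(3, 0)\<close>-quasi-geodesic.\<close>
lemma corner_fellow:
  assumes m: "morse_vertex N (q 0)" and q: "\<And>i. i \<le> n \<Longrightarrow> q i \<in> G" "\<And>i j. i \<le> n \<Longrightarrow> j \<le> n \<Longrightarrow> real (dst (q i) (q j)) = \<bar>real i - real j\<bar>"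
    and low: "\<And>i. i \<le> n \<Longrightarrow> lev (q n) \<le> lev (q i)" and t: "t \<le> lev (q n)"
  shows "real (dst (anc t (q 0)) (anc t (q n))) \<le> 4 * N (3, 6) + 16"
proof -
  define p where "p = q n"
  define \<phi> where "\<phi> i = (if i \<le> lev p then anc i p else q (n - (i - lev p)))" for i
  have p: "p \<in> G" using q(1) by (simp add: p_def)
  have b: "(real j - real i) / 3 \<le> real (dst (\<phi> i) (\<phi> j)) \<and> real (dst (\<phi> i) (\<phi> j)) \<le> 3 * (real j - real i)"
    if ij: "i \<le> j" "j \<le> lev p + n" for i j
  proof (cases "j \<le> lev p")
    case True
    then have "real (dst (\<phi> i) (\<phi> j)) = real j - real i" using ij dst_anc_abs[OF p, of i j] by (simp add: \<phi>_def)
    then show ?thesis using ij by simp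
  next
    case j: False
    define k where "k = j - lev p"
    have k: "k \<le> n" "real k = real j - real (lev p)" using j ij by (auto simp: k_def)
    have pj: "\<phi> j = q (n - k)" using j by (simp add: \<phi>_def k_def)
    show ?thesis
    proof (cases "i \<le> lev p")
      case True
      have a: "anc i p \<in> G" "q (n - k) \<in> G" using p q(1) by auto
      have 1: "real (dst (anc i p) p) = real (lev p) - real i" using dst_anc_abs[OF p, of i "lev p"] True by simp
      have 2: "real (dst p (q (n - k))) = real k" unfolding p_def using q(2)[of n "n - k"] k(1) by simp
      have "real (lev (q (n - k))) - real (lev (anc i p)) \<le> real (dst (anc i p) (q (n - k)))" by (rule lev_diff[OF a])
      moreover have "lev (anc i p) = i" using lev_anc[OF p] True by simp
      moreover have "real (lev p) \<le> real (lev (q (n - k)))" using low[of "n - k"] by (simp add: p_def)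
      ultimately have 3: "real (lev p) - real i \<le> real (dst (anc i p) (q (n - k)))" by linarith
      have 4: "real (dst p (q (n - k))) \<le> real (dst (anc i p) p) + real (dst (anc i p) (q (n - k)))"
        using dst_triangle[OF p a] dst_sym[OF p a(1)] by linarith
      have 5: "real (dst (anc i p) (q (n - k))) \<le> real (dst (anc i p) p) + real (dst p (q (n - k)))"
        using dst_triangle[OF a(1) p a(2)] by linarith
      have "\<phi> i = anc i p" using True by (simp add: \<phi>_def)
      then show ?thesis unfolding pj using 1 2 3 4 5 k(2) ij(1) by simp
    next
      case False
      define l where "l = i - lev p"
      have l: "l \<le> n" "real l = real i - real (lev p)" using False ij by (auto simp: l_def)
      have pi: "\<phi> i = q (n - l)" using False by (simp add: \<phi>_def l_def)
      have "real (dst (q (n - l)) (q (n - k))) = \<bar>real (n - l) - real (n - k)\<bar>" by (rule q(2)) auto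
      then have "real (dst (\<phi> i) (\<phi> j)) = real j - real i" unfolding pi pj using k l ij(1) by (simp add: of_nat_diff)
      then show ?thesis using ij(1) by simp
    qed
  qed
  have gg: "\<phi> i \<in> G" for i using p q(1) by (simp add: \<phi>_def)
  have "\<phi> (lev p + n) = q 0" by (cases "n = 0") (auto simp: \<phi>_def p_def)
  then have q1: "qpath 3 0 (lev p + n) \<phi> (q 0)" unfolding qpath_def using b p gg by (simp add: \<phi>_def)
  have q2: "qpath 3 0 (lev (q 0)) (\<lambda>i. anc i (q 0)) (q 0)" using tree_qpath[of "q 0" 3 0] q(1) by simp
  have tl: "t \<le> lev p" "t \<le> lev (q 0)" using t low[of 0] by (auto simp: p_def)
  have \<phi>t: "\<phi> t = anc t p" using tl by (simp add: \<phi>_def)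
  have "real (dst (anc t (q 0)) (\<phi> t)) \<le> 4 * N (3, 0 + 3 + 3) + 16"
    by (rule qpaths_fellow[OF m q2 q1]) (use lev_anc[OF p, of t] lev_anc[OF q(1)[of 0], of t] tl \<phi>t in auto)
  then show ?thesis using \<phi>t by (simp add: p_def)
qed

text \<open>Twice the bound \<open>4 * N (3, 6) + 16\<close> of \<open>corner_fellow\<close>,
  rounded up; the 6 is \<open>C + K + 3\<close> for a \<open>(3, 0)\<close>-quasi-geodesic.\<close>

definition fellow_const :: "(real \<times> real \<Rightarrow> real) \<Rightarrow> nat" where "fellow_const N = nat \<lceil>8 * N (3, 6) + 32\<rceil>"

text \<open>The hypothesis says that \<open>t\<close> is at most the Gromov product of
  \<open>x\<close> and \<open>y\<close>, so the lowest vertex on a geodesic between them has level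
  at least \<open>t\<close>. Both ancestors are compared with the ancestor of that vertex.\<close>

lemma fellow_below:
  assumes x: "morse_vertex N x" and y: "morse_vertex N y" and t: "2 * t + dst x y \<le> lev x + lev y"
  shows "dst (anc t x) (anc t y) \<le> fellow_const N"
proof -
  have G: "x \<in> G" "y \<in> G" using x y morse_vertex_G by auto
  obtain w where w: "w \<in> W" "length w = dst x y" "mul x w = y" using dst_word[OF G] by blast
  define d where "d = length w"
  define q where "q i = mul x (take i w)" for i
  have qG: "q i \<in> G" for i unfolding q_def using G W_take[OF w(1)] by blast
  have up: "dst (q i) (q j) \<le> j - i" if "i \<le> j" for i j
  proof -
    have "take j w = take i w @ take (j - i) (drop i w)" using that by (metis le_add_diff_inverse take_add)
    then have "q j = mul (q i) (take (j - i) (drop i w))" unfolding q_def using mul_append[OF G(1) W_take[OF w(1)]] by simp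
    then have "dst (q i) (q j) \<le> length (take (j - i) (drop i w))"
      using dst_le[OF qG W_take[OF W_drop[OF w(1)]]] by metis
    then show ?thesis by simp
  qed
  have q0: "q 0 = x" "q d = y" using G w by (auto simp: q_def d_def)
  have eq: "dst (q i) (q j) = j - i" if "i \<le> j" "j \<le> d" for i j
  proof -
    have "dst x y \<le> dst x (q i) + dst (q i) y" by (rule dst_triangle[OF G(1) qG G(2)])
    moreover have "dst (q i) y \<le> dst (q i) (q j) + dst (q j) y" by (rule dst_triangle[OF qG qG G(2)])
    ultimately have "d \<le> i + (dst (q i) (q j) + (d - j))" using up[of 0 i] up[of j d] that q0 w(2) by (simp add: d_def)
    then show ?thesis using up[OF that(1)] that by simp
  qed
  have qd: "real (dst (q i) (q j)) = \<bar>real i - real j\<bar>" if "i \<le> d" "j \<le> d" for i j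
  proof (cases "i \<le> j")
    case True then show ?thesis using eq[OF True that(2)] by (simp add: of_nat_diff)
  next
    case False then show ?thesis using eq[of j i] that dst_sym[OF qG[of i] qG[of j]] by (simp add: of_nat_diff)
  qed
  obtain n where n: "n \<le> d" "\<And>i. i \<le> d \<Longrightarrow> lev (q n) \<le> lev (q i)"
    using ex_has_least_nat[of "\<lambda>i. i \<le> d" 0 "\<lambda>i. lev (q i)"] by auto
  have tn: "t \<le> lev (q n)"
  proof -
    have "lev x \<le> lev (q n) + n" using lev_lip[OF qG G(1), of n] dst_sym[OF qG[of n] G(1)] eq[of 0 n] q0 n(1) by simp
    moreover have "lev y \<le> lev (q n) + (d - n)" using lev_lip[OF qG G(2), of n] eq[of n d] q0 n(1) by simp
    ultimately show ?thesis using t w(2) n(1) by (simp add: d_def)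
  qed
  have 1: "real (dst (anc t x) (anc t (q n))) \<le> 4 * N (3, 6) + 16"
    using corner_fellow[of N q n t] x qG qd n tn q0 by auto
  let ?q = "\<lambda>i. q (d - i)"
  have "real (dst (anc t (?q 0)) (anc t (?q (d - n)))) \<le> 4 * N (3, 6) + 16"
  proof (rule corner_fellow)
    show "morse_vertex N (?q 0)" using y q0 by simp
    show "q (d - i) \<in> G" for i by (rule qG)
    show "real (dst (q (d - i)) (q (d - j))) = \<bar>real i - real j\<bar>" if "i \<le> d - n" "j \<le> d - n" for i j
      using qd[of "d - i" "d - j"] that by (simp add: of_nat_diff)
    show "lev (q (d - (d - n))) \<le> lev (q (d - i))" for i using n by simp
    show "t \<le> lev (q (d - (d - n)))" using n tn by simp
  qed
  then have 2: "real (dst (anc t y) (anc t (q n))) \<le> 4 * N (3, 6) + 16" using q0 n by simp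
  have H: "anc t x \<in> G" "anc t (q n) \<in> G" "anc t y \<in> G" using G qG by auto
  have "real (dst (anc t x) (anc t y)) \<le> real (dst (anc t x) (anc t (q n))) + real (dst (anc t y) (anc t (q n)))"
    using dst_triangle[OF H] dst_sym[OF H(3,2)] by linarith
  then have "real (dst (anc t x) (anc t y)) \<le> 8 * N (3, 6) + 32" using 1 2 by linarith
  then show ?thesis unfolding fellow_const_def using real_nat_ceiling_ge[of "8 * N (3, 6) + 32"] by linarith
qed

text \<open>The converse direction: a path down to close ancestors and up again bounds the distance,
  hence the Gromov product from below.\<close>

lemma dst_above: assumes G: "x \<in> G" "y \<in> G" and n: "n \<le> lev x" "n \<le> lev y" and d: "dst (anc n x) (anc n y) \<le> d"
  shows "dst x y + 2 * n \<le> lev x + lev y + d"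
proof -
  have H: "anc n x \<in> G" "anc n y \<in> G" using G by auto
  have "dst x (anc n x) = lev x - n" using dst_anc[OF G(1) n(1) order_refl] dst_sym[OF G(1) H(1)] by simp
  moreover have "dst (anc n y) y = lev y - n" using dst_anc[OF G(2) n(2) order_refl] by simp
  ultimately show ?thesis using dst_triangle[OF G(1) H(1) G(2)] dst_triangle[OF H G(2)] d n by simp
qed

text \<open>A version at finite level, with error \<open>d\<close>, of the statement that the Gromov
  product of the limits is at least \<open>t\<close>.\<close>

definition near :: "nat \<Rightarrow> nat \<Rightarrow> (nat \<Rightarrow> 'a cpoint) \<Rightarrow> (nat \<Rightarrow> 'a cpoint) \<Rightarrow> bool" where
  "near t d x y \<longleftrightarrow> (\<exists>m. \<forall>i\<ge>m. \<forall>j\<ge>m. t \<le> lev (fst (x i)) \<and> t \<le> lev (fst (y j)) \<and> dst (anc t (fst (x i))) (anc t (fst (y j))) \<le> d)"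

lemma near_sym: assumes "range x \<subseteq> P" "range y \<subseteq> P" "near t d x y" shows "near t d y x"
proof -
  have G: "fst (x i) \<in> G" "fst (y i) \<in> G" for i using assms(1,2) fst_point by blast+
  then show ?thesis using assms(3) dst_sym[OF anc_G[OF G(1)] anc_G[OF G(2)]] unfolding near_def by metis
qed

lemma near_mono: assumes "near t d x y" "d \<le> d'" shows "near t d' x y"
proof -
  obtain m where "\<And>i j. i \<ge> m \<Longrightarrow> j \<ge> m \<Longrightarrow> t \<le> lev (fst (x i)) \<and> t \<le> lev (fst (y j)) \<and> dst (anc t (fst (x i))) (anc t (fst (y j))) \<le> d"
    using assms(1) unfolding near_def by blast
  then have "\<And>i j. i \<ge> m \<Longrightarrow> j \<ge> m \<Longrightarrow> t \<le> lev (fst (x i)) \<and> t \<le> lev (fst (y j)) \<and> dst (anc t (fst (x i))) (anc t (fst (y j))) \<le> d'"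
    using assms(2) order_trans by blast
  then show ?thesis unfolding near_def by blast
qed

lemma near_trans: assumes "range x \<subseteq> P" "range y \<subseteq> P" "range z \<subseteq> P" "near t d x y" "near t d' y z" shows "near t (d + d') x z"
proof -
  have G: "fst (x i) \<in> G" "fst (y i) \<in> G" "fst (z i) \<in> G" for i using assms(1,2,3) fst_point by blast+
  obtain m where m: "\<And>i j. i \<ge> m \<Longrightarrow> j \<ge> m \<Longrightarrow> t \<le> lev (fst (x i)) \<and> t \<le> lev (fst (y j)) \<and> dst (anc t (fst (x i))) (anc t (fst (y j))) \<le> d"
    using assms(4) unfolding near_def by blast
  obtain m' where m': "\<And>i j. i \<ge> m' \<Longrightarrow> j \<ge> m' \<Longrightarrow> t \<le> lev (fst (y i)) \<and> t \<le> lev (fst (z j)) \<and> dst (anc t (fst (y i))) (anc t (fst (z j))) \<le> d'"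
    using assms(5) unfolding near_def by blast
  have "t \<le> lev (fst (x i)) \<and> t \<le> lev (fst (z j)) \<and> dst (anc t (fst (x i))) (anc t (fst (z j))) \<le> d + d'"
    if "i \<ge> max m m'" "j \<ge> max m m'" for i j
    using m[of i "max m m'"] m'[of "max m m'" j] that
      dst_triangle[OF anc_G[OF G(1), of t i] anc_G[OF G(2), of t "max m m'"] anc_G[OF G(3), of t j]] by simp
  then show ?thesis unfolding near_def by blast
qed

end

section \<open>Covers of the boundary of a Morse stratum\<close>

locale boundary = rooted S R rt for S :: "'a set" and R rt +
  fixes e :: "'a cpoint" and N :: "real \<times> real \<Rightarrow> real"
  assumes e: "e \<in> cayley_points S R" "fst e = rt"
begin

abbreviation "st \<equiv> morse_stratum P D N e"
abbreviation "Bd \<equiv> seq_boundary st D e"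
abbreviation "gp \<equiv> gromov_prod D e"
abbreviation "h \<equiv> fellow_const N"

lemma st_morse_vertex: "p \<in> st \<Longrightarrow> morse_vertex N (fst p)"
  unfolding morse_stratum_def morse_joined_def morse_vertex_def using e(2) by blast

lemma st_P: "p \<in> st \<Longrightarrow> p \<in> P" by (simp add: morse_stratum_def)

text \<open>Three distances are replaced with error 2 each, and the Gromov product halves the
  sum.\<close>

lemma gp_approx: assumes "p \<in> P" "q \<in> P"
  shows "\<bar>gp p q - (real (lev (fst p)) + real (lev (fst q)) - real (dst (fst p) (fst q))) / 2\<bar> \<le> 3"
proof -
  have "dst (fst p) (fst e) = lev (fst p)" "dst (fst q) (fst e) = lev (fst q)"
    using dst_sym[OF fst_point[OF assms(1)] fst_point[OF e(1)]] dst_sym[OF fst_point[OF assms(2)] fst_point[OF e(1)]] e(2)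
    by (simp_all add: lev_def)
  then have *: "\<bar>D p e - real (lev (fst p))\<bar> \<le> 2" "\<bar>D q e - real (lev (fst q))\<bar> \<le> 2" "\<bar>D p q - real (dst (fst p) (fst q))\<bar> \<le> 2"
    using D_dst[OF assms(1) e(1)] D_dst[OF assms(2) e(1)] D_dst[OF assms] by simp_all
  show ?thesis using abs_le_D1[OF *(1)] abs_le_D2[OF *(1)] abs_le_D1[OF *(2)] abs_le_D2[OF *(2)] abs_le_D1[OF *(3)] abs_le_D2[OF *(3)]
    unfolding gromov_prod_def by (intro abs_leI) (simp_all add: field_simps)
qed

lemma gp_fellow: assumes p: "p \<in> st" and q: "q \<in> st" and t: "real t + 3 \<le> gp p q"
  shows "t \<le> lev (fst p) \<and> t \<le> lev (fst q) \<and> dst (anc t (fst p)) (anc t (fst q)) \<le> h"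
proof -
  have P: "p \<in> P" "q \<in> P" using p q st_P by auto
  have G: "fst p \<in> G" "fst q \<in> G" using P by auto
  have "real t \<le> (real (lev (fst p)) + real (lev (fst q)) - real (dst (fst p) (fst q))) / 2" using gp_approx[OF P] t by linarith
  then have "real (2 * t + dst (fst p) (fst q)) \<le> real (lev (fst p) + lev (fst q))" by (simp add: field_simps)
  then have *: "2 * t + dst (fst p) (fst q) \<le> lev (fst p) + lev (fst q)" unfolding of_nat_le_iff .
  then show ?thesis using fellow_below[OF st_morse_vertex[OF p] st_morse_vertex[OF q] *] lev_lip[OF G] lev_lip[OF G(2,1)] dst_sym[OF G] by auto
qed

lemma fellow_gp: assumes P: "p \<in> P" "q \<in> P" and n: "n \<le> lev (fst p)" "n \<le> lev (fst q)" "dst (anc n (fst p)) (anc n (fst q)) \<le> d"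
  shows "real n - real d / 2 - 3 \<le> gp p q"
proof -
  have "dst (fst p) (fst q) + 2 * n \<le> lev (fst p) + lev (fst q) + d" using dst_above[OF _ _ n] P by simp
  then have "real (dst (fst p) (fst q)) + 2 * real n \<le> real (lev (fst p)) + real (lev (fst q)) + real d" by linarith
  then show ?thesis using gp_approx[OF P] by (simp add: abs_le_iff field_simps)
qed

lemma Bd_mem: assumes "\<xi> \<in> Bd" "x \<in> \<xi>" shows "range x \<subseteq> st" "range x \<subseteq> P"
  using assms st_P unfolding seq_boundary_def seq_to_infty_def by blast+

lemma near_equiv: assumes "range x \<subseteq> st" "range y \<subseteq> st" "seq_equiv D e x y" shows "near t h x y"
proof -
  obtain m where "\<forall>i\<ge>m. \<forall>j\<ge>m. real t + 3 \<le> gp (x i) (y j)" using assms(3) unfolding seq_equiv_def by blast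
  then show ?thesis unfolding near_def using gp_fellow[OF subsetD[OF assms(1) rangeI] subsetD[OF assms(2) rangeI]] by blast
qed

text \<open>Two members of a boundary point are compared through the sequence \<open>x0\<close> that
  defines the class.\<close>

lemma Bd_near: assumes "\<xi> \<in> Bd" "x \<in> \<xi>" "y \<in> \<xi>" shows "near t (h + h) x y"
proof -
  obtain x0 where x0: "seq_to_infty st D e x0" "\<xi> = {y. seq_to_infty st D e y \<and> seq_equiv D e x0 y}"
    using assms(1) unfolding seq_boundary_def by blast
  have r: "range x0 \<subseteq> st" using x0(1) unfolding seq_to_infty_def by blast
  have rP: "range x0 \<subseteq> P" using r st_P by blast
  have "near t h x0 x" "near t h x0 y" using near_equiv[OF r Bd_mem(1)] assms x0(2) by auto
  then show ?thesis using near_trans[OF _ rP _ near_sym[OF rP], of x y t h h] Bd_mem(2)[OF assms(1)] assms(2,3) by blast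
qed

lemma Bd_nonempty: assumes "\<xi> \<in> Bd" shows "\<exists>x. x \<in> \<xi>"
proof -
  obtain x0 where x0: "seq_to_infty st D e x0" "\<xi> = {y. seq_to_infty st D e y \<and> seq_equiv D e x0 y}"
    using assms unfolding seq_boundary_def by blast
  moreover have "seq_equiv D e x0 x0" using x0(1) unfolding seq_to_infty_def seq_equiv_def by blast
  ultimately show ?thesis by blast
qed

definition limanc :: "nat \<Rightarrow> (nat \<Rightarrow> 'a cpoint) set \<Rightarrow> 'a word set set" where
  "limanc n \<xi> = {u. \<exists>x\<in>\<xi>. \<exists>\<^sub>\<infinity>i. anc n (fst (x i)) = u}"

text \<open>Eventually the ancestors lie in a finite ball, so one of them recurs infinitely
  often.\<close>

lemma limanc_nonempty: assumes "\<xi> \<in> Bd" shows "\<exists>u. u \<in> limanc n \<xi>"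
proof -
  obtain x where x: "x \<in> \<xi>" using Bd_nonempty[OF assms] by blast
  obtain m where m: "\<And>i j. i \<ge> m \<Longrightarrow> j \<ge> m \<Longrightarrow> dst (anc n (fst (x i))) (anc n (fst (x j))) \<le> h + h"
    using Bd_near[OF assms x x, of n] unfolding near_def by blast
  have G: "fst (x i) \<in> G" for i using Bd_mem(2)[OF assms x] fst_point by blast
  let ?A = "{v \<in> G. dst (anc n (fst (x m))) v \<le> h + h}"
  have "(\<lambda>i. anc n (fst (x i))) ` {m..} \<subseteq> ?A" using m G by auto
  then have "finite ((\<lambda>i. anc n (fst (x i))) ` {m..})" by (rule finite_subset) (rule finite_ball[OF anc_G[OF G]])
  from pigeonhole_infinite[OF _ this] obtain i0 where i0: "infinite {i \<in> {m..}. anc n (fst (x i)) = anc n (fst (x i0))}"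
    using infinite_Ici by blast
  have "infinite {i. anc n (fst (x i)) = anc n (fst (x i0))}" by (rule infinite_super[OF _ i0]) blast
  then have "anc n (fst (x i0)) \<in> limanc n \<xi>" unfolding limanc_def INFM_iff_infinite using x by blast
  then show ?thesis by blast
qed

text \<open>Both sequences stay within \<open>2 * h\<close> of \<open>u\<close> at level
  \<open>n\<close>, hence within \<open>4 * h\<close> of each other; the Gromov product loses half
  of this and the 3 of \<open>gp_approx\<close>.\<close>

lemma limanc_prod: assumes \<xi>: "\<xi> \<in> Bd" and \<eta>: "\<eta> \<in> Bd" and u: "u \<in> limanc n \<xi>" "u \<in> limanc n \<eta>"
  shows "ereal (real n - (2 * real h + 3)) \<le> boundary_gromov_prod D e \<xi> \<eta>"
proof -
  obtain x where x: "x \<in> \<xi>" "\<exists>\<^sub>\<infinity>i. anc n (fst (x i)) = u" using u(1) unfolding limanc_def by blast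
  obtain y where y: "y \<in> \<eta>" "\<exists>\<^sub>\<infinity>i. anc n (fst (y i)) = u" using u(2) unfolding limanc_def by blast
  note xP = Bd_mem(2)[OF \<xi> x(1)] and yP = Bd_mem(2)[OF \<eta> y(1)]
  have G: "fst (x i) \<in> G" "fst (y i) \<in> G" for i using xP yP fst_point by blast+
  obtain m where m: "\<And>i j. i \<ge> m \<Longrightarrow> j \<ge> m \<Longrightarrow> n \<le> lev (fst (x i)) \<and> dst (anc n (fst (x i))) (anc n (fst (x j))) \<le> h + h"
    using Bd_near[OF \<xi> x(1) x(1), of n] unfolding near_def by blast
  obtain m' where m': "\<And>i j. i \<ge> m' \<Longrightarrow> j \<ge> m' \<Longrightarrow> n \<le> lev (fst (y i)) \<and> dst (anc n (fst (y i))) (anc n (fst (y j))) \<le> h + h"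
    using Bd_near[OF \<eta> y(1) y(1), of n] unfolding near_def by blast
  obtain i0 where i0: "i0 \<ge> m" "anc n (fst (x i0)) = u" using x(2) unfolding INFM_nat_le by blast
  obtain j0 where j0: "j0 \<ge> m'" "anc n (fst (y j0)) = u" using y(2) unfolding INFM_nat_le by blast
  have uG: "u \<in> G" using i0(2) G by auto
  have "real n - (2 * real h + 3) \<le> gp (x i) (y j)" if ij: "i \<ge> max m m'" "j \<ge> max m m'" for i j
  proof -
    have a: "n \<le> lev (fst (x i))" "dst (anc n (fst (x i))) u \<le> h + h" using m[of i i0] i0 ij by auto
    have b: "n \<le> lev (fst (y j))" "dst (anc n (fst (y j))) u \<le> h + h" using m'[of j j0] j0 ij by auto
    have "dst (anc n (fst (x i))) (anc n (fst (y j))) \<le> 4 * h"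
      using dst_triangle[OF anc_G[OF G(1)] uG anc_G[OF G(2)], of n i n j] a(2) b(2) dst_sym[OF uG anc_G[OF G(2)], of n j] by simp
    from fellow_gp[OF subsetD[OF xP rangeI] subsetD[OF yP rangeI] a(1) b(1) this] show ?thesis by simp
  qed
  then have "eventually (\<lambda>z. ereal (real n - (2 * real h + 3)) \<le> (case z of (i, j) \<Rightarrow> ereal (gp (x i) (y j)))) (sequentially \<times>\<^sub>F sequentially)"
    unfolding eventually_prod_sequentially by (intro exI[of _ "max m m'"]) auto
  then have "ereal (real n - (2 * real h + 3)) \<le> Liminf (sequentially \<times>\<^sub>F sequentially) (\<lambda>(i, j). ereal (gp (x i) (y j)))"
    by (rule Liminf_bounded)
  then show ?thesis unfolding boundary_gromov_prod_def by (intro SUP_upper2[OF x(1)] SUP_upper2[OF y(1)])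
qed

text \<open>Some representatives \<open>x'\<close> and \<open>y'\<close> realise the product and are
  near with error \<open>h\<close>; changing each representative costs another
  \<open>2 * h\<close>.\<close>

lemma prod_near: assumes \<xi>: "\<xi> \<in> Bd" and \<eta>: "\<eta> \<in> Bd" and t: "ereal (real t + 3) < boundary_gromov_prod D e \<xi> \<eta>"
    and x: "x \<in> \<xi>" and y: "y \<in> \<eta>"
  shows "near t (5 * h) x y"
proof -
  obtain x' y' where x': "x' \<in> \<xi>" and y': "y' \<in> \<eta>"
    and l: "ereal (real t + 3) < Liminf (sequentially \<times>\<^sub>F sequentially) (\<lambda>(i, j). ereal (gp (x' i) (y' j)))"
    using t unfolding boundary_gromov_prod_def less_SUP_iff by blast
  have "\<exists>m. \<forall>j\<ge>m. \<forall>i\<ge>m. real t + 3 < gp (x' i) (y' j)"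
    using less_LiminfD[OF l] unfolding eventually_prod_sequentially by simp
  then obtain m where m: "\<And>i j. i \<ge> m \<Longrightarrow> j \<ge> m \<Longrightarrow> real t + 3 < gp (x' i) (y' j)" by blast
  note sx = Bd_mem[OF \<xi> x'] and sy = Bd_mem[OF \<eta> y']
  have "near t h x' y'" unfolding near_def
    using gp_fellow[OF subsetD[OF sx(1) rangeI] subsetD[OF sy(1) rangeI]] m by (meson less_imp_le)
  then have "near t (h + (h + h)) x' y" by (rule near_trans[OF sx(2) sy(2) Bd_mem(2)[OF \<eta> y] _ Bd_near[OF \<eta> y' y]])
  then have "near t ((h + h) + (h + (h + h))) x y" by (rule near_trans[OF Bd_mem(2)[OF \<xi> x] sx(2) Bd_mem(2)[OF \<eta> y] Bd_near[OF \<xi> x x']])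
  moreover have "(h + h) + (h + (h + h)) = 5 * h" by simp
  ultimately show ?thesis by metis
qed

text \<open>Finitely many candidates are all seen from a single, sufficiently late term of one
  sequence for \<open>\<xi>\<close>: they are ancestors of the ball of radius \<open>5 * h\<close>
  about its ancestor at level \<open>n + \<kappa>\<close>. A bound on all finite subsets also gives
  finiteness.\<close>

lemma limanc_two:
  assumes \<kappa>: "\<And>x k n. morse_vertex N x \<Longrightarrow> k \<le> lev x \<Longrightarrow> n + \<kappa> \<le> k \<Longrightarrow> card (anc n ` {y \<in> G. dst (anc k x) y \<le> 5 * h}) \<le> 2"
    and \<xi>: "\<xi> \<in> Bd" and C: "\<And>u. u \<in> C \<Longrightarrow> \<exists>\<eta>\<in>Bd. u \<in> limanc n \<eta> \<and> (\<forall>x\<in>\<xi>. \<forall>y\<in>\<eta>. near (n + \<kappa>) (5 * h) x y)"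
  shows "finite C \<and> card C \<le> 2"
proof (rule finite_if_finite_subsets_card_bdd)
  fix F assume F: "F \<subseteq> C" "finite F"
  obtain x where x: "x \<in> \<xi>" using Bd_nonempty[OF \<xi>] by blast
  note xP = Bd_mem[OF \<xi> x]
  let ?t = "n + \<kappa>"
  have "\<exists>m. \<forall>i\<ge>m. ?t \<le> lev (fst (x i)) \<and> u \<in> anc n ` {y \<in> G. dst (anc ?t (fst (x i))) y \<le> 5 * h}" if "u \<in> F" for u
  proof -
    have "u \<in> C" using F(1) that by blast
    from C[OF this] obtain \<eta> where \<eta>: "\<eta> \<in> Bd" "u \<in> limanc n \<eta>" "\<forall>x\<in>\<xi>. \<forall>y\<in>\<eta>. near ?t (5 * h) x y" by (elim bexE conjE)
    obtain y where y: "y \<in> \<eta>" "\<exists>\<^sub>\<infinity>i. anc n (fst (y i)) = u" using \<eta>(2) unfolding limanc_def by blast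
    obtain m where m: "\<And>i j. i \<ge> m \<Longrightarrow> j \<ge> m \<Longrightarrow> ?t \<le> lev (fst (x i)) \<and> dst (anc ?t (fst (x i))) (anc ?t (fst (y j))) \<le> 5 * h"
      using \<eta>(3)[rule_format, OF x y(1)] unfolding near_def by blast
    obtain j where j: "j \<ge> m" "anc n (fst (y j)) = u" using y(2) unfolding INFM_nat_le by blast
    have yG: "fst (y j) \<in> G" using Bd_mem(2)[OF \<eta>(1) y(1)] fst_point by blast
    have "u = anc n (anc ?t (fst (y j)))" using anc_anc[OF yG, of n ?t] j(2) by simp
    then show ?thesis using m j(1) anc_G[OF yG] by blast
  qed
  then have "\<forall>u\<in>F. \<exists>m. \<forall>i\<ge>m. ?t \<le> lev (fst (x i)) \<and> u \<in> anc n ` {y \<in> G. dst (anc ?t (fst (x i))) y \<le> 5 * h}"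
    by (intro ballI)
  from bchoice[OF this] obtain mf where
    "\<forall>u\<in>F. \<forall>i\<ge>mf u. ?t \<le> lev (fst (x i)) \<and> u \<in> anc n ` {y \<in> G. dst (anc ?t (fst (x i))) y \<le> 5 * h}"
    by (elim exE)
  note mf = this[rule_format]
  \<comment> \<open>The sum serves as an index beyond all \<open>mf u\<close>.\<close>
  define i where "i = (\<Sum>u\<in>F. mf u)"
  have i: "mf u \<le> i" if "u \<in> F" for u unfolding i_def using member_le_sum[OF that, of mf] F(2) by simp
  show "card F \<le> 2"
  proof (cases "F = {}")
    case False
    then obtain u0 where u0: "u0 \<in> F" by (metis ex_in_conv)
    have xi: "x i \<in> st" using xP(1) by blast
    have l: "?t \<le> lev (fst (x i))" using mf[OF u0 i[OF u0]] by blast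
    have sub: "F \<subseteq> anc n ` {y \<in> G. dst (anc ?t (fst (x i))) y \<le> 5 * h}" using mf i by blast
    have xG: "fst (x i) \<in> G" using st_P[OF xi] by simp
    have "finite (anc n ` {y \<in> G. dst (anc ?t (fst (x i))) y \<le> 5 * h})" using finite_ball[OF anc_G[OF xG]] by simp
    from card_mono[OF this sub] show ?thesis using \<kappa>[OF st_morse_vertex[OF xi] l order_refl] by linarith
  qed simp
qed

text \<open>The cover at scale \<open>r\<close> consists of the \<open>c * r\<close>-neighbourhoods
  of the sets of boundary points with a common vertex in \<open>limanc n\<close>. Thickening makes
  them open and provides the Lebesgue number; being in such a neighbourhood still forces nearness at
  level \<open>n + \<kappa>\<close>, where \<open>limanc_two\<close> bounds the
  multiplicity.\<close>

lemma cdim_boundary: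
  assumes vis: "visual_metric st D e \<rho>"
  shows "cdim_le Bd \<rho> 1"
proof -
  have met: "metric_on Bd \<rho>" using vis by (simp add: visual_metric_def)
  let ?bp = "boundary_gromov_prod D e"
  have "\<exists>\<epsilon>>0. \<exists>k1>0. \<exists>k2>0. \<forall>\<xi>\<in>Bd. \<forall>\<eta>\<in>Bd. \<xi> \<noteq> \<eta> \<longrightarrow> \<bar>?bp \<xi> \<eta>\<bar> \<noteq> \<infinity> \<and>
      k1 * exp (- \<epsilon> * real_of_ereal (?bp \<xi> \<eta>)) \<le> \<rho> \<xi> \<eta> \<and> \<rho> \<xi> \<eta> \<le> k2 * exp (- \<epsilon> * real_of_ereal (?bp \<xi> \<eta>))"
    using vis unfolding visual_metric_def by (rule conjunct2)
  then obtain \<epsilon> k1 k2 where pos: "\<epsilon> > 0" "k1 > 0" "k2 > 0" and v0: "\<forall>\<xi>\<in>Bd. \<forall>\<eta>\<in>Bd. \<xi> \<noteq> \<eta> \<longrightarrow> \<bar>?bp \<xi> \<eta>\<bar> \<noteq> \<infinity> \<and>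
      k1 * exp (- \<epsilon> * real_of_ereal (?bp \<xi> \<eta>)) \<le> \<rho> \<xi> \<eta> \<and> \<rho> \<xi> \<eta> \<le> k2 * exp (- \<epsilon> * real_of_ereal (?bp \<xi> \<eta>))"
    by (elim exE conjE)
  note v = v0[rule_format]
  obtain \<kappa> where \<kappa>: "\<And>x k n. morse_vertex N x \<Longrightarrow> k \<le> lev x \<Longrightarrow> n + \<kappa> \<le> k \<Longrightarrow> card (anc n ` {y \<in> G. dst (anc k x) y \<le> 5 * h}) \<le> 2"
    using two_ancestors[of N "5 * h"] by blast
  have rsym: "\<rho> \<xi> \<eta> = \<rho> \<eta> \<xi>" and r0: "0 \<le> \<rho> \<xi> \<eta>" and rself: "\<rho> \<xi> \<xi> = 0" if "\<xi> \<in> Bd" "\<eta> \<in> Bd" for \<xi> \<eta>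
    using met that unfolding metric_on_def by blast+
  have rtri: "\<rho> \<xi> \<zeta> \<le> \<rho> \<xi> \<eta> + \<rho> \<eta> \<zeta>" if "\<xi> \<in> Bd" "\<eta> \<in> Bd" "\<zeta> \<in> Bd" for \<xi> \<eta> \<zeta>
    using met that unfolding metric_on_def by blast
  define c0 where "c0 = 2 * real h + 3"
  \<comment> \<open>The bound \<open>1/4\<close> keeps the thickened sets within diameter
    \<open>r / 4 + r / 2 + r / 4\<close>. The other bound makes points closer than
    \<open>c * r\<close> have Gromov product above \<open>n + \<kappa> + 3\<close>, as
    \<open>prod_near\<close> requires.\<close>
  define c where "c = min (1/4) (k1 * exp (- \<epsilon> * (c0 + real \<kappa> + 5)) / (2 * k2))"
  have c: "0 < c" "c \<le> 1/4" "c \<le> k1 * exp (- \<epsilon> * (c0 + real \<kappa> + 5)) / (2 * k2)" using pos by (auto simp: c_def)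
  have main: "\<exists>\<U>. \<Union>\<U> = Bd \<and> (\<forall>U\<in>\<U>. metric_open Bd \<rho> U) \<and> (\<forall>U\<in>\<U>. \<forall>x\<in>U. \<forall>y\<in>U. \<rho> x y \<le> r) \<and>
      lebesgue_number Bd \<rho> \<U> \<ge> ereal (c * r) \<and> (\<forall>x\<in>Bd. finite {U\<in>\<U>. x \<in> U} \<and> card {U\<in>\<U>. x \<in> U} \<le> 1 + 1)"
    if r: "0 < r" "r < 2 * k2" for r
  proof -
    \<comment> \<open>A common ancestor at level at least \<open>a\<close> gives Gromov product at
      least \<open>a - c0\<close>, and the upper visual estimate then is \<open>r / 2\<close>. For
      \<open>r\<close> below \<open>2 * k2\<close> the logarithm is nonnegative, so rounding to a
      natural number is harmless.\<close>
    define a where "a = c0 + ln (2 * k2 / r) / \<epsilon>"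
    define n where "n = nat \<lceil>a\<rceil>"
    have "0 \<le> ln (2 * k2 / r)" using r by (simp add: field_simps)
    then have a0: "0 \<le> a" using pos by (simp add: a_def c0_def)
    have n: "a \<le> real n" "real n \<le> a + 1" using a0 by (simp_all add: n_def)
    have ea: "exp (- \<epsilon> * (a - c0)) = r / (2 * k2)" using pos r by (simp add: a_def exp_minus ln_div exp_diff)
    have close: "\<rho> \<xi> \<eta> \<le> r / 2" if \<xi>: "\<xi> \<in> Bd" "\<eta> \<in> Bd" and u: "u \<in> limanc n \<xi>" "u \<in> limanc n \<eta>" for \<xi> \<eta> u
    proof (cases "\<xi> = \<eta>")
      case True then show ?thesis using rself[OF \<xi>] r by simp
    next
      case False
      define b where "b = real_of_ereal (boundary_gromov_prod D e \<xi> \<eta>)"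
      have be: "ereal b = boundary_gromov_prod D e \<xi> \<eta>" unfolding b_def by (rule ereal_real'[OF conjunct1[OF v[OF \<xi> False]]])
      have "real n - c0 \<le> b" using limanc_prod[OF \<xi> u] unfolding be[symmetric] c0_def by simp
      then have "a - c0 \<le> b" using n by linarith
      then have "exp (- \<epsilon> * b) \<le> exp (- \<epsilon> * (a - c0))" using pos by simp
      then have "k2 * exp (- \<epsilon> * b) \<le> k2 * (r / (2 * k2))" unfolding ea using pos by (intro mult_left_mono) auto
      also have "\<dots> = r / 2" using pos by simp
      finally show ?thesis using v[OF \<xi> False] unfolding b_def by linarith
    qed
    have cr: "c * r \<le> k1 * exp (- \<epsilon> * (real (n + \<kappa>) + 4))"
    proof -
      have "c * r \<le> k1 * exp (- \<epsilon> * (c0 + real \<kappa> + 5)) / (2 * k2) * r" using c(3) r(1) by (intro mult_right_mono) auto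
      also have "\<dots> = k1 * (exp (- \<epsilon> * (c0 + real \<kappa> + 5)) * exp (- \<epsilon> * (a - c0)))" unfolding ea by simp
      also have "\<dots> = k1 * exp (- \<epsilon> * (a + real \<kappa> + 5))" by (simp add: exp_add[symmetric] algebra_simps)
      also have "\<dots> \<le> k1 * exp (- \<epsilon> * (real (n + \<kappa>) + 4))" using pos n by simp
      finally show ?thesis .
    qed
    have nr: "near (n + \<kappa>) (5 * h) x y" if \<xi>: "\<xi> \<in> Bd" "\<eta> \<in> Bd" and l: "\<rho> \<xi> \<eta> < c * r" and xy: "x \<in> \<xi>" "y \<in> \<eta>" for \<xi> \<eta> x y
    proof (cases "\<xi> = \<eta>")
      case True
      have "near (n + \<kappa>) (h + h) x y" using Bd_near[OF \<xi>(1)] xy True by blast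
      then show ?thesis by (rule near_mono) simp
    next
      case False
      define b where "b = real_of_ereal (boundary_gromov_prod D e \<xi> \<eta>)"
      have be: "ereal b = boundary_gromov_prod D e \<xi> \<eta>" unfolding b_def by (rule ereal_real'[OF conjunct1[OF v[OF \<xi> False]]])
      have "k1 * exp (- \<epsilon> * b) < k1 * exp (- \<epsilon> * (real (n + \<kappa>) + 4))" using v[OF \<xi> False] l cr unfolding b_def by linarith
      then have "real (n + \<kappa>) + 4 < b" using pos by simp
      then have "ereal (real (n + \<kappa>) + 3) < boundary_gromov_prod D e \<xi> \<eta>" unfolding be[symmetric] by simp
      then show ?thesis by (rule prod_near[OF \<xi> _ xy])
    qed
    define F where "F u = {\<xi> \<in> Bd. \<exists>\<eta>\<in>Bd. \<rho> \<xi> \<eta> < c * r \<and> u \<in> limanc n \<eta>}" for u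
    have crp: "0 < c * r" using c r by simp
    have 1: "\<Union>(range F) = Bd"
    proof (intro equalityI subsetI)
      fix \<xi> assume \<xi>: "\<xi> \<in> Bd"
      obtain u where "u \<in> limanc n \<xi>" using limanc_nonempty[OF \<xi>] by blast
      moreover have "\<rho> \<xi> \<xi> < c * r" using rself[OF \<xi> \<xi>] crp by simp
      ultimately have "\<xi> \<in> F u" unfolding F_def using \<xi> by blast
      then show "\<xi> \<in> \<Union>(range F)" by blast
    qed (auto simp: F_def)
    have 2: "metric_open Bd \<rho> (F u)" for u unfolding metric_open_def
    proof (intro conjI ballI)
      show "F u \<subseteq> Bd" by (auto simp: F_def)
      fix \<xi> assume "\<xi> \<in> F u"
      then obtain \<eta> where \<eta>: "\<xi> \<in> Bd" "\<eta> \<in> Bd" "\<rho> \<xi> \<eta> < c * r" "u \<in> limanc n \<eta>" by (auto simp: F_def)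
      have "\<zeta> \<in> F u" if \<zeta>: "\<zeta> \<in> Bd" "\<rho> \<xi> \<zeta> < c * r - \<rho> \<xi> \<eta>" for \<zeta>
      proof -
        have "\<rho> \<zeta> \<eta> < c * r" using rtri[OF \<zeta>(1) \<eta>(1,2)] rsym[OF \<zeta>(1) \<eta>(1)] \<zeta>(2) by linarith
        then show ?thesis using \<zeta> \<eta> by (auto simp: F_def)
      qed
      then show "\<exists>\<epsilon>>0. \<forall>y\<in>Bd. \<rho> \<xi> y < \<epsilon> \<longrightarrow> y \<in> F u" using \<eta>(3) by (intro exI[of _ "c * r - \<rho> \<xi> \<eta>"]) auto
    qed
    have 3: "\<rho> \<xi> \<xi>' \<le> r" if mem: "\<xi> \<in> F u" "\<xi>' \<in> F u" for \<xi> \<xi>' u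
    proof -
      obtain \<eta> where \<eta>: "\<xi> \<in> Bd" "\<eta> \<in> Bd" "\<rho> \<xi> \<eta> < c * r" "u \<in> limanc n \<eta>" using mem(1) by (auto simp: F_def)
      obtain \<eta>' where \<eta>': "\<xi>' \<in> Bd" "\<eta>' \<in> Bd" "\<rho> \<xi>' \<eta>' < c * r" "u \<in> limanc n \<eta>'" using mem(2) by (auto simp: F_def)
      have "\<rho> \<xi> \<xi>' \<le> \<rho> \<xi> \<eta> + (\<rho> \<eta> \<eta>' + \<rho> \<xi>' \<eta>')"
        using rtri[OF \<eta>(1,2) \<eta>'(1)] rtri[OF \<eta>(2) \<eta>'(2,1)] rsym[OF \<eta>'(2,1)] by linarith
      moreover have "\<rho> \<eta> \<eta>' \<le> r / 2" by (rule close[OF \<eta>(2) \<eta>'(2) \<eta>(4) \<eta>'(4)])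
      moreover have "c * r \<le> 1/4 * r" using c(2) r(1) by (intro mult_right_mono) auto
      ultimately show ?thesis using \<eta>(3) \<eta>'(3) by linarith
    qed
    have 4: "ereal (c * r) \<le> lebesgue_number Bd \<rho> (range F)" unfolding lebesgue_number_def
    proof (rule INF_greatest)
      fix \<xi> assume \<xi>: "\<xi> \<in> Bd"
      obtain u where u: "u \<in> limanc n \<xi>" using limanc_nonempty[OF \<xi>] by blast
      have "c * r \<le> \<rho> \<xi> \<eta>" if "\<eta> \<in> Bd - F u" for \<eta>
      proof (rule ccontr)
        assume "\<not> ?thesis"
        then have "\<rho> \<eta> \<xi> < c * r" using rsym[OF \<xi>, of \<eta>] that by simp
        then show False using that \<xi> u by (auto simp: F_def)
      qed
      then have "ereal (c * r) \<le> (INF \<eta>\<in>Bd - F u. ereal (\<rho> \<xi> \<eta>))" by (intro INF_greatest) simp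
      then show "ereal (c * r) \<le> (SUP U\<in>range F. INF \<eta>\<in>Bd - U. ereal (\<rho> \<xi> \<eta>))" by (rule SUP_upper2[OF rangeI])
    qed
    have 5: "finite {U \<in> range F. \<xi> \<in> U} \<and> card {U \<in> range F. \<xi> \<in> U} \<le> 1 + 1" if \<xi>: "\<xi> \<in> Bd" for \<xi>
    proof -
      let ?C = "{u. \<xi> \<in> F u}"
      have "finite ?C \<and> card ?C \<le> 2"
      proof (rule limanc_two[OF \<kappa> \<xi>])
        fix u assume "u \<in> ?C"
        then obtain \<eta> where \<eta>: "\<eta> \<in> Bd" "\<rho> \<xi> \<eta> < c * r" "u \<in> limanc n \<eta>" by (auto simp: F_def)
        then show "\<exists>\<eta>\<in>Bd. u \<in> limanc n \<eta> \<and> (\<forall>x\<in>\<xi>. \<forall>y\<in>\<eta>. near (n + \<kappa>) (5 * h) x y)" using nr[OF \<xi> \<eta>(1,2)] by blast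
      qed
      then have C: "finite ?C" "card ?C \<le> 2" by auto
      have eq: "{U \<in> range F. \<xi> \<in> U} = F ` ?C" by (intro equalityI subsetI) auto
      show ?thesis unfolding eq using C card_image_le[OF C(1), of F] by simp
    qed
    show ?thesis
      by (rule exI[of _ "range F"]) (intro conjI ballI; use 1 2 3 4 5 in blast)
  qed
  show ?thesis unfolding cdim_le_def
  proof (rule exI[of _ c], intro conjI)
    show "0 < c" "c < 1" using c by auto
    show "\<exists>r0>0. \<forall>r. 0 < r \<and> r < r0 \<longrightarrow> (\<exists>\<U>. \<Union>\<U> = Bd \<and> (\<forall>U\<in>\<U>. metric_open Bd \<rho> U) \<and> (\<forall>U\<in>\<U>. \<forall>x\<in>U. \<forall>y\<in>U. \<rho> x y \<le> r) \<and>
      lebesgue_number Bd \<rho> \<U> \<ge> ereal (c * r) \<and> (\<forall>x\<in>Bd. finite {U\<in>\<U>. x \<in> U} \<and> card {U\<in>\<U>. x \<in> U} \<le> 1 + 1))"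
      using main pos(3) by (intro exI[of _ "2 * k2"]) auto
  qed
qed

end

section \<open>The theorem\<close>

text \<open>\<open>presentation\<close> excludes the empty relator so that every face has darts, but
  \<open>R\<close> itself may contain it. Deleting it changes neither the group nor the Cayley
  graph.\<close>

lemma C'_sixth_remove_Nil: assumes "C'_sixth S R" shows "C'_sixth S (R - {[]})"
proof -
  have "symmetrised S (R - {[]})" using assms unfolding C'_sixth_def symmetrised_def by auto
  then show ?thesis using assms unfolding C'_sixth_def by blast
qed

lemma word_eq_remove_Nil: "word_eq S (R - {[]}) = word_eq S R"
proof (intro ext iffI)
  fix u v assume "word_eq S (R - {[]}) u v"
  then show "word_eq S R u v" unfolding word_eq_def
  proof (induction rule: equivclp_induct)
    case (step y z)
    then have "elem_step S R y z \<or> elem_step S R z y" unfolding elem_step_def by blast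
    then have "equivclp (elem_step S R) y z" by (meson equivclp_sym r_into_equivclp)
    with step show ?case by (meson equivclp_trans)
  qed simp
next
  fix u v assume "word_eq S R u v"
  then show "word_eq S (R - {[]}) u v" unfolding word_eq_def
  proof (induction rule: equivclp_induct)
    case (step y z)
    have *: "elem_step S (R - {[]}) a b \<or> a = b" if "elem_step S R a b" for a b
    proof -
      obtain p q w where w: "a = p @ q" "b = p @ w @ q" "w \<in> R \<or> (\<exists>x \<in> S \<times> UNIV. w = [x, letter_inv x])"
        using \<open>elem_step S R a b\<close> unfolding elem_step_def by blast
      show ?thesis
      proof (cases "w = []")
        case False
        then have "w \<in> R - {[]} \<or> (\<exists>x \<in> S \<times> UNIV. w = [x, letter_inv x])" using w(3) by blast
        then show ?thesis unfolding elem_step_def using w(1,2) by blast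
      qed (use w in simp)
    qed
    have "equivclp (elem_step S (R - {[]})) y z"
      using step.hyps(2) *[of y z] *[of z y] by (metis equivclp_refl equivclp_sym r_into_equivclp)
    with step show ?case by (meson equivclp_trans)
  qed simp
qed

lemma cayley_remove_Nil:
  "cayley_points S (R - {[]}) = cayley_points S R" "cayley_dist S (R - {[]}) = cayley_dist S R"
  "cayley_base S (R - {[]}) = cayley_base S R"
proof -
  have cls: "grp_cls S (R - {[]}) = grp_cls S R" and gm: "gen_mult S (R - {[]}) = gen_mult S R"
    and wd: "word_dist S (R - {[]}) = word_dist S R"
    unfolding grp_cls_def gen_mult_def word_dist_def word_eq_remove_Nil by (rule refl)+
  have el: "grp_elems S (R - {[]}) = grp_elems S R" unfolding grp_elems_def cls by (rule refl)
  show "cayley_points S (R - {[]}) = cayley_points S R" unfolding cayley_points_def el by (rule refl)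
  have th: "cayley_through S (R - {[]}) = cayley_through S R"
    unfolding cayley_through_def cayley_ends_def gm wd by (rule refl)
  show "cayley_dist S (R - {[]}) = cayley_dist S R" by (intro ext) (simp only: cayley_dist_def th)
  show "cayley_base S (R - {[]}) = cayley_base S R" by (simp add: cayley_base_def grp_one_def cls)
qed

theorem theoremE:
  fixes S :: "'a set" and R :: "'a word set"
  assumes "finite S" and "C'_sixth S R"
  shows "(\<forall>Y. stable_subset (cayley_points S R) (cayley_dist S R) Y \<longrightarrow>
            asdim_le Y (cayley_dist S R) 2) \<and>
         (\<forall>N \<rho>. morse_gauge N \<and>
            visual_metric (morse_stratum (cayley_points S R) (cayley_dist S R) N (cayley_base S R))
              (cayley_dist S R) (cayley_base S R) \<rho> \<longrightarrow>
            cdim_le (seq_boundary (morse_stratum (cayley_points S R) (cayley_dist S R) N (cayley_base S R))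
                       (cayley_dist S R) (cayley_base S R)) \<rho> 1)"
proof -
  interpret presentation S "R - {[]}"
    by unfold_locales (use assms C'_sixth_remove_Nil in auto)
  have "cdim_le (seq_boundary (morse_stratum P D N (cayley_base S (R - {[]}))) D (cayley_base S (R - {[]}))) \<rho> 1"
    if vis: "visual_metric (morse_stratum P D N (cayley_base S (R - {[]}))) D (cayley_base S (R - {[]})) \<rho>" for N \<rho>
  proof -
    interpret boundary S "R - {[]}" "grp_one S (R - {[]})" "cayley_base S (R - {[]})" N
      by unfold_locales (auto simp: cayley_base_def vertex_point)
    show ?thesis by (rule cdim_boundary[OF vis])
  qed
  then show ?thesis using stable_asdim unfolding cayley_remove_Nil by blast
qed

end
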